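(* Let $\mathcal{E}$ be a full additive Karoubian subcategory of an abelian category $\mathcal{A}$. There are triangle equivalences (i) $K^{\infty,+}(\mathcal{E})/K^{+}(\mathcal{E})\simeq K^{\infty,b}(\mathcal{E})/K^{+,b}(\mathcal{E})\simeq K^{-,b}(\mathcal{E})/K^{b}(\mathcal{E})$; (ii) $K^{\infty,-}(\mathcal{E})/K^{-}(\mathcal{E})\simeq K^{\infty,b}(\mathcal{E})/K^{-,b}(\mathcal{E})\simeq K^{+,b}(\mathcal{E})/K^{b}(\mathcal{E})$; (iii) $K(\mathcal{E})/K^{\infty,-}(\mathcal{E})\simeq K^{\infty,+}(\mathcal{E})/K^{\infty,b}(\mathcal{E})\simeq K^{+}(\mathcal{E})/K^{+,b}(\mathcal{E})$; (iv) $K(\mathcal{E})/K^{\infty,+}(\mathcal{E})\simeq K^{\infty,-}(\mathcal{E})/K^{\infty,b}(\mathcal{E})\simeq K^{-}(\mathcal{E})/K^{-,b}(\mathcal{E})$; (v) $K(\mathcal{E})/K^-(\mathcal{E})\simeq K^{\infty,+}(\mathcal{E})/K^{-,b}(\mathcal{E})\simeq K^+(\mathcal{E})/K^b(\mathcal{E})$; (vi) $K(\mathcal{E})/K^+(\mathcal{E})\simeq K^{\infty,-}(\mathcal{E})/K^{+,b}(\mathcal{E})\simeq K^-(\mathcal{E})/K^b(\mathcal{E})$. If $\mathcal{E}=\mathcal{A}$, then moreover there are triangle equivalences (1) $K^{+,b}(\mathcal{E})/K^{+,\emptyset}(\mathcal{E})\simeq K^{b}(\mathcal{E})/K^{b,\emptyset}(\mathcal{E})\simeq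 K^{-,b}(\mathcal{E})/K^{-,\emptyset}(\mathcal{E})\simeq K^{\infty,b}(\mathcal{E})/K^{\infty,\emptyset}(\mathcal{E})$; (2) $K^{\infty,b}(\mathcal{E})/K^{+,b}(\mathcal{E})\simeq K^{\infty,\emptyset}(\mathcal{E})/K^{+,\emptyset}(\mathcal{E})\simeq K^{-,\emptyset}(\mathcal{E})/K^{b,\emptyset}(\mathcal{E})$; (3) $K^{\infty,b}(\mathcal{E})/K^{-,b}(\mathcal{E})\simeq K^{\infty,\emptyset}(\mathcal{E})/K^{-,\emptyset}(\mathcal{E})\simeq K^{+,\emptyset}(\mathcal{E})/K^{b,\emptyset}(\mathcal{E})$.
   Context: Karoubian means that every idempotent splits. Complexes are cochain complexes; the cohomology of a complex over $\mathcal{E}$ is computed in $\mathcal{A}$. A complex $X$ (or its cohomology) is left bounded if $X^n=0$ (resp. $H^n(X)=0$) for $n\ll 0$, right bounded if this holds for $n\gg 0$, bounded if both. $K(\mathcal{E})$ is the homotopy category of all complexes over $\mathcal{E}$. The following are full triangulated subcategories of $K(\mathcal{E})$: $K^{\infty,+}(\mathcal{E})$, $K^{\infty,-}(\mathcal{E})$, $K^{\infty,b}(\mathcal{E})$, $K^{\infty,\emptyset}(\mathcal{E})$ consist of all unbounded complexes with left bounded, right bounded, bounded, zero cohomology respectively; $K^{+}(\mathcal{E})$, $K^{-}(\mathcal{E})$, $K^{b}(\mathcal{E})$ consist of all complexes homotopy equivalent to left bounded, right bounded, bounded complexes respectively; $K^{+,b}(\mathcal{E})$ (resp. $K^{-,b}(\mathcal{E})$)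 consists of all complexes homotopy equivalent to left (resp. right) bounded complexes with bounded cohomology; $K^{+,\emptyset}(\mathcal{E})$, $K^{-,\emptyset}(\mathcal{E})$, $K^{b,\emptyset}(\mathcal{E})$ consist of all complexes homotopy equivalent to left bounded, right bounded, bounded exact complexes respectively. Quotients are Verdier quotients. *)

theory Defs
  imports "HOL-Algebra.Group"
begin

section \<open>Categories, functors and equivalences\<close>

record ('o, 'm) cat =
  Obj :: "'o set"
  Arr :: "'m set"
  Dom :: "'m \<Rightarrow> 'o"
  Cod :: "'m \<Rightarrow> 'o"
  Ident :: "'o \<Rightarrow> 'm"
  Comp :: "'m \<Rightarrow> 'm \<Rightarrow> 'm"  (infixr "\<cdot>\<index>" 70)

definition Hom :: "('o, 'm, 'x) cat_scheme \<Rightarrow> 'o \<Rightarrow> 'o \<Rightarrow> 'm set" where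
  "Hom C X Y = {f \<in> Arr C. Dom C f = X \<and> Cod C f = Y}"

text \<open>\<open>g \<cdot> f\<close> means "first \<open>f\<close>, then \<open>g\<close>".\<close>

locale category = fixes C :: "('o, 'm, 'x) cat_scheme" (structure)
  assumes Dom_Obj: "f \<in> Arr C \<Longrightarrow> Dom C f \<in> Obj C"
    and Cod_Obj: "f \<in> Arr C \<Longrightarrow> Cod C f \<in> Obj C"
    and Ident_Hom: "X \<in> Obj C \<Longrightarrow> Ident C X \<in> Hom C X X"
    and Comp_Hom: "f \<in> Hom C X Y \<Longrightarrow> g \<in> Hom C Y Z \<Longrightarrow> g \<cdot> f \<in> Hom C X Z"
    and Comp_Ident: "f \<in> Hom C X Y \<Longrightarrow> f \<cdot> Ident C X = f"
    and Ident_Comp: "f \<in> Hom C X Y \<Longrightarrow> Ident C Y \<cdot> f = f"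
    and Comp_assoc: "f \<in> Hom C W X \<Longrightarrow> g \<in> Hom C X Y \<Longrightarrow> h \<in> Hom C Y Z
                     \<Longrightarrow> (h \<cdot> g) \<cdot> f = h \<cdot> (g \<cdot> f)"

definition full_subcat :: "('o, 'm, 'x) cat_scheme \<Rightarrow> 'o set \<Rightarrow> ('o, 'm, 'x) cat_scheme" where
  "full_subcat C S = C\<lparr>Obj := S, Arr := {f \<in> Arr C. Dom C f \<in> S \<and> Cod C f \<in> S}\<rparr>"

definition iso_arr :: "('o, 'm, 'x) cat_scheme \<Rightarrow> 'm \<Rightarrow> bool" where
  "iso_arr C f \<longleftrightarrow> f \<in> Arr C \<and> (\<exists>g \<in> Hom C (Cod C f) (Dom C f).
      g \<cdot>\<^bsub>C\<^esub> f = Ident C (Dom C f) \<and> f \<cdot>\<^bsub>C\<^esub> g = Ident C (Cod C f))"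

definition isomorphic :: "('o, 'm, 'x) cat_scheme \<Rightarrow> 'o \<Rightarrow> 'o \<Rightarrow> bool" where
  "isomorphic C X Y \<longleftrightarrow> (\<exists>f \<in> Hom C X Y. iso_arr C f)"

definition zero_object :: "('o, 'm, 'x) cat_scheme \<Rightarrow> 'o \<Rightarrow> bool" where
  "zero_object C Z \<longleftrightarrow> Z \<in> Obj C \<and>
     (\<forall>X \<in> Obj C. (\<exists>!f. f \<in> Hom C X Z) \<and> (\<exists>!f. f \<in> Hom C Z X))"

definition karoubian :: "('o, 'm, 'x) cat_scheme \<Rightarrow> bool" where
  "karoubian C \<longleftrightarrow> (\<forall>X \<in> Obj C. \<forall>e \<in> Hom C X X. e \<cdot>\<^bsub>C\<^esub> e = e \<longrightarrow>
     (\<exists>Y \<in> Obj C. \<exists>p \<in> Hom C X Y. \<exists>i \<in> Hom C Y X.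
        i \<cdot>\<^bsub>C\<^esub> p = e \<and> p \<cdot>\<^bsub>C\<^esub> i = Ident C Y))"

definition is_functor :: "('o, 'm, 'x) cat_scheme \<Rightarrow> ('p, 'n, 'y) cat_scheme
    \<Rightarrow> ('o \<Rightarrow> 'p) \<Rightarrow> ('m \<Rightarrow> 'n) \<Rightarrow> bool" where
  "is_functor C D Fo Fa \<longleftrightarrow> category C \<and> category D \<and>
     (\<forall>X \<in> Obj C. Fo X \<in> Obj D) \<and>
     (\<forall>f \<in> Arr C. Fa f \<in> Hom D (Fo (Dom C f)) (Fo (Cod C f))) \<and>
     (\<forall>X \<in> Obj C. Fa (Ident C X) = Ident D (Fo X)) \<and>
     (\<forall>f \<in> Arr C. \<forall>g \<in> Arr C. Cod C f = Dom C g \<longrightarrow> Fa (g \<cdot>\<^bsub>C\<^esub> f) = Fa g \<cdot>\<^bsub>D\<^esub> Fa f)"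

definition natural_iso :: "('o, 'm, 'x) cat_scheme \<Rightarrow> ('p, 'n, 'y) cat_scheme
    \<Rightarrow> ('o \<Rightarrow> 'p) \<Rightarrow> ('m \<Rightarrow> 'n) \<Rightarrow> ('o \<Rightarrow> 'p) \<Rightarrow> ('m \<Rightarrow> 'n) \<Rightarrow> ('o \<Rightarrow> 'n) \<Rightarrow> bool" where
  "natural_iso C D Fo Fa Go Ga \<eta> \<longleftrightarrow>
     (\<forall>X \<in> Obj C. \<eta> X \<in> Hom D (Fo X) (Go X) \<and> iso_arr D (\<eta> X)) \<and>
     (\<forall>f \<in> Arr C. \<eta> (Cod C f) \<cdot>\<^bsub>D\<^esub> Fa f = Ga f \<cdot>\<^bsub>D\<^esub> \<eta> (Dom C f))"

definition is_equivalence :: "('o, 'm, 'x) cat_scheme \<Rightarrow> ('p, 'n, 'y) cat_scheme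
    \<Rightarrow> ('o \<Rightarrow> 'p) \<Rightarrow> ('m \<Rightarrow> 'n) \<Rightarrow> bool" where
  "is_equivalence C D Fo Fa \<longleftrightarrow> is_functor C D Fo Fa \<and>
     (\<exists>Go Ga \<eta> \<epsilon>. is_functor D C Go Ga \<and>
        natural_iso C C id id (Go \<circ> Fo) (Ga \<circ> Fa) \<eta> \<and>
        natural_iso D D (Fo \<circ> Go) (Fa \<circ> Ga) id id \<epsilon>)"


section \<open>Additive and abelian categories\<close>

text \<open>\<open>Add\<close> is only meaningful on parallel arrows; \<open>Zero C X Y\<close> is the zero arrow from \<open>X\<close> to \<open>Y\<close>.\<close>

record ('o, 'm) acat = "('o, 'm) cat" +
  Add :: "'m \<Rightarrow> 'm \<Rightarrow> 'm"  (infixl "\<boxplus>\<index>" 65)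
  Zero :: "'o \<Rightarrow> 'o \<Rightarrow> 'm"

definition hom_group :: "('o, 'm, 'x) acat_scheme \<Rightarrow> 'o \<Rightarrow> 'o \<Rightarrow> 'm monoid" where
  "hom_group C X Y = \<lparr>carrier = Hom C X Y, monoid.mult = Add C, one = Zero C X Y\<rparr>"

definition Neg :: "('o, 'm, 'x) acat_scheme \<Rightarrow> 'm \<Rightarrow> 'm" where
  "Neg C f = m_inv (hom_group C (Dom C f) (Cod C f)) f"

locale preadditive_category = category C for C :: "('o, 'm, 'x) acat_scheme" (structure) +
  assumes hom_comm_group: "X \<in> Obj C \<Longrightarrow> Y \<in> Obj C \<Longrightarrow> comm_group (hom_group C X Y)"
    and Comp_Add: "f \<in> Hom C X Y \<Longrightarrow> f' \<in> Hom C X Y \<Longrightarrow> g \<in> Hom C Y Z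
                   \<Longrightarrow> g \<cdot> (f \<boxplus> f') = (g \<cdot> f) \<boxplus> (g \<cdot> f')"
    and Add_Comp: "f \<in> Hom C X Y \<Longrightarrow> g \<in> Hom C Y Z \<Longrightarrow> g' \<in> Hom C Y Z
                   \<Longrightarrow> (g \<boxplus> g') \<cdot> f = (g \<cdot> f) \<boxplus> (g' \<cdot> f)"

text \<open>\<open>is_biproduct C X Y S i j p q\<close>: \<open>S\<close> is a biproduct of \<open>X\<close> and \<open>Y\<close> with injections
  \<open>i\<close>, \<open>j\<close> and projections \<open>p\<close>, \<open>q\<close>.\<close>

definition is_biproduct :: "('o, 'm, 'x) acat_scheme \<Rightarrow> 'o \<Rightarrow> 'o \<Rightarrow> 'o
    \<Rightarrow> 'm \<Rightarrow> 'm \<Rightarrow> 'm \<Rightarrow> 'm \<Rightarrow> bool" where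
  "is_biproduct C X Y S i j p q \<longleftrightarrow>
     i \<in> Hom C X S \<and> j \<in> Hom C Y S \<and> p \<in> Hom C S X \<and> q \<in> Hom C S Y \<and>
     p \<cdot>\<^bsub>C\<^esub> i = Ident C X \<and> q \<cdot>\<^bsub>C\<^esub> j = Ident C Y \<and>
     p \<cdot>\<^bsub>C\<^esub> j = Zero C Y X \<and> q \<cdot>\<^bsub>C\<^esub> i = Zero C X Y \<and>
     (i \<cdot>\<^bsub>C\<^esub> p) \<boxplus>\<^bsub>C\<^esub> (j \<cdot>\<^bsub>C\<^esub> q) = Ident C S"

locale additive_category = preadditive_category C for C :: "('o, 'm, 'x) acat_scheme" (structure) +
  assumes ex_zero: "\<exists>Z. zero_object C Z"
    and ex_biproduct: "X \<in> Obj C \<Longrightarrow> Y \<in> Obj C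
                       \<Longrightarrow> \<exists>S \<in> Obj C. \<exists>i j p q. is_biproduct C X Y S i j p q"

definition is_kernel :: "('o, 'm, 'x) acat_scheme \<Rightarrow> 'm \<Rightarrow> 'm \<Rightarrow> bool" where
  "is_kernel C f k \<longleftrightarrow> f \<in> Arr C \<and> k \<in> Arr C \<and> Cod C k = Dom C f \<and>
     f \<cdot>\<^bsub>C\<^esub> k = Zero C (Dom C k) (Cod C f) \<and>
     (\<forall>g \<in> Arr C. Cod C g = Dom C f \<and> f \<cdot>\<^bsub>C\<^esub> g = Zero C (Dom C g) (Cod C f) \<longrightarrow>
        (\<exists>!u. u \<in> Hom C (Dom C g) (Dom C k) \<and> k \<cdot>\<^bsub>C\<^esub> u = g))"

definition is_cokernel :: "('o, 'm, 'x) acat_scheme \<Rightarrow> 'm \<Rightarrow> 'm \<Rightarrow> bool" where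
  "is_cokernel C f c \<longleftrightarrow> f \<in> Arr C \<and> c \<in> Arr C \<and> Dom C c = Cod C f \<and>
     c \<cdot>\<^bsub>C\<^esub> f = Zero C (Dom C f) (Cod C c) \<and>
     (\<forall>g \<in> Arr C. Dom C g = Cod C f \<and> g \<cdot>\<^bsub>C\<^esub> f = Zero C (Dom C f) (Cod C g) \<longrightarrow>
        (\<exists>!u. u \<in> Hom C (Cod C c) (Cod C g) \<and> u \<cdot>\<^bsub>C\<^esub> c = g))"

definition is_mono :: "('o, 'm, 'x) cat_scheme \<Rightarrow> 'm \<Rightarrow> bool" where
  "is_mono C f \<longleftrightarrow> f \<in> Arr C \<and> (\<forall>W. \<forall>g \<in> Hom C W (Dom C f). \<forall>h \<in> Hom C W (Dom C f).
     f \<cdot>\<^bsub>C\<^esub> g = f \<cdot>\<^bsub>C\<^esub> h \<longrightarrow> g = h)"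

definition is_epi :: "('o, 'm, 'x) cat_scheme \<Rightarrow> 'm \<Rightarrow> bool" where
  "is_epi C f \<longleftrightarrow> f \<in> Arr C \<and> (\<forall>W. \<forall>g \<in> Hom C (Cod C f) W. \<forall>h \<in> Hom C (Cod C f) W.
     g \<cdot>\<^bsub>C\<^esub> f = h \<cdot>\<^bsub>C\<^esub> f \<longrightarrow> g = h)"

locale abelian_category = additive_category C for C :: "('o, 'm, 'x) acat_scheme" (structure) +
  assumes ex_kernel: "f \<in> Arr C \<Longrightarrow> \<exists>k. is_kernel C f k"
    and ex_cokernel: "f \<in> Arr C \<Longrightarrow> \<exists>c. is_cokernel C f c"
    and mono_normal: "is_mono C f \<Longrightarrow> \<exists>g. is_kernel C g f"
    and epi_normal: "is_epi C f \<Longrightarrow> \<exists>g. is_cokernel C g f"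


section \<open>Categories with shift and distinguished triangles\<close>

text \<open>A triangle \<open>X \<rightarrow> Y \<rightarrow> Z \<rightarrow> X[1]\<close> is recorded by its three arrows.\<close>

record ('o, 'm) tcat = "('o, 'm) cat" +
  Sh :: "'o \<Rightarrow> 'o"
  ShA :: "'m \<Rightarrow> 'm"
  Tri :: "('m \<times> 'm \<times> 'm) set"

definition triangle_iso :: "('o, 'm, 'x) tcat_scheme \<Rightarrow> 'm \<times> 'm \<times> 'm \<Rightarrow> 'm \<times> 'm \<times> 'm \<Rightarrow> bool" where
  "triangle_iso T t t' \<longleftrightarrow> (case t of (u, v, w) \<Rightarrow> case t' of (u', v', w') \<Rightarrow>
     u \<in> Arr T \<and> v \<in> Hom T (Cod T u) (Dom T w) \<and> w \<in> Arr T \<and> Cod T w = Sh T (Dom T u) \<and>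
     u' \<in> Arr T \<and> v' \<in> Hom T (Cod T u') (Dom T w') \<and> w' \<in> Arr T \<and> Cod T w' = Sh T (Dom T u') \<and>
     (\<exists>a \<in> Hom T (Dom T u) (Dom T u'). \<exists>b \<in> Hom T (Dom T v) (Dom T v').
      \<exists>c \<in> Hom T (Dom T w) (Dom T w').
        iso_arr T a \<and> iso_arr T b \<and> iso_arr T c \<and>
        b \<cdot>\<^bsub>T\<^esub> u = u' \<cdot>\<^bsub>T\<^esub> a \<and> c \<cdot>\<^bsub>T\<^esub> v = v' \<cdot>\<^bsub>T\<^esub> b \<and> ShA T a \<cdot>\<^bsub>T\<^esub> w = w' \<cdot>\<^bsub>T\<^esub> c))"

definition with_triangles :: "('o, 'm, 'x) tcat_scheme \<Rightarrow> ('m \<times> 'm \<times> 'm) set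
    \<Rightarrow> ('o, 'm, 'x) tcat_scheme" where
  "with_triangles T B = T\<lparr>Tri := {t. \<exists>t' \<in> B. triangle_iso T t t'}\<rparr>"

definition full_tri :: "('o, 'm, 'x) tcat_scheme \<Rightarrow> 'o set \<Rightarrow> ('o, 'm, 'x) tcat_scheme" where
  "full_tri T S = (full_subcat T S)
     \<lparr>Tri := {(u, v, w) \<in> Tri T. Dom T u \<in> S \<and> Dom T v \<in> S \<and> Dom T w \<in> S}\<rparr>"

text \<open>Additivity is not imposed on a triangle functor: between triangulated categories it follows
  from the preservation of distinguished triangles.\<close>

definition triangle_functor :: "('o, 'm, 'x) tcat_scheme \<Rightarrow> ('p, 'n, 'y) tcat_scheme
    \<Rightarrow> ('o \<Rightarrow> 'p) \<Rightarrow> ('m \<Rightarrow> 'n) \<Rightarrow> ('o \<Rightarrow> 'n) \<Rightarrow> bool" where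
  "triangle_functor C D Fo Fa \<xi> \<longleftrightarrow> is_functor C D Fo Fa \<and>
     natural_iso C D (Fo \<circ> Sh C) (Fa \<circ> ShA C) (Sh D \<circ> Fo) (ShA D \<circ> Fa) \<xi> \<and>
     (\<forall>u v w. (u, v, w) \<in> Tri C \<longrightarrow> (Fa u, Fa v, \<xi> (Dom C u) \<cdot>\<^bsub>D\<^esub> Fa w) \<in> Tri D)"

definition triangle_equivalent :: "('o, 'm, 'x) tcat_scheme \<Rightarrow> ('p, 'n, 'y) tcat_scheme \<Rightarrow> bool"
    (infix "\<simeq>\<^sub>\<Delta>" 50) where
  "C \<simeq>\<^sub>\<Delta> D \<longleftrightarrow> (\<exists>Fo Fa \<xi>. triangle_functor C D Fo Fa \<xi> \<and> is_equivalence C D Fo Fa)"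


section \<open>Verdier quotients\<close>

definition cone_in :: "('o, 'm, 'x) tcat_scheme \<Rightarrow> 'o set \<Rightarrow> 'm set" where
  "cone_in T S = {s \<in> Arr T. \<exists>v w. (s, v, w) \<in> Tri T \<and> Cod T v \<in> S}"

text \<open>A roof \<open>(s, f)\<close> stands for the fraction \<open>f s\<inverse>\<close>: the legs \<open>s : W \<rightarrow> X\<close> and \<open>f : W \<rightarrow> Y\<close>
  have the same domain, and the cone of \<open>s\<close> is in \<open>S\<close>.\<close>

definition roofs :: "('o, 'm, 'x) tcat_scheme \<Rightarrow> 'o set \<Rightarrow> 'o \<Rightarrow> 'o \<Rightarrow> ('m \<times> 'm) set" where
  "roofs T S X Y = {(s, f). s \<in> cone_in T S \<and> Cod T s = X \<and> f \<in> Hom T (Dom T s) Y}"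

definition roof_eq :: "('o, 'm, 'x) tcat_scheme \<Rightarrow> 'o set \<Rightarrow> 'm \<times> 'm \<Rightarrow> 'm \<times> 'm \<Rightarrow> bool" where
  "roof_eq T S r r' \<longleftrightarrow> (case r of (s, f) \<Rightarrow> case r' of (s', f') \<Rightarrow>
     \<exists>W. \<exists>a \<in> Hom T W (Dom T s). \<exists>b \<in> Hom T W (Dom T s').
       s \<cdot>\<^bsub>T\<^esub> a = s' \<cdot>\<^bsub>T\<^esub> b \<and> s \<cdot>\<^bsub>T\<^esub> a \<in> cone_in T S \<and> f \<cdot>\<^bsub>T\<^esub> a = f' \<cdot>\<^bsub>T\<^esub> b)"

text \<open>Arrows of the quotient are triples of source, target and equivalence class of roofs.\<close>

definition frac :: "('o, 'm, 'x) tcat_scheme \<Rightarrow> 'o set \<Rightarrow> 'o \<Rightarrow> 'o \<Rightarrow> 'm \<times> 'm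
    \<Rightarrow> 'o \<times> 'o \<times> ('m \<times> 'm) set" where
  "frac T S X Y r = (X, Y, {r' \<in> roofs T S X Y. roof_eq T S r r'})"

definition localize :: "('o, 'm, 'x) tcat_scheme \<Rightarrow> 'o set \<Rightarrow> 'm
    \<Rightarrow> 'o \<times> 'o \<times> ('m \<times> 'm) set" where
  "localize T S f = frac T S (Dom T f) (Cod T f) (Ident T (Dom T f), f)"

text \<open>To compose \<open>f s\<inverse>\<close> with \<open>g t\<inverse>\<close> one completes \<open>f\<close> and \<open>t\<close> to a commutative square
  \<open>f t' = t f'\<close> with the cone of \<open>t'\<close> in \<open>S\<close>; the composite is \<open>(g f') (s t')\<inverse>\<close>.
  The set below collects the roofs that are equivalent to a composite obtained in this way.\<close>

definition comp_roofs :: "('o, 'm, 'x) tcat_scheme \<Rightarrow> 'o set \<Rightarrow> 'o \<Rightarrow> 'o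
    \<Rightarrow> ('m \<times> 'm) set \<Rightarrow> ('m \<times> 'm) set \<Rightarrow> ('m \<times> 'm) set" where
  "comp_roofs T S X Z \<psi> \<phi> = {r \<in> roofs T S X Z.
     \<exists>s f t g t' f'. (s, f) \<in> \<phi> \<and> (t, g) \<in> \<psi> \<and>
       t' \<in> cone_in T S \<and> Cod T t' = Dom T s \<and> f' \<in> Hom T (Dom T t') (Dom T t) \<and>
       f \<cdot>\<^bsub>T\<^esub> t' = t \<cdot>\<^bsub>T\<^esub> f' \<and>
       roof_eq T S (s \<cdot>\<^bsub>T\<^esub> t', g \<cdot>\<^bsub>T\<^esub> f') r}"

text \<open>\<open>T / S\<close> for a triangulated subcategory with object class \<open>S\<close>. Its distinguished triangles are
  those isomorphic to the images of distinguished triangles of \<open>T\<close>.\<close>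

definition verdier_quotient :: "('o, 'm, 'x) tcat_scheme \<Rightarrow> 'o set
    \<Rightarrow> ('o, 'o \<times> 'o \<times> ('m \<times> 'm) set) tcat" where
  "verdier_quotient T S = with_triangles
     \<lparr>Obj = Obj T,
      Arr = {frac T S X Y r | X Y r. X \<in> Obj T \<and> Y \<in> Obj T \<and> r \<in> roofs T S X Y},
      Dom = (\<lambda>(X, Y, \<phi>). X),
      Cod = (\<lambda>(X, Y, \<phi>). Y),
      Ident = (\<lambda>X. localize T S (Ident T X)),
      Comp = (\<lambda>(Y, Z, \<psi>) (X, Y', \<phi>). (X, Z, comp_roofs T S X Z \<psi> \<phi>)),
      Sh = Sh T,
      ShA = (\<lambda>(X, Y, \<phi>). (Sh T X, Sh T Y,
               {r \<in> roofs T S (Sh T X) (Sh T Y). \<exists>(s, f) \<in> \<phi>. roof_eq T S (ShA T s, ShA T f) r})),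
      Tri = {}\<rparr>
     {(localize T S u, localize T S v, localize T S w) | u v w. (u, v, w) \<in> Tri T}"


section \<open>Complexes and the homotopy category\<close>

datatype ('o, 'm) cochain = Cochain (cobj: "int \<Rightarrow> 'o") (cdiff: "int \<Rightarrow> 'm")

definition is_complex :: "('o, 'm, 'x) acat_scheme \<Rightarrow> ('o, 'm) cochain \<Rightarrow> bool" where
  "is_complex C X \<longleftrightarrow> (\<forall>n. cobj X n \<in> Obj C \<and> cdiff X n \<in> Hom C (cobj X n) (cobj X (n + 1)) \<and>
     cdiff X (n + 1) \<cdot>\<^bsub>C\<^esub> cdiff X n = Zero C (cobj X n) (cobj X (n + 2)))"

definition chain_maps :: "('o, 'm, 'x) acat_scheme \<Rightarrow> ('o, 'm) cochain \<Rightarrow> ('o, 'm) cochain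
    \<Rightarrow> (int \<Rightarrow> 'm) set" where
  "chain_maps C X Y = {f. \<forall>n. f n \<in> Hom C (cobj X n) (cobj Y n) \<and>
     cdiff Y n \<cdot>\<^bsub>C\<^esub> f n = f (n + 1) \<cdot>\<^bsub>C\<^esub> cdiff X n}"

definition homotopic :: "('o, 'm, 'x) acat_scheme \<Rightarrow> ('o, 'm) cochain \<Rightarrow> ('o, 'm) cochain
    \<Rightarrow> (int \<Rightarrow> 'm) \<Rightarrow> (int \<Rightarrow> 'm) \<Rightarrow> bool" where
  "homotopic C X Y f g \<longleftrightarrow> (\<exists>h. \<forall>n. h n \<in> Hom C (cobj X n) (cobj Y (n - 1)) \<and>
     f n = g n \<boxplus>\<^bsub>C\<^esub> ((cdiff Y (n - 1) \<cdot>\<^bsub>C\<^esub> h n) \<boxplus>\<^bsub>C\<^esub> (h (n + 1) \<cdot>\<^bsub>C\<^esub> cdiff X n)))"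

type_synonym ('o, 'm) harr = "('o, 'm) cochain \<times> ('o, 'm) cochain \<times> (int \<Rightarrow> 'm) set"

definition hclass :: "('o, 'm, 'x) acat_scheme \<Rightarrow> ('o, 'm) cochain \<Rightarrow> ('o, 'm) cochain
    \<Rightarrow> (int \<Rightarrow> 'm) \<Rightarrow> ('o, 'm) harr" where
  "hclass C X Y f = (X, Y, {g \<in> chain_maps C X Y. homotopic C X Y f g})"

definition shift :: "('o, 'm, 'x) acat_scheme \<Rightarrow> ('o, 'm) cochain \<Rightarrow> ('o, 'm) cochain" where
  "shift C X = Cochain (\<lambda>n. cobj X (n + 1)) (\<lambda>n. Neg C (cdiff X (n + 1)))"

text \<open>\<open>is_cone C X Y f Z j p\<close>: \<open>Z\<close> is a mapping cone of \<open>f : X \<rightarrow> Y\<close>, that is,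
  \<open>Z\<^sup>n = X\<^sup>n\<^sup>+\<^sup>1 \<oplus> Y\<^sup>n\<close> with differential \<open>(x, y) \<mapsto> (-d x, f x + d y)\<close>;
  \<open>j : Y \<rightarrow> Z\<close> and \<open>p : Z \<rightarrow> X[1]\<close> are the canonical maps.\<close>

definition is_cone :: "('o, 'm, 'x) acat_scheme \<Rightarrow> ('o, 'm) cochain \<Rightarrow> ('o, 'm) cochain
    \<Rightarrow> (int \<Rightarrow> 'm) \<Rightarrow> ('o, 'm) cochain \<Rightarrow> (int \<Rightarrow> 'm) \<Rightarrow> (int \<Rightarrow> 'm) \<Rightarrow> bool" where
  "is_cone C X Y f Z j p \<longleftrightarrow> is_complex C Z \<and> (\<exists>i q. \<forall>n.
     is_biproduct C (cobj X (n + 1)) (cobj Y n) (cobj Z n) (i n) (j n) (p n) (q n) \<and>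
     cdiff Z n = (i (n + 1) \<cdot>\<^bsub>C\<^esub> (Neg C (cdiff X (n + 1)) \<cdot>\<^bsub>C\<^esub> p n)) \<boxplus>\<^bsub>C\<^esub>
       ((j (n + 1) \<cdot>\<^bsub>C\<^esub> (f (n + 1) \<cdot>\<^bsub>C\<^esub> p n)) \<boxplus>\<^bsub>C\<^esub> (j (n + 1) \<cdot>\<^bsub>C\<^esub> (cdiff Y n \<cdot>\<^bsub>C\<^esub> q n))))"

definition homotopy_cat :: "('o, 'm, 'x) acat_scheme
    \<Rightarrow> (('o, 'm) cochain, ('o, 'm) harr) tcat" where
  "homotopy_cat C = with_triangles
     \<lparr>Obj = {X. is_complex C X},
      Arr = {hclass C X Y f | X Y f. is_complex C X \<and> is_complex C Y \<and> f \<in> chain_maps C X Y},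
      Dom = (\<lambda>(X, Y, \<phi>). X),
      Cod = (\<lambda>(X, Y, \<phi>). Y),
      Ident = (\<lambda>X. hclass C X X (\<lambda>n. Ident C (cobj X n))),
      Comp = (\<lambda>(Y, Z, \<psi>) (X, Y', \<phi>). (X, Z, {h \<in> chain_maps C X Z.
               \<exists>f \<in> \<phi>. \<exists>g \<in> \<psi>. homotopic C X Z (\<lambda>n. g n \<cdot>\<^bsub>C\<^esub> f n) h})),
      Sh = shift C,
      ShA = (\<lambda>(X, Y, \<phi>). (shift C X, shift C Y, (\<lambda>f n. f (n + 1)) ` \<phi>)),
      Tri = {}\<rparr>
     {(hclass C X Y f, hclass C Y Z j, hclass C Z (shift C X) p) | X Y Z f j p.
        is_complex C X \<and> is_complex C Y \<and> f \<in> chain_maps C X Y \<and> is_cone C X Y f Z j p}"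


section \<open>Cohomology and the subcategories of the homotopy category\<close>

text \<open>The object \<open>H\<^sup>n(X)\<close>, well defined up to isomorphism: the cokernel of the map
  \<open>u : X\<^sup>n\<^sup>-\<^sup>1 \<rightarrow> Ker d\<^sup>n\<close> induced by the differential.\<close>

definition cohomology :: "('o, 'm, 'x) acat_scheme \<Rightarrow> ('o, 'm) cochain \<Rightarrow> int \<Rightarrow> 'o" where
  "cohomology A X n = (SOME H. \<exists>k u c. is_kernel A (cdiff X n) k \<and>
     u \<in> Hom A (cobj X (n - 1)) (Dom A k) \<and> k \<cdot>\<^bsub>A\<^esub> u = cdiff X (n - 1) \<and>
     is_cokernel A u c \<and> H = Cod A c)"

definition left_bounded :: "('o, 'm, 'x) acat_scheme \<Rightarrow> ('o, 'm) cochain \<Rightarrow> bool" where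
  "left_bounded C X \<longleftrightarrow> (\<exists>N. \<forall>n < N. zero_object C (cobj X n))"

definition right_bounded :: "('o, 'm, 'x) acat_scheme \<Rightarrow> ('o, 'm) cochain \<Rightarrow> bool" where
  "right_bounded C X \<longleftrightarrow> (\<exists>N. \<forall>n > N. zero_object C (cobj X n))"

definition coh_left_bounded :: "('o, 'm, 'x) acat_scheme \<Rightarrow> ('o, 'm) cochain \<Rightarrow> bool" where
  "coh_left_bounded A X \<longleftrightarrow> (\<exists>N. \<forall>n < N. zero_object A (cohomology A X n))"

definition coh_right_bounded :: "('o, 'm, 'x) acat_scheme \<Rightarrow> ('o, 'm) cochain \<Rightarrow> bool" where
  "coh_right_bounded A X \<longleftrightarrow> (\<exists>N. \<forall>n > N. zero_object A (cohomology A X n))"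

definition exact_complex :: "('o, 'm, 'x) acat_scheme \<Rightarrow> ('o, 'm) cochain \<Rightarrow> bool" where
  "exact_complex A X \<longleftrightarrow> (\<forall>n. zero_object A (cohomology A X n))"

text \<open>In what follows \<open>E\<close> is the set of objects of a full subcategory of \<open>A\<close>. Complexes, chain maps
  and homotopies live in \<open>E\<close>, cohomology is taken in \<open>A\<close>.\<close>

abbreviation HK :: "('o, 'm, 'x) acat_scheme \<Rightarrow> 'o set
    \<Rightarrow> (('o, 'm) cochain, ('o, 'm) harr) tcat" where
  "HK A E \<equiv> homotopy_cat (full_subcat A E)"

text \<open>The superscripts \<open>\<infinity>\<close>, \<open>+\<close>, \<open>-\<close>, \<open>b\<close>, \<open>\<emptyset>\<close> are written \<open>inf\<close>, \<open>p\<close>, \<open>m\<close>, \<open>b\<close>, \<open>0\<close>.\<close>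

definition K_all where "K_all A E = Obj (HK A E)"

definition K_inf_p where "K_inf_p A E = {X \<in> K_all A E. coh_left_bounded A X}"
definition K_inf_m where "K_inf_m A E = {X \<in> K_all A E. coh_right_bounded A X}"
definition K_inf_b where
  "K_inf_b A E = {X \<in> K_all A E. coh_left_bounded A X \<and> coh_right_bounded A X}"
definition K_inf_0 where "K_inf_0 A E = {X \<in> K_all A E. exact_complex A X}"

definition heq_closure :: "('o, 'm, 'x) acat_scheme \<Rightarrow> 'o set \<Rightarrow> (('o, 'm) cochain \<Rightarrow> bool)
    \<Rightarrow> ('o, 'm) cochain set" where
  "heq_closure A E P = {X \<in> K_all A E. \<exists>Y \<in> K_all A E. P Y \<and> isomorphic (HK A E) X Y}"

definition K_p where "K_p A E = heq_closure A E (left_bounded A)"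
definition K_m where "K_m A E = heq_closure A E (right_bounded A)"
definition K_b where "K_b A E = heq_closure A E (\<lambda>Y. left_bounded A Y \<and> right_bounded A Y)"

definition K_p_b where "K_p_b A E = heq_closure A E
  (\<lambda>Y. left_bounded A Y \<and> coh_left_bounded A Y \<and> coh_right_bounded A Y)"
definition K_m_b where "K_m_b A E = heq_closure A E
  (\<lambda>Y. right_bounded A Y \<and> coh_left_bounded A Y \<and> coh_right_bounded A Y)"

definition K_p_0 where "K_p_0 A E = heq_closure A E (\<lambda>Y. left_bounded A Y \<and> exact_complex A Y)"
definition K_m_0 where "K_m_0 A E = heq_closure A E (\<lambda>Y. right_bounded A Y \<and> exact_complex A Y)"
definition K_b_0 where "K_b_0 A E = heq_closure A E
  (\<lambda>Y. left_bounded A Y \<and> right_bounded A Y \<and> exact_complex A Y)"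

text \<open>\<open>KQ A E S U\<close> is the Verdier quotient of the full triangulated subcategory \<open>S A E\<close> of
  \<open>K(E)\<close> by \<open>U A E\<close>.\<close>

definition KQ :: "('o, 'm, 'x) acat_scheme \<Rightarrow> 'o set
    \<Rightarrow> (('o, 'm, 'x) acat_scheme \<Rightarrow> 'o set \<Rightarrow> ('o, 'm) cochain set)
    \<Rightarrow> (('o, 'm, 'x) acat_scheme \<Rightarrow> 'o set \<Rightarrow> ('o, 'm) cochain set)
    \<Rightarrow> (('o, 'm) cochain, ('o, 'm) cochain \<times> ('o, 'm) cochain \<times>
         (('o, 'm) harr \<times> ('o, 'm) harr) set) tcat" where
  "KQ A E S U = verdier_quotient (full_tri (HK A E) (S A E)) (U A E)"

end

theory Submission
  imports Defs
begin

text \<open>Every equivalence is the functor induced by an inclusion of triangulated subcategories. Let \<open>U\<close> and \<open>V\<close> be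
  triangulated subcategories of a triangulated category \<open>W\<close>. If every object \<open>X\<close> of \<open>W\<close> lies in a
  distinguished triangle \<open>M \<rightarrow> X \<rightarrow> N \<rightarrow> M[1]\<close> with \<open>M\<close> in \<open>V\<close> and \<open>N\<close> in \<open>U\<close>, or with \<open>M\<close> in \<open>U\<close>
  and \<open>N\<close> in \<open>V\<close>, then \<open>V / (V \<inter> U) \<rightarrow> W / U\<close> is an equivalence: modulo \<open>U\<close> the object \<open>X\<close> is isomorphic
  to an object of \<open>V\<close>, and every fraction, every equality of fractions and every distinguished triangle
  can be moved into \<open>V\<close> along such isomorphisms (\<open>subquotient_equivalence\<close>).

  The triangles come from truncations. For an arbitrary full subcategory \<open>E\<close> the brutal truncation gives
  \<open>M \<rightarrow> X \<rightarrow> N\<close> with \<open>M\<close> left bounded and \<open>N\<close> right bounded up to homotopy (\<open>brutal_triangle\<close>). When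
  \<open>E\<close> is the whole abelian category, a complex with right bounded cohomology is quasi-isomorphic to the right
  bounded complex \<open>\<tau>\<^sup>\<le>\<^sup>n X\<close> for large \<open>n\<close>, and one with left bounded cohomology to \<open>\<tau>\<^sup>\<ge>\<^sup>n X\<close>
  for small \<open>n\<close> (\<open>left_triangle\<close>, \<open>right_triangle\<close>). In both cases the cone of the truncation map is
  exact. It contracts in the degrees in which the map is an identity, so it is homotopy equivalent to a
  complex bounded on that side; at the end of the contraction an idempotent has to be split
  (\<open>split_low\<close>, \<open>split_high\<close>). The same argument identifies \<open>K\<^sup>+ \<inter> K\<^sup>-\<close> with \<open>K\<^sup>b\<close> (\<open>K_b_eq\<close>). The other
  intersections that occur as \<open>V \<inter> U\<close> amount to the invariance of cohomology under homotopy equivalence.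

  The Verdier quotient is built from roofs over an arbitrary category that satisfies the axioms
  \<open>triangulated\<close>, and the homotopy category is shown to satisfy them (\<open>triangulated_K\<close>). There the
  calculations with complexes are carried out in a ring: the homogeneous maps between graded objects act
  faithfully on one abelian group, and mapping cones become identities between elements of its endomorphism
  ring (\<open>dg_category\<close>). Vanishing of cohomology is tested on generalised elements, a cycle being a boundary
  after composition with an epimorphism (\<open>zero_cohomology_iff\<close>). This makes diagram chases through cones
  possible.\<close>

section \<open>Isomorphisms of triangles\<close>

lemma Hom_iff: "f \<in> Hom C X Y \<longleftrightarrow> f \<in> Arr C \<and> Dom C f = X \<and> Cod C f = Y"
  by (simp add: Hom_def)

context category
begin

lemma comp_arr [simp]:
  assumes "f \<in> Arr C" "g \<in> Arr C" "Cod C f = Dom C g"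
  shows "g \<cdot> f \<in> Arr C" "Dom C (g \<cdot> f) = Dom C f" "Cod C (g \<cdot> f) = Cod C g"
  using Comp_Hom[of f "Dom C f" "Cod C f" g "Cod C g"] assms by (auto simp: Hom_def)

lemma ident_arr [simp]:
  assumes "X \<in> Obj C"
  shows "Ident C X \<in> Arr C" "Dom C (Ident C X) = X" "Cod C (Ident C X) = X"
  using Ident_Hom[OF assms] by (auto simp: Hom_def)

lemma Dom_Cod_Obj [simp]: "f \<in> Arr C \<Longrightarrow> Dom C f \<in> Obj C" "f \<in> Arr C \<Longrightarrow> Cod C f \<in> Obj C"
  by (rule Dom_Obj, assumption) (rule Cod_Obj, assumption)

lemma comp_assoc [simp]:
  assumes "f \<in> Arr C" "g \<in> Arr C" "h \<in> Arr C" "Cod C f = Dom C g" "Cod C g = Dom C h"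
  shows "(h \<cdot> g) \<cdot> f = h \<cdot> (g \<cdot> f)"
  by (rule Comp_assoc[of f "Dom C f" "Cod C f" g "Cod C g" h "Cod C h"]) (use assms in \<open>auto simp: Hom_def\<close>)

lemma ident_comp [simp]: "f \<in> Arr C \<Longrightarrow> Cod C f = X \<Longrightarrow> Ident C X \<cdot> f = f"
  by (rule Ident_Comp[of f "Dom C f"]) (auto simp: Hom_def)

lemma comp_ident [simp]: "f \<in> Arr C \<Longrightarrow> Dom C f = X \<Longrightarrow> f \<cdot> Ident C X = f"
  by (rule Comp_Ident[of f _ "Cod C f"]) (auto simp: Hom_def)

lemma comp_assoc_eq:
  assumes "g \<cdot> f = k" "f \<in> Arr C" "g \<in> Arr C" "Cod C f = Dom C g" "x \<in> Arr C" "Cod C x = Dom C f"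
  shows "g \<cdot> (f \<cdot> x) = k \<cdot> x"
  using assms by (metis comp_assoc)

lemma iso_arrE:
  assumes "iso_arr C f"
  obtains g where "f \<in> Arr C" "g \<in> Arr C" "Dom C g = Cod C f" "Cod C g = Dom C f"
    "g \<cdot> f = Ident C (Dom C f)" "f \<cdot> g = Ident C (Cod C f)" "iso_arr C g"
  using assms unfolding iso_arr_def Bex_def Hom_iff by metis

lemma iso_arrI:
  assumes "f \<in> Hom C X Y" "g \<in> Hom C Y X" "g \<cdot> f = Ident C X" "f \<cdot> g = Ident C Y"
  shows "iso_arr C f"
  using assms unfolding iso_arr_def Bex_def Hom_iff by metis

lemma iso_ident [simp]: "X \<in> Obj C \<Longrightarrow> iso_arr C (Ident C X)"
  by (rule iso_arrI[of _ X X "Ident C X"]) (auto simp: Hom_def)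

lemma iso_comp:
  assumes "iso_arr C f" "iso_arr C g" "Cod C f = Dom C g"
  shows "iso_arr C (g \<cdot> f)"
proof -
  obtain f' where f': "f \<in> Arr C" "f' \<in> Arr C" "Dom C f' = Cod C f" "Cod C f' = Dom C f"
    "f' \<cdot> f = Ident C (Dom C f)" "f \<cdot> f' = Ident C (Cod C f)" by (rule iso_arrE[OF assms(1)])
  obtain g' where g': "g \<in> Arr C" "g' \<in> Arr C" "Dom C g' = Cod C g" "Cod C g' = Dom C g"
    "g' \<cdot> g = Ident C (Dom C g)" "g \<cdot> g' = Ident C (Cod C g)" by (rule iso_arrE[OF assms(2)])
  show ?thesis
    by (rule iso_arrI[of _ "Dom C f" "Cod C g" "f' \<cdot> g'"])
      (use f' g' assms(3) in \<open>auto simp: Hom_def comp_assoc_eq[OF g'(5)] comp_assoc_eq[OF f'(6)]\<close>)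
qed

lemma isomorphic_refl: "X \<in> Obj C \<Longrightarrow> isomorphic C X X"
  unfolding isomorphic_def by (rule bexI[of _ "Ident C X"]) (auto simp: Hom_def)

lemma isomorphic_sym: "isomorphic C X Y \<Longrightarrow> isomorphic C Y X"
  unfolding isomorphic_def Bex_def Hom_iff by (metis iso_arrE)

lemma isomorphic_trans: "isomorphic C X Y \<Longrightarrow> isomorphic C Y Z \<Longrightarrow> isomorphic C X Z"
  unfolding isomorphic_def Bex_def Hom_iff by (metis comp_arr iso_comp)

lemma zero_objects_isomorphic:
  assumes "zero_object C Z" "zero_object C Z'"
  shows "isomorphic C Z Z'"
proof -
  have o: "Z \<in> Obj C" "Z' \<in> Obj C" using assms by (auto simp: zero_object_def)
  obtain f g where f: "f \<in> Hom C Z Z'" and g: "g \<in> Hom C Z' Z"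
    using assms by (auto simp: zero_object_def)
  have "g \<cdot> f = Ident C Z" "f \<cdot> g = Ident C Z'"
    using assms o Comp_Hom[OF f g] Comp_Hom[OF g f] Ident_Hom[OF o(1)] Ident_Hom[OF o(2)]
    unfolding zero_object_def by metis+
  then show ?thesis using iso_arrI[OF f g] f unfolding isomorphic_def by blast
qed

end

definition typed_triangle :: "('o, 'm, 'x) tcat_scheme \<Rightarrow> 'm \<Rightarrow> 'm \<Rightarrow> 'm \<Rightarrow> bool" where
  "typed_triangle T u v w \<longleftrightarrow>
     u \<in> Arr T \<and> v \<in> Arr T \<and> w \<in> Arr T \<and> Dom T v = Cod T u \<and> Dom T w = Cod T v \<and> Cod T w = Sh T (Dom T u)"

lemma triangle_iso_iff:
  "triangle_iso T (u, v, w) (u', v', w') \<longleftrightarrow> typed_triangle T u v w \<and> typed_triangle T u' v' w' \<and>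
     (\<exists>a b c. iso_arr T a \<and> iso_arr T b \<and> iso_arr T c \<and>
        a \<in> Hom T (Dom T u) (Dom T u') \<and> b \<in> Hom T (Cod T u) (Cod T u') \<and> c \<in> Hom T (Cod T v) (Cod T v') \<and>
        b \<cdot>\<^bsub>T\<^esub> u = u' \<cdot>\<^bsub>T\<^esub> a \<and> c \<cdot>\<^bsub>T\<^esub> v = v' \<cdot>\<^bsub>T\<^esub> b \<and> ShA T a \<cdot>\<^bsub>T\<^esub> w = w' \<cdot>\<^bsub>T\<^esub> c)"
proof (cases "typed_triangle T u v w \<and> typed_triangle T u' v' w'")
  case True
  then show ?thesis by (auto simp: triangle_iso_def typed_triangle_def Hom_iff Bex_def)
next
  case False
  then show ?thesis by (auto simp: triangle_iso_def typed_triangle_def Hom_iff)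
qed

locale shift_category = category T for T :: "('o, 'm, 'x) tcat_scheme" (structure) +
  assumes Sh_Obj: "X \<in> Obj T \<Longrightarrow> Sh T X \<in> Obj T"
    and ShA_Hom: "f \<in> Hom T X Y \<Longrightarrow> ShA T f \<in> Hom T (Sh T X) (Sh T Y)"
    and ShA_Ident: "X \<in> Obj T \<Longrightarrow> ShA T (Ident T X) = Ident T (Sh T X)"
    and ShA_Comp: "f \<in> Hom T X Y \<Longrightarrow> g \<in> Hom T Y Z \<Longrightarrow> ShA T (g \<cdot> f) = ShA T g \<cdot> ShA T f"
begin

lemma sha_arr [simp]:
  assumes "f \<in> Arr T"
  shows "ShA T f \<in> Arr T" "Dom T (ShA T f) = Sh T (Dom T f)" "Cod T (ShA T f) = Sh T (Cod T f)"
  using ShA_Hom[of f "Dom T f" "Cod T f"] assms by (auto simp: Hom_def)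

lemma sha_comp [simp]:
  assumes "f \<in> Arr T" "g \<in> Arr T" "Cod T f = Dom T g"
  shows "ShA T (g \<cdot> f) = ShA T g \<cdot> ShA T f"
  using ShA_Comp[of f "Dom T f" "Cod T f" g "Cod T g"] assms by (auto simp: Hom_def)

lemma sh_obj [simp]: "X \<in> Obj T \<Longrightarrow> Sh T X \<in> Obj T" by (rule Sh_Obj)

lemma sha_ident [simp]: "X \<in> Obj T \<Longrightarrow> ShA T (Ident T X) = Ident T (Sh T X)" by (rule ShA_Ident)

lemma sha_iso:
  assumes "iso_arr T f"
  shows "iso_arr T (ShA T f)"
proof -
  obtain g where g: "f \<in> Arr T" "g \<in> Arr T" "Dom T g = Cod T f" "Cod T g = Dom T f"
    "g \<cdot> f = Ident T (Dom T f)" "f \<cdot> g = Ident T (Cod T f)" by (rule iso_arrE[OF assms])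
  show ?thesis
    by (rule iso_arrI[of _ "Sh T (Dom T f)" "Sh T (Cod T f)" "ShA T g"])
      (use g in \<open>auto simp: Hom_def simp flip: sha_comp\<close>)
qed

lemma triangle_iso_refl: "typed_triangle T u v w \<Longrightarrow> triangle_iso T (u, v, w) (u, v, w)"
  unfolding triangle_iso_iff
  by (rule conjI, assumption, rule conjI, assumption,
      rule exI[of _ "Ident T (Dom T u)"], rule exI[of _ "Ident T (Cod T u)"], rule exI[of _ "Ident T (Cod T v)"])
    (auto simp: typed_triangle_def Hom_def)

lemma triangle_iso_trans:
  assumes "triangle_iso T t t'" "triangle_iso T t' t''"
  shows "triangle_iso T t t''"
proof -
  obtain u v w u' v' w' u'' v'' w'' where t: "t = (u, v, w)" "t' = (u', v', w')" "t'' = (u'', v'', w'')"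
    by (metis prod_cases3)
  note A = assms[unfolded t triangle_iso_iff]
  obtain a b c where 1: "iso_arr T a" "iso_arr T b" "iso_arr T c" "a \<in> Hom T (Dom T u) (Dom T u')"
    "b \<in> Hom T (Cod T u) (Cod T u')" "c \<in> Hom T (Cod T v) (Cod T v')"
    "b \<cdot> u = u' \<cdot> a" "c \<cdot> v = v' \<cdot> b" "ShA T a \<cdot> w = w' \<cdot> c" using A(1) by blast
  obtain a' b' c' where 2: "iso_arr T a'" "iso_arr T b'" "iso_arr T c'" "a' \<in> Hom T (Dom T u') (Dom T u'')"
    "b' \<in> Hom T (Cod T u') (Cod T u'')" "c' \<in> Hom T (Cod T v') (Cod T v'')"
    "b' \<cdot> u' = u'' \<cdot> a'" "c' \<cdot> v' = v'' \<cdot> b'" "ShA T a' \<cdot> w' = w'' \<cdot> c'" using A(2) by blast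
  have ty: "typed_triangle T u v w" "typed_triangle T u' v' w'" "typed_triangle T u'' v'' w''"
    using A by auto
  note ty' = ty[unfolded typed_triangle_def]
  have i: "iso_arr T (a' \<cdot> a)" "iso_arr T (b' \<cdot> b)" "iso_arr T (c' \<cdot> c)"
    using 1 2 by (auto intro!: iso_comp simp: Hom_def)
  have e: "(b' \<cdot> b) \<cdot> u = u'' \<cdot> (a' \<cdot> a)" "(c' \<cdot> c) \<cdot> v = v'' \<cdot> (b' \<cdot> b)"
    "ShA T (a' \<cdot> a) \<cdot> w = w'' \<cdot> (c' \<cdot> c)"
    using 1 2 ty' by (auto simp: Hom_def comp_assoc_eq[OF 2(7)] comp_assoc_eq[OF 2(8)] comp_assoc_eq[OF 2(9)])
  show ?thesis unfolding t triangle_iso_iff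
    using ty i e 1(4-6) 2(4-6) by (meson Comp_Hom)
qed

lemma triangle_iso_sym:
  assumes "triangle_iso T t t'"
  shows "triangle_iso T t' t"
proof -
  obtain u v w u' v' w' where t: "t = (u, v, w)" "t' = (u', v', w')"
    by (metis prod_cases3)
  note A = assms[unfolded t triangle_iso_iff]
  obtain a b c where 1: "iso_arr T a" "iso_arr T b" "iso_arr T c" "a \<in> Hom T (Dom T u) (Dom T u')"
    "b \<in> Hom T (Cod T u) (Cod T u')" "c \<in> Hom T (Cod T v) (Cod T v')"
    "b \<cdot> u = u' \<cdot> a" "c \<cdot> v = v' \<cdot> b" "ShA T a \<cdot> w = w' \<cdot> c" using A by blast
  have ty: "typed_triangle T u v w" "typed_triangle T u' v' w'"
    using A by auto
  note ty' = ty[unfolded typed_triangle_def]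
  obtain a' where a: "a \<in> Arr T" "a' \<in> Arr T" "Dom T a' = Cod T a" "Cod T a' = Dom T a"
    "a' \<cdot> a = Ident T (Dom T a)" "a \<cdot> a' = Ident T (Cod T a)" "iso_arr T a'" by (rule iso_arrE[OF 1(1)])
  obtain b' where b: "b \<in> Arr T" "b' \<in> Arr T" "Dom T b' = Cod T b" "Cod T b' = Dom T b"
    "b' \<cdot> b = Ident T (Dom T b)" "b \<cdot> b' = Ident T (Cod T b)" "iso_arr T b'" by (rule iso_arrE[OF 1(2)])
  obtain c' where c: "c \<in> Arr T" "c' \<in> Arr T" "Dom T c' = Cod T c" "Cod T c' = Dom T c"
    "c' \<cdot> c = Ident T (Dom T c)" "c \<cdot> c' = Ident T (Cod T c)" "iso_arr T c'" by (rule iso_arrE[OF 1(3)])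
  note D = 1(4-6)[unfolded Hom_iff] ty' a(1-4) b(1-4) c(1-4)
  have "b' \<cdot> u' = b' \<cdot> (u' \<cdot> (a \<cdot> a'))" using a(6) D by simp
  also have "\<dots> = b' \<cdot> ((u' \<cdot> a) \<cdot> a')" using D by simp
  also have "\<dots> = b' \<cdot> ((b \<cdot> u) \<cdot> a')" by (simp only: 1(7))
  also have "\<dots> = u \<cdot> a'" using D by (simp add: comp_assoc_eq[OF b(5)])
  finally have e1: "b' \<cdot> u' = u \<cdot> a'" .
  have "c' \<cdot> v' = c' \<cdot> (v' \<cdot> (b \<cdot> b'))" using b(6) D by simp
  also have "\<dots> = c' \<cdot> ((v' \<cdot> b) \<cdot> b')" using D by simp
  also have "\<dots> = c' \<cdot> ((c \<cdot> v) \<cdot> b')" by (simp only: 1(8))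
  also have "\<dots> = v \<cdot> b'" using D by (simp add: comp_assoc_eq[OF c(5)])
  finally have e2: "c' \<cdot> v' = v \<cdot> b'" .
  have s: "ShA T a' \<cdot> ShA T a = Ident T (Sh T (Dom T u))" using a D by (simp flip: sha_comp)
  have "ShA T a' \<cdot> w' = ShA T a' \<cdot> (w' \<cdot> (c \<cdot> c'))" using c(6) D by simp
  also have "\<dots> = ShA T a' \<cdot> ((w' \<cdot> c) \<cdot> c')" using D by simp
  also have "\<dots> = ShA T a' \<cdot> ((ShA T a \<cdot> w) \<cdot> c')" by (simp only: 1(9))
  also have "\<dots> = w \<cdot> c'" using D by (simp add: comp_assoc_eq[OF s])
  finally have e3: "ShA T a' \<cdot> w' = w \<cdot> c'" .
  show ?thesis unfolding t triangle_iso_iff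
    by (intro conjI ty exI[of _ a'] exI[of _ b'] exI[of _ c'] a b c e1 e2 e3)
      (use D in \<open>auto simp: Hom_def\<close>)
qed

end

lemma triangle_iso_with_triangles [simp]:
  "triangle_iso (with_triangles T B) = triangle_iso T"
  by (intro ext) (simp add: triangle_iso_def with_triangles_def iso_arr_def Hom_def)

lemma Tri_with_triangles: "Tri (with_triangles T B) = {t. \<exists>t' \<in> B. triangle_iso T t t'}"
  by (simp add: with_triangles_def)

lemma with_triangles_simps [simp]:
  "Obj (with_triangles T B) = Obj T" "Arr (with_triangles T B) = Arr T"
  "Dom (with_triangles T B) = Dom T" "Cod (with_triangles T B) = Cod T"
  "Ident (with_triangles T B) = Ident T" "Comp (with_triangles T B) = Comp T"
  "Sh (with_triangles T B) = Sh T" "ShA (with_triangles T B) = ShA T"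
  "Hom (with_triangles T B) = Hom T" "iso_arr (with_triangles T B) = iso_arr T"
  by (auto simp: with_triangles_def Hom_def iso_arr_def fun_eq_iff)

section \<open>Equivalences that are the identity on objects\<close>

text \<open>The embedding of quotients below is the identity on objects. A quasi-inverse \<open>G\<close> picks for each
  object \<open>Y\<close> of \<open>D\<close> an isomorphism \<open>\<epsilon> Y\<close> from an object of \<open>C\<close>; conjugation with \<open>\<epsilon>\<close> defines \<open>G\<close> on arrows
  and its compatibility with the shift. That \<open>G\<close> preserves distinguished triangles is not
  automatic: \<open>lift\<close> says that \<open>D\<close> has no distinguished triangles beyond those coming from \<open>C\<close>, so
  that the embedding reflects them.\<close>

locale triangle_embedding =
  C: shift_category C + D: shift_category D
  for C :: "('o, 'm, 'x) tcat_scheme" and D :: "('o, 'n, 'y) tcat_scheme" and F :: "'m \<Rightarrow> 'n" +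
  assumes funct: "is_functor C D id F"
    and F_sh: "X \<in> Obj C \<Longrightarrow> Sh C X = Sh D X"
    and F_sha: "f \<in> Arr C \<Longrightarrow> F (ShA C f) = ShA D (F f)"
    and full: "X \<in> Obj C \<Longrightarrow> Y \<in> Obj C \<Longrightarrow> g \<in> Hom D X Y \<Longrightarrow> \<exists>f \<in> Hom C X Y. F f = g"
    and faithful: "f \<in> Hom C X Y \<Longrightarrow> f' \<in> Hom C X Y \<Longrightarrow> F f = F f' \<Longrightarrow> f = f'"
    and ess_surj: "Y \<in> Obj D \<Longrightarrow> \<exists>X \<in> Obj C. isomorphic D X Y"
    and C_typed: "(u, v, w) \<in> Tri C \<Longrightarrow> typed_triangle C u v w"
    and D_typed: "(u', v', w') \<in> Tri D \<Longrightarrow> typed_triangle D u' v' w'"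
    and C_closed: "triangle_iso C t t' \<Longrightarrow> t' \<in> Tri C \<Longrightarrow> t \<in> Tri C"
    and D_closed: "triangle_iso D d d' \<Longrightarrow> d' \<in> Tri D \<Longrightarrow> d \<in> Tri D"
    and F_tri: "(u, v, w) \<in> Tri C \<Longrightarrow> (F u, F v, F w) \<in> Tri D"
    and lift: "d \<in> Tri D \<Longrightarrow> \<exists>u v w. (u, v, w) \<in> Tri C \<and> triangle_iso D d (F u, F v, F w)"
begin

lemma obj_D [simp]: "X \<in> Obj C \<Longrightarrow> X \<in> Obj D"
  using funct by (simp add: is_functor_def)

lemma F_arr [simp]:
  assumes "f \<in> Arr C"
  shows "F f \<in> Arr D" "Dom D (F f) = Dom C f" "Cod D (F f) = Cod C f"
  using funct assms by (auto simp: is_functor_def Hom_def)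

lemma F_ident [simp]: "X \<in> Obj C \<Longrightarrow> F (Ident C X) = Ident D X"
  using funct by (simp add: is_functor_def)

lemma F_comp [simp]:
  "f \<in> Arr C \<Longrightarrow> g \<in> Arr C \<Longrightarrow> Cod C f = Dom C g \<Longrightarrow> F (g \<cdot>\<^bsub>C\<^esub> f) = F g \<cdot>\<^bsub>D\<^esub> F f"
  using funct by (simp add: is_functor_def)

definition pre :: "'o \<Rightarrow> 'o \<Rightarrow> 'n \<Rightarrow> 'm" where
  "pre X Y g = (SOME f. f \<in> Hom C X Y \<and> F f = g)"

lemma pre:
  assumes "g \<in> Arr D" "Dom D g = X" "Cod D g = Y" "X \<in> Obj C" "Y \<in> Obj C"
  shows "F (pre X Y g) = g" "pre X Y g \<in> Arr C" "Dom C (pre X Y g) = X" "Cod C (pre X Y g) = Y"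
proof -
  have "\<exists>f. f \<in> Hom C X Y \<and> F f = g" using full[of X Y g] assms by (auto simp: Hom_def)
  then have "pre X Y g \<in> Hom C X Y \<and> F (pre X Y g) = g" unfolding pre_def by (rule someI_ex)
  then show "F (pre X Y g) = g" "pre X Y g \<in> Arr C" "Dom C (pre X Y g) = X" "Cod C (pre X Y g) = Y"
    by (auto simp: Hom_def)
qed

lemma faithfulI:
  assumes "F f = F f'" "f \<in> Arr C" "f' \<in> Arr C" "Dom C f = Dom C f'" "Cod C f = Cod C f'"
  shows "f = f'"
  by (rule faithful[of f "Dom C f" "Cod C f"]) (use assms in \<open>auto simp: Hom_def\<close>)

lemma iso_reflect:
  assumes "iso_arr D g" "X \<in> Obj C" "Y \<in> Obj C" "g \<in> Hom D X Y"
  shows "iso_arr C (pre X Y g)"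
proof -
  obtain h where h: "g \<in> Arr D" "h \<in> Arr D" "Dom D h = Cod D g" "Cod D h = Dom D g"
    "h \<cdot>\<^bsub>D\<^esub> g = Ident D (Dom D g)" "g \<cdot>\<^bsub>D\<^esub> h = Ident D (Cod D g)" by (rule D.iso_arrE[OF assms(1)])
  note P = pre[of g X Y] pre[of h Y X]
  show ?thesis
    by (rule C.iso_arrI[of _ X Y "pre Y X h"])
      (use h assms P in \<open>auto simp: Hom_def intro!: faithfulI\<close>)
qed

text \<open>By \<open>lift\<close> the image of a triangle is isomorphic to the image of a distinguished one. Fullness and
  faithfulness pull this isomorphism back.\<close>

lemma tri_reflect:
  assumes "typed_triangle C u v w" "(F u, F v, F w) \<in> Tri D"
  shows "(u, v, w) \<in> Tri C"
proof -
  obtain u' v' w' where T: "(u', v', w') \<in> Tri C" and "triangle_iso D (F u, F v, F w) (F u', F v', F w')"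
    using lift[OF assms(2)] by blast
  note T' = C_typed[OF T, unfolded typed_triangle_def] assms(1)[unfolded typed_triangle_def]
  obtain a b c where 1: "iso_arr D a" "iso_arr D b" "iso_arr D c" "a \<in> Hom D (Dom D (F u)) (Dom D (F u'))"
    "b \<in> Hom D (Cod D (F u)) (Cod D (F u'))" "c \<in> Hom D (Cod D (F v)) (Cod D (F v'))"
    "b \<cdot>\<^bsub>D\<^esub> F u = F u' \<cdot>\<^bsub>D\<^esub> a" "c \<cdot>\<^bsub>D\<^esub> F v = F v' \<cdot>\<^bsub>D\<^esub> b" "ShA D a \<cdot>\<^bsub>D\<^esub> F w = F w' \<cdot>\<^bsub>D\<^esub> c"
    using \<open>triangle_iso D _ _\<close> unfolding triangle_iso_iff by blast
  note H = 1(4-6)[unfolded Hom_iff]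
  define a' b' c' where d: "a' = pre (Dom C u) (Dom C u') a" "b' = pre (Cod C u) (Cod C u') b"
    "c' = pre (Cod C v) (Cod C v') c"
  have a': "F a' = a" "a' \<in> Arr C" "Dom C a' = Dom C u" "Cod C a' = Dom C u'"
    unfolding d by (rule pre; use H T' in simp)+
  have b': "F b' = b" "b' \<in> Arr C" "Dom C b' = Cod C u" "Cod C b' = Cod C u'"
    unfolding d by (rule pre; use H T' in simp)+
  have c': "F c' = c" "c' \<in> Arr C" "Dom C c' = Cod C v" "Cod C c' = Cod C v'"
    unfolding d by (rule pre; use H T' in simp)+
  have i: "iso_arr C a'" "iso_arr C b'" "iso_arr C c'"
    unfolding d by (rule iso_reflect; use 1 T' in simp)+
  have e: "b' \<cdot>\<^bsub>C\<^esub> u = u' \<cdot>\<^bsub>C\<^esub> a'" "c' \<cdot>\<^bsub>C\<^esub> v = v' \<cdot>\<^bsub>C\<^esub> b'" "ShA C a' \<cdot>\<^bsub>C\<^esub> w = w' \<cdot>\<^bsub>C\<^esub> c'"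
    by (rule faithfulI; use a' b' c' T' 1(7-9) in \<open>simp add: F_sha\<close>)+
  have "triangle_iso C (u, v, w) (u', v', w')"
    unfolding triangle_iso_iff
    by (intro conjI assms(1) C_typed[OF T] exI[of _ a'] exI[of _ b'] exI[of _ c'] i e)
      (use a' b' c' T' in \<open>simp_all add: Hom_def\<close>)
  then show ?thesis using C_closed T by blast
qed

lemma full_faithful_ess_surj: "C \<simeq>\<^sub>\<Delta> D" "D \<simeq>\<^sub>\<Delta> C"
proof -
  have "\<forall>Y. \<exists>X e d. Y \<in> Obj D \<longrightarrow> X \<in> Obj C \<and> e \<in> Arr D \<and> d \<in> Arr D \<and> Dom D e = X \<and> Cod D e = Y \<and>
     Dom D d = Y \<and> Cod D d = X \<and> d \<cdot>\<^bsub>D\<^esub> e = Ident D X \<and> e \<cdot>\<^bsub>D\<^esub> d = Ident D Y \<and> iso_arr D e \<and> iso_arr D d"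
    using ess_surj unfolding isomorphic_def Bex_def Hom_iff by (metis D.iso_arrE)
  then obtain Go where "\<forall>Y. \<exists>e d. Y \<in> Obj D \<longrightarrow> Go Y \<in> Obj C \<and> e \<in> Arr D \<and> d \<in> Arr D \<and> Dom D e = Go Y \<and> Cod D e = Y \<and>
     Dom D d = Y \<and> Cod D d = Go Y \<and> d \<cdot>\<^bsub>D\<^esub> e = Ident D (Go Y) \<and> e \<cdot>\<^bsub>D\<^esub> d = Ident D Y \<and> iso_arr D e \<and> iso_arr D d"
    by (rule choice[THEN exE])
  then obtain e where "\<forall>Y. \<exists>d. Y \<in> Obj D \<longrightarrow> Go Y \<in> Obj C \<and> e Y \<in> Arr D \<and> d \<in> Arr D \<and> Dom D (e Y) = Go Y \<and> Cod D (e Y) = Y \<and>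
     Dom D d = Y \<and> Cod D d = Go Y \<and> d \<cdot>\<^bsub>D\<^esub> e Y = Ident D (Go Y) \<and> e Y \<cdot>\<^bsub>D\<^esub> d = Ident D Y \<and> iso_arr D (e Y) \<and> iso_arr D d"
    by (rule choice[THEN exE])
  then obtain d where "\<forall>Y. Y \<in> Obj D \<longrightarrow> Go Y \<in> Obj C \<and> e Y \<in> Arr D \<and> d Y \<in> Arr D \<and> Dom D (e Y) = Go Y \<and> Cod D (e Y) = Y \<and>
     Dom D (d Y) = Y \<and> Cod D (d Y) = Go Y \<and> d Y \<cdot>\<^bsub>D\<^esub> e Y = Ident D (Go Y) \<and> e Y \<cdot>\<^bsub>D\<^esub> d Y = Ident D Y \<and> iso_arr D (e Y) \<and> iso_arr D (d Y)"
    by (rule choice[THEN exE])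
  then have G [simp]: "Y \<in> Obj D \<Longrightarrow> Go Y \<in> Obj C" "Y \<in> Obj D \<Longrightarrow> e Y \<in> Arr D" "Y \<in> Obj D \<Longrightarrow> d Y \<in> Arr D"
    "Y \<in> Obj D \<Longrightarrow> Dom D (e Y) = Go Y" "Y \<in> Obj D \<Longrightarrow> Cod D (e Y) = Y"
    "Y \<in> Obj D \<Longrightarrow> Dom D (d Y) = Y" "Y \<in> Obj D \<Longrightarrow> Cod D (d Y) = Go Y"
    "Y \<in> Obj D \<Longrightarrow> d Y \<cdot>\<^bsub>D\<^esub> e Y = Ident D (Go Y)" "Y \<in> Obj D \<Longrightarrow> e Y \<cdot>\<^bsub>D\<^esub> d Y = Ident D Y"
    and eiso: "Y \<in> Obj D \<Longrightarrow> iso_arr D (e Y)" and diso: "Y \<in> Obj D \<Longrightarrow> iso_arr D (d Y)" for Y by auto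
  have ed [simp]: "e Y \<cdot>\<^bsub>D\<^esub> (d Y \<cdot>\<^bsub>D\<^esub> x) = x" if "Y \<in> Obj D" "x \<in> Arr D" "Cod D x = Y" for Y x
    using that D.comp_assoc_eq[of "e Y" "d Y" "Ident D Y" x] by simp
  have de [simp]: "d Y \<cdot>\<^bsub>D\<^esub> (e Y \<cdot>\<^bsub>D\<^esub> x) = x" if "Y \<in> Obj D" "x \<in> Arr D" "Cod D x = Go Y" for Y x
    using that D.comp_assoc_eq[of "d Y" "e Y" "Ident D (Go Y)" x] by simp
  define Ga where "Ga f = pre (Go (Dom D f)) (Go (Cod D f)) (d (Cod D f) \<cdot>\<^bsub>D\<^esub> (f \<cdot>\<^bsub>D\<^esub> e (Dom D f)))" for f
  have Ga [simp]: "F (Ga f) = d (Cod D f) \<cdot>\<^bsub>D\<^esub> (f \<cdot>\<^bsub>D\<^esub> e (Dom D f))" "Ga f \<in> Arr C"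
    "Dom C (Ga f) = Go (Dom D f)" "Cod C (Ga f) = Go (Cod D f)" if "f \<in> Arr D" for f
    unfolding Ga_def by (rule pre; use that in simp)+
  have Gfun: "is_functor D C Go Ga"
    unfolding is_functor_def
    using C.category_axioms D.category_axioms by (auto simp: Hom_def intro!: faithfulI)
  have ne: "natural_iso D D (id \<circ> Go) (F \<circ> Ga) id id e" and nd: "natural_iso D D id id (id \<circ> Go) (F \<circ> Ga) d"
    unfolding natural_iso_def by (auto simp: Hom_def eiso diso)
  define e' where "e' X = pre (Go X) X (e X)" for X
  define d' where "d' X = pre X (Go X) (d X)" for X
  have e' [simp]: "F (e' X) = e X" "e' X \<in> Arr C" "Dom C (e' X) = Go X" "Cod C (e' X) = X" "iso_arr C (e' X)"
    if "X \<in> Obj C" for X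
    unfolding e'_def by (rule pre, use that in simp_all)+ (rule iso_reflect, use that in \<open>simp_all add: eiso Hom_def\<close>)
  have d' [simp]: "F (d' X) = d X" "d' X \<in> Arr C" "Dom C (d' X) = X" "Cod C (d' X) = Go X" "iso_arr C (d' X)"
    if "X \<in> Obj C" for X
    unfolding d'_def by (rule pre, use that in simp_all)+ (rule iso_reflect, use that in \<open>simp_all add: diso Hom_def\<close>)
  have ne': "natural_iso C C (Go \<circ> id) (Ga \<circ> F) id id e'" and nd': "natural_iso C C id id (Go \<circ> id) (Ga \<circ> F) d'"
    unfolding natural_iso_def by (auto simp: Hom_def intro!: faithfulI)
  have eqF: "is_equivalence C D id F"
    unfolding is_equivalence_def
    using funct Gfun nd' ne by blast
  have eqG: "is_equivalence D C Go Ga"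
    unfolding is_equivalence_def
    using funct Gfun nd ne' by blast
  have idnat: "natural_iso C D (id \<circ> Sh C) (F \<circ> ShA C) (Sh D \<circ> id) (ShA D \<circ> F) (\<lambda>X. Ident D (Sh D X))"
    unfolding natural_iso_def by (auto simp: F_sh F_sha Hom_def)
  have "triangle_functor C D id F (\<lambda>X. Ident D (Sh D X))"
    unfolding triangle_functor_def
  proof (intro conjI funct idnat allI impI)
    fix u v w assume T: "(u, v, w) \<in> Tri C"
    then show "(F u, F v, Ident D (Sh D (Dom C u)) \<cdot>\<^bsub>D\<^esub> F w) \<in> Tri D"
      using F_tri[OF T] C_typed[OF T] by (simp add: typed_triangle_def F_sh)
  qed
  then show "C \<simeq>\<^sub>\<Delta> D" using eqF unfolding triangle_equivalent_def by blast
  have sed [simp]: "ShA D (e Y) \<cdot>\<^bsub>D\<^esub> (ShA D (d Y) \<cdot>\<^bsub>D\<^esub> x) = x" if "Y \<in> Obj D" "x \<in> Arr D" "Cod D x = Sh D Y" for Y x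
  proof -
    have "ShA D (e Y) \<cdot>\<^bsub>D\<^esub> ShA D (d Y) = Ident D (Sh D Y)" using that by (simp flip: D.sha_comp)
    from D.comp_assoc_eq[OF this] that show ?thesis by simp
  qed
  have sde: "ShA D (d Y) \<cdot>\<^bsub>D\<^esub> ShA D (e Y) = Ident D (Sh D (Go Y))" if "Y \<in> Obj D" for Y
    using that by (simp flip: D.sha_comp)
  have SG: "Sh C (Go Y) \<in> Obj C" "Sh D (Go Y) = Sh C (Go Y)" if "Y \<in> Obj D" for Y
    using that by (simp_all add: F_sh[symmetric])
  define x where "x Y = pre (Go (Sh D Y)) (Sh C (Go Y)) (ShA D (d Y) \<cdot>\<^bsub>D\<^esub> e (Sh D Y))" for Y
  have x [simp]: "F (x Y) = ShA D (d Y) \<cdot>\<^bsub>D\<^esub> e (Sh D Y)" "x Y \<in> Arr C" "Dom C (x Y) = Go (Sh D Y)"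
    "Cod C (x Y) = Sh C (Go Y)"
    if "Y \<in> Obj D" for Y
    unfolding x_def by (rule pre, use that SG in simp_all)+
  have xi: "iso_arr C (x Y)" if "Y \<in> Obj D" for Y
    unfolding x_def
    by (rule iso_reflect) (use that SG in \<open>auto intro!: D.iso_comp D.sha_iso simp: Hom_def eiso diso\<close>)
  have xnat: "natural_iso D C (Go \<circ> Sh D) (Ga \<circ> ShA D) (Sh C \<circ> Go) (ShA C \<circ> Ga) x"
    unfolding natural_iso_def by (auto simp: Hom_def xi SG F_sha intro!: faithfulI)
  have "triangle_functor D C Go Ga x"
    unfolding triangle_functor_def
  proof (intro conjI Gfun xnat allI impI)
    fix u v w assume T: "(u, v, w) \<in> Tri D"
    note ty = D_typed[OF T]
    note ty' = ty[unfolded typed_triangle_def]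
    have O: "Dom D u \<in> Obj D" using ty' by simp
    have tyG: "typed_triangle C (Ga u) (Ga v) (x (Dom D u) \<cdot>\<^bsub>C\<^esub> Ga w)"
      using ty' by (simp add: typed_triangle_def)
    then have tyFG: "typed_triangle D (F (Ga u)) (F (Ga v)) (F (x (Dom D u) \<cdot>\<^bsub>C\<^esub> Ga w))"
      unfolding typed_triangle_def by (simp add: F_sh)
    have "triangle_iso D (F (Ga u), F (Ga v), F (x (Dom D u) \<cdot>\<^bsub>C\<^esub> Ga w)) (u, v, w)"
      unfolding triangle_iso_iff
      by (intro conjI tyFG ty exI[of _ "e (Dom D u)"] exI[of _ "e (Cod D u)"] exI[of _ "e (Cod D v)"])
        (use ty' in \<open>auto simp: Hom_def eiso SG\<close>)
    then show "(Ga u, Ga v, x (Dom D u) \<cdot>\<^bsub>C\<^esub> Ga w) \<in> Tri C"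
      using tri_reflect[OF tyG] D_closed T by blast
  qed
  then show "D \<simeq>\<^sub>\<Delta> C" using eqG unfolding triangle_equivalent_def by blast
qed

end

section \<open>Triangulated categories and their localizing classes\<close>

text \<open>A form of the axioms of triangulated categories that mentions neither zero arrows nor addition, made for
  the calculus of fractions. Rotation does not identify the new third arrow, and the octahedron is
  asserted for some choice of cones, which \<open>cone_unique\<close> makes harmless. In \<open>equalize\<close> the difference
  \<open>f - g\<close> factors as \<open>u h\<close> because \<open>t\<close> annihilates it, and \<open>s\<close> is the arrow whose cone is the
  target of \<open>h\<close>; \<open>coequalize\<close> is the dual. All axioms pass to full triangulated subcategories.\<close>

locale triangulated = shift_category T for T :: "('o, 'm, 'x) tcat_scheme" (structure) +
  assumes Tri_typed: "(u, v, w) \<in> Tri T \<Longrightarrow> typed_triangle T u v w"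
    and Tri_closed: "triangle_iso T d d' \<Longrightarrow> d' \<in> Tri T \<Longrightarrow> d \<in> Tri T"
    and identity_triangle: "X \<in> Obj T \<Longrightarrow> \<exists>v w. (Ident T X, v, w) \<in> Tri T \<and> zero_object T (Cod T v)"
    and extend_first: "u \<in> Arr T \<Longrightarrow> \<exists>v w. (u, v, w) \<in> Tri T"
    and extend_second: "v \<in> Arr T \<Longrightarrow> \<exists>u w. (u, v, w) \<in> Tri T"
    and extend_third: "X \<in> Obj T \<Longrightarrow> w \<in> Arr T \<Longrightarrow> Cod T w = Sh T X
      \<Longrightarrow> \<exists>u v. (u, v, w) \<in> Tri T \<and> Dom T u = X"
    and rotate: "(u, v, w) \<in> Tri T \<Longrightarrow> \<exists>x. (v, w, x) \<in> Tri T"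
    and fill_first: "(u, v, w) \<in> Tri T \<Longrightarrow> (u', v', w') \<in> Tri T
      \<Longrightarrow> b \<in> Hom T (Cod T u) (Cod T u') \<Longrightarrow> c \<in> Hom T (Cod T v) (Cod T v') \<Longrightarrow> c \<cdot> v = v' \<cdot> b
      \<Longrightarrow> \<exists>a \<in> Hom T (Dom T u) (Dom T u'). b \<cdot> u = u' \<cdot> a"
    and fill_second: "(u, v, w) \<in> Tri T \<Longrightarrow> (u', v', w') \<in> Tri T
      \<Longrightarrow> a \<in> Hom T (Dom T u) (Dom T u') \<Longrightarrow> c \<in> Hom T (Cod T v) (Cod T v') \<Longrightarrow> ShA T a \<cdot> w = w' \<cdot> c
      \<Longrightarrow> \<exists>b \<in> Hom T (Cod T u) (Cod T u'). b \<cdot> u = u' \<cdot> a"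
    and cone_unique: "(u, v, w) \<in> Tri T \<Longrightarrow> (u, v', w') \<in> Tri T
      \<Longrightarrow> \<exists>c \<in> Hom T (Cod T v) (Cod T v'). iso_arr T c \<and> c \<cdot> v = v' \<and> w = w' \<cdot> c"
    and octahedron: "f \<in> Arr T \<Longrightarrow> g \<in> Arr T \<Longrightarrow> Cod T f = Dom T g
      \<Longrightarrow> \<exists>j k l i m n a b x. (f, j, k) \<in> Tri T \<and> (g, l, i) \<in> Tri T \<and> (g \<cdot> f, m, n) \<in> Tri T \<and> (a, b, x) \<in> Tri T \<and>
           a \<in> Hom T (Cod T j) (Cod T m) \<and> b \<in> Hom T (Cod T m) (Cod T l) \<and>
           a \<cdot> j = m \<cdot> g \<and> n \<cdot> a = k \<and> b \<cdot> m = l \<and> i \<cdot> b = ShA T f \<cdot> n"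
    and equalize: "(u, t, w) \<in> Tri T \<Longrightarrow> f \<in> Hom T X (Dom T t) \<Longrightarrow> g \<in> Hom T X (Dom T t) \<Longrightarrow> t \<cdot> f = t \<cdot> g
      \<Longrightarrow> \<exists>s h w'. (s, h, w') \<in> Tri T \<and> Dom T h = X \<and> Cod T h = Dom T u \<and> f \<cdot> s = g \<cdot> s"
    and coequalize: "(s, v, w) \<in> Tri T \<Longrightarrow> f \<in> Hom T (Cod T s) Y \<Longrightarrow> g \<in> Hom T (Cod T s) Y \<Longrightarrow> f \<cdot> s = g \<cdot> s
      \<Longrightarrow> \<exists>h t x. (h, t, x) \<in> Tri T \<and> Dom T h = Cod T v \<and> Cod T h = Y \<and> t \<cdot> f = t \<cdot> g"
    and shift_triangle: "(u, v, w) \<in> Tri T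
      \<Longrightarrow> \<exists>v' w'. (ShA T u, v', w') \<in> Tri T \<and> Cod T v' = Sh T (Cod T v)"
begin

lemma tri:
  assumes "(u, v, w) \<in> Tri T"
  shows "u \<in> Arr T" "v \<in> Arr T" "w \<in> Arr T" "Dom T v = Cod T u" "Dom T w = Cod T v" "Cod T w = Sh T (Dom T u)"
  using Tri_typed[OF assms] by (auto simp: typed_triangle_def)

lemma iso_cone_zero:
  assumes "iso_arr T u"
  shows "\<exists>v w. (u, v, w) \<in> Tri T \<and> zero_object T (Cod T v)"
proof -
  obtain u' where u: "u \<in> Arr T" "u' \<in> Arr T" "Dom T u' = Cod T u" "Cod T u' = Dom T u"
    "u' \<cdot> u = Ident T (Dom T u)" "u \<cdot> u' = Ident T (Cod T u)" "iso_arr T u'" by (rule iso_arrE[OF assms])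
  obtain v w where V: "(Ident T (Dom T u), v, w) \<in> Tri T" "zero_object T (Cod T v)"
    using identity_triangle[of "Dom T u"] u by auto
  note V' = tri[OF V(1)]
  have ty: "typed_triangle T u (v \<cdot> u') w" using V' u by (simp add: typed_triangle_def)
  have "triangle_iso T (u, v \<cdot> u', w) (Ident T (Dom T u), v, w)"
    unfolding triangle_iso_iff
    by (intro conjI ty Tri_typed[OF V(1)] exI[of _ "Ident T (Dom T u)"] exI[of _ u'] exI[of _ "Ident T (Cod T v)"])
      (use V' u in \<open>simp_all add: Hom_def\<close>)
  moreover have "Cod T (v \<cdot> u') = Cod T v" using V' u by simp
  ultimately show ?thesis using Tri_closed V by metis
qed

end

definition triangulated_subcat :: "('o, 'm, 'x) tcat_scheme \<Rightarrow> 'o set \<Rightarrow> bool" where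
  "triangulated_subcat T U \<longleftrightarrow> U \<subseteq> Obj T \<and> (\<forall>Z. zero_object T Z \<longrightarrow> Z \<in> U) \<and>
     (\<forall>X \<in> Obj T. Sh T X \<in> U \<longleftrightarrow> X \<in> U) \<and>
     (\<forall>u v w. (u, v, w) \<in> Tri T \<longrightarrow>
        (Dom T u \<in> U \<longrightarrow> Cod T u \<in> U \<longrightarrow> Cod T v \<in> U) \<and>
        (Dom T u \<in> U \<longrightarrow> Cod T v \<in> U \<longrightarrow> Cod T u \<in> U) \<and>
        (Cod T u \<in> U \<longrightarrow> Cod T v \<in> U \<longrightarrow> Dom T u \<in> U))"

lemma triangulated_subcatD:
  assumes "triangulated_subcat T U"
  shows "U \<subseteq> Obj T" "zero_object T Z \<Longrightarrow> Z \<in> U" "X \<in> Obj T \<Longrightarrow> Sh T X \<in> U \<longleftrightarrow> X \<in> U"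
    "(u, v, w) \<in> Tri T \<Longrightarrow> Dom T u \<in> U \<Longrightarrow> Cod T u \<in> U \<Longrightarrow> Cod T v \<in> U"
    "(u, v, w) \<in> Tri T \<Longrightarrow> Dom T u \<in> U \<Longrightarrow> Cod T v \<in> U \<Longrightarrow> Cod T u \<in> U"
    "(u, v, w) \<in> Tri T \<Longrightarrow> Cod T u \<in> U \<Longrightarrow> Cod T v \<in> U \<Longrightarrow> Dom T u \<in> U"
  using assms unfolding triangulated_subcat_def by blast+

lemma triangulated_subcatI:
  assumes "U \<subseteq> Obj T" "\<And>Z. zero_object T Z \<Longrightarrow> Z \<in> U" "\<And>X. X \<in> Obj T \<Longrightarrow> Sh T X \<in> U \<longleftrightarrow> X \<in> U"
    "\<And>u v w. (u, v, w) \<in> Tri T \<Longrightarrow> Dom T u \<in> U \<Longrightarrow> Cod T u \<in> U \<Longrightarrow> Cod T v \<in> U"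
    "\<And>u v w. (u, v, w) \<in> Tri T \<Longrightarrow> Dom T u \<in> U \<Longrightarrow> Cod T v \<in> U \<Longrightarrow> Cod T u \<in> U"
    "\<And>u v w. (u, v, w) \<in> Tri T \<Longrightarrow> Cod T u \<in> U \<Longrightarrow> Cod T v \<in> U \<Longrightarrow> Dom T u \<in> U"
  shows "triangulated_subcat T U"
  unfolding triangulated_subcat_def by (intro conjI allI ballI impI; (rule assms; assumption))

lemma triangulated_subcat_Int:
  assumes "triangulated_subcat T U" "triangulated_subcat T V"
  shows "triangulated_subcat T (U \<inter> V)"
proof (rule triangulated_subcatI)
  fix u v w assume A: "(u, v, w) \<in> Tri T"
  note D = triangulated_subcatD(4-6)[OF assms(1) A] triangulated_subcatD(4-6)[OF assms(2) A]
  show "Dom T u \<in> U \<inter> V \<Longrightarrow> Cod T u \<in> U \<inter> V \<Longrightarrow> Cod T v \<in> U \<inter> V"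
    "Dom T u \<in> U \<inter> V \<Longrightarrow> Cod T v \<in> U \<inter> V \<Longrightarrow> Cod T u \<in> U \<inter> V"
    "Cod T u \<in> U \<inter> V \<Longrightarrow> Cod T v \<in> U \<inter> V \<Longrightarrow> Dom T u \<in> U \<inter> V"
    using D by simp_all
qed (use triangulated_subcatD(1-3)[OF assms(1)] triangulated_subcatD(1-3)[OF assms(2)] in auto)

locale localization = triangulated T for T :: "('o, 'm, 'x) tcat_scheme" (structure) +
  fixes U :: "'o set"
  assumes sub: "triangulated_subcat T U"
begin

abbreviation S where "S \<equiv> cone_in T U"

lemma U_Obj: "X \<in> U \<Longrightarrow> X \<in> Obj T"
  and U_zero: "zero_object T Z \<Longrightarrow> Z \<in> U"
  and U_Sh: "X \<in> Obj T \<Longrightarrow> Sh T X \<in> U \<longleftrightarrow> X \<in> U"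
  using sub unfolding triangulated_subcat_def by blast+

lemma U_tri:
  assumes "(u, v, w) \<in> Tri T"
  shows "Dom T u \<in> U \<Longrightarrow> Cod T u \<in> U \<Longrightarrow> Cod T v \<in> U"
    "Dom T u \<in> U \<Longrightarrow> Cod T v \<in> U \<Longrightarrow> Cod T u \<in> U"
    "Cod T u \<in> U \<Longrightarrow> Cod T v \<in> U \<Longrightarrow> Dom T u \<in> U"
  using sub assms unfolding triangulated_subcat_def by blast+

lemma U_iso:
  assumes "isomorphic T X Y" "X \<in> U"
  shows "Y \<in> U"
proof -
  obtain u where u: "iso_arr T u" "Dom T u = X" "Cod T u = Y"
    using assms unfolding isomorphic_def Bex_def Hom_iff by blast
  obtain v w where "(u, v, w) \<in> Tri T" "zero_object T (Cod T v)" using iso_cone_zero[OF u(1)] by blast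
  then show ?thesis using U_tri(2) U_zero u assms by blast
qed

lemma S_arr [simp]: "s \<in> S \<Longrightarrow> s \<in> Arr T" by (simp add: cone_in_def)

lemma S_E:
  assumes "s \<in> S"
  obtains v w where "(s, v, w) \<in> Tri T" "Cod T v \<in> U"
  using assms unfolding cone_in_def by blast

lemma S_iff:
  assumes "(s, v, w) \<in> Tri T"
  shows "s \<in> S \<longleftrightarrow> Cod T v \<in> U"
proof
  assume "s \<in> S"
  then obtain v' w' where V: "(s, v', w') \<in> Tri T" "Cod T v' \<in> U" by (rule S_E)
  obtain c where "c \<in> Hom T (Cod T v') (Cod T v)" "iso_arr T c" using cone_unique[OF V(1) assms] by blast
  then have "isomorphic T (Cod T v') (Cod T v)" unfolding isomorphic_def by blast
  then show "Cod T v \<in> U" using U_iso V by blast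
next
  assume "Cod T v \<in> U" then show "s \<in> S" using assms tri(1)[OF assms] unfolding cone_in_def by blast
qed

lemma S_iso: "iso_arr T s \<Longrightarrow> s \<in> S"
  using iso_cone_zero[of s] U_zero S_iff by blast

lemma S_ident [simp]: "X \<in> Obj T \<Longrightarrow> Ident T X \<in> S" by (simp add: S_iso)

text \<open>By the octahedron the cones of \<open>f\<close>, \<open>g f\<close> and \<open>g\<close> form a distinguished triangle.\<close>

lemma S_two_of_three:
  assumes "f \<in> Arr T" "g \<in> Arr T" "Cod T f = Dom T g"
  shows "f \<in> S \<Longrightarrow> g \<in> S \<Longrightarrow> g \<cdot> f \<in> S" "f \<in> S \<Longrightarrow> g \<cdot> f \<in> S \<Longrightarrow> g \<in> S" "g \<in> S \<Longrightarrow> g \<cdot> f \<in> S \<Longrightarrow> f \<in> S"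
proof -
  obtain j k l i m n a b x where O: "(f, j, k) \<in> Tri T" "(g, l, i) \<in> Tri T" "(g \<cdot> f, m, n) \<in> Tri T" "(a, b, x) \<in> Tri T"
           "a \<in> Hom T (Cod T j) (Cod T m)" "b \<in> Hom T (Cod T m) (Cod T l)"
    using octahedron[OF assms] by blast
  have "Dom T a = Cod T j" "Cod T a = Cod T m" "Cod T b = Cod T l" using O by (auto simp: Hom_def)
  then show "f \<in> S \<Longrightarrow> g \<in> S \<Longrightarrow> g \<cdot> f \<in> S" "f \<in> S \<Longrightarrow> g \<cdot> f \<in> S \<Longrightarrow> g \<in> S" "g \<in> S \<Longrightarrow> g \<cdot> f \<in> S \<Longrightarrow> f \<in> S"
    using U_tri[OF O(4)] by (auto simp: S_iff[OF O(1)] S_iff[OF O(2)] S_iff[OF O(3)])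
qed

lemma S_comp [simp]: "f \<in> S \<Longrightarrow> g \<in> S \<Longrightarrow> Cod T f = Dom T g \<Longrightarrow> g \<cdot> f \<in> S"
  by (rule S_two_of_three(1)) auto

lemma S_second_iff:
  assumes "(u, v, w) \<in> Tri T"
  shows "v \<in> S \<longleftrightarrow> Dom T u \<in> U"
proof -
  obtain x where "(v, w, x) \<in> Tri T" using rotate[OF assms] by blast
  then show ?thesis using S_iff[of v w x] tri[OF assms] U_Sh[of "Dom T u"] by simp
qed

lemma S_shift:
  assumes "s \<in> S"
  shows "ShA T s \<in> S"
proof -
  obtain v w where V: "(s, v, w) \<in> Tri T" "Cod T v \<in> U" using assms by (rule S_E)
  obtain v' w' where "(ShA T s, v', w') \<in> Tri T" "Cod T v' = Sh T (Cod T v)" using shift_triangle[OF V(1)] by blast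
  then show ?thesis using S_iff V U_Sh[of "Cod T v"] tri[OF V(1)] by simp
qed

text \<open>Take for \<open>t'\<close> the fibre of the composite of \<open>f\<close> with the second arrow \<open>v\<close> of the triangle on \<open>t\<close>: both \<open>t\<close> and
  \<open>t'\<close> then have the same cone.\<close>

lemma right_Ore:
  assumes "t \<in> S" "f \<in> Arr T" "Cod T f = Cod T t"
  obtains t' f' where "t' \<in> S" "f' \<in> Arr T" "Cod T t' = Dom T f" "Dom T f' = Dom T t'" "Cod T f' = Dom T t"
    "f \<cdot> t' = t \<cdot> f'"
proof -
  obtain v w where V: "(t, v, w) \<in> Tri T" "Cod T v \<in> U" using assms(1) by (rule S_E)
  note V' = tri[OF V(1)]
  obtain t' w' where T': "(t', v \<cdot> f, w') \<in> Tri T" using extend_second[of "v \<cdot> f"] V' assms by auto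
  note T'' = tri[OF T']
  have c: "Cod T (v \<cdot> f) = Cod T v" "Cod T t' = Dom T f" using V' assms T'' by simp_all
  have "t' \<in> S" using S_iff[OF T'] c V by simp
  moreover obtain a where "a \<in> Hom T (Dom T t') (Dom T t)" "f \<cdot> t' = t \<cdot> a"
    using fill_first[OF T' V(1), of f "Ident T (Cod T v)"] V' assms T'' by (auto simp: Hom_def)
  ultimately show ?thesis using that c by (auto simp: Hom_def)
qed

lemma left_Ore:
  assumes "s \<in> S" "f \<in> Arr T" "Dom T s = Dom T f"
  obtains t g where "t \<in> S" "g \<in> Arr T" "Dom T t = Cod T f" "Dom T g = Cod T s" "Cod T g = Cod T t"
    "g \<cdot> s = t \<cdot> f"
proof -
  obtain v w where V: "(s, v, w) \<in> Tri T" "Cod T v \<in> U" using assms(1) by (rule S_E)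
  note V' = tri[OF V(1)]
  obtain t g' where T': "(t, g', ShA T f \<cdot> w) \<in> Tri T" "Dom T t = Cod T f"
    using extend_third[of "Cod T f" "ShA T f \<cdot> w"] V' assms by auto
  note T'' = tri[OF T'(1)]
  have c: "Cod T g' = Cod T v" using V' assms T'' by simp
  have "t \<in> S" using S_iff[OF T'(1)] c V by simp
  moreover obtain b where "b \<in> Hom T (Cod T s) (Cod T t)" "b \<cdot> s = t \<cdot> f"
    using fill_second[OF V(1) T'(1), of f "Ident T (Cod T v)"] V' assms T' T'' c by (auto simp: Hom_def)
  ultimately show ?thesis using that T' by (auto simp: Hom_def)
qed

lemma right_cancel:
  assumes "t \<in> S" "f \<in> Arr T" "g \<in> Arr T" "Dom T f = Dom T g" "Cod T f = Dom T t" "Cod T g = Dom T t" "t \<cdot> f = t \<cdot> g"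
  obtains s where "s \<in> S" "Cod T s = Dom T f" "f \<cdot> s = g \<cdot> s"
proof -
  obtain u w where V: "(u, t, w) \<in> Tri T" using extend_second[of t] assms by auto
  have "Dom T u \<in> U" using S_second_iff[OF V] assms by simp
  moreover obtain s h w' where H: "(s, h, w') \<in> Tri T" "Dom T h = Dom T f" "Cod T h = Dom T u" "f \<cdot> s = g \<cdot> s"
    using equalize[OF V, of f "Dom T f" g] assms by (auto simp: Hom_def)
  ultimately show ?thesis using that[of s] S_iff[OF H(1)] tri[OF H(1)] by auto
qed

lemma left_cancel:
  assumes "s \<in> S" "f \<in> Arr T" "g \<in> Arr T" "Dom T f = Cod T s" "Dom T g = Cod T s" "Cod T f = Cod T g" "f \<cdot> s = g \<cdot> s"
  obtains t where "t \<in> S" "Dom T t = Cod T f" "t \<cdot> f = t \<cdot> g"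
proof -
  obtain v w where V: "(s, v, w) \<in> Tri T" "Cod T v \<in> U" using assms(1) by (rule S_E)
  obtain h t x where H: "(h, t, x) \<in> Tri T" "Dom T h = Cod T v" "Cod T h = Cod T f" "t \<cdot> f = t \<cdot> g"
    using coequalize[OF V(1), of f "Cod T f" g] assms by (auto simp: Hom_def)
  show ?thesis using that[of t] S_second_iff[OF H(1)] V tri[OF H(1)] H by auto
qed

text \<open>Factor the square through its diagonal \<open>u' s = t u\<close> and apply the octahedron to both halves. The arrow between the
  cones of \<open>u\<close> and \<open>t u\<close> has a cone isomorphic to that of \<open>t\<close>, and the arrow between the cones of \<open>u' s\<close> and
  \<open>u'\<close> has the cone of \<open>s\<close> as its fibre.\<close>

lemma S_cone_map:
  assumes A: "(u, v, w) \<in> Tri T" and B: "(u', v', w') \<in> Tri T"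
    and s: "s \<in> S" "Dom T s = Dom T u" "Cod T s = Dom T u'"
    and t: "t \<in> S" "Dom T t = Cod T u" "Cod T t = Cod T u'" and e: "u' \<cdot> s = t \<cdot> u"
  obtains c where "c \<in> S" "Dom T c = Cod T v" "Cod T c = Cod T v'" "c \<cdot> v = v' \<cdot> t" "ShA T s \<cdot> w = w' \<cdot> c"
proof -
  note AB = tri[OF A] tri[OF B]
  obtain j k l i m n a b x where 1: "(u, j, k) \<in> Tri T" "(t, l, i) \<in> Tri T" "(t \<cdot> u, m, n) \<in> Tri T" "(a, b, x) \<in> Tri T"
           "a \<in> Hom T (Cod T j) (Cod T m)" "b \<in> Hom T (Cod T m) (Cod T l)" "a \<cdot> j = m \<cdot> t" "n \<cdot> a = k"
    using octahedron[of u t] AB t by auto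
  obtain j' k' l' i' m' n' a' b' x' where 2: "(s, j', k') \<in> Tri T" "(u', l', i') \<in> Tri T" "(u' \<cdot> s, m', n') \<in> Tri T" "(a', b', x') \<in> Tri T"
           "a' \<in> Hom T (Cod T j') (Cod T m')" "b' \<in> Hom T (Cod T m') (Cod T l')" "b' \<cdot> m' = l'" "i' \<cdot> b' = ShA T s \<cdot> n'"
    using octahedron[of s u'] AB s by auto
  have "Cod T l \<in> U" using S_iff[OF 1(2)] t by simp
  then have aS: "a \<in> S" using S_iff[OF 1(4)] 1(6) by (simp add: Hom_def)
  have "Cod T j' \<in> U" using S_iff[OF 2(1)] s by simp
  then have bS: "b' \<in> S" using S_second_iff[OF 2(4)] 2(5) by (simp add: Hom_def)
  obtain c1 where c1: "c1 \<in> Hom T (Cod T v) (Cod T j)" "iso_arr T c1" "c1 \<cdot> v = j" "w = k \<cdot> c1"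
    using cone_unique[OF A 1(1)] by blast
  obtain c2 where c2: "c2 \<in> Hom T (Cod T m) (Cod T m')" "iso_arr T c2" "c2 \<cdot> m = m'" "n = n' \<cdot> c2"
    using cone_unique[OF 1(3) 2(3)[unfolded e]] by blast
  obtain c3 where c3: "c3 \<in> Hom T (Cod T l') (Cod T v')" "iso_arr T c3" "c3 \<cdot> l' = v'" "i' = w' \<cdot> c3"
    using cone_unique[OF 2(2) B] by blast
  note H = c1(1)[unfolded Hom_iff] c2(1)[unfolded Hom_iff] c3(1)[unfolded Hom_iff]
    1(5,6)[unfolded Hom_iff] 2(5,6)[unfolded Hom_iff] tri[OF 1(1)] tri[OF 1(2)] tri[OF 1(3)]
    tri[OF 2(1)] tri[OF 2(2)] tri[OF 2(3)] AB
  have us: "u' \<cdot> s \<in> Arr T" "Dom T (u' \<cdot> s) = Dom T u" "Cod T (u' \<cdot> s) = Cod T u'"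
    "t \<cdot> u \<in> Arr T" "Dom T (t \<cdot> u) = Dom T u" "Cod T (t \<cdot> u) = Cod T u'" using AB s t by auto
  let ?c = "c3 \<cdot> (b' \<cdot> (c2 \<cdot> (a \<cdot> c1)))"
  have "?c \<in> S" using H aS bS S_iso[OF c1(2)] S_iso[OF c2(2)] S_iso[OF c3(2)] by simp
  moreover have "Dom T ?c = Cod T v" "Cod T ?c = Cod T v'" using H by simp_all
  moreover have "?c \<cdot> v = v' \<cdot> t"
  proof -
    have "?c \<cdot> v = c3 \<cdot> (b' \<cdot> (c2 \<cdot> (a \<cdot> j)))" using H by (simp add: c1(3))
    also have "\<dots> = c3 \<cdot> (b' \<cdot> ((c2 \<cdot> m) \<cdot> t))" using H us t by (simp add: 1(7) del: c2(3))
    also have "\<dots> = c3 \<cdot> ((b' \<cdot> m') \<cdot> t)" unfolding c2(3) using H us t by simp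
    also have "\<dots> = (c3 \<cdot> l') \<cdot> t" unfolding 2(7) using H us t by simp
    finally show ?thesis unfolding c3(3) .
  qed
  moreover have "ShA T s \<cdot> w = w' \<cdot> ?c"
  proof -
    have "w' \<cdot> ?c = (w' \<cdot> c3) \<cdot> (b' \<cdot> (c2 \<cdot> (a \<cdot> c1)))" using H by simp
    also have "\<dots> = (i' \<cdot> b') \<cdot> (c2 \<cdot> (a \<cdot> c1))" unfolding c3(4)[symmetric] using H by simp
    also have "\<dots> = ShA T s \<cdot> ((n' \<cdot> c2) \<cdot> (a \<cdot> c1))" unfolding 2(8) using H us s by simp
    also have "\<dots> = ShA T s \<cdot> ((n \<cdot> a) \<cdot> c1)" unfolding c2(4)[symmetric] using H us s by simp
    also have "\<dots> = ShA T s \<cdot> w" unfolding 1(8) c1(4) ..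
    finally show ?thesis by simp
  qed
  ultimately show ?thesis by (rule that)
qed

end

section \<open>Full triangulated subcategories\<close>

lemma full_tri_simps [simp]:
  "Obj (full_tri T S) = S" "Arr (full_tri T S) = {f \<in> Arr T. Dom T f \<in> S \<and> Cod T f \<in> S}"
  "Dom (full_tri T S) = Dom T" "Cod (full_tri T S) = Cod T"
  "Ident (full_tri T S) = Ident T" "Comp (full_tri T S) = Comp T"
  "Sh (full_tri T S) = Sh T" "ShA (full_tri T S) = ShA T"
  "Tri (full_tri T S) = {(u, v, w) \<in> Tri T. Dom T u \<in> S \<and> Dom T v \<in> S \<and> Dom T w \<in> S}"
  by (auto simp: full_tri_def full_subcat_def)

lemma Hom_full_tri: "X \<in> S \<Longrightarrow> Y \<in> S \<Longrightarrow> Hom (full_tri T S) X Y = Hom T X Y"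
  by (auto simp: Hom_def)

lemma Hom_full_tri_iff: "f \<in> Hom (full_tri T S) X Y \<longleftrightarrow> X \<in> S \<and> Y \<in> S \<and> f \<in> Hom T X Y"
  by (auto simp: Hom_def)

lemma iso_full_tri: "iso_arr (full_tri T S) f \<longleftrightarrow> iso_arr T f \<and> Dom T f \<in> S \<and> Cod T f \<in> S"
  unfolding iso_arr_def by (auto simp: Hom_full_tri_iff Bex_def)

lemma isomorphic_full_tri: "X \<in> S \<Longrightarrow> Y \<in> S \<Longrightarrow> isomorphic (full_tri T S) X Y \<longleftrightarrow> isomorphic T X Y"
  unfolding isomorphic_def by (auto simp: Hom_full_tri_iff iso_full_tri Bex_def Hom_def)

lemma typed_full_tri:
  "typed_triangle (full_tri T S) u v w \<longleftrightarrow> typed_triangle T u v w \<and> Dom T u \<in> S \<and> Dom T v \<in> S \<and> Dom T w \<in> S \<and> Cod T w \<in> S"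
  by (auto simp: typed_triangle_def)

lemma triangle_iso_full_tri: "triangle_iso (full_tri T S) t t' \<Longrightarrow> triangle_iso T t t'"
  by (cases t; cases t') (auto simp: triangle_iso_iff typed_full_tri iso_full_tri Hom_full_tri_iff)

lemma full_tri_full_tri:
  assumes "S \<subseteq> S'"
  shows "full_tri (full_tri T S') S = full_tri T S"
proof -
  have "Tri (full_tri (full_tri T S') S) = Tri (full_tri T S)" "Arr (full_tri (full_tri T S') S) = Arr (full_tri T S)"
    using assms by auto
  then show ?thesis by (simp add: full_tri_def full_subcat_def)
qed

context localization
begin

lemma zero_full: "zero_object T Z \<Longrightarrow> zero_object (full_tri T U) Z"
  using U_zero[of Z] U_Obj by (auto simp: zero_object_def Hom_full_tri)

text \<open>The axioms produce triangles two of whose terms are prescribed, so the third lies in \<open>U\<close> as well.\<close>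

lemma triangulated_full_tri: "triangulated (full_tri T U)"
proof -
  let ?F = "full_tri T U"
  interpret F: category ?F
    by unfold_locales
      (auto simp: Hom_full_tri_iff intro: Comp_Hom Ident_Hom U_Obj, auto simp: Hom_def)
  note [simp] = Hom_full_tri_iff
  have U3: "Dom T u \<in> U" "Cod T u \<in> U" "Cod T v \<in> U" if "(u, v, w) \<in> Tri ?F" for u v w
    using that tri[of u v w] by auto
  have F_triI: "(u, v, w) \<in> Tri ?F" if "(u, v, w) \<in> Tri T" "Dom T u \<in> U" "Cod T u \<in> U" "Cod T v \<in> U" for u v w
    using that tri[of u v w] by auto
  show ?thesis
  proof unfold_locales
    fix X assume "X \<in> Obj ?F" then show "Sh ?F X \<in> Obj ?F" using U_Sh[of X] U_Obj by auto
  next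
    fix f X Y assume "f \<in> Hom ?F X Y" then show "ShA ?F f \<in> Hom ?F (Sh ?F X) (Sh ?F Y)"
      using ShA_Hom[of f X Y] U_Sh[of X] U_Sh[of Y] U_Obj by auto
  next
    fix X assume "X \<in> Obj ?F" then show "ShA ?F (Ident ?F X) = Ident ?F (Sh ?F X)" using U_Obj by auto
  next
    fix f X Y g Z assume "f \<in> Hom ?F X Y" "g \<in> Hom ?F Y Z"
    then show "ShA ?F (g \<cdot>\<^bsub>?F\<^esub> f) = ShA ?F g \<cdot>\<^bsub>?F\<^esub> ShA ?F f" using ShA_Comp[of f X Y g Z] by auto
  next
    fix u v w assume A: "(u, v, w) \<in> Tri ?F"
    then show "typed_triangle ?F u v w"
      using Tri_typed[of u v w] U_Sh[of "Dom T u"] tri[of u v w] U_Obj by (auto simp: typed_full_tri)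
  next
    fix t t' assume A: "triangle_iso ?F t t'" "t' \<in> Tri ?F"
    then have "t \<in> Tri T" using Tri_closed[OF triangle_iso_full_tri[OF A(1)]] by (cases t') auto
    then show "t \<in> Tri ?F" using A(1) by (cases t; cases t') (auto simp: triangle_iso_iff typed_full_tri)
  next
    fix X assume X: "X \<in> Obj ?F"
    then obtain v w where V: "(Ident T X, v, w) \<in> Tri T" "zero_object T (Cod T v)"
      using identity_triangle[of X] U_Obj by auto
    then have "(Ident T X, v, w) \<in> Tri ?F" using X U_zero[OF V(2)] U_Obj by (intro F_triI) auto
    then show "\<exists>v w. (Ident ?F X, v, w) \<in> Tri ?F \<and> zero_object ?F (Cod ?F v)"
      using zero_full[OF V(2)] by auto
  next
    fix u assume u: "u \<in> Arr ?F"
    then obtain v w where V: "(u, v, w) \<in> Tri T" using extend_first[of u] by auto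
    then have "(u, v, w) \<in> Tri ?F" using u U_tri(1)[OF V] by (intro F_triI) auto
    then show "\<exists>v w. (u, v, w) \<in> Tri ?F" by blast
  next
    fix v assume v: "v \<in> Arr ?F"
    then obtain u w where V: "(u, v, w) \<in> Tri T" using extend_second[of v] by auto
    then have "(u, v, w) \<in> Tri ?F" using v U_tri(3)[OF V] tri[OF V] by (intro F_triI) auto
    then show "\<exists>u w. (u, v, w) \<in> Tri ?F" by blast
  next
    fix X w assume w: "w \<in> Arr ?F" "X \<in> Obj ?F" "Cod ?F w = Sh ?F X"
    then obtain u v where V: "(u, v, w) \<in> Tri T" "Dom T u = X" using extend_third[of X w] U_Obj by auto
    then have "(u, v, w) \<in> Tri ?F" using w U_tri(2)[OF V(1)] tri[OF V(1)] by (intro F_triI) auto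
    then show "\<exists>u v. (u, v, w) \<in> Tri ?F \<and> Dom ?F u = X" using V by auto
  next
    fix u v w assume A: "(u, v, w) \<in> Tri ?F"
    then obtain x where "(v, w, x) \<in> Tri T" using rotate[of u v w] by auto
    then show "\<exists>x. (v, w, x) \<in> Tri ?F" using U3[OF A] A U_Sh[of "Dom T u"] tri[of u v w] U_Obj
      by (intro exI[of _ x] F_triI) auto
  next
    fix u v w u' v' w' b c
    assume A: "(u, v, w) \<in> Tri ?F" "(u', v', w') \<in> Tri ?F"
      and H: "b \<in> Hom ?F (Cod ?F u) (Cod ?F u')" "c \<in> Hom ?F (Cod ?F v) (Cod ?F v')" "c \<cdot>\<^bsub>?F\<^esub> v = v' \<cdot>\<^bsub>?F\<^esub> b"
    have "\<exists>a \<in> Hom T (Dom T u) (Dom T u'). b \<cdot> u = u' \<cdot> a"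
      by (rule fill_first[of u v w u' v' w' b c]) (use A H in simp_all)
    then show "\<exists>a \<in> Hom ?F (Dom ?F u) (Dom ?F u'). b \<cdot>\<^bsub>?F\<^esub> u = u' \<cdot>\<^bsub>?F\<^esub> a"
      using U3(1)[OF A(1)] U3(1)[OF A(2)] by (simp add: Bex_def)
  next
    fix u v w u' v' w' a c
    assume A: "(u, v, w) \<in> Tri ?F" "(u', v', w') \<in> Tri ?F"
      and H: "a \<in> Hom ?F (Dom ?F u) (Dom ?F u')" "c \<in> Hom ?F (Cod ?F v) (Cod ?F v')" "ShA ?F a \<cdot>\<^bsub>?F\<^esub> w = w' \<cdot>\<^bsub>?F\<^esub> c"
    have "\<exists>b \<in> Hom T (Cod T u) (Cod T u'). b \<cdot> u = u' \<cdot> a"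
      by (rule fill_second[of u v w u' v' w' a c]) (use A H in simp_all)
    then show "\<exists>b \<in> Hom ?F (Cod ?F u) (Cod ?F u'). b \<cdot>\<^bsub>?F\<^esub> u = u' \<cdot>\<^bsub>?F\<^esub> a"
      using U3(2)[OF A(1)] U3(2)[OF A(2)] by (simp add: Bex_def)
  next
    fix u v w v' w'
    assume A: "(u, v, w) \<in> Tri ?F" "(u, v', w') \<in> Tri ?F"
    then obtain c where "c \<in> Hom T (Cod T v) (Cod T v')" "iso_arr T c" "c \<cdot> v = v'" "w = w' \<cdot> c"
      using cone_unique[of u v w v' w'] by auto
    then show "\<exists>c \<in> Hom ?F (Cod ?F v) (Cod ?F v'). iso_arr ?F c \<and> c \<cdot>\<^bsub>?F\<^esub> v = v' \<and> w = w' \<cdot>\<^bsub>?F\<^esub> c"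
      using U3[OF A(1)] U3[OF A(2)] by (auto simp: iso_full_tri Hom_iff)
  next
    fix f g assume fg: "f \<in> Arr ?F" "g \<in> Arr ?F" "Cod ?F f = Dom ?F g"
    then obtain j k l i m n a b x where O: "(f, j, k) \<in> Tri T" "(g, l, i) \<in> Tri T" "(g \<cdot> f, m, n) \<in> Tri T" "(a, b, x) \<in> Tri T"
           "a \<in> Hom T (Cod T j) (Cod T m)" "b \<in> Hom T (Cod T m) (Cod T l)"
           "a \<cdot> j = m \<cdot> g" "n \<cdot> a = k" "b \<cdot> m = l" "i \<cdot> b = ShA T f \<cdot> n"
      using octahedron[of f g] by auto
    have C: "Cod T j \<in> U" "Cod T l \<in> U" "Cod T m \<in> U"
      using U_tri(1)[OF O(1)] U_tri(1)[OF O(2)] U_tri(1)[OF O(3)] fg by auto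
    have "(f, j, k) \<in> Tri ?F" "(g, l, i) \<in> Tri ?F" "(g \<cdot> f, m, n) \<in> Tri ?F" "(a, b, x) \<in> Tri ?F"
      by (rule F_triI; use O(1-6) C fg in \<open>auto simp: Hom_iff\<close>)+
    then show "\<exists>j k l i m n a b x. (f, j, k) \<in> Tri ?F \<and> (g, l, i) \<in> Tri ?F \<and> (g \<cdot>\<^bsub>?F\<^esub> f, m, n) \<in> Tri ?F \<and> (a, b, x) \<in> Tri ?F \<and>
           a \<in> Hom ?F (Cod ?F j) (Cod ?F m) \<and> b \<in> Hom ?F (Cod ?F m) (Cod ?F l) \<and>
           a \<cdot>\<^bsub>?F\<^esub> j = m \<cdot>\<^bsub>?F\<^esub> g \<and> n \<cdot>\<^bsub>?F\<^esub> a = k \<and> b \<cdot>\<^bsub>?F\<^esub> m = l \<and> i \<cdot>\<^bsub>?F\<^esub> b = ShA ?F f \<cdot>\<^bsub>?F\<^esub> n"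
      using O(5-) C by (simp only: full_tri_simps Hom_full_tri_iff simp_thms) blast
  next
    fix u t w f X g
    assume A: "(u, t, w) \<in> Tri ?F" "f \<in> Hom ?F X (Dom ?F t)" "g \<in> Hom ?F X (Dom ?F t)" "t \<cdot>\<^bsub>?F\<^esub> f = t \<cdot>\<^bsub>?F\<^esub> g"
    then obtain s h w' where H: "(s, h, w') \<in> Tri T" "Dom T h = X" "Cod T h = Dom T u" "f \<cdot> s = g \<cdot> s"
      using equalize[of u t w f X g] by auto
    have "(s, h, w') \<in> Tri ?F" using U_tri(3)[OF H(1)] A H tri[OF H(1)] by (intro F_triI) auto
    then show "\<exists>s h w'. (s, h, w') \<in> Tri ?F \<and> Dom ?F h = X \<and> Cod ?F h = Dom ?F u \<and> f \<cdot>\<^bsub>?F\<^esub> s = g \<cdot>\<^bsub>?F\<^esub> s"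
      using H(2-) by (simp only: full_tri_simps) blast
  next
    fix s v w f Y g
    assume A: "(s, v, w) \<in> Tri ?F" "f \<in> Hom ?F (Cod ?F s) Y" "g \<in> Hom ?F (Cod ?F s) Y" "f \<cdot>\<^bsub>?F\<^esub> s = g \<cdot>\<^bsub>?F\<^esub> s"
    then obtain h t x where H: "(h, t, x) \<in> Tri T" "Dom T h = Cod T v" "Cod T h = Y" "t \<cdot> f = t \<cdot> g"
      using coequalize[of s v w f Y g] by auto
    have "(h, t, x) \<in> Tri ?F" using U_tri(1)[OF H(1)] A H U3[OF A(1)] by (intro F_triI) auto
    then show "\<exists>h t x. (h, t, x) \<in> Tri ?F \<and> Dom ?F h = Cod ?F v \<and> Cod ?F h = Y \<and> t \<cdot>\<^bsub>?F\<^esub> f = t \<cdot>\<^bsub>?F\<^esub> g"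
      using H(2-) by (simp only: full_tri_simps) blast
  next
    fix u v w assume A: "(u, v, w) \<in> Tri ?F"
    then obtain v' w' where H: "(ShA T u, v', w') \<in> Tri T" "Cod T v' = Sh T (Cod T v)"
      using shift_triangle[of u v w] by auto
    have "(ShA T u, v', w') \<in> Tri ?F" 
      using A H U3[OF A] U_Sh[of "Dom T u"] U_Sh[of "Cod T u"] U_Sh[of "Cod T v"] U_Obj tri(1)[of u v w]
      by (intro F_triI) simp_all
    then show "\<exists>v' w'. (ShA ?F u, v', w') \<in> Tri ?F \<and> Cod ?F v' = Sh ?F (Cod ?F v)" using H(2) by auto
  qed
qed

text \<open>A zero object of the subcategory is also one of \<open>T\<close>, being isomorphic there to the cone of an identity.
  Hence it belongs to \<open>V\<close>.\<close>

lemma subcat_of_full_tri: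
  assumes "triangulated_subcat T V"
  shows "triangulated_subcat (full_tri T U) (U \<inter> V)"
proof -
  interpret V: localization T V by unfold_locales (rule assms)
  interpret F: triangulated "full_tri T U" by (rule triangulated_full_tri)
  have Z: "Z \<in> U \<inter> V" if Z: "zero_object (full_tri T U) Z" for Z
  proof -
    have "Z \<in> U" using Z by (simp add: zero_object_def)
    then obtain v w where "(Ident T Z, v, w) \<in> Tri T" and N: "zero_object T (Cod T v)"
      using identity_triangle[of Z] U_Obj by blast
    have "isomorphic (full_tri T U) (Cod T v) Z"
      by (rule F.zero_objects_isomorphic[OF zero_full[OF N] Z])
    then have "isomorphic T (Cod T v) Z" using isomorphic_full_tri[OF U_zero[OF N] \<open>Z \<in> U\<close>] by blast
    then show ?thesis using V.U_iso V.U_zero[OF N] \<open>Z \<in> U\<close> by blast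
  qed
  have Sh: "(Sh T X \<in> U \<inter> V) = (X \<in> U \<inter> V)" if "X \<in> U" for X
    using that U_Sh[of X] V.U_Sh[of X] U_Obj by auto
  show ?thesis
  proof (rule triangulated_subcatI)
    fix u v w assume A: "(u, v, w) \<in> Tri (full_tri T U)"
    then have T: "(u, v, w) \<in> Tri T" and U: "Dom T u \<in> U" "Cod T u \<in> U" "Cod T v \<in> U"
      using tri[of u v w] by auto
    note V = V.U_tri[OF T]
    show "Cod (full_tri T U) v \<in> U \<inter> V" if "Dom (full_tri T U) u \<in> U \<inter> V" "Cod (full_tri T U) u \<in> U \<inter> V"
      using that V(1) U by simp
    show "Cod (full_tri T U) u \<in> U \<inter> V" if "Dom (full_tri T U) u \<in> U \<inter> V" "Cod (full_tri T U) v \<in> U \<inter> V"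
      using that V(2) U by simp
    show "Dom (full_tri T U) u \<in> U \<inter> V" if "Cod (full_tri T U) u \<in> U \<inter> V" "Cod (full_tri T U) v \<in> U \<inter> V"
      using that V(3) U by simp
  qed (use Z Sh in auto)
qed

end

section \<open>The category of fractions\<close>

context localization
begin

lemma roofs_iff:
  "(s, f) \<in> roofs T U X Y \<longleftrightarrow> s \<in> S \<and> Cod T s = X \<and> f \<in> Arr T \<and> Dom T f = Dom T s \<and> Cod T f = Y"
  by (auto simp: roofs_def Hom_def)

lemma roof_eq_iff:
  "roof_eq T U (s, f) (s', f') \<longleftrightarrow> (\<exists>a b. a \<in> Arr T \<and> b \<in> Arr T \<and> Dom T b = Dom T a \<and> Cod T a = Dom T s \<and>
      Cod T b = Dom T s' \<and> s \<cdot> a = s' \<cdot> b \<and> s \<cdot> a \<in> S \<and> f \<cdot> a = f' \<cdot> b)"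
  unfolding roof_eq_def by (auto simp: Hom_iff Bex_def)

lemma roof_eq_refl: "r \<in> roofs T U X Y \<Longrightarrow> roof_eq T U r r"
  by (cases r) (auto simp: roofs_iff roof_eq_iff intro!: exI[of _ "Ident T (Dom T (fst r))"])

lemma roof_eq_sym: "roof_eq T U r r' \<Longrightarrow> roof_eq T U r' r"
  by (cases r; cases r') (auto simp: roof_eq_iff, metis)

text \<open>The two common refinements are refined further by an Ore square, which is made to commute over the legs by
  cancelling an arrow of the localizing class.\<close>

lemma roof_eq_trans:
  assumes "roof_eq T U r r'" "roof_eq T U r' r''"
    and "r \<in> roofs T U X Y" "r' \<in> roofs T U X Y" "r'' \<in> roofs T U X Y"
  shows "roof_eq T U r r''"
proof -
  obtain s f s' f' s'' f'' where r: "r = (s, f)" "r' = (s', f')" "r'' = (s'', f'')" by (metis surj_pair)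
  note R = assms(3-)[unfolded r roofs_iff]
  obtain a b where 1: "a \<in> Arr T" "b \<in> Arr T" "Dom T b = Dom T a" "Cod T a = Dom T s" "Cod T b = Dom T s'"
    "s \<cdot> a = s' \<cdot> b" "s \<cdot> a \<in> S" "f \<cdot> a = f' \<cdot> b" using assms(1) unfolding r roof_eq_iff by blast
  obtain c d where 2: "c \<in> Arr T" "d \<in> Arr T" "Dom T d = Dom T c" "Cod T c = Dom T s'" "Cod T d = Dom T s''"
    "s' \<cdot> c = s'' \<cdot> d" "s' \<cdot> c \<in> S" "f' \<cdot> c = f'' \<cdot> d" using assms(2) unfolding r roof_eq_iff by blast
  have c': "s' \<cdot> b \<in> Arr T" "Cod T (s' \<cdot> b) = Cod T (s' \<cdot> c)" "Dom T (s' \<cdot> b) = Dom T b" "Dom T (s' \<cdot> c) = Dom T c"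
    using R 1 2 by simp_all
  obtain w v where 3: "w \<in> S" "v \<in> Arr T" "Cod T w = Dom T b" "Dom T v = Dom T w" "Cod T v = Dom T c"
    "(s' \<cdot> b) \<cdot> w = (s' \<cdot> c) \<cdot> v"
    using right_Ore[OF 2(7) c'(1,2)] c'(3,4) by metis
  have "s' \<cdot> (b \<cdot> w) = s' \<cdot> (c \<cdot> v)" using 3 1(2-5) 2(1-5) R by simp
  then obtain z where z: "z \<in> S" "Cod T z = Dom T w" "(b \<cdot> w) \<cdot> z = (c \<cdot> v) \<cdot> z"
    using right_cancel[of s' "b \<cdot> w" "c \<cdot> v"] 3 1(2-5) 2(1-5) R by auto
  have z': "b \<cdot> (w \<cdot> z) = c \<cdot> (v \<cdot> z)" using z 3 1(2-5) 2(1-5) R by simp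
  note D = 1(1-5) 2(1-5) 3(1-5) z(1,2) R
  have "s \<cdot> (a \<cdot> (w \<cdot> z)) = (s \<cdot> a) \<cdot> (w \<cdot> z)" using D by simp
  also have "\<dots> = s' \<cdot> (b \<cdot> (w \<cdot> z))" unfolding 1(6) using D by simp
  also have "\<dots> = (s' \<cdot> c) \<cdot> (v \<cdot> z)" unfolding z' using D by simp
  also have "\<dots> = s'' \<cdot> (d \<cdot> (v \<cdot> z))" unfolding 2(6) using D by simp
  finally have e1: "s \<cdot> (a \<cdot> (w \<cdot> z)) = s'' \<cdot> (d \<cdot> (v \<cdot> z))" .
  have "f \<cdot> (a \<cdot> (w \<cdot> z)) = (f \<cdot> a) \<cdot> (w \<cdot> z)" using D by simp
  also have "\<dots> = f' \<cdot> (b \<cdot> (w \<cdot> z))" unfolding 1(8) using D by simp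
  also have "\<dots> = (f' \<cdot> c) \<cdot> (v \<cdot> z)" unfolding z' using D by simp
  also have "\<dots> = f'' \<cdot> (d \<cdot> (v \<cdot> z))" unfolding 2(8) using D by simp
  finally have e2: "f \<cdot> (a \<cdot> (w \<cdot> z)) = f'' \<cdot> (d \<cdot> (v \<cdot> z))" .
  have "(s \<cdot> a) \<cdot> (w \<cdot> z) \<in> S" by (rule S_comp[OF _ 1(7)]) (use D in simp_all)
  then have "s \<cdot> (a \<cdot> (w \<cdot> z)) \<in> S" using D by simp
  then show ?thesis unfolding r roof_eq_iff using e1 e2 D
    by (intro exI[of _ "a \<cdot> (w \<cdot> z)"] exI[of _ "d \<cdot> (v \<cdot> z)"]) simp
qed

lemma frac_eq_iff:
  assumes "r \<in> roofs T U X Y" "r' \<in> roofs T U X Y"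
  shows "frac T U X Y r = frac T U X Y r' \<longleftrightarrow> roof_eq T U r r'"
proof
  assume "frac T U X Y r = frac T U X Y r'"
  then have "{q \<in> roofs T U X Y. roof_eq T U r q} = {q \<in> roofs T U X Y. roof_eq T U r' q}" by (simp add: frac_def)
  then show "roof_eq T U r r'" using roof_eq_refl[OF assms(2)] assms(2) by blast
next
  assume e: "roof_eq T U r r'"
  have "roof_eq T U r q \<longleftrightarrow> roof_eq T U r' q" if "q \<in> roofs T U X Y" for q
    using e roof_eq_sym[OF e] roof_eq_trans[of _ _ _ X Y] assms that by blast
  then show "frac T U X Y r = frac T U X Y r'" by (auto simp: frac_def)
qed

lemma roof_eqI:
  assumes "a \<in> Arr T" "Cod T a = Dom T s" "(s, f) \<in> roofs T U X Y" "s \<cdot> a \<in> S"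
  shows "roof_eq T U (s, f) (s \<cdot> a, f \<cdot> a)"
  unfolding roof_eq_iff using assms by (intro exI[of _ a] exI[of _ "Ident T (Dom T a)"]) (simp add: roofs_iff)

text \<open>The composite of two roofs does not depend on the square used to form it, nor on the roofs
  representing the fractions.\<close>

definition composite where
  "composite s f t g r \<longleftrightarrow> (\<exists>t' f'. t' \<in> S \<and> Cod T t' = Dom T s \<and> f' \<in> Hom T (Dom T t') (Dom T t) \<and>
     f \<cdot> t' = t \<cdot> f' \<and> roof_eq T U (s \<cdot> t', g \<cdot> f') r)"

lemma comp_square_independent:
  assumes sf: "(s, f) \<in> roofs T U X Y" and tg: "(t, g) \<in> roofs T U Y Z"
    and 1: "t1 \<in> S" "Cod T t1 = Dom T s" "f1 \<in> Arr T" "Dom T f1 = Dom T t1" "Cod T f1 = Dom T t" "f \<cdot> t1 = t \<cdot> f1"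
    and 2: "t2 \<in> S" "Cod T t2 = Dom T s" "f2 \<in> Arr T" "Dom T f2 = Dom T t2" "Cod T f2 = Dom T t" "f \<cdot> t2 = t \<cdot> f2"
  shows "roof_eq T U (s \<cdot> t1, g \<cdot> f1) (s \<cdot> t2, g \<cdot> f2)"
proof -
  note R = sf[unfolded roofs_iff] tg[unfolded roofs_iff] 1(1-5) 2(1-5)
  obtain x y where 3: "x \<in> S" "y \<in> Arr T" "Cod T x = Dom T t1" "Dom T y = Dom T x" "Cod T y = Dom T t2"
    "t1 \<cdot> x = t2 \<cdot> y"
    using right_Ore[of t2 t1] R by (metis S_arr)
  have "t \<cdot> (f1 \<cdot> x) = (f \<cdot> t1) \<cdot> x" unfolding 1(6) using R 3(1-5) by simp
  also have "\<dots> = f \<cdot> (t2 \<cdot> y)" unfolding 3(6)[symmetric] using R 3(1-5) by simp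
  also have "\<dots> = (f \<cdot> t2) \<cdot> y" using R 3(1-5) by simp
  also have "\<dots> = t \<cdot> (f2 \<cdot> y)" unfolding 2(6) using R 3(1-5) by simp
  finally obtain z where z: "z \<in> S" "Cod T z = Dom T x" "(f1 \<cdot> x) \<cdot> z = (f2 \<cdot> y) \<cdot> z"
    using right_cancel[of t "f1 \<cdot> x" "f2 \<cdot> y"] R 3(1-5) by auto
  note D = R 3(1-5) z(1,2)
  have z': "f1 \<cdot> (x \<cdot> z) = f2 \<cdot> (y \<cdot> z)" using z(3) D by simp
  have "(s \<cdot> t1) \<cdot> (x \<cdot> z) = s \<cdot> ((t1 \<cdot> x) \<cdot> z)" using D by simp
  also have "\<dots> = (s \<cdot> t2) \<cdot> (y \<cdot> z)" unfolding 3(6) using D by simp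
  finally have e1: "(s \<cdot> t1) \<cdot> (x \<cdot> z) = (s \<cdot> t2) \<cdot> (y \<cdot> z)" .
  have "(g \<cdot> f1) \<cdot> (x \<cdot> z) = g \<cdot> (f1 \<cdot> (x \<cdot> z))" using D by simp
  also have "\<dots> = (g \<cdot> f2) \<cdot> (y \<cdot> z)" unfolding z' using D by simp
  finally have e2: "(g \<cdot> f1) \<cdot> (x \<cdot> z) = (g \<cdot> f2) \<cdot> (y \<cdot> z)" .
  have "(s \<cdot> t1) \<cdot> (x \<cdot> z) \<in> S" using D by (intro S_comp) simp_all
  then show ?thesis unfolding roof_eq_iff using e1 e2 D
    by (intro exI[of _ "x \<cdot> z"] exI[of _ "y \<cdot> z"]) simp
qed

lemma composite_roof:
  assumes sf: "(s, f) \<in> roofs T U X Y" and tg: "(t, g) \<in> roofs T U Y Z"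
    and 1: "t1 \<in> S" "Cod T t1 = Dom T s" "f1 \<in> Arr T" "Dom T f1 = Dom T t1" "Cod T f1 = Dom T t"
  shows "(s \<cdot> t1, g \<cdot> f1) \<in> roofs T U X Z"
  using assms by (simp add: roofs_iff)

lemma composite_iff:
  assumes sf: "(s, f) \<in> roofs T U X Y" and tg: "(t, g) \<in> roofs T U Y Z" and r: "r \<in> roofs T U X Z"
    and 1: "t1 \<in> S" "Cod T t1 = Dom T s" "f1 \<in> Arr T" "Dom T f1 = Dom T t1" "Cod T f1 = Dom T t" "f \<cdot> t1 = t \<cdot> f1"
  shows "composite s f t g r \<longleftrightarrow> roof_eq T U (s \<cdot> t1, g \<cdot> f1) r"
proof
  assume "composite s f t g r"
  then obtain t2 f2 where 2: "t2 \<in> S" "Cod T t2 = Dom T s" "f2 \<in> Arr T" "Dom T f2 = Dom T t2" "Cod T f2 = Dom T t" "f \<cdot> t2 = t \<cdot> f2"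
    and e: "roof_eq T U (s \<cdot> t2, g \<cdot> f2) r" unfolding composite_def Hom_iff by blast
  show "roof_eq T U (s \<cdot> t1, g \<cdot> f1) r"
    by (rule roof_eq_trans[OF comp_square_independent[OF sf tg 1 2] e composite_roof[OF sf tg 1(1-5)]
          composite_roof[OF sf tg 2(1-5)] r])
next
  assume "roof_eq T U (s \<cdot> t1, g \<cdot> f1) r"
  then show "composite s f t g r" unfolding composite_def Hom_iff using 1 by blast
qed

lemma composite_refine_left:
  assumes sf: "(s, f) \<in> roofs T U X Y" and tg: "(t, g) \<in> roofs T U Y Z" and r: "r \<in> roofs T U X Z"
    and a: "a \<in> Arr T" "Cod T a = Dom T s" "s \<cdot> a \<in> S"
  shows "composite (s \<cdot> a) (f \<cdot> a) t g r \<longleftrightarrow> composite s f t g r"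
proof -
  note R = sf[unfolded roofs_iff] tg[unfolded roofs_iff]
  have aS: "a \<in> S" using S_two_of_three(3)[of a s] a R by simp
  have sfa: "(s \<cdot> a, f \<cdot> a) \<in> roofs T U X Y" using R a by (simp add: roofs_iff)
  have "f \<cdot> a \<in> Arr T" "Cod T (f \<cdot> a) = Cod T t" "Dom T (f \<cdot> a) = Dom T a" "Dom T (s \<cdot> a) = Dom T a"
    using R a by simp_all
  then obtain t' f' where 1: "t' \<in> S" "Cod T t' = Dom T (s \<cdot> a)" "f' \<in> Arr T" "Dom T f' = Dom T t'" "Cod T f' = Dom T t"
    "(f \<cdot> a) \<cdot> t' = t \<cdot> f'" using right_Ore[of t "f \<cdot> a"] R by metis
  have ca: "Cod T t' = Dom T a" using 1(2) R a by simp
  have 2: "a \<cdot> t' \<in> S" "Cod T (a \<cdot> t') = Dom T s" "f' \<in> Arr T" "Dom T f' = Dom T (a \<cdot> t')" "Cod T f' = Dom T t"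
    "f \<cdot> (a \<cdot> t') = t \<cdot> f'" using 1 ca a aS R by simp_all
  show ?thesis
    unfolding composite_iff[OF sfa tg r 1] composite_iff[OF sf tg r 2] using ca a R 1 by simp
qed

lemma composite_refine_right:
  assumes sf: "(s, f) \<in> roofs T U X Y" and tg: "(t, g) \<in> roofs T U Y Z" and r: "r \<in> roofs T U X Z"
    and b: "b \<in> Arr T" "Cod T b = Dom T t" "t \<cdot> b \<in> S"
  shows "composite s f (t \<cdot> b) (g \<cdot> b) r \<longleftrightarrow> composite s f t g r"
proof -
  note R = sf[unfolded roofs_iff] tg[unfolded roofs_iff]
  have tgb: "(t \<cdot> b, g \<cdot> b) \<in> roofs T U Y Z" using R b by (simp add: roofs_iff)
  have "f \<in> Arr T" "Cod T f = Cod T (t \<cdot> b)" using R b by simp_all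
  then obtain t' f' where 1: "t' \<in> S" "Cod T t' = Dom T s" "f' \<in> Arr T" "Dom T f' = Dom T t'" "Cod T f' = Dom T (t \<cdot> b)"
    "f \<cdot> t' = (t \<cdot> b) \<cdot> f'" using right_Ore[of "t \<cdot> b" f] R b by metis
  have cb: "Cod T f' = Dom T b" using 1(5) R b by simp
  have 2: "t' \<in> S" "Cod T t' = Dom T s" "b \<cdot> f' \<in> Arr T" "Dom T (b \<cdot> f') = Dom T t'" "Cod T (b \<cdot> f') = Dom T t"
    "f \<cdot> t' = t \<cdot> (b \<cdot> f')" using 1 cb b R by simp_all
  show ?thesis
    unfolding composite_iff[OF sf tgb r 1] composite_iff[OF sf tg r 2] using cb b R 1 by simp
qed

lemma composite_cong:
  assumes sf: "(s, f) \<in> roofs T U X Y" "(s', f') \<in> roofs T U X Y" "roof_eq T U (s, f) (s', f')"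
    and tg: "(t, g) \<in> roofs T U Y Z" "(t', g') \<in> roofs T U Y Z" "roof_eq T U (t, g) (t', g')"
    and r: "r \<in> roofs T U X Z"
  shows "composite s f t g r \<longleftrightarrow> composite s' f' t' g' r"
proof -
  obtain a b where 1: "a \<in> Arr T" "b \<in> Arr T" "Cod T a = Dom T s" "Cod T b = Dom T s'"
    "s \<cdot> a = s' \<cdot> b" "s \<cdot> a \<in> S" "f \<cdot> a = f' \<cdot> b" using sf(3) unfolding roof_eq_iff by blast
  obtain c d where 2: "c \<in> Arr T" "d \<in> Arr T" "Cod T c = Dom T t" "Cod T d = Dom T t'"
    "t \<cdot> c = t' \<cdot> d" "t \<cdot> c \<in> S" "g \<cdot> c = g' \<cdot> d" using tg(3) unfolding roof_eq_iff by blast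
  have sfa: "(s \<cdot> a, f \<cdot> a) \<in> roofs T U X Y" "(s' \<cdot> b, f' \<cdot> b) \<in> roofs T U X Y"
    using sf(1,2) 1 by (auto simp: roofs_iff)
  have "composite s f t g r \<longleftrightarrow> composite (s \<cdot> a) (f \<cdot> a) (t \<cdot> c) (g \<cdot> c) r"
    using composite_refine_left[OF sf(1) tg(1) r 1(1,3,6)] composite_refine_right[OF sfa(1) tg(1) r 2(1,3,6)] by simp
  moreover have "composite s' f' t' g' r \<longleftrightarrow> composite (s' \<cdot> b) (f' \<cdot> b) (t' \<cdot> d) (g' \<cdot> d) r"
    using composite_refine_left[OF sf(2) tg(2) r 1(2,4) 1(6)[unfolded 1(5)]]
      composite_refine_right[OF sfa(2) tg(2) r 2(2,4) 2(6)[unfolded 2(5)]] by simp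
  ultimately show ?thesis unfolding 1(5,7) 2(5,7) by simp
qed

abbreviation Q where "Q \<equiv> verdier_quotient T U"
abbreviation loc where "loc \<equiv> localize T U"

lemma Q_simps:
  "Obj Q = Obj T" "Arr Q = {frac T U X Y r | X Y r. X \<in> Obj T \<and> Y \<in> Obj T \<and> r \<in> roofs T U X Y}"
  "Dom Q (frac T U X Y r) = X" "Cod Q (frac T U X Y r) = Y" "Ident Q X = loc (Ident T X)"
  "Sh Q = Sh T"
  by (simp_all add: verdier_quotient_def frac_def)

lemma frac_Hom:
  assumes "(s, f) \<in> roofs T U X Y"
  shows "frac T U X Y (s, f) \<in> Hom Q X Y"
proof -
  have "X \<in> Obj T" "Y \<in> Obj T" using assms by (auto simp: roofs_iff)
  then show ?thesis unfolding Hom_iff Q_simps using assms by blast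
qed

lemma Q_HomE:
  assumes "p \<in> Hom Q X Y"
  obtains s f where "(s, f) \<in> roofs T U X Y" "p = frac T U X Y (s, f)"
  using assms unfolding Hom_iff by (auto simp: Q_simps)

lemma frac_comp:
  assumes sf: "(s, f) \<in> roofs T U X Y" and tg: "(t, g) \<in> roofs T U Y Z"
    and 1: "t1 \<in> S" "Cod T t1 = Dom T s" "f1 \<in> Arr T" "Dom T f1 = Dom T t1" "Cod T f1 = Dom T t" "f \<cdot> t1 = t \<cdot> f1"
  shows "frac T U Y Z (t, g) \<cdot>\<^bsub>Q\<^esub> frac T U X Y (s, f) = frac T U X Z (s \<cdot> t1, g \<cdot> f1)"
proof -
  let ?A = "{r \<in> roofs T U X Y. roof_eq T U (s, f) r}" and ?B = "{r \<in> roofs T U Y Z. roof_eq T U (t, g) r}"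
  have "comp_roofs T U X Z ?B ?A = {r \<in> roofs T U X Z. \<exists>s' f' t' g'. (s', f') \<in> ?A \<and> (t', g') \<in> ?B \<and> composite s' f' t' g' r}"
    unfolding comp_roofs_def composite_def by blast
  also have "\<dots> = {r \<in> roofs T U X Z. composite s f t g r}"
    using composite_cong[OF sf _ _ tg] sf tg roof_eq_refl[OF sf] roof_eq_refl[OF tg] by blast
  also have "\<dots> = {r \<in> roofs T U X Z. roof_eq T U (s \<cdot> t1, g \<cdot> f1) r}"
    using composite_iff[OF sf tg _ 1] by blast
  finally show ?thesis by (simp add: verdier_quotient_def frac_def)
qed

lemma localize_eq: "f \<in> Arr T \<Longrightarrow> loc f = frac T U (Dom T f) (Cod T f) (Ident T (Dom T f), f)"
  by (simp add: localize_def)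

lemma localize_roof: "f \<in> Arr T \<Longrightarrow> (Ident T (Dom T f), f) \<in> roofs T U (Dom T f) (Cod T f)"
  by (simp add: roofs_iff)

lemma localize_Hom: "f \<in> Arr T \<Longrightarrow> loc f \<in> Hom Q (Dom T f) (Cod T f)"
  unfolding localize_def by (rule frac_Hom[OF localize_roof])

lemma localize_comp:
  assumes "f \<in> Arr T" "g \<in> Arr T" "Cod T f = Dom T g"
  shows "loc g \<cdot>\<^bsub>Q\<^esub> loc f = loc (g \<cdot> f)"
proof -
  have "(Ident T (Cod T f), g) \<in> roofs T U (Cod T f) (Cod T g)" using assms by (simp add: roofs_iff)
  from frac_comp[OF localize_roof[OF assms(1)] this, of "Ident T (Dom T f)" f] show ?thesis
    unfolding localize_def using assms by simp
qed

lemma category_Q: "category Q"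
proof
  fix p assume "p \<in> Arr Q"
  then show "Dom Q p \<in> Obj Q" "Cod Q p \<in> Obj Q" by (auto simp: Q_simps)
next
  fix X assume "X \<in> Obj Q"
  then show "Ident Q X \<in> Hom Q X X" using localize_Hom[of "Ident T X"] by (simp add: Q_simps)
next
  fix p X Y q Z assume "p \<in> Hom Q X Y" "q \<in> Hom Q Y Z"
  then obtain s f t g where p: "(s, f) \<in> roofs T U X Y" "p = frac T U X Y (s, f)"
    and q: "(t, g) \<in> roofs T U Y Z" "q = frac T U Y Z (t, g)" by (metis Q_HomE)
  obtain t' f' where 1: "t' \<in> S" "Cod T t' = Dom T s" "f' \<in> Arr T" "Dom T f' = Dom T t'" "Cod T f' = Dom T t" "f \<cdot> t' = t \<cdot> f'"
    using right_Ore[of t f] p(1) q(1) unfolding roofs_iff by metis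
  show "q \<cdot>\<^bsub>Q\<^esub> p \<in> Hom Q X Z"
    unfolding p q frac_comp[OF p(1) q(1) 1] by (rule frac_Hom[OF composite_roof[OF p(1) q(1) 1(1-5)]])
next
  fix p X Y assume "p \<in> Hom Q X Y"
  then obtain s f where p: "(s, f) \<in> roofs T U X Y" "p = frac T U X Y (s, f)" by (rule Q_HomE)
  then have R: "s \<in> S" "Cod T s = X" "f \<in> Arr T" "Dom T f = Dom T s" "Cod T f = Y" "X \<in> Obj T" "Y \<in> Obj T"
    by (auto simp: roofs_iff)
  have I: "(Ident T X, Ident T X) \<in> roofs T U X X" "(Ident T Y, Ident T Y) \<in> roofs T U Y Y" using R by (auto simp: roofs_iff)
  show "p \<cdot>\<^bsub>Q\<^esub> Ident Q X = p"
    using frac_comp[OF I(1) p(1), of s "Ident T (Dom T s)"] R p(2) by (simp add: Q_simps localize_eq)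
  show "Ident Q Y \<cdot>\<^bsub>Q\<^esub> p = p"
    using frac_comp[OF p(1) I(2), of "Ident T (Dom T s)" f] R p(2) by (simp add: Q_simps localize_eq)
next
  fix p W X q Y o' Z assume "p \<in> Hom Q W X" "q \<in> Hom Q X Y" "o' \<in> Hom Q Y Z"
  then obtain s f t g r h where p: "(s, f) \<in> roofs T U W X" "p = frac T U W X (s, f)"
    and q: "(t, g) \<in> roofs T U X Y" "q = frac T U X Y (t, g)"
    and o: "(r, h) \<in> roofs T U Y Z" "o' = frac T U Y Z (r, h)" by (metis Q_HomE)
  note R = p(1)[unfolded roofs_iff] q(1)[unfolded roofs_iff] o(1)[unfolded roofs_iff]
  obtain t' f' where 1: "t' \<in> S" "Cod T t' = Dom T s" "f' \<in> Arr T" "Dom T f' = Dom T t'" "Cod T f' = Dom T t" "f \<cdot> t' = t \<cdot> f'"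
    using right_Ore[of t f] R by metis
  obtain r' g' where 2: "r' \<in> S" "Cod T r' = Dom T t" "g' \<in> Arr T" "Dom T g' = Dom T r'" "Cod T g' = Dom T r" "g \<cdot> r' = r \<cdot> g'"
    using right_Ore[of r g] R by metis
  obtain r'' f'' where 3: "r'' \<in> S" "Cod T r'' = Dom T t'" "f'' \<in> Arr T" "Dom T f'' = Dom T r''" "Cod T f'' = Dom T r'" "f' \<cdot> r'' = r' \<cdot> f''"
    using right_Ore[of r' f'] 1(3,4,5) 2(1-5) by metis
  note D = R 1(1-5) 2(1-5) 3(1-5)
  have qp: "(s \<cdot> t', g \<cdot> f') \<in> roofs T U W Y" by (rule composite_roof[OF p(1) q(1) 1(1-5)])
  have oq: "(t \<cdot> r', h \<cdot> g') \<in> roofs T U X Z" by (rule composite_roof[OF q(1) o(1) 2(1-5)])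
  have "(g \<cdot> f') \<cdot> r'' = g \<cdot> (f' \<cdot> r'')" using D by simp
  also have "\<dots> = (g \<cdot> r') \<cdot> f''" unfolding 3(6) using D by simp
  also have "\<dots> = r \<cdot> (g' \<cdot> f'')" unfolding 2(6) using D by simp
  finally have e1: "(g \<cdot> f') \<cdot> r'' = r \<cdot> (g' \<cdot> f'')" .
  have "f \<cdot> (t' \<cdot> r'') = (f \<cdot> t') \<cdot> r''" using D by simp
  also have "\<dots> = t \<cdot> (f' \<cdot> r'')" unfolding 1(6) using D by simp
  also have "\<dots> = (t \<cdot> r') \<cdot> f''" unfolding 3(6) using D by simp
  finally have e2: "f \<cdot> (t' \<cdot> r'') = (t \<cdot> r') \<cdot> f''" .
  have "o' \<cdot>\<^bsub>Q\<^esub> (q \<cdot>\<^bsub>Q\<^esub> p) = frac T U W Z ((s \<cdot> t') \<cdot> r'', h \<cdot> (g' \<cdot> f''))"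
    unfolding p q o frac_comp[OF p(1) q(1) 1]
    by (rule frac_comp[OF qp o(1)]) (use D e1 in simp_all)
  moreover have "(o' \<cdot>\<^bsub>Q\<^esub> q) \<cdot>\<^bsub>Q\<^esub> p = frac T U W Z (s \<cdot> (t' \<cdot> r''), (h \<cdot> g') \<cdot> f'')"
    unfolding p q o frac_comp[OF q(1) o(1) 2]
    by (rule frac_comp[OF p(1) oq]) (use D e2 in simp_all)
  ultimately show "(o' \<cdot>\<^bsub>Q\<^esub> q) \<cdot>\<^bsub>Q\<^esub> p = o' \<cdot>\<^bsub>Q\<^esub> (q \<cdot>\<^bsub>Q\<^esub> p)" using D by simp
qed

lemma localize_S_iso:
  assumes "s \<in> S"
  shows "iso_arr Q (loc s)"
proof -
  let ?W = "Dom T s" and ?X = "Cod T s"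
  have s: "s \<in> Arr T" using assms by simp
  have inv: "(s, Ident T ?W) \<in> roofs T U ?X ?W" "(Ident T ?W, s) \<in> roofs T U ?W ?X" using assms by (auto simp: roofs_iff)
  have 1: "frac T U ?X ?W (s, Ident T ?W) \<cdot>\<^bsub>Q\<^esub> loc s = Ident Q ?W"
    using frac_comp[OF inv(2,1), of "Ident T ?W" "Ident T ?W"] s by (simp add: localize_eq Q_simps)
  have "loc s \<cdot>\<^bsub>Q\<^esub> frac T U ?X ?W (s, Ident T ?W) = frac T U ?X ?X (s, s)"
    using frac_comp[OF inv, of "Ident T ?W" "Ident T ?W"] s by (simp add: localize_eq)
  also have "\<dots> = frac T U ?X ?X (Ident T ?X, Ident T ?X)"
    using roof_eqI[of s "Ident T ?X" "Ident T ?X" ?X ?X] assms s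
    by (subst frac_eq_iff) (auto simp: roofs_iff intro: roof_eq_sym)
  finally have 2: "loc s \<cdot>\<^bsub>Q\<^esub> frac T U ?X ?W (s, Ident T ?W) = Ident Q ?X" using s by (simp add: localize_eq Q_simps)
  show ?thesis
    using category.iso_arrI[OF category_Q localize_Hom[OF s] frac_Hom[OF inv(1)] 1 2] .
qed

end

text \<open>A functor that maps one localizing class into another induces a functor on fractions; the formula for the
  shift of \<open>verdier_quotient\<close> is the special case of the shift functor.\<close>

definition induced where
  "induced T' U' Fo Fa = (\<lambda>(X, Y, \<phi>). (Fo X, Fo Y,
     {r \<in> roofs T' U' (Fo X) (Fo Y). \<exists>(s, f) \<in> \<phi>. roof_eq T' U' (Fa s, Fa f) r}))"

locale localization_functor = A: localization T U + B: localization T' U'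
  for T :: "('o, 'm, 'x) tcat_scheme" and U :: "'o set" and T' :: "('p, 'n, 'y) tcat_scheme" and U' :: "'p set" +
  fixes Fo :: "'o \<Rightarrow> 'p" and Fa :: "'m \<Rightarrow> 'n"
  assumes F_functor: "is_functor T T' Fo Fa"
    and F_S: "s \<in> cone_in T U \<Longrightarrow> Fa s \<in> cone_in T' U'"
begin

lemma F_arr:
  assumes "f \<in> Arr T"
  shows "Fa f \<in> Arr T'" "Dom T' (Fa f) = Fo (Dom T f)" "Cod T' (Fa f) = Fo (Cod T f)"
  using F_functor assms by (auto simp: is_functor_def Hom_def)

lemma F_comp:
  "f \<in> Arr T \<Longrightarrow> g \<in> Arr T \<Longrightarrow> Cod T f = Dom T g \<Longrightarrow> Fa (g \<cdot>\<^bsub>T\<^esub> f) = Fa g \<cdot>\<^bsub>T'\<^esub> Fa f"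
  using F_functor by (simp add: is_functor_def)

lemma F_roof: "(s, f) \<in> roofs T U X Y \<Longrightarrow> (Fa s, Fa f) \<in> roofs T' U' (Fo X) (Fo Y)"
  by (auto simp: A.roofs_iff B.roofs_iff F_S F_arr)

lemma F_roof_eq:
  assumes "roof_eq T U (s, f) (s', f')" "(s, f) \<in> roofs T U X Y" "(s', f') \<in> roofs T U X Y"
  shows "roof_eq T' U' (Fa s, Fa f) (Fa s', Fa f')"
proof -
  obtain a b where 1: "a \<in> Arr T" "b \<in> Arr T" "Dom T b = Dom T a" "Cod T a = Dom T s" "Cod T b = Dom T s'"
    "s \<cdot>\<^bsub>T\<^esub> a = s' \<cdot>\<^bsub>T\<^esub> b" "s \<cdot>\<^bsub>T\<^esub> a \<in> A.S" "f \<cdot>\<^bsub>T\<^esub> a = f' \<cdot>\<^bsub>T\<^esub> b"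
    using assms(1) unfolding A.roof_eq_iff by blast
  note R = assms(2-)[unfolded A.roofs_iff]
  show ?thesis unfolding B.roof_eq_iff
    using 1(1-5) R F_S[OF 1(7)] arg_cong[OF 1(6), of Fa] arg_cong[OF 1(8), of Fa]
    by (intro exI[of _ "Fa a"] exI[of _ "Fa b"]) (simp add: F_arr F_comp)
qed

lemma induced_frac:
  assumes "(s, f) \<in> roofs T U X Y"
  shows "induced T' U' Fo Fa (frac T U X Y (s, f)) = frac T' U' (Fo X) (Fo Y) (Fa s, Fa f)"
proof -
  have "roof_eq T' U' (Fa s, Fa f) r"
    if "r \<in> roofs T' U' (Fo X) (Fo Y)" "(s', f') \<in> roofs T U X Y" "roof_eq T U (s, f) (s', f')"
      "roof_eq T' U' (Fa s', Fa f') r" for r s' f'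
    using B.roof_eq_trans[OF F_roof_eq[OF that(3) assms that(2)] that(4) F_roof[OF assms] F_roof[OF that(2)] that(1)] .
  moreover have "\<exists>(s', f') \<in> {r \<in> roofs T U X Y. roof_eq T U (s, f) r}. roof_eq T' U' (Fa s', Fa f') r"
    if "roof_eq T' U' (Fa s, Fa f) r" for r
    using that assms A.roof_eq_refl[OF assms] by (intro bexI[of _ "(s, f)"]) auto
  ultimately show ?thesis unfolding induced_def frac_def by fastforce
qed

lemma induced_functor: "is_functor A.Q B.Q Fo (induced T' U' Fo Fa)"
  unfolding is_functor_def
proof (intro conjI A.category_Q B.category_Q ballI impI)
  fix X assume "X \<in> Obj A.Q"
  then have X: "X \<in> Obj T" by (simp add: A.Q_simps)
  then show "Fo X \<in> Obj B.Q" using F_functor by (simp add: is_functor_def B.Q_simps)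
  have I: "Fa (Ident T X) = Ident T' (Fo X)" "Fo X \<in> Obj T'" using F_functor X by (simp_all add: is_functor_def)
  show "induced T' U' Fo Fa (Ident A.Q X) = Ident B.Q (Fo X)"
    using induced_frac[of "Ident T X" "Ident T X" X X] X I
    by (simp add: A.Q_simps B.Q_simps A.localize_eq B.localize_eq A.roofs_iff)
next
  fix p assume "p \<in> Arr A.Q"
  then obtain s f where p: "(s, f) \<in> roofs T U (Dom A.Q p) (Cod A.Q p)" "p = frac T U (Dom A.Q p) (Cod A.Q p) (s, f)"
    using A.Q_HomE[of p "Dom A.Q p" "Cod A.Q p"] by (metis Hom_iff)
  show "induced T' U' Fo Fa p \<in> Hom B.Q (Fo (Dom A.Q p)) (Fo (Cod A.Q p))"
    using induced_frac[OF p(1)] B.frac_Hom[OF F_roof[OF p(1)]] p(2) by simp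
next
  fix p q assume "p \<in> Arr A.Q" "q \<in> Arr A.Q" "Cod A.Q p = Dom A.Q q"
  then have "p \<in> Hom A.Q (Dom A.Q p) (Cod A.Q p)" "q \<in> Hom A.Q (Cod A.Q p) (Cod A.Q q)" by (auto simp: Hom_iff)
  then obtain s f t g X Y Z where p: "(s, f) \<in> roofs T U X Y" "p = frac T U X Y (s, f)"
    and q: "(t, g) \<in> roofs T U Y Z" "q = frac T U Y Z (t, g)" by (metis A.Q_HomE)
  note R = p(1)[unfolded A.roofs_iff] q(1)[unfolded A.roofs_iff]
  obtain t' f' where 1: "t' \<in> A.S" "Cod T t' = Dom T s" "f' \<in> Arr T" "Dom T f' = Dom T t'" "Cod T f' = Dom T t" "f \<cdot>\<^bsub>T\<^esub> t' = t \<cdot>\<^bsub>T\<^esub> f'"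
    using A.right_Ore[of t f] R by metis
  note C = A.composite_roof[OF p(1) q(1) 1(1-5)]
  have "Fa f \<cdot>\<^bsub>T'\<^esub> Fa t' = Fa t \<cdot>\<^bsub>T'\<^esub> Fa f'" using arg_cong[OF 1(6), of Fa] 1(1-5) R by (simp add: F_comp)
  then have "frac T' U' (Fo Y) (Fo Z) (Fa t, Fa g) \<cdot>\<^bsub>B.Q\<^esub> frac T' U' (Fo X) (Fo Y) (Fa s, Fa f) =
    frac T' U' (Fo X) (Fo Z) (Fa s \<cdot>\<^bsub>T'\<^esub> Fa t', Fa g \<cdot>\<^bsub>T'\<^esub> Fa f')"
    by (intro B.frac_comp F_roof p q) (use 1(1-5) R in \<open>simp_all add: F_arr F_S\<close>)
  then show "induced T' U' Fo Fa (q \<cdot>\<^bsub>A.Q\<^esub> p) = induced T' U' Fo Fa q \<cdot>\<^bsub>B.Q\<^esub> induced T' U' Fo Fa p"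
    unfolding p q A.frac_comp[OF p(1) q(1) 1] induced_frac[OF p(1)] induced_frac[OF q(1)] induced_frac[OF C]
    using 1(1-5) R by (simp add: F_comp)
qed

lemma induced_localize:
  assumes "f \<in> Arr T"
  shows "induced T' U' Fo Fa (localize T U f) = localize T' U' (Fa f)"
proof -
  have "Fa (Ident T (Dom T f)) = Ident T' (Fo (Dom T f))" using F_functor assms by (simp add: is_functor_def)
  then show ?thesis using assms induced_frac[OF A.localize_roof[OF assms]] by (simp add: localize_def F_arr)
qed

end

context localization
begin

lemma ShA_Q: "ShA Q = induced T U (Sh T) (ShA T)"
  by (simp add: verdier_quotient_def induced_def)

lemma shift_functor: "is_functor T T (Sh T) (ShA T)"
  unfolding is_functor_def using category_axioms by (auto simp: Hom_iff)

lemma localization_shift: "localization_functor T U T U (Sh T) (ShA T)"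
  by unfold_locales (auto intro: shift_functor S_shift)

lemma shift_category_Q: "shift_category Q"
proof -
  interpret H: localization_functor T U T U "Sh T" "ShA T" by (rule localization_shift)
  interpret C: category Q by (rule category_Q)
  note F = H.induced_functor[folded ShA_Q]
  show ?thesis
  proof
    fix X assume "X \<in> Obj Q" then show "Sh Q X \<in> Obj Q" by (simp add: Q_simps)
  next
    fix f X Y assume "f \<in> Hom Q X Y" then show "ShA Q f \<in> Hom Q (Sh Q X) (Sh Q Y)"
      using F unfolding is_functor_def Q_simps(6) by (auto simp: Hom_iff)
  next
    fix X assume "X \<in> Obj Q" then show "ShA Q (Ident Q X) = Ident Q (Sh Q X)"
      using F unfolding is_functor_def Q_simps(6) by blast
  next
    fix f X Y g Z assume "f \<in> Hom Q X Y" "g \<in> Hom Q Y Z"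
    then show "ShA Q (g \<cdot>\<^bsub>Q\<^esub> f) = ShA Q g \<cdot>\<^bsub>Q\<^esub> ShA Q f"
      using F unfolding is_functor_def by (auto simp: Hom_iff)
  qed
qed

lemma ShA_localize: "f \<in> Arr T \<Longrightarrow> ShA Q (loc f) = loc (ShA T f)"
  using localization_functor.induced_localize[OF localization_shift] unfolding ShA_Q .

lemma Tri_Q: "t \<in> Tri Q \<longleftrightarrow> (\<exists>u v w. (u, v, w) \<in> Tri T \<and>
    triangle_iso Q t (loc u, loc v, loc w))"
proof -
  let ?B = "{(loc u, loc v, loc w) | u v w. (u, v, w) \<in> Tri T}"
  obtain R where R: "Q = with_triangles R ?B" unfolding verdier_quotient_def by blast
  have "triangle_iso Q = triangle_iso R" unfolding R by (rule triangle_iso_with_triangles)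
  moreover have "Tri Q = {t. \<exists>t' \<in> ?B. triangle_iso R t t'}" unfolding R by (rule Tri_with_triangles)
  ultimately show ?thesis by (simp only: mem_Collect_eq Bex_def) blast
qed

lemma typed_localize:
  assumes "typed_triangle T u v w"
  shows "typed_triangle Q (loc u) (loc v) (loc w)"
  using assms localize_Hom[of u] localize_Hom[of v] localize_Hom[of w]
  unfolding typed_triangle_def Hom_iff by (simp add: Q_simps)

lemma Q_tri_typed:
  assumes "(u, v, w) \<in> Tri Q"
  shows "typed_triangle Q u v w"
  using assms unfolding Tri_Q by (auto simp: triangle_iso_iff)

lemma Q_tri_closed: "triangle_iso Q t t' \<Longrightarrow> t' \<in> Tri Q \<Longrightarrow> t \<in> Tri Q"
  unfolding Tri_Q using shift_category.triangle_iso_trans[OF shift_category_Q] by blast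

lemma localize_tri:
  assumes "(u, v, w) \<in> Tri T"
  shows "(loc u, loc v, loc w) \<in> Tri Q"
  unfolding Tri_Q
  using assms shift_category.triangle_iso_refl[OF shift_category_Q typed_localize[OF Tri_typed[OF assms]]] by blast

text \<open>The arrows that a square with sides in the localizing class induces on the cones are themselves in the class
  and become invertible.\<close>

lemma localize_triangle_iso:
  assumes A: "(u, v, w) \<in> Tri T" and B: "(u', v', w') \<in> Tri T"
    and s: "s \<in> S" "Dom T s = Dom T u" "Cod T s = Dom T u'"
    and t: "t \<in> S" "Dom T t = Cod T u" "Cod T t = Cod T u'" and e: "u' \<cdot> s = t \<cdot> u"
  shows "triangle_iso Q (loc u, loc v, loc w) (loc u', loc v', loc w')"
proof -
  obtain c where c: "c \<in> S" "Dom T c = Cod T v" "Cod T c = Cod T v'" "c \<cdot> v = v' \<cdot> t" "ShA T s \<cdot> w = w' \<cdot> c"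
    using S_cone_map[OF assms] .
  note D = s t c(1-3) tri[OF A] tri[OF B]
  have H: "Dom Q (loc f) = Dom T f" "Cod Q (loc f) = Cod T f" if "f \<in> Arr T" for f
    using localize_Hom[OF that] by (simp_all add: Hom_iff)
  show ?thesis unfolding triangle_iso_iff
    by (intro conjI typed_localize Tri_typed[OF A] Tri_typed[OF B]
        exI[of _ "loc s"] exI[of _ "loc t"] exI[of _ "loc c"])
      (use D e c(4,5) localize_Hom[of s] localize_Hom[of t] localize_Hom[of c]
        in \<open>simp_all add: localize_S_iso H localize_comp ShA_localize\<close>)
qed

end

section \<open>Quotients of subcategories\<close>

context localization
begin

text \<open>Both roofs represent the right fraction with legs \<open>g\<close> and \<open>t\<close>.\<close>

lemma frac_eqI_postcompose:
  assumes sf: "(s, f) \<in> roofs T U X Y" "(s', f') \<in> roofs T U X Y"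
    and t: "t \<in> S" "Dom T t = Y" and g: "g \<in> Arr T" "Dom T g = X" "Cod T g = Cod T t"
    and e: "g \<cdot> s = t \<cdot> f" "g \<cdot> s' = t \<cdot> f'"
  shows "frac T U X Y (s, f) = frac T U X Y (s', f')"
proof -
  note R = sf[unfolded roofs_iff] t g
  obtain x y where 3: "x \<in> S" "y \<in> Arr T" "Cod T x = Dom T s" "Dom T y = Dom T x" "Cod T y = Dom T s'" "s \<cdot> x = s' \<cdot> y"
    using right_Ore[of s' s] R by (metis S_arr)
  have "t \<cdot> (f \<cdot> x) = (g \<cdot> s) \<cdot> x" unfolding e using R 3(1-5) by simp
  also have "\<dots> = g \<cdot> (s' \<cdot> y)" unfolding 3(6)[symmetric] using R 3(1-5) by simp
  also have "\<dots> = (g \<cdot> s') \<cdot> y" using R 3(1-5) by simp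
  also have "\<dots> = t \<cdot> (f' \<cdot> y)" unfolding e using R 3(1-5) by simp
  finally obtain z where z: "z \<in> S" "Cod T z = Dom T x" "(f \<cdot> x) \<cdot> z = (f' \<cdot> y) \<cdot> z"
    using right_cancel[of t "f \<cdot> x" "f' \<cdot> y"] R 3(1-5) by auto
  have "f \<cdot> (x \<cdot> z) = f' \<cdot> (y \<cdot> z)" using z R 3(1-5) by simp
  moreover have "s \<cdot> (x \<cdot> z) = s' \<cdot> (y \<cdot> z)"
  proof -
    have "s \<cdot> (x \<cdot> z) = (s \<cdot> x) \<cdot> z" using R 3(1-5) z(1,2) by simp
    also have "\<dots> = s' \<cdot> (y \<cdot> z)" unfolding 3(6) using R 3(1-5) z(1,2) by simp
    finally show ?thesis .
  qed
  moreover have "s \<cdot> (x \<cdot> z) \<in> S" using R 3(1-5) z(1,2) by simp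
  ultimately show ?thesis
    unfolding frac_eq_iff[OF sf] roof_eq_iff using R 3(1-5) z(1,2)
    by (intro exI[of _ "x \<cdot> z"] exI[of _ "y \<cdot> z"]) simp
qed

end

locale subquotient = localization T U for T :: "('o, 'm, 'x) tcat_scheme" (structure) and U :: "'o set" +
  fixes V :: "'o set"
  assumes subV: "triangulated_subcat T V"
begin

abbreviation TV where "TV \<equiv> full_tri T V"
abbreviation UV where "UV \<equiv> V \<inter> U"

sublocale V: localization T V by unfold_locales (rule subV)

sublocale A: localization TV UV
  by (intro localization.intro V.triangulated_full_tri localization_axioms.intro V.subcat_of_full_tri sub)

lemma S_sub: "s \<in> A.S \<longleftrightarrow> s \<in> S \<and> Dom T s \<in> V \<and> Cod T s \<in> V"
proof
  assume "s \<in> A.S"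
  then obtain v w where "(s, v, w) \<in> Tri TV" "Cod T v \<in> V \<inter> U" unfolding cone_in_def by auto
  then show "s \<in> S \<and> Dom T s \<in> V \<and> Cod T s \<in> V" using S_iff[of s v w] tri[of s v w] by auto
next
  assume s: "s \<in> S \<and> Dom T s \<in> V \<and> Cod T s \<in> V"
  then obtain v w where W: "(s, v, w) \<in> Tri T" "Cod T v \<in> U" by (auto elim: S_E)
  then have "Cod T v \<in> V" using V.U_tri(1)[OF W(1)] s by simp
  then have "(s, v, w) \<in> Tri TV" using W s tri[OF W(1)] by simp
  then show "s \<in> A.S" using A.S_iff[of s v w] W \<open>Cod T v \<in> V\<close> by simp
qed

lemma roofs_sub: "(s, f) \<in> roofs TV UV X Y \<longleftrightarrow> (s, f) \<in> roofs T U X Y \<and> Dom T s \<in> V \<and> X \<in> V \<and> Y \<in> V"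
  unfolding A.roofs_iff roofs_iff S_sub by auto

abbreviation incl where "incl \<equiv> induced T U id id"

sublocale I: localization_functor TV UV T U id id
  by unfold_locales (use A.category_axioms category_axioms V.U_Obj in \<open>auto simp: is_functor_def Hom_def S_sub\<close>)

lemma incl_frac:
  "(s, f) \<in> roofs TV UV X Y \<Longrightarrow> incl (frac TV UV X Y (s, f)) = frac T U X Y (s, f)"
  using I.induced_frac by simp

lemma incl_localize: "f \<in> Arr TV \<Longrightarrow> incl (A.loc f) = loc f"
  using I.induced_localize by simp

lemma incl_shift:
  assumes "p \<in> Arr A.Q"
  shows "incl (ShA A.Q p) = ShA Q (incl p)"
proof -
  interpret SA: localization_functor TV UV TV UV "Sh TV" "ShA TV"
    by (rule A.localization_shift)
  interpret SB: localization_functor T U T U "Sh T" "ShA T" by (rule localization_shift)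
  obtain s f X Y where p: "(s, f) \<in> roofs TV UV X Y" "p = frac TV UV X Y (s, f)"
    using assms by (metis Hom_iff A.Q_HomE)
  have q: "(s, f) \<in> roofs T U X Y" using p roofs_sub by simp
  show ?thesis
    unfolding p(2) A.ShA_Q ShA_Q SA.induced_frac[OF p(1)] incl_frac[OF SA.F_roof[OF p(1)]] incl_frac[OF p(1)] SB.induced_frac[OF q]
    by simp
qed

text \<open>The inclusion of \<open>V\<close> induces a functor of quotients that is the identity on objects and commutes strictly with
  the shift. Only fullness, faithfulness, essential surjectivity and the lifting of triangles depend on more
  than this.\<close>

lemma embedding:
  assumes full: "\<And>X Y g. X \<in> V \<Longrightarrow> Y \<in> V \<Longrightarrow> g \<in> Hom Q X Y \<Longrightarrow> \<exists>f \<in> Hom A.Q X Y. incl f = g"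
    and faithful: "\<And>s f s' f' X Y. (s, f) \<in> roofs TV UV X Y \<Longrightarrow> (s', f') \<in> roofs TV UV X Y
      \<Longrightarrow> roof_eq T U (s, f) (s', f') \<Longrightarrow> roof_eq TV UV (s, f) (s', f')"
    and ess_surj: "\<And>Y. Y \<in> Obj T \<Longrightarrow> \<exists>X \<in> V. isomorphic Q X Y"
    and lift: "\<And>u v w. (u, v, w) \<in> Tri T \<Longrightarrow> \<exists>u' v' w'. (u', v', w') \<in> Tri TV \<and>
       triangle_iso Q (loc u, loc v, loc w) (loc u', loc v', loc w')"
  shows "A.Q \<simeq>\<^sub>\<Delta> Q" "Q \<simeq>\<^sub>\<Delta> A.Q"
proof -
  interpret QA: shift_category A.Q by (rule A.shift_category_Q)
  interpret QB: shift_category Q by (rule shift_category_Q)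
  have arr: "u \<in> Arr TV" "v \<in> Arr TV" "w \<in> Arr TV" if "(u, v, w) \<in> Tri TV" for u v w
    using A.tri[OF that] by auto
  have F_iso: "triangle_iso Q (incl u, incl v, incl w) (incl u', incl v', incl w')"
    if I: "triangle_iso A.Q (u, v, w) (u', v', w')" for u v w u' v' w'
  proof -
    note F = I.induced_functor[unfolded is_functor_def]
    have ar: "incl f \<in> Arr Q" "Dom Q (incl f) = Dom A.Q f" "Cod Q (incl f) = Cod A.Q f" if "f \<in> Arr A.Q" for f
      using F that by (auto simp: Hom_iff)
    have co: "incl g \<cdot>\<^bsub>Q\<^esub> incl f = incl (g \<cdot>\<^bsub>A.Q\<^esub> f)" if "f \<in> Arr A.Q" "g \<in> Arr A.Q" "Cod A.Q f = Dom A.Q g" for f g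
      using F that by auto
    have io: "iso_arr Q (incl f)" if f: "iso_arr A.Q f" for f
    proof -
      obtain g where g: "f \<in> Arr A.Q" "g \<in> Arr A.Q" "Dom A.Q g = Cod A.Q f" "Cod A.Q g = Dom A.Q f"
        "g \<cdot>\<^bsub>A.Q\<^esub> f = Ident A.Q (Dom A.Q f)" "f \<cdot>\<^bsub>A.Q\<^esub> g = Ident A.Q (Cod A.Q f)" by (rule QA.iso_arrE[OF f])
      have "incl (Ident A.Q X) = Ident Q X" if "X \<in> Obj A.Q" for X using F that by auto
      then show ?thesis
        by (intro QB.iso_arrI[of _ "Dom A.Q f" "Cod A.Q f" "incl g"]) (use g in \<open>simp_all add: Hom_iff ar co\<close>)
    qed
    have sh: "Sh A.Q = Sh Q" by (simp add: A.Q_simps Q_simps)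
    have ty: "typed_triangle Q (incl u) (incl v) (incl w)" if "typed_triangle A.Q u v w" for u v w
      using that unfolding typed_triangle_def by (simp add: ar sh)
    obtain a b c where 1: "iso_arr A.Q a" "iso_arr A.Q b" "iso_arr A.Q c" "a \<in> Hom A.Q (Dom A.Q u) (Dom A.Q u')"
      "b \<in> Hom A.Q (Cod A.Q u) (Cod A.Q u')" "c \<in> Hom A.Q (Cod A.Q v) (Cod A.Q v')"
      "b \<cdot>\<^bsub>A.Q\<^esub> u = u' \<cdot>\<^bsub>A.Q\<^esub> a" "c \<cdot>\<^bsub>A.Q\<^esub> v = v' \<cdot>\<^bsub>A.Q\<^esub> b" "ShA A.Q a \<cdot>\<^bsub>A.Q\<^esub> w = w' \<cdot>\<^bsub>A.Q\<^esub> c"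
      and T: "typed_triangle A.Q u v w" "typed_triangle A.Q u' v' w'"
      using I unfolding triangle_iso_iff by blast
    note D = 1(4-6)[unfolded Hom_iff] T[unfolded typed_triangle_def]
    have sha: "ShA Q (incl a) = incl (ShA A.Q a)" using D incl_shift by simp
    have e: "incl b \<cdot>\<^bsub>Q\<^esub> incl u = incl u' \<cdot>\<^bsub>Q\<^esub> incl a" "incl c \<cdot>\<^bsub>Q\<^esub> incl v = incl v' \<cdot>\<^bsub>Q\<^esub> incl b"
      "ShA Q (incl a) \<cdot>\<^bsub>Q\<^esub> incl w = incl w' \<cdot>\<^bsub>Q\<^esub> incl c"
      unfolding sha by (simp_all only: co D QA.sha_arr 1(7-9))
    show ?thesis unfolding triangle_iso_iff
      by (intro conjI ty[OF T(1)] ty[OF T(2)] exI[of _ "incl a"] exI[of _ "incl b"] exI[of _ "incl c"] io 1(1-3) e)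
        (use D in \<open>simp_all add: Hom_iff ar\<close>)
  qed
  have lin: "(incl u, incl v, incl w) \<in> Tri Q" if uvw: "(u, v, w) \<in> Tri A.Q" for u v w
  proof -
    obtain u' v' w' where H: "(u', v', w') \<in> Tri TV" "triangle_iso A.Q (u, v, w)
       (A.loc u', A.loc v', A.loc w')"
      using uvw unfolding A.Tri_Q by blast
    have "triangle_iso Q (incl u, incl v, incl w) (loc u', loc v', loc w')"
      using F_iso[OF H(2)] unfolding incl_localize[OF arr(1)[OF H(1)]] incl_localize[OF arr(2)[OF H(1)]] incl_localize[OF arr(3)[OF H(1)]] .
    moreover have "(u', v', w') \<in> Tri T" using H by simp
    ultimately show ?thesis unfolding Tri_Q by blast
  qed
  interpret E: triangle_embedding A.Q Q incl
  proof
    show "is_functor A.Q Q id incl" by (rule I.induced_functor)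
    show "Sh A.Q X = Sh Q X" for X by (simp add: A.Q_simps Q_simps)
    show "incl (ShA A.Q f) = ShA Q (incl f)" if "f \<in> Arr A.Q" for f by (rule incl_shift[OF that])
    show "\<exists>f \<in> Hom A.Q X Y. incl f = g" if "X \<in> Obj A.Q" "Y \<in> Obj A.Q" "g \<in> Hom Q X Y" for X Y g
      using full[of X Y g] that by (simp add: A.Q_simps)
    show "p = p'" if pp: "p \<in> Hom A.Q X Y" "p' \<in> Hom A.Q X Y" "incl p = incl p'" for X Y p p'
    proof -
      obtain s f where p: "(s, f) \<in> roofs TV UV X Y" "p = frac TV UV X Y (s, f)"
        using pp(1) by (rule A.Q_HomE)
      obtain s' f' where p': "(s', f') \<in> roofs TV UV X Y" "p' = frac TV UV X Y (s', f')"
        using pp(2) by (rule A.Q_HomE)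
      have r: "(s, f) \<in> roofs T U X Y" "(s', f') \<in> roofs T U X Y" using p p' roofs_sub by auto
      have "roof_eq T U (s, f) (s', f')"
        using pp(3) unfolding p p' incl_frac[OF p(1)] incl_frac[OF p'(1)] frac_eq_iff[OF r] .
      then show ?thesis using faithful[OF p(1) p'(1)] A.frac_eq_iff[OF p(1) p'(1)] p p' by simp
    qed
    show "\<exists>X \<in> Obj A.Q. isomorphic Q X Y" if "Y \<in> Obj Q" for Y
      using ess_surj[of Y] that by (simp add: A.Q_simps Q_simps)
    show "typed_triangle A.Q u v w" if "(u, v, w) \<in> Tri A.Q" for u v w by (rule A.Q_tri_typed[OF that])
    show "typed_triangle Q u v w" if "(u, v, w) \<in> Tri Q" for u v w by (rule Q_tri_typed[OF that])
    show "t \<in> Tri A.Q" if "triangle_iso A.Q t t'" "t' \<in> Tri A.Q" for t t' by (rule A.Q_tri_closed[OF that])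
    show "t \<in> Tri Q" if "triangle_iso Q t t'" "t' \<in> Tri Q" for t t' by (rule Q_tri_closed[OF that])
    show "(incl u, incl v, incl w) \<in> Tri Q" if "(u, v, w) \<in> Tri A.Q" for u v w by (rule lin[OF that])
    show "\<exists>u v w. (u, v, w) \<in> Tri A.Q \<and> triangle_iso Q t (incl u, incl v, incl w)" if t: "t \<in> Tri Q" for t
    proof -
      obtain u v w where T: "(u, v, w) \<in> Tri T" "triangle_iso Q t (loc u, loc v, loc w)"
        using t unfolding Tri_Q by blast
      obtain u' v' w' where T': "(u', v', w') \<in> Tri TV"
        "triangle_iso Q (loc u, loc v, loc w) (loc u', loc v', loc w')"
        using lift[OF T(1)] by blast
      note a = arr[OF T'(1)]
      show ?thesis
        using A.localize_tri[OF T'(1)] QB.triangle_iso_trans[OF T(2) T'(2)]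
          incl_localize[OF a(1)] incl_localize[OF a(2)] incl_localize[OF a(3)] by metis
    qed
  qed
  show "A.Q \<simeq>\<^sub>\<Delta> Q" "Q \<simeq>\<^sub>\<Delta> A.Q" by (rule E.full_faithful_ess_surj)+
qed

text \<open>If every object receives an arrow of the localizing class from \<open>V\<close>, then every roof and every equality of
  roofs can be refined to one that lives in \<open>V\<close>, and every triangle is replaced by one on a refined arrow.\<close>

lemma embedding_right:
  assumes R: "\<And>X. X \<in> Obj T \<Longrightarrow> \<exists>m \<in> S. Dom T m \<in> V \<and> Cod T m = X"
  shows "A.Q \<simeq>\<^sub>\<Delta> Q" "Q \<simeq>\<^sub>\<Delta> A.Q"
proof -
  have full: "\<exists>q \<in> Hom A.Q X Y. incl q = g" if XY: "X \<in> V" "Y \<in> V" "g \<in> Hom Q X Y" for X Y g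
  proof -
    obtain s f where g: "(s, f) \<in> roofs T U X Y" "g = frac T U X Y (s, f)" using XY(3) by (rule Q_HomE)
    note H = g(1)[unfolded roofs_iff]
    obtain m where m: "m \<in> S" "Dom T m \<in> V" "Cod T m = Dom T s" using R[of "Dom T s"] H by auto
    have r: "(s \<cdot> m, f \<cdot> m) \<in> roofs T U X Y" "(s \<cdot> m, f \<cdot> m) \<in> roofs TV UV X Y"
      using H m XY unfolding roofs_sub by (auto simp: roofs_iff)
    have "roof_eq T U (s \<cdot> m, f \<cdot> m) (s, f)" 
      by (rule roof_eq_sym, rule roof_eqI) (use m H g(1) in auto)
    then show ?thesis
      using A.frac_Hom[OF r(2)] incl_frac[OF r(2)] frac_eq_iff[OF r(1) g(1)] g(2) by metis
  qed
  have faithful: "roof_eq TV UV (s, f) (s', f')"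
    if p: "(s, f) \<in> roofs TV UV X Y" "(s', f') \<in> roofs TV UV X Y"
      and eq: "roof_eq T U (s, f) (s', f')" for s f s' f' X Y
  proof -
    note H = p[unfolded roofs_sub roofs_iff]
    obtain a b where 1: "a \<in> Arr T" "b \<in> Arr T" "Dom T b = Dom T a" "Cod T a = Dom T s" "Cod T b = Dom T s'"
      "s \<cdot> a = s' \<cdot> b" "s \<cdot> a \<in> S" "f \<cdot> a = f' \<cdot> b" using eq unfolding roof_eq_iff by blast
    obtain m where m: "m \<in> S" "Dom T m \<in> V" "Cod T m = Dom T a" using R[of "Dom T a"] 1 by auto
    have e: "s \<cdot> (a \<cdot> m) = s' \<cdot> (b \<cdot> m)" "f \<cdot> (a \<cdot> m) = f' \<cdot> (b \<cdot> m)"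
      using arg_cong[OF 1(6), of "\<lambda>z. z \<cdot> m"] arg_cong[OF 1(8), of "\<lambda>z. z \<cdot> m"] 1(1-5) H m by simp_all
    have "(s \<cdot> a) \<cdot> m \<in> S" by (rule S_comp[OF m(1) 1(7)]) (use m 1(1-5) H in simp)
    then have "s \<cdot> (a \<cdot> m) \<in> A.S" unfolding S_sub using 1(1-5) H m by simp
    then show ?thesis unfolding A.roof_eq_iff using 1(1-5) H m e
      by (intro exI[of _ "a \<cdot> m"] exI[of _ "b \<cdot> m"]) simp
  qed
  have ess: "\<exists>X \<in> V. isomorphic Q X Y" if Y: "Y \<in> Obj T" for Y
  proof -
    obtain m where m: "m \<in> S" "Dom T m \<in> V" "Cod T m = Y" using R[OF Y] by blast
    then show ?thesis using localize_S_iso[OF m(1)] localize_Hom[of m] unfolding isomorphic_def by auto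
  qed
  have lift: "\<exists>u' v' w'. (u', v', w') \<in> Tri TV \<and>
       triangle_iso Q (loc u, loc v, loc w) (loc u', loc v', loc w')"
    if T: "(u, v, w) \<in> Tri T" for u v w
  proof -
    note H = tri[OF T]
    obtain n where n: "n \<in> S" "Dom T n \<in> V" "Cod T n = Cod T u" using R[of "Cod T u"] H by auto
    obtain t f where t: "t \<in> S" "f \<in> Arr T" "Cod T t = Dom T u" "Dom T f = Dom T t" "Cod T f = Dom T n" "u \<cdot> t = n \<cdot> f"
      using right_Ore[OF n(1), of u] H n by metis
    obtain m where m: "m \<in> S" "Dom T m \<in> V" "Cod T m = Dom T t" using R[of "Dom T t"] t by auto
    have e: "u \<cdot> (t \<cdot> m) = n \<cdot> (f \<cdot> m)" using arg_cong[OF t(6), of "\<lambda>z. z \<cdot> m"] t(1-5) H m n by simp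
    obtain v' w' where V': "(f \<cdot> m, v', w') \<in> Tri TV"
      using A.extend_first[of "f \<cdot> m"] t m n by auto
    then have "(f \<cdot> m, v', w') \<in> Tri T" by simp
    then have "triangle_iso Q (loc (f \<cdot> m), loc v', loc w') (loc u, loc v, loc w)"
      by (rule localize_triangle_iso[of _ _ _ _ _ _ "t \<cdot> m" n]) (use T t m n H e in simp_all)
    then show ?thesis using V' shift_category.triangle_iso_sym[OF shift_category_Q] by blast
  qed
  show "A.Q \<simeq>\<^sub>\<Delta> Q" "Q \<simeq>\<^sub>\<Delta> A.Q" by (rule embedding[OF full faithful ess lift]; assumption)+
qed

text \<open>If instead every object maps to \<open>V\<close> by an arrow of the localizing class, the roofs have to be turned into
  right fractions \<open>X \<rightarrow> Z \<leftarrow> Y\<close> first, which can be pushed into \<open>V\<close>, and then back.\<close>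

lemma embedding_left:
  assumes L: "\<And>X. X \<in> Obj T \<Longrightarrow> \<exists>m \<in> S. Dom T m = X \<and> Cod T m \<in> V"
  shows "A.Q \<simeq>\<^sub>\<Delta> Q" "Q \<simeq>\<^sub>\<Delta> A.Q"
proof -
  have full: "\<exists>q \<in> Hom A.Q X Y. incl q = g" if XY: "X \<in> V" "Y \<in> V" "g \<in> Hom Q X Y" for X Y g
  proof -
    obtain s f where g: "(s, f) \<in> roofs T U X Y" "g = frac T U X Y (s, f)" using XY(3) by (rule Q_HomE)
    note H = g(1)[unfolded roofs_iff]
    obtain t h where t: "t \<in> S" "h \<in> Arr T" "Dom T t = Cod T f" "Dom T h = Cod T s" "Cod T h = Cod T t" "h \<cdot> s = t \<cdot> f"
      using left_Ore[of s f] H by metis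
    obtain m where m: "m \<in> S" "Dom T m = Cod T t" "Cod T m \<in> V" using L[of "Cod T t"] t by auto
    have mt: "m \<cdot> t \<in> A.S" "m \<cdot> h \<in> Arr TV" "Cod T (m \<cdot> h) = Cod T (m \<cdot> t)" "Dom T (m \<cdot> h) = X" "Dom T (m \<cdot> t) = Y"
      unfolding S_sub using m t XY H by auto
    obtain s' f' where s': "s' \<in> A.S" "f' \<in> Arr TV" "Cod T s' = Dom T (m \<cdot> h)" "Dom T f' = Dom T s'"
      "Cod T f' = Dom T (m \<cdot> t)" "(m \<cdot> h) \<cdot> s' = (m \<cdot> t) \<cdot> f'"
      using A.right_Ore[OF mt(1,2)] mt(3) by (metis full_tri_simps(3,4,6))
    have r: "(s', f') \<in> roofs T U X Y" "(s', f') \<in> roofs TV UV X Y"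
      unfolding roofs_sub using s' mt XY by (auto simp: S_sub roofs_iff)
    have "(m \<cdot> h) \<cdot> s = (m \<cdot> t) \<cdot> f" using t m H by simp
    then have "frac T U X Y (s', f') = frac T U X Y (s, f)"
      using mt by (intro frac_eqI_postcompose[OF r(1) g(1), of "m \<cdot> t" "m \<cdot> h"]) (auto simp: S_sub s'(6))
    then show ?thesis using A.frac_Hom[OF r(2)] incl_frac[OF r(2)] g(2) by metis
  qed
  have faithful: "roof_eq TV UV (s1, f1) (s2, f2)"
    if p: "(s1, f1) \<in> roofs TV UV X Y" "(s2, f2) \<in> roofs TV UV X Y"
      and eq: "roof_eq T U (s1, f1) (s2, f2)" for s1 f1 s2 f2 X Y
  proof -
    note H = p[unfolded roofs_sub roofs_iff]
    have "s1 \<in> Arr TV" "s2 \<in> A.S" using H by (auto simp: S_sub)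
    then obtain x y where 3: "x \<in> A.S" "y \<in> Arr TV" "Cod T x = Dom T s1" "Dom T y = Dom T x" "Cod T y = Dom T s2"
      "s1 \<cdot> x = s2 \<cdot> y" using A.right_Ore[of s2 s1] H by (metis full_tri_simps(3,4,6))
    have x': "x \<in> S" "x \<in> Arr T" "y \<in> Arr T" "Dom T x \<in> V" using 3 by (auto simp: S_sub)
    define s f g where d: "s = s1 \<cdot> x" "f = f1 \<cdot> x" "g = f2 \<cdot> y"
    have sS: "s \<in> S" "Dom T s = Dom T x" "Cod T s = X"
      using H 3(3-5) x' S_comp[OF x'(1), of s1] by (simp_all add: d)
    have fg: "f \<in> Arr T" "g \<in> Arr T" "Dom T f = Dom T s" "Dom T g = Dom T s" "Cod T f = Y" "Cod T g = Y"
      using H 3 x' by (simp_all add: d)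
    have XY: "X \<in> V" "Y \<in> V" "Dom T s \<in> V" using H sS x' by auto
    have r: "(s, f) \<in> roofs TV UV X Y" "(s, g) \<in> roofs TV UV X Y"
      unfolding roofs_sub using sS fg XY by (auto simp: roofs_iff)
    have rT: "(s1, f1) \<in> roofs T U X Y" "(s2, f2) \<in> roofs T U X Y" "(s, f) \<in> roofs T U X Y" "(s, g) \<in> roofs T U X Y"
      using r p by (auto simp: roofs_sub)
    have sA: "s \<in> A.S" using sS XY by (simp add: S_sub)
    have e1: "roof_eq TV UV (s1, f1) (s, f)"
      using A.roof_eqI[of x s1 f1 X Y] p(1) 3 x' sA H by (simp add: d)
    have e2: "roof_eq TV UV (s2, f2) (s, g)"
      using A.roof_eqI[of y s2 f2 X Y] p(2) 3 sA by (simp add: d)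
    have e1': "roof_eq T U (s1, f1) (s, f)"
      using roof_eqI[of x s1 f1 X Y] rT(1) 3 x' sS by (simp add: d)
    have e2': "roof_eq T U (s2, f2) (s, g)"
      using roof_eqI[of y s2 f2 X Y] rT(2) 3 x' sS by (simp add: d)
    have "roof_eq T U (s, f) (s, g)"
      using roof_eq_trans[OF roof_eq_trans[OF roof_eq_sym[OF e1'] eq rT(3,1,2)] e2' rT(3,2,4)] .
    then obtain a b where 1: "a \<in> Arr T" "b \<in> Arr T" "Dom T b = Dom T a" "Cod T a = Dom T s" "Cod T b = Dom T s"
      "s \<cdot> a = s \<cdot> b" "s \<cdot> a \<in> S" "f \<cdot> a = g \<cdot> b" unfolding roof_eq_iff by blast
    have aS: "a \<in> S" using S_two_of_three(3)[of a s] 1 sS by simp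
    obtain z where z: "z \<in> S" "Cod T z = Dom T a" "a \<cdot> z = b \<cdot> z"
      using right_cancel[of s a b] 1 sS by metis
    have "f \<cdot> (a \<cdot> z) = g \<cdot> (b \<cdot> z)" using arg_cong[OF 1(8), of "\<lambda>q. q \<cdot> z"] 1(1-5) z(1,2) fg sS by simp
    then have "f \<cdot> (a \<cdot> z) = g \<cdot> (a \<cdot> z)" unfolding z(3) .
    then obtain t where t: "t \<in> S" "Dom T t = Y" "t \<cdot> f = t \<cdot> g"
      using left_cancel[of "a \<cdot> z" f g] aS 1(1-5) z(1,2) fg by auto
    obtain m where m: "m \<in> S" "Dom T m = Cod T t" "Cod T m \<in> V" using L[of "Cod T t"] t by auto
    have "m \<cdot> t \<in> A.S" "(m \<cdot> t) \<cdot> f = (m \<cdot> t) \<cdot> g" using m t fg XY by (simp_all add: S_sub)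
    then obtain c where c: "c \<in> A.S" "Cod T c = Dom T s" "f \<cdot> c = g \<cdot> c"
      using A.right_cancel[of "m \<cdot> t" f g] fg XY m t by auto
    have "s \<cdot> c \<in> A.S" using A.S_comp[OF c(1) sA] c by simp
    then have "roof_eq TV UV (s, f) (s, g)"
      unfolding A.roof_eq_iff using c by (intro exI[of _ c]) (auto simp: S_sub)
    then show ?thesis
      using A.roof_eq_trans[OF A.roof_eq_trans[OF e1 _ p(1) r] A.roof_eq_sym[OF e2] p(1) r(2) p(2)] by blast
  qed
  have ess: "\<exists>X \<in> V. isomorphic Q X Y" if Y: "Y \<in> Obj T" for Y
  proof -
    obtain m where m: "m \<in> S" "Dom T m = Y" "Cod T m \<in> V" using L[OF Y] by blast
    then have "isomorphic Q Y (Cod T m)" using localize_S_iso[OF m(1)] localize_Hom[of m] unfolding isomorphic_def by auto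
    then show ?thesis using m category.isomorphic_sym[OF category_Q] by blast
  qed
  have lift: "\<exists>u' v' w'. (u', v', w') \<in> Tri TV \<and>
       triangle_iso Q (loc u, loc v, loc w) (loc u', loc v', loc w')"
    if T: "(u, v, w) \<in> Tri T" for u v w
  proof -
    note H = tri[OF T]
    obtain n where n: "n \<in> S" "Dom T n = Dom T u" "Cod T n \<in> V" using L[of "Dom T u"] H by auto
    obtain t g where t: "t \<in> S" "g \<in> Arr T" "Dom T t = Cod T u" "Dom T g = Cod T n" "Cod T g = Cod T t" "g \<cdot> n = t \<cdot> u"
      using left_Ore[OF n(1), of u] H n by metis
    obtain m where m: "m \<in> S" "Dom T m = Cod T t" "Cod T m \<in> V" using L[of "Cod T t"] t by auto
    have e: "(m \<cdot> g) \<cdot> n = (m \<cdot> t) \<cdot> u" using t m n H by simp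
    obtain v' w' where V': "(m \<cdot> g, v', w') \<in> Tri TV"
      using A.extend_first[of "m \<cdot> g"] t m n by auto
    then have "(m \<cdot> g, v', w') \<in> Tri T" by simp
    then have "triangle_iso Q (loc u, loc v, loc w) (loc (m \<cdot> g), loc v', loc w')"
      by (rule localize_triangle_iso[OF T, of _ _ _ n "m \<cdot> t"]) (use t m n H e in simp_all)
    then show ?thesis using V' by blast
  qed
  show "A.Q \<simeq>\<^sub>\<Delta> Q" "Q \<simeq>\<^sub>\<Delta> A.Q" by (rule embedding[OF full faithful ess lift]; assumption)+
qed

end

text \<open>An arrow of a distinguished triangle becomes invertible modulo \<open>U\<close> when the opposite term lies in \<open>U\<close>. In the
  first case every object of \<open>W\<close> thus receives such an arrow from \<open>V\<close>, in the second case it has one to \<open>V\<close>.\<close>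

theorem (in triangulated) subquotient_equivalence:
  assumes "triangulated_subcat T W" "triangulated_subcat T V" "triangulated_subcat T U" "V \<subseteq> W" "U \<subseteq> W"
    and "(\<forall>X \<in> W. \<exists>u v w. (u, v, w) \<in> Tri T \<and> Cod T u = X \<and> Dom T u \<in> V \<and> Cod T v \<in> U) \<or>
         (\<forall>X \<in> W. \<exists>u v w. (u, v, w) \<in> Tri T \<and> Cod T u = X \<and> Dom T u \<in> U \<and> Cod T v \<in> V)"
  shows "verdier_quotient (full_tri T V) (V \<inter> U) \<simeq>\<^sub>\<Delta> verdier_quotient (full_tri T W) U"
    and "verdier_quotient (full_tri T W) U \<simeq>\<^sub>\<Delta> verdier_quotient (full_tri T V) (V \<inter> U)"
proof -
  interpret W: localization T W by unfold_locales (rule assms)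
  have sub: "triangulated_subcat (full_tri T W) U" "triangulated_subcat (full_tri T W) V"
    using W.subcat_of_full_tri[OF assms(3)] W.subcat_of_full_tri[OF assms(2)] assms(4,5) by (simp_all add: Int_absorb1)
  interpret S: subquotient "full_tri T W" U V
    by (intro subquotient.intro localization.intro W.triangulated_full_tri localization_axioms.intro
        subquotient_axioms.intro sub)
  have V: "full_tri (full_tri T W) V = full_tri T V" using assms(4) by (rule full_tri_full_tri)
  have "S.A.Q \<simeq>\<^sub>\<Delta> S.Q \<and> S.Q \<simeq>\<^sub>\<Delta> S.A.Q"
    using assms(6)
  proof
    assume R: "\<forall>X \<in> W. \<exists>u v w. (u, v, w) \<in> Tri T \<and> Cod T u = X \<and> Dom T u \<in> V \<and> Cod T v \<in> U"
    have "\<exists>m \<in> S.S. Dom (full_tri T W) m \<in> V \<and> Cod (full_tri T W) m = X" if X: "X \<in> Obj (full_tri T W)" for X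
    proof -
      obtain u v w where T: "(u, v, w) \<in> Tri T" "Cod T u = X" "Dom T u \<in> V" "Cod T v \<in> U"
        using bspec[OF R, of X] X by auto
      then have "(u, v, w) \<in> Tri (full_tri T W)" using X assms(4,5) tri[OF T(1)] by auto
      then have "u \<in> S.S" using S.S_iff[of u v w] T by simp
      then show ?thesis using T by auto
    qed
    then show ?thesis using S.embedding_right by blast
  next
    assume L: "\<forall>X \<in> W. \<exists>u v w. (u, v, w) \<in> Tri T \<and> Cod T u = X \<and> Dom T u \<in> U \<and> Cod T v \<in> V"
    have "\<exists>m \<in> S.S. Dom (full_tri T W) m = X \<and> Cod (full_tri T W) m \<in> V" if X: "X \<in> Obj (full_tri T W)" for X
    proof -
      obtain u v w where T: "(u, v, w) \<in> Tri T" "Cod T u = X" "Dom T u \<in> U" "Cod T v \<in> V"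
        using bspec[OF L, of X] X by auto
      then have "(u, v, w) \<in> Tri (full_tri T W)" using X assms(4,5) tri[OF T(1)] by auto
      then have "v \<in> S.S" using S.S_second_iff[of u v w] T by simp
      then show ?thesis using T tri[OF T(1)] by auto
    qed
    then show ?thesis using S.embedding_left by blast
  qed
  then show "verdier_quotient (full_tri T V) (V \<inter> U) \<simeq>\<^sub>\<Delta> verdier_quotient (full_tri T W) U"
    and "verdier_quotient (full_tri T W) U \<simeq>\<^sub>\<Delta> verdier_quotient (full_tri T V) (V \<inter> U)"
    unfolding V by blast+
qed

section \<open>Mapping cones in a differential graded category\<close>

text \<open>Complexes over an additive category form a differential graded category. Its homogeneous maps
  are taken from one ring, so that identities between composites are identities in a ring;
  \<open>G X Y k\<close> is the set of maps of degree \<open>k\<close>, \<open>d X\<close> the differential, and \<open>\<sigma> X\<close> the identity of \<open>X\<close>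
  viewed as a map of degree \<open>-1\<close> to the shift of \<open>X\<close>, with inverse \<open>\<tau> X\<close>.\<close>

locale dg_category =
  fixes Ob :: "'x set" and G :: "'x \<Rightarrow> 'x \<Rightarrow> int \<Rightarrow> 'r::ring set" and e d :: "'x \<Rightarrow> 'r"
    and s :: "'x \<Rightarrow> 'x" and \<sigma> \<tau> :: "'x \<Rightarrow> 'r"
  assumes G_add: "x \<in> G X Y k \<Longrightarrow> y \<in> G X Y k \<Longrightarrow> x + y \<in> G X Y k"
    and G_neg: "x \<in> G X Y k \<Longrightarrow> - x \<in> G X Y k"
    and G_zero: "X \<in> Ob \<Longrightarrow> Y \<in> Ob \<Longrightarrow> 0 \<in> G X Y k"
    and G_mult: "x \<in> G X Y k \<Longrightarrow> y \<in> G Y Z l \<Longrightarrow> y * x \<in> G X Z (k + l)"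
    and e_G: "X \<in> Ob \<Longrightarrow> e X \<in> G X X 0"
    and e_left: "x \<in> G X Y k \<Longrightarrow> e Y * x = x" and e_right: "x \<in> G X Y k \<Longrightarrow> x * e X = x"
    and d_G: "X \<in> Ob \<Longrightarrow> d X \<in> G X X 1" and d_d: "X \<in> Ob \<Longrightarrow> d X * d X = 0"
    and s_Ob: "X \<in> Ob \<Longrightarrow> s X \<in> Ob"
    and \<sigma>_G: "X \<in> Ob \<Longrightarrow> \<sigma> X \<in> G X (s X) (-1)" and \<tau>_G: "X \<in> Ob \<Longrightarrow> \<tau> X \<in> G (s X) X 1"
    and \<tau>_\<sigma>: "X \<in> Ob \<Longrightarrow> \<tau> X * \<sigma> X = e X" and \<sigma>_\<tau>: "X \<in> Ob \<Longrightarrow> \<sigma> X * \<tau> X = e (s X)"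
    and d_s: "X \<in> Ob \<Longrightarrow> d (s X) = - (\<sigma> X * (d X * \<tau> X))"
begin

lemma G_diff: "x \<in> G X Y k \<Longrightarrow> y \<in> G X Y k \<Longrightarrow> x - y \<in> G X Y k"
  using G_add[of x X Y k "- y"] G_neg[of y X Y k] by simp

lemma G_multI: "y \<in> G Y Z l \<Longrightarrow> x \<in> G X Y k \<Longrightarrow> k + l = m \<Longrightarrow> y * x \<in> G X Z m"
  using G_mult by blast

lemma unit:
  assumes "x \<in> G X Y k"
  shows "e Y * x = x" "x * e X = x" "e Y * (x * z) = x * z" "x * (e X * z) = x * z"
  using e_left[OF assms] e_right[OF assms] by (simp_all flip: mult.assoc)

lemma sd:
  assumes "X \<in> Ob"
  shows "\<tau> X * \<sigma> X = e X" "\<tau> X * (\<sigma> X * z) = e X * z" "\<sigma> X * \<tau> X = e (s X)" "\<sigma> X * (\<tau> X * z) = e (s X) * z"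
    "d (s X) * \<sigma> X = - (\<sigma> X * d X)" "d (s X) * (\<sigma> X * z) = - (\<sigma> X * (d X * z))"
    "\<tau> X * d (s X) = - (d X * \<tau> X)" "\<tau> X * (d (s X) * z) = - (d X * (\<tau> X * z))"
    "d X * d X = 0" "d X * (d X * z) = 0"
proof -
  note U = unit[OF \<sigma>_G[OF assms]] unit[OF \<tau>_G[OF assms]] unit[OF d_G[OF assms]]
  show 1: "\<tau> X * \<sigma> X = e X" "\<sigma> X * \<tau> X = e (s X)" "d X * d X = 0" using assms by (simp_all add: \<tau>_\<sigma> \<sigma>_\<tau> d_d)
  then show 2: "\<tau> X * (\<sigma> X * z) = e X * z" "\<sigma> X * (\<tau> X * z) = e (s X) * z" "d X * (d X * z) = 0" for z
    by (simp_all flip: mult.assoc)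
  show 3: "d (s X) * \<sigma> X = - (\<sigma> X * d X)" "\<tau> X * d (s X) = - (d X * \<tau> X)"
    unfolding d_s[OF assms] by (simp_all add: mult.assoc 1 2 U)
  show "d (s X) * (\<sigma> X * z) = - (\<sigma> X * (d X * z))"
    using 3(1) by (metis (no_types) mult.assoc mult_minus_left)
  show "\<tau> X * (d (s X) * z) = - (d X * (\<tau> X * z))"
    using 3(2) by (metis (no_types) mult.assoc mult_minus_left)
qed

definition chn :: "'x \<Rightarrow> 'x \<Rightarrow> 'r \<Rightarrow> bool" where
  "chn X Y x \<longleftrightarrow> X \<in> Ob \<and> Y \<in> Ob \<and> x \<in> G X Y 0 \<and> d Y * x = x * d X"

definition null :: "'x \<Rightarrow> 'x \<Rightarrow> 'r \<Rightarrow> bool" where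
  "null X Y x \<longleftrightarrow> (\<exists>h \<in> G X Y (-1). x = d Y * h + h * d X)"

definition cone :: "'x \<Rightarrow> 'x \<Rightarrow> 'r \<Rightarrow> 'x \<Rightarrow> 'r \<Rightarrow> 'r \<Rightarrow> 'r \<Rightarrow> 'r \<Rightarrow> bool" where
  "cone X Y f Z i j p q \<longleftrightarrow> chn X Y f \<and> Z \<in> Ob \<and>
     i \<in> G X Z (-1) \<and> j \<in> G Y Z 0 \<and> p \<in> G Z X 1 \<and> q \<in> G Z Y 0 \<and>
     p * i = e X \<and> q * j = e Y \<and> p * j = 0 \<and> q * i = 0 \<and> i * p + j * q = e Z \<and>
     d Z = j * (f * p) + j * (d Y * q) - i * (d X * p)"

lemma chnD:
  assumes "chn X Y x"
  shows "X \<in> Ob" "Y \<in> Ob" "x \<in> G X Y 0" "d Y * x = x * d X" "d Y * (x * z) = x * (d X * z)"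
  using assms unfolding chn_def by (simp_all flip: mult.assoc)

lemma coneD:
  assumes "cone X Y f Z i j p q"
  shows "chn X Y f" "X \<in> Ob" "Y \<in> Ob" "Z \<in> Ob" "f \<in> G X Y 0" "i \<in> G X Z (-1)" "j \<in> G Y Z 0" "p \<in> G Z X 1" "q \<in> G Z Y 0"
    "e Z = i * p + j * q"
  using assms unfolding cone_def chn_def by auto

lemma cone_rules:
  assumes "cone X Y f Z i j p q"
  shows "p * i = e X" "p * (i * z) = e X * z" "q * j = e Y" "q * (j * z) = e Y * z"
    "p * j = 0" "p * (j * z) = 0" "q * i = 0" "q * (i * z) = 0"
    "d Z * i = j * f - i * d X" "d Z * (i * z) = j * (f * z) - i * (d X * z)"
    "d Z * j = j * d Y" "d Z * (j * z) = j * (d Y * z)"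
    "p * d Z = - (d X * p)" "p * (d Z * z) = - (d X * (p * z))"
    "q * d Z = f * p + d Y * q" "q * (d Z * z) = f * (p * z) + d Y * (q * z)"
proof -
  note C = coneD[OF assms]
  note U = unit[OF C(5)] unit[OF C(6)] unit[OF C(7)] unit[OF C(8)] unit[OF C(9)] unit[OF d_G[OF C(2)]] unit[OF d_G[OF C(3)]]
  show 1: "p * i = e X" "q * j = e Y" "p * j = 0" "q * i = 0" using assms by (auto simp: cone_def)
  show 2: "p * (i * z) = e X * z" "q * (j * z) = e Y * z" "p * (j * z) = 0" "q * (i * z) = 0" for z
    using 1 by (simp_all flip: mult.assoc)
  have D: "d Z = j * (f * p) + j * (d Y * q) - i * (d X * p)" using assms by (auto simp: cone_def)
  show 3: "d Z * i = j * f - i * d X" "d Z * j = j * d Y" "p * d Z = - (d X * p)" "q * d Z = f * p + d Y * q"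
    unfolding D by (simp_all add: algebra_simps 1 2 U)
  have "d Z * (i * z) = (d Z * i) * z" "d Z * (j * z) = (d Z * j) * z" "p * (d Z * z) = (p * d Z) * z" "q * (d Z * z) = (q * d Z) * z"
    by (simp_all add: mult.assoc)
  then show "d Z * (i * z) = j * (f * z) - i * (d X * z)" "d Z * (j * z) = j * (d Y * z)"
    "p * (d Z * z) = - (d X * (p * z))" "q * (d Z * z) = f * (p * z) + d Y * (q * z)"
    unfolding 3 by (simp_all add: algebra_simps)
qed

lemma coneU:
  assumes "cone X Y f Z i j p q"
  shows "e Y * f = f" "f * e X = f" "e Y * (f * z) = f * z" "f * (e X * z) = f * z"
    "e Z * i = i" "i * e X = i" "e Z * (i * z) = i * z" "i * (e X * z) = i * z"
    "e Z * j = j" "j * e Y = j" "e Z * (j * z) = j * z" "j * (e Y * z) = j * z"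
    "e X * p = p" "p * e Z = p" "e X * (p * z) = p * z" "p * (e Z * z) = p * z"
    "e Y * q = q" "q * e Z = q" "e Y * (q * z) = q * z" "q * (e Z * z) = q * z"
    "d Y * f = f * d X" "d Y * (f * z) = f * (d X * z)"
  using unit[OF coneD(5)[OF assms]] unit[OF coneD(6)[OF assms]] unit[OF coneD(7)[OF assms]]
    unit[OF coneD(8)[OF assms]] unit[OF coneD(9)[OF assms]] chnD[OF coneD(1)[OF assms]] by simp_all

lemma obU:
  assumes "X \<in> Ob"
  shows "e X * d X = d X" "d X * e X = d X" "e X * (d X * z) = d X * z" "d X * (e X * z) = d X * z"
    "e (s X) * \<sigma> X = \<sigma> X" "\<sigma> X * e X = \<sigma> X" "e (s X) * (\<sigma> X * z) = \<sigma> X * z" "\<sigma> X * (e X * z) = \<sigma> X * z"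
    "e X * \<tau> X = \<tau> X" "\<tau> X * e (s X) = \<tau> X" "e X * (\<tau> X * z) = \<tau> X * z" "\<tau> X * (e (s X) * z) = \<tau> X * z"
    "e X * e X = e X" "e X * (e X * z) = e X * z"
  using unit[OF \<sigma>_G[OF assms]] unit[OF \<tau>_G[OF assms]] unit[OF d_G[OF assms]] unit[OF e_G[OF assms]] by simp_all

lemma chn_add: "chn X Y x \<Longrightarrow> chn X Y y \<Longrightarrow> chn X Y (x + y)"
  and chn_diff: "chn X Y x \<Longrightarrow> chn X Y y \<Longrightarrow> chn X Y (x - y)"
  and chn_neg: "chn X Y x \<Longrightarrow> chn X Y (- x)"
  unfolding chn_def by (auto simp: algebra_simps intro: G_add G_diff G_neg)

lemma chn_mult: "chn X Y x \<Longrightarrow> chn Y Z y \<Longrightarrow> chn X Z (y * x)"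
  unfolding chn_def using G_mult[of x X Y 0 y Z 0] by (metis add.right_neutral mult.assoc)

lemma chn_e: "X \<in> Ob \<Longrightarrow> chn X X (e X)"
  unfolding chn_def by (simp add: e_G obU)

lemma chn_zero: "X \<in> Ob \<Longrightarrow> Y \<in> Ob \<Longrightarrow> chn X Y 0"
  unfolding chn_def by (simp add: G_zero)

lemma null_add: "null X Y x \<Longrightarrow> null X Y y \<Longrightarrow> null X Y (x + y)"
proof -
  assume "null X Y x" "null X Y y"
  then obtain h k where h: "h \<in> G X Y (-1)" "x = d Y * h + h * d X" "k \<in> G X Y (-1)" "y = d Y * k + k * d X"
    unfolding null_def by blast
  then show ?thesis unfolding null_def by (intro bexI[of _ "h + k"]) (auto simp: algebra_simps intro: G_add)
qed

lemma null_neg: "null X Y x \<Longrightarrow> null X Y (- x)"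
proof -
  assume "null X Y x"
  then obtain h where h: "h \<in> G X Y (-1)" "x = d Y * h + h * d X" unfolding null_def by blast
  then show ?thesis unfolding null_def by (intro bexI[of _ "- h"]) (auto simp: algebra_simps intro: G_neg)
qed

lemma null_diff: "null X Y x \<Longrightarrow> null X Y y \<Longrightarrow> null X Y (x - y)"
  using null_add[of X Y x "- y"] null_neg[of X Y y] by simp

lemma null_zero: "X \<in> Ob \<Longrightarrow> Y \<in> Ob \<Longrightarrow> null X Y 0"
  unfolding null_def by (intro bexI[of _ 0]) (auto intro: G_zero)

lemma null_mult_left:
  assumes "null X Y x" "chn Y Z y"
  shows "null X Z (y * x)"
proof -
  obtain h where h: "h \<in> G X Y (-1)" "x = d Y * h + h * d X" using assms unfolding null_def by blast
  show ?thesis unfolding null_def h(2)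
    by (intro bexI[of _ "y * h"] G_multI[OF chnD(3)[OF assms(2)] h(1)])
      (simp_all add: algebra_simps chnD(5)[OF assms(2)])
qed

lemma null_mult_right:
  assumes "null Y Z y" "chn X Y x"
  shows "null X Z (y * x)"
proof -
  obtain h where h: "h \<in> G Y Z (-1)" "y = d Z * h + h * d Y" using assms unfolding null_def by blast
  show ?thesis unfolding null_def h(2)
    by (intro bexI[of _ "h * x"] G_multI[OF h(1) chnD(3)[OF assms(2)]])
      (simp_all add: algebra_simps chnD(4)[OF assms(2)])
qed

lemma chn_shift: "chn X Y x \<Longrightarrow> chn (s X) (s Y) (\<sigma> Y * (x * \<tau> X))"
  unfolding chn_def
  by (auto simp: s_Ob sd algebra_simps intro!: G_multI[OF \<sigma>_G] G_multI[OF _ \<tau>_G])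
    (simp flip: mult.assoc)

lemma null_shift:
  assumes "null X Y x" "X \<in> Ob" "Y \<in> Ob"
  shows "null (s X) (s Y) (\<sigma> Y * (x * \<tau> X))"
proof -
  obtain h where h: "h \<in> G X Y (-1)" "x = d Y * h + h * d X" using assms unfolding null_def by blast
  have "- (\<sigma> Y * (h * \<tau> X)) \<in> G (s X) (s Y) (-1)"
    by (rule G_neg, rule G_multI[OF \<sigma>_G G_multI[OF h(1) \<tau>_G]]) (use assms in auto)
  then show ?thesis unfolding null_def h(2)
    by (intro bexI[of _ "- (\<sigma> Y * (h * \<tau> X))"]) (use assms in \<open>simp_all add: algebra_simps sd\<close>)
qed

text \<open>The long exact Hom sequences of a cone; all homotopies below are read off from the matrix forms
  of the maps.\<close>

lemma chn_j: "cone X Y f Z i j p q \<Longrightarrow> chn Y Z j"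
  unfolding chn_def by (simp add: coneD cone_rules)

lemma chn_p: "cone X Y f Z i j p q \<Longrightarrow> chn Z (s X) (\<sigma> X * p)"
  unfolding chn_def using coneD[of X Y f Z i j p q]
  by (auto simp: cone_rules mult.assoc sd s_Ob intro!: G_multI[OF \<sigma>_G])

lemma cone_factor_through_f:
  assumes C: "cone X Y f Z i j p q" and x: "chn W Y x" and n: "null W Z (j * x)"
  obtains a where "chn W X a" "null W Y (x - f * a)"
proof -
  note R = cone_rules[OF C] coneU[OF C] obU[OF coneD(2)[OF C]] obU[OF coneD(3)[OF C]] chnD(4,5)[OF x] unit[OF chnD(3)[OF x]]
  obtain k where k: "k \<in> G W Z (-1)" "j * x = d Z * k + k * d W" using n unfolding null_def by blast
  have "q * (j * x) = q * (d Z * k + k * d W)" "p * (j * x) = p * (d Z * k + k * d W)" unfolding k(2) by simp_all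
  then have 1: "x = f * (p * k) + d Y * (q * k) + q * (k * d W)" "d X * (p * k) = p * (k * d W)"
    by (simp_all add: R algebra_simps)
  have "chn W X (p * k)"
    unfolding chn_def using 1(2) coneD[OF C] chnD(1)[OF x] by (auto simp: mult.assoc intro: G_multI[OF _ k(1)])
  moreover have "null W Y (x - f * (p * k))"
    unfolding null_def
    by (intro bexI[of _ "q * k"] G_multI[OF coneD(9)[OF C] k(1)]) (subst 1(1), simp_all add: algebra_simps)
  ultimately show ?thesis by (rule that)
qed

lemma cone_factor_through_j:
  assumes C: "cone X Y f Z i j p q" and y: "chn Y V y" and n: "null X V (y * f)"
  obtains b where "chn Z V b" "b * j = y"
proof -
  note R = cone_rules[OF C] coneU[OF C] obU[OF coneD(2)[OF C]] obU[OF coneD(3)[OF C]] chnD(4,5)[OF y] unit[OF chnD(3)[OF y]]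
  obtain k where k: "k \<in> G X V (-1)" "y * f = d V * k + k * d X" using n unfolding null_def by blast
  have "y * (f * p) = (y * f) * p" by (simp add: mult.assoc)
  then have 1: "y * (f * p) = d V * (k * p) + k * (d X * p)" unfolding k(2) by (simp add: algebra_simps)
  have "y * q + k * p \<in> G Z V 0"
    by (rule G_add) (rule G_multI[OF chnD(3)[OF y] coneD(9)[OF C]] G_multI[OF k(1) coneD(8)[OF C]], simp)+
  then have "chn Z V (y * q + k * p)"
    unfolding chn_def using chnD[OF y] coneD[OF C] by (simp add: algebra_simps R 1)
  moreover have "(y * q + k * p) * j = y" by (simp add: algebra_simps R)
  ultimately show ?thesis by (rule that)
qed

lemma cone_factor_shift_through_f:
  assumes C: "cone X Y f Z i j p q" and y: "chn X V y" and n: "null Z (s V) (\<sigma> V * (y * p))"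
  obtains b where "chn Y V b" "null X V (y - b * f)"
proof -
  have V: "V \<in> Ob" using chnD[OF y] by simp
  note R = cone_rules[OF C] coneU[OF C] obU[OF coneD(2)[OF C]] obU[OF coneD(3)[OF C]] chnD(4,5)[OF y] unit[OF chnD(3)[OF y]]
    sd[OF V] obU[OF V]
  obtain k where k: "k \<in> G Z (s V) (-1)" "\<sigma> V * (y * p) = d (s V) * k + k * d Z" using n unfolding null_def by blast
  define m where "m = \<tau> V * k"
  have m: "m \<in> G Z V 0" unfolding m_def by (rule G_multI[OF \<tau>_G[OF V] k(1)]) simp
  have "\<tau> V * (\<sigma> V * (y * p)) = \<tau> V * (d (s V) * k + k * d Z)" unfolding k(2) ..
  then have 1: "y * p = m * d Z - d V * m" by (simp add: algebra_simps R m_def)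
  have "(y * p) * i = (m * d Z - d V * m) * i" "(y * p) * j = (m * d Z - d V * m) * j" unfolding 1 by simp_all
  then have 2: "y = m * (j * f) - m * (i * d X) - d V * (m * i)" "d V * (m * j) = m * (j * d Y)"
    by (simp_all add: algebra_simps R)
  have "chn Y V (m * j)"
    unfolding chn_def using coneD[OF C] V 2(2) by (auto simp: mult.assoc intro: G_multI[OF m])
  moreover have "null X V (y - (m * j) * f)"
    unfolding null_def
    by (intro bexI[of _ "- (m * i)"] G_neg G_multI[OF m coneD(6)[OF C]]) (subst 2(1), simp_all add: algebra_simps)
  ultimately show ?thesis by (rule that)
qed

lemma null_jf: "cone X Y f Z i j p q \<Longrightarrow> null X Z (j * f)"
  unfolding null_def by (rule bexI[of _ i]) (simp_all add: cone_rules coneD)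

lemma null_fp:
  assumes C: "cone X Y f Z i j p q"
  shows "null Z (s Y) (\<sigma> Y * (f * p))"
  unfolding null_def
  by (intro bexI[of _ "\<sigma> Y * q"] G_multI[OF \<sigma>_G[OF coneD(3)[OF C]] coneD(9)[OF C]])
    (simp_all add: mult.assoc cone_rules[OF C] sd[OF coneD(3)[OF C]] algebra_simps)

lemma cone_fill:
  assumes C: "cone X Y f Z i j p q" and C': "cone X' Y' f' Z' i' j' p' q'"
    and a: "chn X X' a" and b: "chn Y Y' b" and n: "null X Y' (f' * a - b * f)"
  obtains c where "chn Z Z' c" "c * j = j' * b" "p' * c = a * p"
proof -
  note R = cone_rules[OF C] coneU[OF C] cone_rules[OF C'] coneU[OF C'] obU[OF coneD(2)[OF C]] obU[OF coneD(3)[OF C]]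
    obU[OF coneD(2)[OF C']] obU[OF coneD(3)[OF C']] chnD(4,5)[OF a] unit[OF chnD(3)[OF a]] chnD(4,5)[OF b] unit[OF chnD(3)[OF b]]
  obtain k where k: "k \<in> G X Y' (-1)" "f' * a - b * f = d Y' * k + k * d X" using n unfolding null_def by blast
  note R = R unit[OF k(1)]
  have 1: "f' * a = b * f + d Y' * k + k * d X" using k(2) by (simp add: algebra_simps)
  have 2: "f' * (a * z) = b * (f * z) + d Y' * (k * z) + k * (d X * z)" for z
    using arg_cong[OF 1, of "\<lambda>y. y * z"] by (simp add: algebra_simps)
  define c where "c = i' * (a * p) + j' * (b * q) - j' * (k * p)"
  have "i' * (a * p) \<in> G Z Z' 0" "j' * (b * q) \<in> G Z Z' 0" "j' * (k * p) \<in> G Z Z' 0"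
    by (rule G_multI[OF coneD(6)[OF C'] G_multI[OF chnD(3)[OF a] coneD(8)[OF C] refl]]
        G_multI[OF coneD(7)[OF C'] G_multI[OF chnD(3)[OF b] coneD(9)[OF C] refl]]
        G_multI[OF coneD(7)[OF C'] G_multI[OF k(1) coneD(8)[OF C] refl]], simp)+
  then have "c \<in> G Z Z' 0" unfolding c_def by (intro G_diff G_add)
  moreover have "d Z' * c = c * d Z" unfolding c_def by (simp add: algebra_simps R 1 2)
  ultimately have "chn Z Z' c" using coneD[OF C] coneD[OF C'] by (simp add: chn_def)
  moreover have "c * j = j' * b" "p' * c = a * p" unfolding c_def by (simp_all add: algebra_simps R)
  ultimately show ?thesis by (rule that)
qed

text \<open>An endomorphism \<open>g\<close> of a cone that is homotopic to the identity on both ends is invertible: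
  the square of \<open>g - 1\<close> is homotopic to zero.\<close>

lemma cone_endo:
  assumes C: "cone X Y f Z i j p q" and g: "chn Z Z g" and n1: "null Y Z (g * j - j)" and n2: "null Z (s X) (\<sigma> X * (p * g) - \<sigma> X * p)"
  obtains g' where "chn Z Z g'" "null Z Z (g' * g - e Z)" "null Z Z (g * g' - e Z)"
proof -
  note O = coneD(2,3,4)[OF C]
  note R = cone_rules[OF C] coneU[OF C] obU[OF O(1)] obU[OF O(2)] obU[OF O(3)] sd[OF O(1)] sd[OF O(2)] sd[OF O(3)]
    unit[OF chnD(3)[OF g]] chnD(4,5)[OF g]
  obtain k where k: "k \<in> G Y Z (-1)" "g * j - j = d Z * k + k * d Y" using n1 unfolding null_def by blast
  note R = R unit[OF k(1)]
  obtain l where l: "l \<in> G Z (s X) (-1)" "\<sigma> X * (p * g) - \<sigma> X * p = d (s X) * l + l * d Z" using n2 unfolding null_def by blast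
  define m where "m = \<tau> X * l"
  have m: "m \<in> G Z X 0" unfolding m_def by (rule G_multI[OF \<tau>_G[OF O(1)] l(1)]) simp
  have "\<tau> X * (\<sigma> X * (p * g) - \<sigma> X * p) = \<tau> X * (d (s X) * l + l * d Z)" unfolding l(2) ..
  then have pg: "p * g - p = m * d Z - d X * m" by (simp add: algebra_simps R m_def)
  have kq: "k * q \<in> G Z Z (-1)" by (rule G_multI[OF k(1) coneD(9)[OF C]]) simp
  define y where "y = g - e Z - (d Z * (k * q) + k * (q * d Z))"
  have yj: "y * j = 0" unfolding y_def using k(2) by (simp add: algebra_simps R)
  have ygz: "d Z * y = y * d Z" unfolding y_def by (simp add: algebra_simps R)
  have yG: "y \<in> G Z Z 0" unfolding y_def
    by (intro G_diff G_add chnD(3)[OF g] e_G O) (rule G_multI[OF d_G[OF O(3)] kq] G_multI[OF k(1) G_multI[OF coneD(9)[OF C] d_G[OF O(3)] refl]], simp)+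
  have yip: "y = y * (i * p)"
  proof -
    have "y = y * e Z" using unit(2)[OF yG] by simp
    also have "\<dots> = y * (i * p) + (y * j) * q" unfolding coneD(10)[OF C] by (simp add: algebra_simps)
    finally show ?thesis using yj by simp
  qed
  have yi: "y * (i * d X) = - (d Z * (y * i))"
  proof -
    have "d Z * (y * i) = (d Z * y) * i" by (simp add: mult.assoc)
    also have "\<dots> = y * (d Z * i)" unfolding ygz by (simp add: mult.assoc)
    also have "\<dots> = (y * j) * f - y * (i * d X)" by (simp add: R algebra_simps)
    finally show ?thesis using yj by simp
  qed
  have n0: "null Z Z (y * (g - e Z))"
  proof -
    have ty: "y * (i * m) \<in> G Z Z (-1)" by (rule G_multI[OF yG G_multI[OF coneD(6)[OF C] m refl]]) simp
    have "y * (g - e Z) = y * (i * (p * g - p))"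
      using yip unit(2)[OF yG] by (metis (no_types) mult.assoc right_diff_distrib R(36))
    also have "\<dots> = y * (i * (m * d Z)) - (y * (i * d X)) * m" unfolding pg by (simp add: algebra_simps)
    also have "\<dots> = d Z * (y * (i * m)) + (y * (i * m)) * d Z" unfolding yi by (simp add: algebra_simps)
    finally show ?thesis unfolding null_def using ty by blast
  qed
  have chn1: "chn Z Z (g - e Z)" by (intro chn_diff g chn_e O)
  have n3: "null Z Z ((d Z * (k * q) + (k * q) * d Z) * (g - e Z))"
    by (rule null_mult_right[OF _ chn1]) (use kq in \<open>auto simp: null_def\<close>)
  have "null Z Z (y * (g - e Z) + (d Z * (k * q) + (k * q) * d Z) * (g - e Z))" by (rule null_add[OF n0 n3])
  moreover have "y * (g - e Z) + (d Z * (k * q) + (k * q) * d Z) * (g - e Z) = (g - e Z) * (g - e Z)"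
    unfolding y_def by (simp add: algebra_simps)
  ultimately have n4: "null Z Z ((g - e Z) * (g - e Z))" by simp
  have e1: "(e Z + e Z - g) * g - e Z = - ((g - e Z) * (g - e Z))" "g * (e Z + e Z - g) - e Z = - ((g - e Z) * (g - e Z))"
    by (simp_all add: algebra_simps R)
  show ?thesis
    by (rule that[of "e Z + e Z - g"]) (unfold e1, auto intro: chn_diff chn_add chn_e g O null_neg n4)
qed

lemma cone_identity:
  assumes "cone X X (e X) Z i j p q"
  shows "null Z Z (e Z)"
  unfolding null_def
  by (intro bexI[of _ "i * q"] G_multI[OF coneD(6)[OF assms] coneD(9)[OF assms]])
    (simp_all add: mult.assoc cone_rules[OF assms] coneU[OF assms] coneD(10)[OF assms] algebra_simps)

text \<open>In the following lemmas an explicit homotopy equivalence identifies the second cone with the expected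
  third object.\<close>

lemma cone_rotate:
  assumes C: "cone X Y f Z i j p q" and C': "cone Y Z j W i' j' p' q'"
  obtains \<theta> \<psi> where "chn W (s X) \<theta>" "chn (s X) W \<psi>" "\<theta> * \<psi> = e (s X)" "null W W (e W - \<psi> * \<theta>)"
    "\<theta> * j' = \<sigma> X * p" "(\<sigma> Y * p') * \<psi> = - (\<sigma> Y * (f * \<tau> X))"
proof -
  note O = coneD(2,3,4)[OF C] coneD(4)[OF C']
  note R = cone_rules[OF C] coneU[OF C] cone_rules[OF C'] coneU[OF C'] obU[OF O(1)] obU[OF O(2)] obU[OF O(3)] obU[OF O(4)] sd[OF O(1)] sd[OF O(3)]
  note t = coneD(5-9)[OF C] coneD(5-9)[OF C'] \<sigma>_G[OF O(1)] \<tau>_G[OF O(1)]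
  let ?th = "\<sigma> X * (p * q')" and ?ps = "(j' * i - i' * f) * \<tau> X"
  have "?th \<in> G W (s X) 0" by (rule G_multI[OF t(11) G_multI[OF t(4) t(10) refl]]) simp
  then have 1: "chn W (s X) ?th" unfolding chn_def using O s_Ob by (simp add: mult.assoc R algebra_simps)
  have "j' * i \<in> G X W (-1)" "i' * f \<in> G X W (-1)" by (rule G_multI[OF t(8) t(2)] G_multI[OF t(7) t(1)], simp)+
  then have "?ps \<in> G (s X) W 0" by (intro G_multI[OF G_diff t(12)]) auto
  then have 2: "chn (s X) W ?ps" unfolding chn_def using O s_Ob by (simp add: R algebra_simps)
  have 3: "?th * ?ps = e (s X)" "?th * j' = \<sigma> X * p" "(\<sigma> Y * p') * ?ps = - (\<sigma> Y * (f * \<tau> X))" by (simp_all add: R algebra_simps)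
  have q': "q' = i * (p * q') + j * (q * q')"
    using R(32) unit(1)[OF t(10)] by (metis (no_types) mult.assoc distrib_right coneD(10)[OF C])
  have h: "i' * (q * q') \<in> G W W (-1)" by (rule G_multI[OF t(7) G_multI[OF t(5) t(10) refl]]) simp
  have "e W = i' * p' + j' * (i * (p * q') + j * (q * q'))"
    unfolding q'[symmetric] by (rule coneD(10)[OF C'])
  then have 4: "null W W (e W - ?ps * ?th)"
    unfolding null_def by (intro bexI[OF _ h]) (simp add: R algebra_simps)
  show ?thesis by (rule that[OF 1 2 3(1) 4 3(2,3)])
qed

lemma cone_unrotate:
  assumes C: "cone Y Z f (s X) i j p q" and X: "X \<in> Ob" and C': "cone X Y (p * \<sigma> X) W i' j' p' q'"
  obtains \<theta> \<psi> where "chn W Z \<theta>" "chn Z W \<psi>" "\<theta> * \<psi> = e Z" "null W W (e W - \<psi> * \<theta>)" "\<theta> * j' = f"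
proof -
  note O = coneD(2,3,4)[OF C] coneD(4)[OF C'] X
  note R = cone_rules[OF C] coneU[OF C] cone_rules[OF C'] coneU[OF C'] obU[OF O(1)] obU[OF O(2)] obU[OF O(3)] obU[OF O(4)] obU[OF X] sd[OF X]
  note t = coneD(5-9)[OF C] coneD(5-9)[OF C'] \<sigma>_G[OF X] \<tau>_G[OF X]
  have N: "q * (\<sigma> X * (d X * z)) = - (q * (d (s X) * (\<sigma> X * z)))" "p * (\<sigma> X * (d X * z)) = - (p * (d (s X) * (\<sigma> X * z)))" for z
    by (simp_all add: sd[OF X])
  note N = N[unfolded cone_rules[OF C]]
  have N': "d X * (\<tau> X * j) = - (\<tau> X * (d (s X) * j))" "d X * (\<tau> X * (j * z)) = - (\<tau> X * (d (s X) * (j * z)))"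
    "d X * (\<tau> X * (i * z)) = - (\<tau> X * (d (s X) * (i * z)))" for z
    by (simp_all add: sd[OF X])
  note N' = N'[unfolded cone_rules[OF C]]
  let ?th = "f * q' - q * (\<sigma> X * p')" and ?ps = "- (i' * (\<tau> X * j))"
  have "f * q' \<in> G W Z 0" "q * (\<sigma> X * p') \<in> G W Z 0"
    by (rule G_multI[OF t(1) t(10)] G_multI[OF t(5) G_multI[OF t(11) t(9) refl]], simp)+
  then have 1: "chn W Z ?th" unfolding chn_def using O
    by (auto intro: G_diff simp: algebra_simps R N)
  have "i' * (\<tau> X * j) \<in> G Z W 0" by (rule G_multI[OF t(7) G_multI[OF t(12) t(3) refl]]) simp
  then have "?ps \<in> G Z W 0" by (rule G_neg)
  then have 2: "chn Z W ?ps" unfolding chn_def using O by (simp add: algebra_simps R N')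
  have 3: "?th * ?ps = e Z" "?th * j' = f" by (simp_all add: R algebra_simps)
  have p': "\<sigma> X * p' = i * (p * (\<sigma> X * p')) + j * (q * (\<sigma> X * p'))"
    using unit(1)[OF G_multI[OF t(11) t(9) refl]] unfolding coneD(10)[OF C] by (simp add: algebra_simps)
  have "p' = \<tau> X * (\<sigma> X * p')" by (simp add: R)
  also have "\<dots> = \<tau> X * (i * (p * (\<sigma> X * p'))) + \<tau> X * (j * (q * (\<sigma> X * p')))" by (subst p') (simp add: algebra_simps)
  finally have p': "i' * p' = i' * (\<tau> X * (i * (p * (\<sigma> X * p')))) + i' * (\<tau> X * (j * (q * (\<sigma> X * p'))))"
    by (metis (no_types) distrib_left)
  have h: "i' * (\<tau> X * (i * q')) \<in> G W W (-1)"
    by (rule G_multI[OF t(7) G_multI[OF t(12) G_multI[OF t(2) t(10) refl] refl]]) simp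
  have "e W = i' * (\<tau> X * (i * (p * (\<sigma> X * p')))) + i' * (\<tau> X * (j * (q * (\<sigma> X * p')))) + j' * q'"
    unfolding p'[symmetric] by (rule coneD(10)[OF C'])
  then have 4: "null W W (e W - ?ps * ?th)"
    unfolding null_def by (intro bexI[OF _ h]) (simp add: R N' algebra_simps)
  show ?thesis by (rule that[OF 1 2 3(1) 4 3(2)])
qed

lemma cone_shift:
  assumes C: "cone X Y f Z i j p q"
  shows "cone (s X) (s Y) (\<sigma> Y * (f * \<tau> X)) (s Z) (- (\<sigma> Z * (i * \<tau> X))) (\<sigma> Z * (j * \<tau> Y)) (- (\<sigma> X * (p * \<tau> Z))) (\<sigma> Y * (q * \<tau> Z))"
proof -
  note O = coneD(2,3,4)[OF C]
  note R = cone_rules[OF C] coneU[OF C] obU[OF O(1)] obU[OF O(2)] obU[OF O(3)] sd[OF O(1)] sd[OF O(2)] sd[OF O(3)]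
  note t = coneD(5-9)[OF C]
  have eZ: "\<sigma> Z * (i * (p * \<tau> Z)) + \<sigma> Z * (j * (q * \<tau> Z)) = e (s Z)"
  proof -
    have "\<sigma> Z * (i * (p * \<tau> Z)) + \<sigma> Z * (j * (q * \<tau> Z)) = \<sigma> Z * ((i * p + j * q) * \<tau> Z)" by (simp add: algebra_simps)
    also have "\<dots> = e (s Z)" unfolding coneD(10)[OF C, symmetric] by (simp add: R)
    finally show ?thesis .
  qed
  have dZ: "d Z = j * (f * p) + j * (d Y * q) - i * (d X * p)" using C by (simp add: cone_def)
  have t': "\<sigma> Z * (i * \<tau> X) \<in> G (s X) (s Z) (-1)" "\<sigma> Z * (j * \<tau> Y) \<in> G (s Y) (s Z) 0"
    "\<sigma> X * (p * \<tau> Z) \<in> G (s Z) (s X) 1" "\<sigma> Y * (q * \<tau> Z) \<in> G (s Z) (s Y) 0"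
    by (rule G_multI[OF \<sigma>_G[OF O(3)] G_multI[OF t(2) \<tau>_G[OF O(1)] refl]] G_multI[OF \<sigma>_G[OF O(3)] G_multI[OF t(3) \<tau>_G[OF O(2)] refl]]
        G_multI[OF \<sigma>_G[OF O(1)] G_multI[OF t(4) \<tau>_G[OF O(3)] refl]] G_multI[OF \<sigma>_G[OF O(2)] G_multI[OF t(5) \<tau>_G[OF O(3)] refl]], simp)+
  show ?thesis
    unfolding cone_def
    using t' chn_shift[OF coneD(1)[OF C]] s_Ob[OF O(3)]
    by (simp add: G_neg mult.assoc R eZ d_s[OF O(1)] d_s[OF O(2)] d_s[OF O(3)]) (simp add: dZ algebra_simps)
qed

lemma cone_octahedron:
  assumes C: "cone X Y f Z1 i1 j1 p1 q1" and C2: "cone Y Z g Z2 i2 j2 p2 q2" and C3: "cone X Z (g * f) Z3 i3 j3 p3 q3"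
    and F: "F = i3 * p1 + j3 * (g * q1)" and H: "H = i2 * (f * p3) + j2 * q3"
  shows "chn Z1 Z3 F" "chn Z3 Z2 H" "F * j1 = j3 * g" "(\<sigma> X * p3) * F = \<sigma> X * p1" "H * j3 = j2" "p2 * H = f * p3"
    and "cone Z1 Z3 F W iw jw pw qw \<Longrightarrow> \<exists>\<theta> \<psi>. chn W Z2 \<theta> \<and> chn Z2 W \<psi> \<and> \<theta> * \<psi> = e Z2 \<and> null W W (e W - \<psi> * \<theta>) \<and> \<theta> * jw = H"
proof -
  note O = coneD(2,3,4)[OF C] coneD(3,4)[OF C2] coneD(4)[OF C3]
  note R = cone_rules[OF C] coneU[OF C] cone_rules[OF C2] coneU[OF C2] cone_rules[OF C3] coneU[OF C3]
    obU[OF O(1)] obU[OF O(2)] obU[OF O(3)] obU[OF O(4)] obU[OF O(5)] obU[OF O(6)]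
  note t = coneD(5-9)[OF C] coneD(5-9)[OF C2] coneD(5-9)[OF C3]
  have "i3 * p1 \<in> G Z1 Z3 0" "j3 * (g * q1) \<in> G Z1 Z3 0" "i2 * (f * p3) \<in> G Z3 Z2 0" "j2 * q3 \<in> G Z3 Z2 0"
    by (rule G_multI[OF t(12,4)] G_multI[OF t(13) G_multI[OF t(6,5) refl]] G_multI[OF t(7) G_multI[OF t(1,14) refl]] G_multI[OF t(8,15)], simp)+
  then have FG: "F \<in> G Z1 Z3 0" "H \<in> G Z3 Z2 0" unfolding F H by (auto intro: G_add)
  show "chn Z1 Z3 F" unfolding chn_def using O FG by (simp add: F algebra_simps R)
  show cH: "chn Z3 Z2 H" unfolding chn_def using O FG by (simp add: H algebra_simps R)
  show "F * j1 = j3 * g" "(\<sigma> X * p3) * F = \<sigma> X * p1" "H * j3 = j2" "p2 * H = f * p3"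
    unfolding F H by (simp_all add: algebra_simps R)
  assume C4: "cone Z1 Z3 F W iw jw pw qw"
  note u = coneD(5-9)[OF C4]
  have R4: "cone Z1 Z3 (i3 * p1 + j3 * (g * q1)) W iw jw pw qw" using C4 unfolding F .
  note R = R cone_rules[OF R4] coneU(5-20)[OF R4] obU[OF coneD(4)[OF C4]]
  let ?th = "i2 * (q1 * pw) + H * qw" and ?ps = "iw * (j1 * p2) + jw * (j3 * q2)"
  have "i2 * (q1 * pw) \<in> G W Z2 0" "H * qw \<in> G W Z2 0" "iw * (j1 * p2) \<in> G Z2 W 0" "jw * (j3 * q2) \<in> G Z2 W 0"
    by (rule G_multI[OF t(7) G_multI[OF t(5) u(4) refl]] G_multI[OF FG(2) u(5)]
        G_multI[OF u(2) G_multI[OF t(3,9) refl]] G_multI[OF u(3) G_multI[OF t(13,10) refl]], simp)+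
  then have ty: "?th \<in> G W Z2 0" "?ps \<in> G Z2 W 0" by (auto intro: G_add)
  have 1: "chn W Z2 ?th" unfolding chn_def using O coneD(4)[OF C4] ty by (simp add: H algebra_simps R)
  have 2: "chn Z2 W ?ps" unfolding chn_def using O coneD(4)[OF C4] ty by (simp add: algebra_simps R)
  have 3: "?th * ?ps = e Z2" unfolding coneD(10)[OF C2] H by (simp add: algebra_simps R)
  have 5: "?th * jw = H" by (simp add: H algebra_simps R)
  have h: "iw * (i1 * (p3 * qw)) \<in> G W W (-1)"
    by (rule G_multI[OF u(2) G_multI[OF t(2) G_multI[OF t(14) u(5) refl] refl]]) simp
  have pw: "pw = i1 * (p1 * pw) + j1 * (q1 * pw)"
    using unit(1)[OF u(4)] unfolding coneD(10)[OF C] by (simp add: algebra_simps)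
  have qw: "qw = i3 * (p3 * qw) + j3 * (q3 * qw)"
    using unit(1)[OF u(5)] unfolding coneD(10)[OF C3] by (simp add: algebra_simps)
  have "e W = iw * (i1 * (p1 * pw) + j1 * (q1 * pw)) + jw * (i3 * (p3 * qw) + j3 * (q3 * qw))"
    unfolding pw[symmetric] qw[symmetric] by (rule coneD(10)[OF C4])
  then have 4: "null W W (e W - ?ps * ?th)"
    unfolding null_def by (intro bexI[OF _ h]) (simp add: H algebra_simps R)
  show "\<exists>\<theta> \<psi>. chn W Z2 \<theta> \<and> chn Z2 W \<psi> \<and> \<theta> * \<psi> = e Z2 \<and> null W W (e W - \<psi> * \<theta>) \<and> \<theta> * jw = H"
    using 1 2 3 4 5 by blast
qed

end

section \<open>Preadditive categories\<close>

context preadditive_category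
begin

lemma
  assumes "X \<in> Obj C" "Y \<in> Obj C"
  shows zero_Hom: "Zero C X Y \<in> Hom C X Y"
    and add_Hom: "f \<in> Hom C X Y \<Longrightarrow> g \<in> Hom C X Y \<Longrightarrow> f \<boxplus> g \<in> Hom C X Y"
    and neg_Hom: "f \<in> Hom C X Y \<Longrightarrow> Neg C f \<in> Hom C X Y"
    and add_assoc: "f \<in> Hom C X Y \<Longrightarrow> g \<in> Hom C X Y \<Longrightarrow> h \<in> Hom C X Y \<Longrightarrow> (f \<boxplus> g) \<boxplus> h = f \<boxplus> (g \<boxplus> h)"
    and add_commute: "f \<in> Hom C X Y \<Longrightarrow> g \<in> Hom C X Y \<Longrightarrow> f \<boxplus> g = g \<boxplus> f"
    and zero_add: "f \<in> Hom C X Y \<Longrightarrow> Zero C X Y \<boxplus> f = f"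
    and neg_add: "f \<in> Hom C X Y \<Longrightarrow> Neg C f \<boxplus> f = Zero C X Y"
proof -
  interpret H: comm_group "hom_group C X Y" by (rule hom_comm_group[OF assms])
  note [simp] = hom_group_def
  show "Zero C X Y \<in> Hom C X Y" using H.one_closed by simp
  show "f \<in> Hom C X Y \<Longrightarrow> g \<in> Hom C X Y \<Longrightarrow> f \<boxplus> g \<in> Hom C X Y" using H.m_closed[of f g] by simp
  show "f \<in> Hom C X Y \<Longrightarrow> Neg C f \<in> Hom C X Y" using H.inv_closed[of f] by (simp add: Neg_def Hom_def)
  show "f \<in> Hom C X Y \<Longrightarrow> g \<in> Hom C X Y \<Longrightarrow> h \<in> Hom C X Y \<Longrightarrow> (f \<boxplus> g) \<boxplus> h = f \<boxplus> (g \<boxplus> h)"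
    using H.m_assoc[of f g h] by simp
  show "f \<in> Hom C X Y \<Longrightarrow> g \<in> Hom C X Y \<Longrightarrow> f \<boxplus> g = g \<boxplus> f" using H.m_comm[of f g] by simp
  show "f \<in> Hom C X Y \<Longrightarrow> Zero C X Y \<boxplus> f = f" using H.l_one[of f] by simp
  show "f \<in> Hom C X Y \<Longrightarrow> Neg C f \<boxplus> f = Zero C X Y" using H.l_inv[of f] by (simp add: Neg_def Hom_def)
qed

lemma Hom_objs: "f \<in> Hom C X Y \<Longrightarrow> X \<in> Obj C \<and> Y \<in> Obj C"
  by (auto simp: Hom_def)

lemma add_cancel:
  assumes "f \<in> Hom C X Y" "g \<in> Hom C X Y" "g \<boxplus> f = f"
  shows "g = Zero C X Y"
proof -
  note O = Hom_objs[OF assms(1), THEN conjunct1] Hom_objs[OF assms(1), THEN conjunct2]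
  have n: "Neg C f \<in> Hom C X Y" by (rule neg_Hom[OF O assms(1)])
  have "f \<boxplus> Neg C f = Zero C X Y" using neg_add[OF O assms(1)] add_commute[OF O assms(1) n] by simp
  then show ?thesis
    using assms(3) add_assoc[OF O assms(2,1) n] zero_add[OF O assms(2)] add_commute[OF O assms(2) zero_Hom[OF O]] by metis
qed

lemma comp_zero: "g \<in> Hom C Y Z \<Longrightarrow> X \<in> Obj C \<Longrightarrow> g \<cdot> Zero C X Y = Zero C X Z"
proof -
  assume g: "g \<in> Hom C Y Z" and X: "X \<in> Obj C"
  have O: "X \<in> Obj C" "Y \<in> Obj C" using g X by (auto simp: Hom_def)
  have z: "Zero C X Y \<in> Hom C X Y" by (rule zero_Hom[OF O])
  have c: "g \<cdot> Zero C X Y \<in> Hom C X Z" by (rule Comp_Hom[OF z g])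
  have "(g \<cdot> Zero C X Y) \<boxplus> (g \<cdot> Zero C X Y) = g \<cdot> Zero C X Y"
    using Comp_Add[OF z z g] zero_add[OF O z] by simp
  then show ?thesis by (rule add_cancel[OF c c])
qed

lemma zero_comp: "f \<in> Hom C X Y \<Longrightarrow> Z \<in> Obj C \<Longrightarrow> Zero C Y Z \<cdot> f = Zero C X Z"
proof -
  assume f: "f \<in> Hom C X Y" and Z: "Z \<in> Obj C"
  have O: "Y \<in> Obj C" "Z \<in> Obj C" using f Z by (auto simp: Hom_def)
  have z: "Zero C Y Z \<in> Hom C Y Z" by (rule zero_Hom[OF O])
  have c: "Zero C Y Z \<cdot> f \<in> Hom C X Z" by (rule Comp_Hom[OF f z])
  have "(Zero C Y Z \<cdot> f) \<boxplus> (Zero C Y Z \<cdot> f) = Zero C Y Z \<cdot> f"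
    using Add_Comp[OF f z z] zero_add[OF O z] by simp
  then show ?thesis by (rule add_cancel[OF c c])
qed

lemma zero_object_iff: "zero_object C Z \<longleftrightarrow> Z \<in> Obj C \<and> Ident C Z = Zero C Z Z"
proof
  assume Z: "zero_object C Z"
  then have "Z \<in> Obj C" by (simp add: zero_object_def)
  then show "Z \<in> Obj C \<and> Ident C Z = Zero C Z Z"
    using Z Ident_Hom[of Z] zero_Hom[of Z Z] unfolding zero_object_def by blast
next
  assume Z: "Z \<in> Obj C \<and> Ident C Z = Zero C Z Z"
  have "f = Zero C X Z" if "f \<in> Hom C X Z" for f X
    using Ident_Comp[OF that] zero_comp[OF that, of Z] Z by simp
  moreover have "f = Zero C Z X" if "f \<in> Hom C Z X" for f X
    using Comp_Ident[OF that] comp_zero[OF that, of Z] Z by simp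
  ultimately show "zero_object C Z" unfolding zero_object_def using Z zero_Hom by blast
qed

end

section \<open>The ring of graded maps\<close>

text \<open>All homogeneous maps between \<open>\<int>\<close>-graded objects of all preadditive categories on the types \<open>'o\<close> and \<open>'m\<close> are
  realised as additive operators on one abelian group, whose elements assign to each category,
  each degree and each pair of objects an arrow. A family of arrows \<open>f n : X n \<rightarrow> Y (n + k)\<close>
  acts by composition, and this action is faithful. The product over all categories is what makes
  the group a type that does not depend on a parameter.\<close>

abbreviation hom_exists :: "('o, 'm) acat \<Rightarrow> 'o \<Rightarrow> 'o \<Rightarrow> bool" where
  "hom_exists C X Y \<equiv> preadditive_category C \<and> X \<in> Obj C \<and> Y \<in> Obj C"

typedef ('o, 'm) gvec = "{v :: ('o, 'm) acat \<Rightarrow> int \<Rightarrow> 'o \<Rightarrow> 'o \<Rightarrow> 'm.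
    \<forall>C n W X. if hom_exists C W X then v C n W X \<in> Hom C W X else v C n W X = undefined}"
  by (rule exI[of _ "\<lambda>C n W X. if hom_exists C W X then Zero C W X else undefined"])
    (simp add: preadditive_category.zero_Hom)

setup_lifting type_definition_gvec

instantiation gvec :: (type, type) ab_group_add
begin

lift_definition zero_gvec :: "('a, 'b) gvec" is
  "\<lambda>C n W X. if hom_exists C W X then Zero C W X else undefined"
  by (simp add: preadditive_category.zero_Hom)

lift_definition plus_gvec :: "('a, 'b) gvec \<Rightarrow> ('a, 'b) gvec \<Rightarrow> ('a, 'b) gvec" is
  "\<lambda>v w C n W X. if hom_exists C W X then v C n W X \<boxplus>\<^bsub>C\<^esub> w C n W X else undefined"
  by (simp add: preadditive_category.add_Hom)

lift_definition uminus_gvec :: "('a, 'b) gvec \<Rightarrow> ('a, 'b) gvec" is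
  "\<lambda>v C n W X. if hom_exists C W X then Neg C (v C n W X) else undefined"
  by (simp add: preadditive_category.neg_Hom)

definition minus_gvec :: "('a, 'b) gvec \<Rightarrow> ('a, 'b) gvec \<Rightarrow> ('a, 'b) gvec" where
  "minus_gvec v w = v + (- w)"

instance
proof
  fix u v w :: "('a, 'b) gvec"
  show "u + v + w = u + (v + w)"
    by transfer (auto simp: fun_eq_iff preadditive_category.add_assoc)
  show "u + v = v + u"
    by transfer (auto simp: fun_eq_iff intro: preadditive_category.add_commute)
  show "0 + u = u"
    by transfer (auto simp: fun_eq_iff preadditive_category.zero_add)
  show "- u + u = 0"
    by transfer (auto simp: fun_eq_iff preadditive_category.neg_add)
  show "u - v = u + - v" by (simp add: minus_gvec_def)
qed

end

typedef ('o, 'm) gop = "{F :: ('o, 'm) gvec \<Rightarrow> ('o, 'm) gvec. \<forall>v w. F (v + w) = F v + F w}"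
  by (rule exI[of _ "\<lambda>v. 0"]) simp

setup_lifting type_definition_gop

instantiation gop :: (type, type) ring
begin

lift_definition zero_gop :: "('a, 'b) gop" is "\<lambda>v. 0" by simp
lift_definition plus_gop :: "('a, 'b) gop \<Rightarrow> ('a, 'b) gop \<Rightarrow> ('a, 'b) gop" is "\<lambda>F G v. F v + G v"
  by (simp add: algebra_simps)
lift_definition uminus_gop :: "('a, 'b) gop \<Rightarrow> ('a, 'b) gop" is "\<lambda>F v. - F v" by simp
lift_definition minus_gop :: "('a, 'b) gop \<Rightarrow> ('a, 'b) gop \<Rightarrow> ('a, 'b) gop" is "\<lambda>F G v. F v - G v"
  by (simp add: algebra_simps)
lift_definition times_gop :: "('a, 'b) gop \<Rightarrow> ('a, 'b) gop \<Rightarrow> ('a, 'b) gop" is "\<lambda>F G v. F (G v)" by simp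

instance by standard (transfer; simp add: algebra_simps)+

end

definition graded_hom :: "('o, 'm) acat \<Rightarrow> (int \<Rightarrow> 'o) \<Rightarrow> (int \<Rightarrow> 'o) \<Rightarrow> int \<Rightarrow> (int \<Rightarrow> 'm) set" where
  "graded_hom C X Y k = {f. \<forall>n. f n \<in> Hom C (X n) (Y (n + k))}"

definition act_vec where
  "act_vec C X Y k f v = (\<lambda>C' n W Z. if hom_exists C' W Z
     then if C' = C \<and> Z = Y n then f (n - k) \<cdot>\<^bsub>C\<^esub> v C (n - k) W (X (n - k)) else Zero C' W Z else undefined)"

definition act :: "('o, 'm) acat \<Rightarrow> (int \<Rightarrow> 'o) \<Rightarrow> (int \<Rightarrow> 'o) \<Rightarrow> int \<Rightarrow> (int \<Rightarrow> 'm) \<Rightarrow> ('o, 'm) gop" where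
  "act C X Y k f = Abs_gop (\<lambda>v. Abs_gvec (act_vec C X Y k f (Rep_gvec v)))"

locale preadditive_acat = preadditive_category C for C :: "('o, 'm) acat" (structure)
begin

lemma graded_homD: "f \<in> graded_hom C X Y k \<Longrightarrow> f n \<in> Hom C (X n) (Y (n + k))"
  by (simp add: graded_hom_def)

lemma graded_homD': "f \<in> graded_hom C X Y k \<Longrightarrow> f (n - k) \<in> Hom C (X (n - k)) (Y n)"
  using graded_homD[of f X Y k "n - k"] by simp

lemma Rep_gvec_Hom: "hom_exists C' W X \<Longrightarrow> Rep_gvec v C' n W X \<in> Hom C' W X"
  using Rep_gvec[of v] by (simp split: if_splits)

lemma Rep_act_vec:
  assumes f: "f \<in> graded_hom C X Y k"
  shows "Rep_gvec (Abs_gvec (act_vec C X Y k f (Rep_gvec v))) = act_vec C X Y k f (Rep_gvec v)"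
proof -
  have X: "X (n - k) \<in> Obj C" for n using Hom_objs[OF graded_homD'[OF f]] by simp
  have "f (n - k) \<cdot> Rep_gvec v C (n - k) W (X (n - k)) \<in> Hom C W (Y n)" if "W \<in> Obj C" for n W
    by (rule Comp_Hom[OF Rep_gvec_Hom graded_homD'[OF f]]) (use that X preadditive_category_axioms in simp)
  then show ?thesis
    by (intro Abs_gvec_inverse) (simp add: act_vec_def preadditive_category.zero_Hom)
qed

lemma Rep_act:
  assumes f: "f \<in> graded_hom C X Y k"
  shows "Rep_gop (act C X Y k f) v = Abs_gvec (act_vec C X Y k f (Rep_gvec v))"
proof -
  have "(\<lambda>v. Abs_gvec (act_vec C X Y k f (Rep_gvec v))) \<in> {F. \<forall>v w. F (v + w) = F v + F w}"
  proof (simp, intro allI)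
    fix v w
    have "Rep_gvec (Abs_gvec (act_vec C X Y k f (Rep_gvec (v + w)))) =
      Rep_gvec (Abs_gvec (act_vec C X Y k f (Rep_gvec v)) + Abs_gvec (act_vec C X Y k f (Rep_gvec w)))"
      unfolding Rep_act_vec[OF f] unfolding plus_gvec.rep_eq unfolding Rep_act_vec[OF f]
    proof (intro ext)
      fix C' n W Z
      have X: "X (n - k) \<in> Obj C" using Hom_objs[OF graded_homD'[OF f]] by simp
      show "act_vec C X Y k f (\<lambda>C n W X. if hom_exists C W X then Rep_gvec v C n W X \<boxplus>\<^bsub>C\<^esub> Rep_gvec w C n W X else undefined) C' n W Z
        = (if hom_exists C' W Z then act_vec C X Y k f (Rep_gvec v) C' n W Z \<boxplus>\<^bsub>C'\<^esub> act_vec C X Y k f (Rep_gvec w) C' n W Z else undefined)"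
        using X Comp_Add[OF Rep_gvec_Hom Rep_gvec_Hom graded_homD'[OF f], of W n v n w] preadditive_category_axioms
        by (auto simp: act_vec_def Comp_Add[OF Rep_gvec_Hom Rep_gvec_Hom graded_homD'[OF f]]
            preadditive_category.zero_add[OF _ _ _ preadditive_category.zero_Hom])
    qed
    then show "Abs_gvec (act_vec C X Y k f (Rep_gvec (v + w))) =
       Abs_gvec (act_vec C X Y k f (Rep_gvec v)) + Abs_gvec (act_vec C X Y k f (Rep_gvec w))"
      by (simp only: Rep_gvec_inject)
  qed
  then show ?thesis unfolding act_def by (subst Abs_gop_inverse) auto
qed

lemma Rep_Rep_act:
  assumes f: "f \<in> graded_hom C X Y k"
  shows "Rep_gvec (Rep_gop (act C X Y k f) v) = act_vec C X Y k f (Rep_gvec v)"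
  unfolding Rep_act[OF f] by (rule Rep_act_vec[OF f])

lemma gop_eqI: "(\<And>v. Rep_gvec (Rep_gop a v) = Rep_gvec (Rep_gop b v)) \<Longrightarrow> a = b"
  using Rep_gvec_inject Rep_gop_inject by blast

lemma act_inject:
  assumes f: "f \<in> graded_hom C X Y k" and g: "g \<in> graded_hom C X Y k" and e: "act C X Y k f = act C X Y k g"
  shows "f = g"
proof
  fix n
  have O: "X n \<in> Obj C" "Y (n + k) \<in> Obj C" using Hom_objs[OF graded_homD[OF f]] by auto
  define u where "u = Abs_gvec (\<lambda>C' m W Z. if hom_exists C' W Z
    then if C' = C \<and> m = n \<and> W = X n \<and> Z = X n then Ident C (X n) else Zero C' W Z else undefined)"
  have u: "Rep_gvec u = (\<lambda>C' m W Z. if hom_exists C' W Z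
    then if C' = C \<and> m = n \<and> W = X n \<and> Z = X n then Ident C (X n) else Zero C' W Z else undefined)"
    unfolding u_def
    by (rule Abs_gvec_inverse) (auto simp: Ident_Hom preadditive_category.zero_Hom)
  have "act_vec C X Y k f (Rep_gvec u) C (n + k) (X n) (Y (n + k)) = act_vec C X Y k g (Rep_gvec u) C (n + k) (X n) (Y (n + k))"
    using Rep_Rep_act[OF f, of u] Rep_Rep_act[OF g, of u] e by simp
  then show "f n = g n"
    using O preadditive_category_axioms Comp_Ident[OF graded_homD[OF f]] Comp_Ident[OF graded_homD[OF g]]
    by (simp add: act_vec_def u)
qed

lemma graded_hom_comp:
  assumes f: "f \<in> graded_hom C X Y k" and g: "g \<in> graded_hom C Y Z l"
  shows "(\<lambda>n. g (n + k) \<cdot> f n) \<in> graded_hom C X Z (k + l)"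
  using Comp_Hom[OF graded_homD[OF f] graded_homD[OF g]] by (simp add: graded_hom_def add.assoc)

lemma act_mult:
  assumes f: "f \<in> graded_hom C X Y k" and g: "g \<in> graded_hom C Y Z l"
  shows "act C Y Z l g * act C X Y k f = act C X Z (k + l) (\<lambda>n. g (n + k) \<cdot> f n)"
proof (rule gop_eqI)
  fix v
  show "Rep_gvec (Rep_gop (act C Y Z l g * act C X Y k f) v) = Rep_gvec (Rep_gop (act C X Z (k + l) (\<lambda>n. g (n + k) \<cdot> f n)) v)"
    unfolding times_gop.rep_eq Rep_Rep_act[OF f] Rep_Rep_act[OF g] Rep_Rep_act[OF graded_hom_comp[OF f g]]
  proof (intro ext)
    fix C' n W Z'
    have i: "n - l - k = n - (k + l)" "n - (k + l) + k = n - l" by simp_all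
    have O: "Y (n - l) \<in> Obj C" "X (n - (k + l)) \<in> Obj C"
      using Hom_objs[OF graded_homD'[OF g]] Hom_objs[OF graded_homD[OF f]] by auto
    have f': "f (n - (k + l)) \<in> Hom C (X (n - (k + l))) (Y (n - l))" using graded_homD[OF f, of "n - (k + l)"] by (simp add: i)
    show "act_vec C Y Z l g (act_vec C X Y k f (Rep_gvec v)) C' n W Z' = act_vec C X Z (k + l) (\<lambda>n. g (n + k) \<cdot> f n) (Rep_gvec v) C' n W Z'"
      using Comp_assoc[OF Rep_gvec_Hom f' graded_homD'[OF g]] preadditive_category_axioms O
      by (auto simp: act_vec_def i)
  qed
qed

lemma graded_hom_add:
  "f \<in> graded_hom C X Y k \<Longrightarrow> g \<in> graded_hom C X Y k \<Longrightarrow> (\<lambda>n. f n \<boxplus> g n) \<in> graded_hom C X Y k"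
  unfolding graded_hom_def using add_Hom Hom_objs by blast

lemma act_add:
  assumes f: "f \<in> graded_hom C X Y k" and g: "g \<in> graded_hom C X Y k"
  shows "act C X Y k f + act C X Y k g = act C X Y k (\<lambda>n. f n \<boxplus> g n)"
proof (rule gop_eqI)
  fix v
  show "Rep_gvec (Rep_gop (act C X Y k f + act C X Y k g) v) = Rep_gvec (Rep_gop (act C X Y k (\<lambda>n. f n \<boxplus> g n)) v)"
    unfolding plus_gop.rep_eq plus_gvec.rep_eq Rep_Rep_act[OF f] Rep_Rep_act[OF g] Rep_Rep_act[OF graded_hom_add[OF f g]]
  proof (intro ext)
    fix C' n W Z
    have X: "X (n - k) \<in> Obj C" using Hom_objs[OF graded_homD'[OF f]] by simp
    show "(if hom_exists C' W Z then act_vec C X Y k f (Rep_gvec v) C' n W Z \<boxplus>\<^bsub>C'\<^esub> act_vec C X Y k g (Rep_gvec v) C' n W Z else undefined)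
      = act_vec C X Y k (\<lambda>n. f n \<boxplus> g n) (Rep_gvec v) C' n W Z"
      using X Add_Comp[OF Rep_gvec_Hom graded_homD'[OF f] graded_homD'[OF g]] preadditive_category_axioms
      by (auto simp: act_vec_def preadditive_category.zero_add[OF _ _ _ preadditive_category.zero_Hom])
  qed
qed

lemma graded_hom_zero: "(\<And>n. X n \<in> Obj C) \<Longrightarrow> (\<And>n. Y n \<in> Obj C) \<Longrightarrow> (\<lambda>n. Zero C (X n) (Y (n + k))) \<in> graded_hom C X Y k"
  by (simp add: graded_hom_def zero_Hom)

lemma act_zero:
  assumes "\<And>n. X n \<in> Obj C" "\<And>n. Y n \<in> Obj C"
  shows "act C X Y k (\<lambda>n. Zero C (X n) (Y (n + k))) = 0"
proof -
  note z = graded_hom_zero[of X Y k, OF assms]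
  have "(\<lambda>n. Zero C (X n) (Y (n + k)) \<boxplus> Zero C (X n) (Y (n + k))) = (\<lambda>n. Zero C (X n) (Y (n + k)))"
    using zero_add[OF _ _ zero_Hom] assms by simp
  then have "act C X Y k (\<lambda>n. Zero C (X n) (Y (n + k))) + act C X Y k (\<lambda>n. Zero C (X n) (Y (n + k))) =
    act C X Y k (\<lambda>n. Zero C (X n) (Y (n + k)))"
    using act_add[OF z z] by simp
  then show ?thesis by simp
qed

lemma graded_hom_neg: "f \<in> graded_hom C X Y k \<Longrightarrow> (\<lambda>n. Neg C (f n)) \<in> graded_hom C X Y k"
  unfolding graded_hom_def using neg_Hom Hom_objs by blast

lemma act_neg:
  assumes f: "f \<in> graded_hom C X Y k"
  shows "act C X Y k (\<lambda>n. Neg C (f n)) = - act C X Y k f"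
proof -
  have O: "X n \<in> Obj C" "Y n \<in> Obj C" for n
    using Hom_objs[OF graded_homD[OF f, of n]] Hom_objs[OF graded_homD'[OF f, of n]] by auto
  have "act C X Y k (\<lambda>n. Neg C (f n)) + act C X Y k f = act C X Y k (\<lambda>n. Zero C (X n) (Y (n + k)))"
    unfolding act_add[OF graded_hom_neg[OF f] f] using neg_add[OF _ _ graded_homD[OF f]] O by simp
  then have "act C X Y k (\<lambda>n. Neg C (f n)) + act C X Y k f = 0" using act_zero[of X Y k] O by simp
  then show ?thesis by (simp add: eq_neg_iff_add_eq_0)
qed

end

section \<open>The homotopy category in terms of the ring of graded maps\<close>

context dg_category
begin

lemma chn_unshift: "chn (s X) (s Y) x \<Longrightarrow> X \<in> Ob \<Longrightarrow> Y \<in> Ob \<Longrightarrow> chn X Y (\<tau> Y * (x * \<sigma> X))"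
  using unit[of x "s X" "s Y" 0] chnD[of "s X" "s Y" x]
  unfolding chn_def
  by (auto intro!: G_multI[OF \<tau>_G] G_multI[OF _ \<sigma>_G])
    (metis (no_types) add.inverse_inverse mult.assoc mult_minus_left mult_minus_right sd(5,8))

lemma null_unshift:
  assumes "null (s X) (s Y) (\<sigma> Y * (x * \<tau> X))" "x \<in> G X Y 0" "X \<in> Ob" "Y \<in> Ob"
  shows "null X Y x"
proof -
  obtain k where k: "k \<in> G (s X) (s Y) (-1)" "\<sigma> Y * (x * \<tau> X) = d (s Y) * k + k * d (s X)" using assms unfolding null_def by blast
  note R = sd[OF assms(3)] sd[OF assms(4)] unit[OF k(1)] unit[OF assms(2)]
  have "\<tau> Y * ((\<sigma> Y * (x * \<tau> X)) * \<sigma> X) = \<tau> Y * ((d (s Y) * k + k * d (s X)) * \<sigma> X)" unfolding k(2) ..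
  then have "x + \<tau> Y * (k * (\<sigma> X * d X)) = - (d Y * (\<tau> Y * (k * \<sigma> X)))"
    by (simp add: algebra_simps R)
  then have "x = - (d Y * (\<tau> Y * (k * \<sigma> X))) - \<tau> Y * (k * (\<sigma> X * d X))"
    by (simp only: eq_diff_eq)
  then have "x = d Y * (- (\<tau> Y * (k * \<sigma> X))) + (- (\<tau> Y * (k * \<sigma> X))) * d X"
    by (simp add: mult.assoc)
  moreover have "- (\<tau> Y * (k * \<sigma> X)) \<in> G X Y (-1)"
    by (rule G_neg, rule G_multI[OF \<tau>_G G_multI[OF k(1) \<sigma>_G]]) (use assms in auto)
  ultimately show ?thesis unfolding null_def by blast
qed

end

locale additive_acat = additive_category C for C :: "('o, 'm) acat" (structure)
begin

sublocale preadditive_acat C by unfold_locales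

definition Ob :: "('o, 'm) cochain set" where "Ob = {X. is_complex C X}"
definition G :: "('o, 'm) cochain \<Rightarrow> ('o, 'm) cochain \<Rightarrow> int \<Rightarrow> ('o, 'm) gop set" where
  "G X Y k = act C (cobj X) (cobj Y) k ` graded_hom C (cobj X) (cobj Y) k"
definition e :: "('o, 'm) cochain \<Rightarrow> ('o, 'm) gop" where
  "e X = act C (cobj X) (cobj X) 0 (\<lambda>n. Ident C (cobj X n))"
definition d :: "('o, 'm) cochain \<Rightarrow> ('o, 'm) gop" where
  "d X = act C (cobj X) (cobj X) 1 (cdiff X)"
definition \<sigma> :: "('o, 'm) cochain \<Rightarrow> ('o, 'm) gop" where
  "\<sigma> X = act C (cobj X) (cobj (shift C X)) (- 1) (\<lambda>n. Ident C (cobj X n))"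
definition \<tau> :: "('o, 'm) cochain \<Rightarrow> ('o, 'm) gop" where
  "\<tau> X = act C (cobj (shift C X)) (cobj X) 1 (\<lambda>n. Ident C (cobj X (n + 1)))"

lemma complexD:
  assumes "X \<in> Ob"
  shows "cobj X n \<in> Obj C" "cdiff X n \<in> Hom C (cobj X n) (cobj X (n + 1))"
    "cdiff X (n + 1) \<cdot> cdiff X n = Zero C (cobj X n) (cobj X (n + 2))"
  using assms by (auto simp: Ob_def is_complex_def)

lemma GI: "f \<in> graded_hom C (cobj X) (cobj Y) k \<Longrightarrow> act C (cobj X) (cobj Y) k f \<in> G X Y k"
  by (simp add: G_def)

lemma GE:
  assumes "x \<in> G X Y k"
  obtains f where "f \<in> graded_hom C (cobj X) (cobj Y) k" "x = act C (cobj X) (cobj Y) k f"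
  using assms by (auto simp: G_def)

lemma neg_neg: "f \<in> Hom C X Y \<Longrightarrow> Neg C (Neg C f) = f"
proof -
  assume f: "f \<in> Hom C X Y"
  have "comm_group (hom_group C X Y)" using hom_comm_group Hom_objs[OF f] by blast
  then have "m_inv (hom_group C X Y) (m_inv (hom_group C X Y) f) = f"
    using f by (intro group.inv_inv) (auto simp: comm_group_def hom_group_def)
  then show ?thesis using neg_Hom[OF _ _ f] Hom_objs[OF f] f by (simp add: Neg_def Hom_iff)
qed

lemma neg_comp:
  assumes f: "f \<in> Hom C X Y" and g: "g \<in> Hom C Y Z"
  shows "Neg C g \<cdot> Neg C f = g \<cdot> f"
proof -
  define X' Y' Z' where d: "X' = (\<lambda>n::int. X)" "Y' = (\<lambda>n::int. Y)" "Z' = (\<lambda>n::int. Z)"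
  have F: "(\<lambda>n. f) \<in> graded_hom C X' Y' 0" "(\<lambda>n. g) \<in> graded_hom C Y' Z' 0"
    using f g by (auto simp: graded_hom_def d)
  have "act C X' Z' 0 (\<lambda>n. Neg C g \<cdot> Neg C f) = (- act C Y' Z' 0 (\<lambda>n. g)) * (- act C X' Y' 0 (\<lambda>n. f))"
    using act_mult[OF graded_hom_neg[OF F(1)] graded_hom_neg[OF F(2)]] act_neg[OF F(1)] act_neg[OF F(2)] by simp
  also have "\<dots> = act C X' Z' 0 (\<lambda>n. g \<cdot> f)" using act_mult[OF F] by simp
  finally have "(\<lambda>n::int. Neg C g \<cdot> Neg C f) = (\<lambda>n. g \<cdot> f)"
    using act_inject[of _ X' Z' 0, OF _ graded_hom_comp[OF F, simplified]]
      graded_hom_comp[OF graded_hom_neg[OF F(1)] graded_hom_neg[OF F(2)]] by simp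
  then show ?thesis by (simp add: fun_eq_iff)
qed

lemma shift_simps [simp]:
  "cobj (shift C X) n = cobj X (n + 1)" "cdiff (shift C X) n = Neg C (cdiff X (n + 1))"
  by (simp_all add: shift_def)

lemma shift_complex:
  assumes "X \<in> Ob"
  shows "shift C X \<in> Ob"
proof -
  have i: "n + 1 + 1 = n + 2" "n + 2 + 1 = n + 3" "n + 1 + 2 = n + 3" for n :: int by simp_all
  note D = complexD[OF assms]
  have d1: "cdiff X (n + 1) \<in> Hom C (cobj X (n + 1)) (cobj X (n + 2))" for n using D(2)[of "n + 1"] by (simp add: i)
  have d2: "cdiff X (n + 2) \<in> Hom C (cobj X (n + 2)) (cobj X (n + 3))" for n using D(2)[of "n + 2"] by (simp add: i)
  have "Neg C (cdiff X (n + 1)) \<in> Hom C (cobj X (n + 1)) (cobj X (n + 2))" for n by (rule neg_Hom[OF D(1) D(1) d1])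
  moreover have "Neg C (cdiff X (n + 2)) \<cdot> Neg C (cdiff X (n + 1)) = Zero C (cobj X (n + 1)) (cobj X (n + 3))" for n
    using neg_comp[OF d1 d2] D(3)[of "n + 1"] by (simp add: i)
  ultimately show ?thesis unfolding Ob_def is_complex_def using D(1) by (simp add: i)
qed

lemma unshift_complex: "X \<in> Ob \<Longrightarrow> \<exists>X' \<in> Ob. shift C X' = X"
proof -
  assume X: "X \<in> Ob"
  let ?X = "Cochain (\<lambda>n. cobj X (n - 1)) (\<lambda>n. Neg C (cdiff X (n - 1)))"
  have s: "shift C ?X = X"
    using neg_neg[OF complexD(2)[OF X]] by (cases X) (simp add: shift_def Neg_def[symmetric])
  have n1: "cdiff X (n - 1) \<in> Hom C (cobj X (n - 1)) (cobj X n)" for n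
    using complexD(2)[OF X, of "n - 1"] by simp
  have "Neg C (cdiff X (n - 1)) \<in> Hom C (cobj X (n - 1)) (cobj X n)" for n
    by (rule neg_Hom[OF complexD(1)[OF X] complexD(1)[OF X] n1])
  moreover have "Neg C (cdiff X n) \<cdot> Neg C (cdiff X (n - 1)) = Zero C (cobj X (n - 1)) (cobj X (n + 1))" for n
    using neg_comp[OF n1 complexD(2)[OF X]] complexD(3)[OF X, of "n - 1"] by (simp add: add.commute)
  ultimately have "?X \<in> Ob" unfolding Ob_def is_complex_def
    using complexD(1)[OF X] by (simp add: add.commute)
  then show ?thesis using s by blast
qed

lemma id_graded:
  assumes "X \<in> Ob"
  shows "(\<lambda>n. Ident C (cobj X n)) \<in> graded_hom C (cobj X) (cobj X) 0"
    "(\<lambda>n. Ident C (cobj X n)) \<in> graded_hom C (cobj X) (cobj (shift C X)) (- 1)"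
    "(\<lambda>n. Ident C (cobj X (n + 1))) \<in> graded_hom C (cobj (shift C X)) (cobj X) 1"
    "cdiff X \<in> graded_hom C (cobj X) (cobj X) 1"
  using complexD[OF assms] by (auto simp: graded_hom_def Ident_Hom)

lemma e_unit:
  assumes "x \<in> G X Y k"
  shows "e Y * x = x" "x * e X = x"
proof -
  obtain f where f: "f \<in> graded_hom C (cobj X) (cobj Y) k" "x = act C (cobj X) (cobj Y) k f" using assms by (rule GE)
  have O: "cobj X n \<in> Obj C" "cobj Y n \<in> Obj C" for n
    using Hom_objs[OF graded_homD[OF f(1), of n]] Hom_objs[OF graded_homD'[OF f(1), of n]] by auto
  have i: "(\<lambda>n. Ident C (cobj X n)) \<in> graded_hom C (cobj X) (cobj X) 0" "(\<lambda>n. Ident C (cobj Y n)) \<in> graded_hom C (cobj Y) (cobj Y) 0"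
    using O by (auto simp: graded_hom_def Ident_Hom)
  show "e Y * x = x" unfolding f(2) e_def act_mult[OF f(1) i(2)] using Ident_Comp[OF graded_homD[OF f(1)]] by simp
  show "x * e X = x" unfolding f(2) e_def act_mult[OF i(1) f(1)] using Comp_Ident[OF graded_homD[OF f(1)]] by simp
qed

sublocale dg_category Ob G e d "shift C" \<sigma> \<tau>
proof
  fix x y X Y k l Z
  show "x \<in> G X Y k \<Longrightarrow> y \<in> G X Y k \<Longrightarrow> x + y \<in> G X Y k"
    by (elim GE) (simp add: act_add GI graded_hom_add)
  show "x \<in> G X Y k \<Longrightarrow> - x \<in> G X Y k"
    by (elim GE) (simp add: GI graded_hom_neg flip: act_neg)
  show "X \<in> Ob \<Longrightarrow> Y \<in> Ob \<Longrightarrow> 0 \<in> G X Y k"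
    using GI[OF graded_hom_zero[of "cobj X" "cobj Y" k]] act_zero[of "cobj X" "cobj Y" k] complexD(1) by simp
  show "x \<in> G X Y k \<Longrightarrow> y \<in> G Y Z l \<Longrightarrow> y * x \<in> G X Z (k + l)"
    by (elim GE) (simp add: act_mult GI graded_hom_comp)
  show "x \<in> G X Y k \<Longrightarrow> e Y * x = x" "x \<in> G X Y k \<Longrightarrow> x * e X = x" by (simp_all add: e_unit)
next
  fix X assume X: "X \<in> Ob"
  note i = id_graded[OF X] and O = complexD[OF X]
  show "e X \<in> G X X 0" "d X \<in> G X X 1" "\<sigma> X \<in> G X (shift C X) (- 1)" "\<tau> X \<in> G (shift C X) X 1"
    unfolding e_def d_def \<sigma>_def \<tau>_def by (intro GI i)+
  have "(\<lambda>n. cdiff X (n + 1) \<cdot> cdiff X n) = (\<lambda>n. Zero C (cobj X n) (cobj X (n + 2)))" using O by simp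
  then show "d X * d X = 0" unfolding d_def act_mult[OF i(4) i(4)] using act_zero[of "cobj X" "cobj X" 2] O by simp
  show "shift C X \<in> Ob" by (rule shift_complex[OF X])
  show "\<tau> X * \<sigma> X = e X" unfolding \<tau>_def \<sigma>_def e_def act_mult[OF i(2) i(3)] using O by simp
  show "\<sigma> X * \<tau> X = e (shift C X)" unfolding \<tau>_def \<sigma>_def e_def act_mult[OF i(3) i(2)] using O by simp
  have j: "n + 1 + 1 = n + 2" for n :: int by simp
  have d1: "cdiff X (n + 1) \<in> Hom C (cobj X (n + 1)) (cobj X (n + 2))" for n using O(2)[of "n + 1"] by (simp add: j)
  have g: "(\<lambda>n. cdiff X (n + 1)) \<in> graded_hom C (cobj (shift C X)) (cobj X) 2"
    using d1 by (simp add: graded_hom_def)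
  have "d X * \<tau> X = act C (cobj (shift C X)) (cobj X) 2 (\<lambda>n. cdiff X (n + 1))"
    unfolding d_def \<tau>_def act_mult[OF i(3) i(4)] using Comp_Ident[OF O(2)] by simp
  then have "\<sigma> X * (d X * \<tau> X) = act C (cobj (shift C X)) (cobj (shift C X)) 1 (\<lambda>n. cdiff X (n + 1))"
    unfolding \<sigma>_def using act_mult[OF g i(2)] Ident_Comp[OF d1] by simp
  moreover have "(\<lambda>n. cdiff X (n + 1)) \<in> graded_hom C (cobj (shift C X)) (cobj (shift C X)) 1"
    using d1 by (simp add: graded_hom_def j)
  ultimately show "d (shift C X) = - (\<sigma> X * (d X * \<tau> X))"
    unfolding d_def using act_neg[of "\<lambda>n. cdiff X (n + 1)" "cobj (shift C X)" "cobj (shift C X)" 1]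
    by (simp add: shift_def)
qed

lemma chain_maps_iff:
  assumes "X \<in> Ob" "Y \<in> Ob"
  shows "f \<in> chain_maps C X Y \<longleftrightarrow> f \<in> graded_hom C (cobj X) (cobj Y) 0 \<and> chn X Y (act C (cobj X) (cobj Y) 0 f)"
proof (cases "f \<in> graded_hom C (cobj X) (cobj Y) 0")
  case True
  note i = id_graded(4)[OF assms(1)] id_graded(4)[OF assms(2)]
  have "d Y * act C (cobj X) (cobj Y) 0 f = act C (cobj X) (cobj Y) 0 f * d X \<longleftrightarrow>
    act C (cobj X) (cobj Y) 1 (\<lambda>n. cdiff Y n \<cdot> f n) = act C (cobj X) (cobj Y) 1 (\<lambda>n. f (n + 1) \<cdot> cdiff X n)"
    unfolding d_def act_mult[OF True i(2)] act_mult[OF i(1) True] by simp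
  also have "\<dots> \<longleftrightarrow> (\<lambda>n. cdiff Y n \<cdot> f n) = (\<lambda>n. f (n + 1) \<cdot> cdiff X n)"
    using act_inject[OF graded_hom_comp[OF True i(2), simplified] graded_hom_comp[OF i(1) True, simplified]] by auto
  also have "\<dots> \<longleftrightarrow> (\<forall>n. cdiff Y n \<cdot> f n = f (n + 1) \<cdot> cdiff X n)" by (simp add: fun_eq_iff)
  finally show ?thesis unfolding chn_def chain_maps_def using True assms GI[OF True] by (simp add: graded_hom_def)
next
  case False
  then show ?thesis by (auto simp: chain_maps_def graded_hom_def)
qed

lemma homotopic_iff:
  assumes "X \<in> Ob" "Y \<in> Ob" and f: "f \<in> graded_hom C (cobj X) (cobj Y) 0" and g: "g \<in> graded_hom C (cobj X) (cobj Y) 0"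
  shows "homotopic C X Y f g \<longleftrightarrow> null X Y (act C (cobj X) (cobj Y) 0 f - act C (cobj X) (cobj Y) 0 g)"
proof -
  note i = id_graded(4)[OF assms(1)] id_graded(4)[OF assms(2)]
  have key: "(\<forall>n. f n = g n \<boxplus> ((cdiff Y (n - 1) \<cdot> h n) \<boxplus> (h (n + 1) \<cdot> cdiff X n))) \<longleftrightarrow>
    act C (cobj X) (cobj Y) 0 f - act C (cobj X) (cobj Y) 0 g =
      d Y * act C (cobj X) (cobj Y) (-1) h + act C (cobj X) (cobj Y) (-1) h * d X"
    if h: "h \<in> graded_hom C (cobj X) (cobj Y) (- 1)" for h
  proof -
    let ?a = "\<lambda>n. cdiff Y (n - 1) \<cdot> h n" and ?b = "\<lambda>n. h (n + 1) \<cdot> cdiff X n"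
    have ab: "?a \<in> graded_hom C (cobj X) (cobj Y) 0" "?b \<in> graded_hom C (cobj X) (cobj Y) 0"
      using graded_hom_comp[OF h i(2)] graded_hom_comp[OF i(1) h] by simp_all
    have "d Y * act C (cobj X) (cobj Y) (-1) h + act C (cobj X) (cobj Y) (-1) h * d X
      = act C (cobj X) (cobj Y) 0 (\<lambda>n. ?a n \<boxplus> ?b n)"
      unfolding act_add[OF ab, symmetric] d_def using act_mult[OF h i(2)] act_mult[OF i(1) h] by simp
    then have "(act C (cobj X) (cobj Y) 0 f - act C (cobj X) (cobj Y) 0 g =
      d Y * act C (cobj X) (cobj Y) (-1) h + act C (cobj X) (cobj Y) (-1) h * d X) \<longleftrightarrow>
      act C (cobj X) (cobj Y) 0 f = act C (cobj X) (cobj Y) 0 (\<lambda>n. g n \<boxplus> (?a n \<boxplus> ?b n))"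
      unfolding act_add[OF g graded_hom_add[OF ab], symmetric] by (auto simp: algebra_simps)
    also have "\<dots> \<longleftrightarrow> f = (\<lambda>n. g n \<boxplus> (?a n \<boxplus> ?b n))"
      using act_inject[OF f graded_hom_add[OF g graded_hom_add[OF ab]]] by auto
    finally show ?thesis by (simp add: fun_eq_iff)
  qed
  have "homotopic C X Y f g \<longleftrightarrow> (\<exists>h \<in> graded_hom C (cobj X) (cobj Y) (- 1).
     \<forall>n. f n = g n \<boxplus> ((cdiff Y (n - 1) \<cdot> h n) \<boxplus> (h (n + 1) \<cdot> cdiff X n)))"
    unfolding homotopic_def graded_hom_def by auto
  also have "\<dots> \<longleftrightarrow> null X Y (act C (cobj X) (cobj Y) 0 f - act C (cobj X) (cobj Y) 0 g)"
    unfolding null_def G_def using key by auto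
  finally show ?thesis .
qed

definition fam :: "('o, 'm) cochain \<Rightarrow> ('o, 'm) cochain \<Rightarrow> ('o, 'm) gop \<Rightarrow> int \<Rightarrow> 'm" where
  "fam X Y x = inv_into (graded_hom C (cobj X) (cobj Y) 0) (act C (cobj X) (cobj Y) 0) x"

definition arr :: "('o, 'm) cochain \<Rightarrow> ('o, 'm) cochain \<Rightarrow> ('o, 'm) gop \<Rightarrow> ('o, 'm) harr" where
  "arr X Y x = hclass C X Y (fam X Y x)"

lemma fam:
  assumes "chn X Y x"
  shows "fam X Y x \<in> graded_hom C (cobj X) (cobj Y) 0" "act C (cobj X) (cobj Y) 0 (fam X Y x) = x"
  using chnD(3)[OF assms] unfolding fam_def G_def by (rule inv_into_into, rule f_inv_into_f)

lemma fam_act: "f \<in> graded_hom C (cobj X) (cobj Y) 0 \<Longrightarrow> fam X Y (act C (cobj X) (cobj Y) 0 f) = f"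
  unfolding fam_def by (rule inv_into_f_f) (auto intro: inj_onI act_inject)

lemma arr_eq_set:
  assumes "chn X Y x"
  shows "arr X Y x = (X, Y, {g. g \<in> graded_hom C (cobj X) (cobj Y) 0 \<and> chn X Y (act C (cobj X) (cobj Y) 0 g) \<and>
     null X Y (x - act C (cobj X) (cobj Y) 0 g)})"
  unfolding arr_def hclass_def
  using chnD(1,2)[OF assms] homotopic_iff[OF chnD(1,2)[OF assms] fam(1)[OF assms]] fam(2)[OF assms]
  by (auto simp: chain_maps_iff)

lemma arr_eq_iff:
  assumes "chn X Y x" "chn X Y y"
  shows "arr X Y x = arr X Y y \<longleftrightarrow> null X Y (x - y)"
proof
  assume "arr X Y x = arr X Y y"
  moreover have "fam X Y y \<in> snd (snd (arr X Y y))"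
    using fam[OF assms(2)] assms(2) chnD(1,2)[OF assms(2)] by (simp add: arr_eq_set null_zero)
  ultimately have "fam X Y y \<in> snd (snd (arr X Y x))" by simp
  then show "null X Y (x - y)" using fam[OF assms(2)] by (simp add: arr_eq_set[OF assms(1)])
next
  assume n: "null X Y (x - y)"
  have "null X Y (x - z) \<longleftrightarrow> null X Y (y - z)" for z
    using null_add[of X Y "y - z" "x - y"] null_diff[of X Y "x - z" "x - y"] n by auto
  then show "arr X Y x = arr X Y y" unfolding arr_eq_set[OF assms(1)] arr_eq_set[OF assms(2)] by simp
qed

abbreviation K where "K \<equiv> homotopy_cat C"

abbreviation K_Comp (infixr "\<bullet>" 70) where "g \<bullet> f \<equiv> g \<cdot>\<^bsub>K\<^esub> f"

lemma K_basic:
  "Obj K = Ob" "Dom K (arr X Y x) = X" "Cod K (arr X Y x) = Y" "Sh K = shift C"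
  by (simp_all add: homotopy_cat_def Ob_def arr_def hclass_def)

lemma hclass_arr:
  assumes "X \<in> Ob" "Y \<in> Ob" "f \<in> chain_maps C X Y"
  shows "hclass C X Y f = arr X Y (act C (cobj X) (cobj Y) 0 f)"
  unfolding arr_def using assms by (simp add: chain_maps_iff fam_act)

lemma K_Arr: "Arr K = {arr X Y x | X Y x. chn X Y x}"
proof -
  have "Arr K = {hclass C X Y f | X Y f. X \<in> Ob \<and> Y \<in> Ob \<and> f \<in> chain_maps C X Y}"
    by (simp add: homotopy_cat_def Ob_def)
  also have "\<dots> = {arr X Y x | X Y x. chn X Y x}"
  proof (intro equalityI subsetI)
    fix a assume "a \<in> {hclass C X Y f | X Y f. X \<in> Ob \<and> Y \<in> Ob \<and> f \<in> chain_maps C X Y}"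
    then show "a \<in> {arr X Y x | X Y x. chn X Y x}" using hclass_arr chain_maps_iff by blast
  next
    fix a assume "a \<in> {arr X Y x | X Y x. chn X Y x}"
    then obtain X Y x where a: "a = arr X Y x" "chn X Y x" by blast
    then have "fam X Y x \<in> chain_maps C X Y" using fam[OF a(2)] chnD(1,2)[OF a(2)] by (simp add: chain_maps_iff)
    then show "a \<in> {hclass C X Y f | X Y f. X \<in> Ob \<and> Y \<in> Ob \<and> f \<in> chain_maps C X Y}"
      using a chnD(1,2)[OF a(2)] unfolding arr_def by blast
  qed
  finally show ?thesis .
qed

lemma arr_Hom: "chn X Y x \<Longrightarrow> arr X Y x \<in> Hom K X Y"
  unfolding Hom_iff K_basic K_Arr by blast

lemma K_HomE:
  assumes "a \<in> Hom K X Y"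
  obtains x where "chn X Y x" "a = arr X Y x"
  using assms unfolding Hom_iff K_Arr by (auto simp: K_basic)

lemma K_Ident: "X \<in> Ob \<Longrightarrow> Ident K X = arr X X (e X)"
  unfolding arr_def e_def by (simp add: homotopy_cat_def fam_act id_graded)

lemma K_comp:
  assumes x: "chn X Y x" and y: "chn Y Z y"
  shows "arr Y Z y \<bullet> arr X Y x = arr X Z (y * x)"
proof -
  let ?a = "\<lambda>X Y f. act C (cobj X) (cobj Y) 0 f"
  have O: "X \<in> Ob" "Y \<in> Ob" "Z \<in> Ob" using chnD[OF x] chnD[OF y] by auto
  have am: "?a X Z (\<lambda>n. g n \<cdot> f n) = ?a Y Z g * ?a X Y f" "(\<lambda>n. g n \<cdot> f n) \<in> graded_hom C (cobj X) (cobj Z) 0"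
    if "f \<in> graded_hom C (cobj X) (cobj Y) 0" "g \<in> graded_hom C (cobj Y) (cobj Z) 0" for f g
    using act_mult[OF that] graded_hom_comp[OF that] by simp_all
  have 1: "null X Z (y * x - ?a X Z h)"
    if f: "f \<in> graded_hom C (cobj X) (cobj Y) 0" "chn X Y (?a X Y f)" "null X Y (x - ?a X Y f)"
      and g: "g \<in> graded_hom C (cobj Y) (cobj Z) 0" "chn Y Z (?a Y Z g)" "null Y Z (y - ?a Y Z g)"
      and h: "null X Z (?a X Z (\<lambda>n. g n \<cdot> f n) - ?a X Z h)" for f g h
  proof -
    have "null X Z (y * (x - ?a X Y f) + (y - ?a Y Z g) * ?a X Y f + (?a X Z (\<lambda>n. g n \<cdot> f n) - ?a X Z h))"
      by (intro null_add null_mult_left[OF f(3) y] null_mult_right[OF g(3) f(2)] h)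
    then show ?thesis unfolding am(1)[OF f(1) g(1)] by (simp add: algebra_simps)
  qed
  have "{h \<in> chain_maps C X Z. \<exists>f \<in> snd (snd (arr X Y x)). \<exists>g \<in> snd (snd (arr Y Z y)). homotopic C X Z (\<lambda>n. g n \<cdot> f n) h}
    = snd (snd (arr X Z (y * x)))" (is "?L = ?R")
  proof (intro equalityI subsetI)
    fix h assume "h \<in> ?L"
    then show "h \<in> ?R"
      using 1 am(2) unfolding arr_eq_set[OF x] arr_eq_set[OF y] arr_eq_set[OF chn_mult[OF x y]]
      by (auto simp: chain_maps_iff O homotopic_iff)
  next
    fix h assume "h \<in> ?R"
    then have h: "h \<in> graded_hom C (cobj X) (cobj Z) 0" "chn X Z (?a X Z h)" "null X Z (y * x - ?a X Z h)"
      unfolding arr_eq_set[OF chn_mult[OF x y]] by auto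
    have hh: "homotopic C X Z (\<lambda>n. fam Y Z y n \<cdot> fam X Y x n) h"
      using h am[OF fam(1)[OF x] fam(1)[OF y]] by (simp add: homotopic_iff O fam(2)[OF x] fam(2)[OF y])
    have "fam X Y x \<in> snd (snd (arr X Y x))" "fam Y Z y \<in> snd (snd (arr Y Z y))"
      unfolding arr_eq_set[OF x] arr_eq_set[OF y] using fam[OF x] fam[OF y] x y O by (simp_all add: null_zero)
    then show "h \<in> ?L" using hh h by (auto simp: chain_maps_iff O)
  qed
  moreover have "arr Y Z y \<bullet> arr X Y x =
    (X, Z, {h \<in> chain_maps C X Z. \<exists>f \<in> snd (snd (arr X Y x)). \<exists>g \<in> snd (snd (arr Y Z y)). homotopic C X Z (\<lambda>n. g n \<cdot> f n) h})"
    by (simp add: homotopy_cat_def arr_def hclass_def)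
  ultimately show ?thesis by (simp add: arr_def hclass_def)
qed

lemma act_shift:
  assumes "X \<in> Ob" "Y \<in> Ob" and f: "f \<in> graded_hom C (cobj X) (cobj Y) 0"
  shows "(\<lambda>n. f (n + 1)) \<in> graded_hom C (cobj (shift C X)) (cobj (shift C Y)) 0"
    "act C (cobj (shift C X)) (cobj (shift C Y)) 0 (\<lambda>n. f (n + 1)) = \<sigma> Y * (act C (cobj X) (cobj Y) 0 f * \<tau> X)"
proof -
  show g: "(\<lambda>n. f (n + 1)) \<in> graded_hom C (cobj (shift C X)) (cobj (shift C Y)) 0"
    using f by (simp add: graded_hom_def)
  have f1: "(\<lambda>n. f (n + 1)) \<in> graded_hom C (cobj (shift C X)) (cobj Y) 1" using f by (simp add: graded_hom_def)
  have F: "f n \<in> Hom C (cobj X n) (cobj Y n)" for n using f by (simp add: graded_hom_def)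
  have "act C (cobj X) (cobj Y) 0 f * \<tau> X = act C (cobj (shift C X)) (cobj Y) 1 (\<lambda>n. f (n + 1))"
    unfolding \<tau>_def act_mult[OF id_graded(3)[OF assms(1)] f] using Comp_Ident[OF F] by simp
  then show "act C (cobj (shift C X)) (cobj (shift C Y)) 0 (\<lambda>n. f (n + 1)) = \<sigma> Y * (act C (cobj X) (cobj Y) 0 f * \<tau> X)"
    unfolding \<sigma>_def using act_mult[OF f1 id_graded(2)[OF assms(2)]] Ident_Comp[OF F] by simp
qed

lemma K_ShA:
  assumes x: "chn X Y x"
  shows "ShA K (arr X Y x) = arr (shift C X) (shift C Y) (\<sigma> Y * (x * \<tau> X))"
proof -
  let ?a = "\<lambda>X Y f. act C (cobj X) (cobj Y) 0 f"
  have O: "X \<in> Ob" "Y \<in> Ob" using chnD[OF x] by auto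
  have "(\<lambda>f n. f (n + 1)) ` snd (snd (arr X Y x)) = snd (snd (arr (shift C X) (shift C Y) (\<sigma> Y * (x * \<tau> X))))" (is "?L = ?R")
  proof (intro equalityI subsetI)
    fix g assume "g \<in> ?L"
    then obtain f where f: "f \<in> graded_hom C (cobj X) (cobj Y) 0" "chn X Y (?a X Y f)" "null X Y (x - ?a X Y f)"
      and g: "g = (\<lambda>n. f (n + 1))" unfolding arr_eq_set[OF x] by auto
    have "null (shift C X) (shift C Y) (\<sigma> Y * (x * \<tau> X) - \<sigma> Y * (?a X Y f * \<tau> X))"
      using null_shift[OF f(3) O] by (simp add: algebra_simps)
    then show "g \<in> ?R" unfolding arr_eq_set[OF chn_shift[OF x]] g
      using act_shift[OF O f(1)] chn_shift[OF f(2)] by simp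
  next
    fix g assume "g \<in> ?R"
    then have g: "g \<in> graded_hom C (cobj (shift C X)) (cobj (shift C Y)) 0" "chn (shift C X) (shift C Y) (?a (shift C X) (shift C Y) g)"
      "null (shift C X) (shift C Y) (\<sigma> Y * (x * \<tau> X) - ?a (shift C X) (shift C Y) g)"
      unfolding arr_eq_set[OF chn_shift[OF x]] by auto
    define f where "f n = g (n - 1)" for n
    have f: "f \<in> graded_hom C (cobj X) (cobj Y) 0"
    proof -
      have "\<forall>n. g n \<in> Hom C (cobj X (n + 1)) (cobj Y (n + 1))" using g(1) by (simp add: graded_hom_def)
      then have "g (n - 1) \<in> Hom C (cobj X (n - 1 + 1)) (cobj Y (n - 1 + 1))" for n by blast
      then show ?thesis by (simp add: graded_hom_def f_def)
    qed
    have gf: "g = (\<lambda>n. f (n + 1))" by (simp add: f_def)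
    have ga: "?a (shift C X) (shift C Y) g = \<sigma> Y * (?a X Y f * \<tau> X)" unfolding gf by (rule act_shift[OF O f])
    have fG: "?a X Y f \<in> G X Y 0" by (rule GI[OF f])
    have "\<tau> Y * ((\<sigma> Y * (?a X Y f * \<tau> X)) * \<sigma> X) = ?a X Y f"
      using unit[OF fG] by (simp add: mult.assoc sd O)
    then have "chn X Y (?a X Y f)" using chn_unshift[OF g(2) O] unfolding ga by simp
    moreover have "null X Y (x - ?a X Y f)"
    proof (rule null_unshift[OF _ _ O])
      show "null (shift C X) (shift C Y) (\<sigma> Y * ((x - ?a X Y f) * \<tau> X))"
        using g(3) unfolding ga by (simp add: algebra_simps)
      show "x - ?a X Y f \<in> G X Y 0" by (rule G_diff[OF chnD(3)[OF x] fG])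
    qed
    ultimately show "g \<in> ?L" unfolding arr_eq_set[OF x] gf using f by auto
  qed
  then show ?thesis by (simp add: homotopy_cat_def arr_def hclass_def)
qed

text \<open>Mapping cones in the sense of \<open>is_cone\<close> are the cones of the differential graded category, and they exist
  because biproducts do. In the following lemma \<open>S\<close> and \<open>D\<close> are the components and the differential
  of a would-be cone.\<close>

lemma cone_matrices:
  assumes O: "X \<in> Ob" "Y \<in> Ob" and f: "f \<in> chain_maps C X Y"
    and b: "\<And>n. is_biproduct C (cobj X (n + 1)) (cobj Y n) (S n) (i n) (j n) (p n) (q n)"
    and D: "\<And>n. D n = (i (n + 1) \<cdot> (Neg C (cdiff X (n + 1)) \<cdot> p n)) \<boxplus>
       ((j (n + 1) \<cdot> (f (n + 1) \<cdot> p n)) \<boxplus> (j (n + 1) \<cdot> (cdiff Y n \<cdot> q n)))"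
  shows "is_complex C (Cochain S D)"
    and "cone X Y (act C (cobj X) (cobj Y) 0 f) (Cochain S D) (act C (cobj X) S (- 1) (\<lambda>n. i (n - 1)))
      (act C (cobj Y) S 0 j) (act C S (cobj X) 1 p) (act C S (cobj Y) 0 q)"
    and "j \<in> graded_hom C (cobj Y) S 0" "p \<in> graded_hom C S (cobj X) 1"
proof -
  note b' = b[unfolded is_biproduct_def]
  have SO: "S n \<in> Obj C" for n using b'[of n] Hom_objs by blast
  define i' where "i' n = i (n - 1)" for n
  have b1: "i (n - 1) \<in> Hom C (cobj X n) (S (n - 1))" "p (n - 1) \<cdot> i (n - 1) = Ident C (cobj X n)"
    "q (n - 1) \<cdot> i (n - 1) = Zero C (cobj X n) (cobj Y (n - 1))" for n using b'[of "n - 1"] by simp_all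
  have i: "i' \<in> graded_hom C (cobj X) S (-1)" using b1 by (simp add: graded_hom_def i'_def)
  show jpq: "j \<in> graded_hom C (cobj Y) S 0" "p \<in> graded_hom C S (cobj X) 1"
    using b' by (auto simp: graded_hom_def)
  have q: "q \<in> graded_hom C S (cobj Y) 0" using b' by (auto simp: graded_hom_def)
  note F = f[unfolded chain_maps_iff[OF O]]
  note g = i jpq q F[THEN conjunct1] id_graded(4)[OF O(1)] id_graded(4)[OF O(2)]
  let ?i = "act C (cobj X) S (- 1) i'" and ?j = "act C (cobj Y) S 0 j" and ?p = "act C S (cobj X) 1 p"
    and ?q = "act C S (cobj Y) 0 q" and ?f = "act C (cobj X) (cobj Y) 0 f"
  have 1: "?p * ?i = e X" unfolding e_def act_mult[OF g(1,3)] using b1 by (simp add: i'_def)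
  have 2: "?q * ?j = e Y" unfolding e_def act_mult[OF g(2,4)] using b' by simp
  have 3: "?p * ?j = 0" unfolding act_mult[OF g(2,3)] using b' act_zero[of "cobj Y" "cobj X" 1] complexD(1)[OF O(1)] complexD(1)[OF O(2)] by simp
  have 4: "?q * ?i = 0" unfolding act_mult[OF g(1,4)]
    using b1 act_zero[of "cobj X" "cobj Y" "- 1"] complexD(1)[OF O(1)] complexD(1)[OF O(2)] by (simp add: i'_def)
  have m: "?p * (?i * z) = e X * z" "?q * (?j * z) = e Y * z" "?p * (?j * z) = 0" "?q * (?i * z) = 0" for z
    using 1 2 3 4 by (simp_all flip: mult.assoc)
  note c1 = graded_hom_comp[OF g(3) graded_hom_neg[OF g(6)]] and c2 = graded_hom_comp[OF g(3,5)] and c3 = graded_hom_comp[OF g(4,7)]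
  note c1' = graded_hom_comp[OF c1 g(1)] and c2' = graded_hom_comp[OF c2 g(2)] and c3' = graded_hom_comp[OF c3 g(2)]
  have a1: "?i * ((- d X) * ?p) = act C S S 1 (\<lambda>n. i (n + 1) \<cdot> (Neg C (cdiff X (n + 1)) \<cdot> p n))"
    unfolding d_def act_neg[OF g(6), symmetric] act_mult[OF g(3) graded_hom_neg[OF g(6)]] act_mult[OF c1 g(1)] by (simp add: i'_def add.commute)
  have a2: "?j * (?f * ?p) = act C S S 1 (\<lambda>n. j (n + 1) \<cdot> (f (n + 1) \<cdot> p n))"
    unfolding act_mult[OF g(3,5)] act_mult[OF c2 g(2)] by simp
  have a3: "?j * (d Y * ?q) = act C S S 1 (\<lambda>n. j (n + 1) \<cdot> (cdiff Y n \<cdot> q n))"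
    unfolding d_def act_mult[OF g(4,7)] act_mult[OF c3 g(2)] by simp
  have D': "act C S S 1 D = ?i * ((- d X) * ?p) + (?j * (?f * ?p) + ?j * (d Y * ?q))"
    unfolding a1 a2 a3
    using act_add[OF c2'[simplified] c3'[simplified]] act_add[OF c1'[simplified] graded_hom_add[OF c2'[simplified] c3'[simplified]]]
    by (simp add: D[abs_def] i'_def add.commute)
  have Dg: "D \<in> graded_hom C S S 1"
    using graded_hom_add[OF c1'[simplified] graded_hom_add[OF c2'[simplified] c3'[simplified]]] by (simp add: D[abs_def] i'_def add.commute)
  have "act C S S 1 D * act C S S 1 D = 0"
    unfolding D' using chnD(4,5)[OF F[THEN conjunct2]] unit[OF GI[OF g(5)]]
    by (simp add: algebra_simps m 1 2 3 4 obU[OF O(1)] obU[OF O(2)] sd[OF O(1)] sd[OF O(2)])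
  then have "act C S S 2 (\<lambda>n. D (n + 1) \<cdot> D n) = act C S S 2 (\<lambda>n. Zero C (S n) (S (n + 2)))"
    using act_mult[OF Dg Dg] act_zero[of S S 2] SO by simp
  then have DD: "(\<lambda>n. D (n + 1) \<cdot> D n) = (\<lambda>n. Zero C (S n) (S (n + 2)))"
    using act_inject[OF graded_hom_comp[OF Dg Dg, simplified] graded_hom_zero[of S S 2]] SO by simp
  show c: "is_complex C (Cochain S D)"
    unfolding is_complex_def using SO Dg fun_cong[OF DD] by (simp add: graded_hom_def)
  let ?Z = "Cochain S D"
  have ZO: "?Z \<in> Ob" using c by (simp add: Ob_def)
  have 5: "?i * ?p + ?j * ?q = e ?Z"
    unfolding e_def act_mult[OF g(3,1)] act_mult[OF g(4,2)]
    using b' act_add[OF graded_hom_comp[OF g(3,1), simplified] graded_hom_comp[OF g(4,2), simplified]] by (simp add: i'_def)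
  have dZ: "d ?Z = ?j * (?f * ?p) + ?j * (d Y * ?q) - ?i * (d X * ?p)"
    using D' by (simp add: d_def algebra_simps)
  have t: "?i \<in> G X ?Z (- 1)" "?j \<in> G Y ?Z 0" "?p \<in> G ?Z X 1" "?q \<in> G ?Z Y 0"
    unfolding G_def using g(1-4) by auto
  show "cone X Y ?f ?Z (act C (cobj X) S (- 1) (\<lambda>n. i (n - 1))) ?j ?p ?q"
    using F ZO t 1 2 3 4 5 dZ unfolding cone_def i'_def[abs_def] by simp
qed

lemma cone_of_is_cone:
  assumes O: "X \<in> Ob" "Y \<in> Ob" and f: "f \<in> chain_maps C X Y" and Z: "is_cone C X Y f Z j p"
  obtains i q where "cone X Y (act C (cobj X) (cobj Y) 0 f) Z i (act C (cobj Y) (cobj Z) 0 j) (act C (cobj Z) (cobj X) 1 p) q"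
    "j \<in> graded_hom C (cobj Y) (cobj Z) 0" "p \<in> graded_hom C (cobj Z) (cobj X) 1"
proof -
  obtain i q where b: "\<And>n. is_biproduct C (cobj X (n + 1)) (cobj Y n) (cobj Z n) (i n) (j n) (p n) (q n)"
    and dZ: "\<And>n. cdiff Z n = (i (n + 1) \<cdot> (Neg C (cdiff X (n + 1)) \<cdot> p n)) \<boxplus>
       ((j (n + 1) \<cdot> (f (n + 1) \<cdot> p n)) \<boxplus> (j (n + 1) \<cdot> (cdiff Y n \<cdot> q n)))"
    using Z unfolding is_cone_def by blast
  have "Cochain (cobj Z) (cdiff Z) = Z" by (cases Z) simp
  then show ?thesis using cone_matrices(2-4)[OF O f b dZ] that by simp
qed

lemma is_cone_exists:
  assumes O: "X \<in> Ob" "Y \<in> Ob" and f: "f \<in> chain_maps C X Y"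
  shows "\<exists>Z j p. is_cone C X Y f Z j p"
proof -
  have "\<forall>n. \<exists>S i j p q. is_biproduct C (cobj X (n + 1)) (cobj Y n) S i j p q"
    using ex_biproduct complexD(1) O by blast
  then obtain S where "\<forall>n. \<exists>i j p q. is_biproduct C (cobj X (n + 1)) (cobj Y n) (S n) i j p q" by (rule choice[THEN exE])
  then obtain i where "\<forall>n. \<exists>j p q. is_biproduct C (cobj X (n + 1)) (cobj Y n) (S n) (i n) j p q" by (rule choice[THEN exE])
  then obtain j where "\<forall>n. \<exists>p q. is_biproduct C (cobj X (n + 1)) (cobj Y n) (S n) (i n) (j n) p q" by (rule choice[THEN exE])
  then obtain p where "\<forall>n. \<exists>q. is_biproduct C (cobj X (n + 1)) (cobj Y n) (S n) (i n) (j n) (p n) q" by (rule choice[THEN exE])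
  then obtain q where b: "\<forall>n. is_biproduct C (cobj X (n + 1)) (cobj Y n) (S n) (i n) (j n) (p n) (q n)" by (rule choice[THEN exE])
  define D where "D n = (i (n + 1) \<cdot> (Neg C (cdiff X (n + 1)) \<cdot> p n)) \<boxplus>
       ((j (n + 1) \<cdot> (f (n + 1) \<cdot> p n)) \<boxplus> (j (n + 1) \<cdot> (cdiff Y n \<cdot> q n)))" for n
  have "is_cone C X Y f (Cochain S D) j p"
    unfolding is_cone_def
    by (intro conjI cone_matrices(1)[OF O f b[rule_format] D_def] exI[of _ i] exI[of _ q]) (use b in \<open>simp add: D_def\<close>)
  then show ?thesis by blast
qed

abbreviation conn where "conn X Z p \<equiv> arr Z (shift C X) (\<sigma> X * p)"

definition std_triangle where
  "std_triangle X Y Z f j p = (arr X Y f, arr Y Z j, conn X Z p)"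

lemma std_triangle_of_is_cone:
  assumes O: "X \<in> Ob" "Y \<in> Ob" and f: "f \<in> chain_maps C X Y" and Z: "is_cone C X Y f Z j p"
  obtains x i j' p' q where "cone X Y x Z i j' p' q" "x = act C (cobj X) (cobj Y) 0 f"
    "(hclass C X Y f, hclass C Y Z j, hclass C Z (shift C X) p) = std_triangle X Y Z x j' p'"
proof -
  obtain i q where c: "cone X Y (act C (cobj X) (cobj Y) 0 f) Z i (act C (cobj Y) (cobj Z) 0 j) (act C (cobj Z) (cobj X) 1 p) q"
    and g: "j \<in> graded_hom C (cobj Y) (cobj Z) 0" "p \<in> graded_hom C (cobj Z) (cobj X) 1"
    by (rule cone_of_is_cone[OF assms])
  have p0: "p \<in> graded_hom C (cobj Z) (cobj (shift C X)) 0" using g(2) by (simp add: graded_hom_def)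
  have p': "p n \<in> Hom C (cobj Z n) (cobj X (n + 1))" for n using g(2) by (simp add: graded_hom_def)
  have "\<sigma> X * act C (cobj Z) (cobj X) 1 p = act C (cobj Z) (cobj (shift C X)) 0 p"
    unfolding \<sigma>_def act_mult[OF g(2) id_graded(2)[OF O(1)]] using Ident_Comp[OF p'] by simp
  then have "(hclass C X Y f, hclass C Y Z j, hclass C Z (shift C X) p) =
    std_triangle X Y Z (act C (cobj X) (cobj Y) 0 f) (act C (cobj Y) (cobj Z) 0 j) (act C (cobj Z) (cobj X) 1 p)"
    unfolding std_triangle_def arr_def using f by (simp add: fam_act[OF p0] fam_act[OF g(1)] fam_act chain_maps_iff O)
  then show ?thesis using that c by blast
qed

lemma cone_exists:
  assumes "chn X Y x"
  obtains Z i j p q where "cone X Y x Z i j p q"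
    "std_triangle X Y Z x j p \<in> {(hclass C X Y f, hclass C Y Z j, hclass C Z (shift C X) p) | X Y Z f j p.
        is_complex C X \<and> is_complex C Y \<and> f \<in> chain_maps C X Y \<and> is_cone C X Y f Z j p}"
proof -
  have O: "X \<in> Ob" "Y \<in> Ob" using chnD[OF assms] by auto
  have f: "fam X Y x \<in> chain_maps C X Y" "act C (cobj X) (cobj Y) 0 (fam X Y x) = x"
    using fam[OF assms] assms O by (auto simp: chain_maps_iff)
  obtain Z j p where Z: "is_cone C X Y (fam X Y x) Z j p" using is_cone_exists[OF O f(1)] by blast
  obtain i j' p' q where c: "cone X Y x Z i j' p' q"
    "(hclass C X Y (fam X Y x), hclass C Y Z j, hclass C Z (shift C X) p) = std_triangle X Y Z x j' p'"
    using std_triangle_of_is_cone[OF O f(1) Z] f(2) by metis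
  show ?thesis
    by (rule that[OF c(1)], unfold c(2)[symmetric]) (use O f(1) Z in \<open>unfold Ob_def, blast\<close>)
qed

end

section \<open>The homotopy category is triangulated\<close>

lemma (in category) two_sided_iso:
  assumes "f \<in> Hom C X Y" "g \<in> Hom C Y X" "iso_arr C (g \<cdot> f)" "iso_arr C (f \<cdot> g)"
  shows "iso_arr C f"
proof -
  note H = assms(1,2)[unfolded Hom_iff]
  obtain h where h: "h \<in> Arr C" "Dom C h = X" "Cod C h = X" "h \<cdot> (g \<cdot> f) = Ident C X"
    using iso_arrE[OF assms(3)] H by (metis comp_arr)
  obtain k where k: "k \<in> Arr C" "Dom C k = Y" "Cod C k = Y" "(f \<cdot> g) \<cdot> k = Ident C Y"
    using iso_arrE[OF assms(4)] H by (metis comp_arr)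
  have e: "h \<cdot> g = (h \<cdot> g) \<cdot> ((f \<cdot> g) \<cdot> k)" unfolding k(4) using h H by simp
  also have "\<dots> = (h \<cdot> (g \<cdot> f)) \<cdot> (g \<cdot> k)" using h(1-3) k(1-3) H by simp
  also have "\<dots> = g \<cdot> k" unfolding h(4) using k(1-3) H by simp
  finally have e: "h \<cdot> g = g \<cdot> k" .
  show ?thesis
  proof (rule iso_arrI[OF assms(1)])
    show "h \<cdot> g \<in> Hom C Y X" using h H by (simp add: Hom_iff)
    show "(h \<cdot> g) \<cdot> f = Ident C X" using h H by simp
    show "f \<cdot> (h \<cdot> g) = Ident C Y" unfolding e using k H by simp
  qed
qed

lemma (in dg_category) chn_unrotate:
  assumes c: "cone Y Z f (s X) i j p q" and X: "X \<in> Ob"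
  shows "chn X Y (p * \<sigma> X)"
proof -
  have "d Y * (p * \<sigma> X) = - (p * (d (s X) * \<sigma> X))" using cone_rules(14)[OF c, of "\<sigma> X"] by simp
  also have "\<dots> = p * \<sigma> X * d X" by (simp add: sd[OF X] mult.assoc)
  finally have "d Y * (p * \<sigma> X) = p * \<sigma> X * d X" .
  moreover have "p * \<sigma> X \<in> G X Y 0" by (rule G_multI[OF coneD(8)[OF c] \<sigma>_G[OF X]]) simp
  ultimately show ?thesis using X coneD(2)[OF c] by (simp add: chn_def)
qed

context additive_acat
begin

lemma category_K: "category K"
proof
  fix f assume "f \<in> Arr K"
  then show "Dom K f \<in> Obj K" "Cod K f \<in> Obj K" by (auto simp: K_Arr K_basic dest: chnD)
next
  fix X assume "X \<in> Obj K"
  then show "Ident K X \<in> Hom K X X" using arr_Hom[OF chn_e] by (simp add: K_basic K_Ident)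
next
  fix f X Y g Z assume "f \<in> Hom K X Y" "g \<in> Hom K Y Z"
  then show "g \<bullet> f \<in> Hom K X Z" by (elim K_HomE) (simp add: K_comp arr_Hom chn_mult)
next
  fix f X Y assume "f \<in> Hom K X Y"
  then obtain x where x: "chn X Y x" "f = arr X Y x" by (rule K_HomE)
  show "f \<bullet> Ident K X = f" "Ident K Y \<bullet> f = f"
    using chnD[OF x(1)] unit[OF chnD(3)[OF x(1)]] by (simp_all add: x(2) K_Ident K_comp[OF chn_e x(1)] K_comp[OF x(1) chn_e])
next
  fix f W X g Y h Z assume "f \<in> Hom K W X" "g \<in> Hom K X Y" "h \<in> Hom K Y Z"
  then show "(h \<bullet> g) \<bullet> f = h \<bullet> (g \<bullet> f)"
    by (elim K_HomE) (simp add: K_comp chn_mult mult.assoc)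
qed

lemma shift_category_K: "shift_category K"
proof -
  interpret category K by (rule category_K)
  show ?thesis
  proof
    fix X assume "X \<in> Obj K" then show "Sh K X \<in> Obj K" by (simp add: K_basic s_Ob)
  next
    fix f X Y assume "f \<in> Hom K X Y" then show "ShA K f \<in> Hom K (Sh K X) (Sh K Y)"
      by (elim K_HomE) (simp add: K_ShA K_basic arr_Hom chn_shift)
  next
    fix X assume X: "X \<in> Obj K" then show "ShA K (Ident K X) = Ident K (Sh K X)"
      by (simp add: K_basic K_Ident K_ShA chn_e s_Ob obU sd)
  next
    fix f X Y g Z assume "f \<in> Hom K X Y" "g \<in> Hom K Y Z"
    then show "ShA K (g \<bullet> f) = ShA K g \<bullet> ShA K f"
    proof (elim K_HomE)
      fix x y assume x: "chn X Y x" "f = arr X Y x" and y: "chn Y Z y" "g = arr Y Z y"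
      note O = chnD(1,2)[OF x(1)] chnD(2)[OF y(1)]
      have "\<sigma> Z * (y * \<tau> Y) * (\<sigma> Y * (x * \<tau> X)) = \<sigma> Z * (y * x * \<tau> X)"
        using unit[OF chnD(3)[OF y(1)]] by (simp add: mult.assoc sd O)
      then show ?thesis
        by (simp add: x(2) y(2) K_comp[OF x(1) y(1)] K_ShA[OF x(1)] K_ShA[OF y(1)] K_ShA[OF chn_mult[OF x(1) y(1)]]
            K_comp[OF chn_shift[OF x(1)] chn_shift[OF y(1)]])
    qed
  qed
qed

interpretation K: shift_category K by (rule shift_category_K)

lemma arr_simps [simp]:
  "chn X Y x \<Longrightarrow> arr X Y x \<in> Arr K" "Dom K (arr X Y x) = X" "Cod K (arr X Y x) = Y" "Sh K = shift C" "Obj K = Ob"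
  using arr_Hom[of X Y x] by (auto simp: Hom_iff K_basic)

lemma cone_ex:
  assumes "chn X Y x"
  obtains Z i j p q where "cone X Y x Z i j p q"
  using cone_exists[OF assms] by metis

lemma Tri_E:
  assumes "t \<in> Tri K"
  obtains X Y f Z i j p q where "cone X Y f Z i j p q" "triangle_iso K t (std_triangle X Y Z f j p)"
proof -
  obtain R where R: "K = with_triangles R {(hclass C X Y f, hclass C Y Z j, hclass C Z (shift C X) p) | X Y Z f j p.
        is_complex C X \<and> is_complex C Y \<and> f \<in> chain_maps C X Y \<and> is_cone C X Y f Z j p}"
    unfolding homotopy_cat_def by blast
  have ti: "triangle_iso K = triangle_iso R" unfolding R by (rule triangle_iso_with_triangles)
  obtain X Y Z f j p where H: "X \<in> Ob" "Y \<in> Ob" "f \<in> chain_maps C X Y" "is_cone C X Y f Z j p"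
    "triangle_iso K t (hclass C X Y f, hclass C Y Z j, hclass C Z (shift C X) p)"
    using assms unfolding ti unfolding R Tri_with_triangles Ob_def by blast
  obtain x i j' p' q where "cone X Y x Z i j' p' q"
    "(hclass C X Y f, hclass C Y Z j, hclass C Z (shift C X) p) = std_triangle X Y Z x j' p'"
    by (rule std_triangle_of_is_cone[OF H(1-4)])
  then show ?thesis using that H(5) by simp
qed

lemma Tri_closed_K:
  assumes "triangle_iso K t t'" "t' \<in> Tri K"
  shows "t \<in> Tri K"
proof -
  obtain R B where R: "K = with_triangles R B" unfolding homotopy_cat_def by blast
  have ti: "triangle_iso K = triangle_iso R" unfolding R by (rule triangle_iso_with_triangles)
  have T: "Tri K = {t. \<exists>t' \<in> B. triangle_iso K t t'}" unfolding ti unfolding R by (rule Tri_with_triangles)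
  show ?thesis using assms K.triangle_iso_trans unfolding T by blast
qed

lemma std_typed:
  assumes "cone X Y f Z i j p q"
  shows "typed_triangle K (arr X Y f) (arr Y Z j) (conn X Z p)"
  unfolding typed_triangle_def using coneD(1)[OF assms] chn_j[OF assms] chn_p[OF assms] by simp

lemma std_fill:
  assumes c: "cone X Y f Z i j p q" and c': "cone X' Y' f' Z' i' j' p' q'"
    and a: "a \<in> Hom K X X'" and b: "b \<in> Hom K Y Y'" and e: "arr X' Y' f' \<bullet> a = b \<bullet> arr X Y f"
  obtains g where "g \<in> Hom K Z Z'" "g \<bullet> arr Y Z j = arr Y' Z' j' \<bullet> b"
    "ShA K a \<bullet> conn X Z p = conn X' Z' p' \<bullet> g"
proof -
  obtain x where x: "chn X X' x" "a = arr X X' x" using a by (rule K_HomE)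
  obtain y where y: "chn Y Y' y" "b = arr Y Y' y" using b by (rule K_HomE)
  note f = coneD(1)[OF c] coneD(1)[OF c']
  have "null X Y' (f' * x - y * f)"
    using e arr_eq_iff[OF chn_mult[OF x(1) f(2)] chn_mult[OF f(1) y(1)]] by (simp add: x y K_comp[OF x(1) f(2)] K_comp[OF f(1) y(1)])
  then obtain z where z: "chn Z Z' z" "z * j = j' * y" "p' * z = x * p" by (rule cone_fill[OF c c' x(1) y(1)])
  note O = chnD(1)[OF x(1)]
  have "\<sigma> X' * (x * \<tau> X) * (\<sigma> X * p) = \<sigma> X' * p' * z"
    using unit[OF chnD(3)[OF x(1)]] by (simp add: mult.assoc sd[OF O] z)
  then have e2: "ShA K a \<bullet> conn X Z p = conn X' Z' p' \<bullet> arr Z Z' z"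
    by (simp add: x(2) K_ShA[OF x(1)] K_comp[OF chn_p[OF c] chn_shift[OF x(1)]] K_comp[OF z(1) chn_p[OF c']])
  have e1: "arr Z Z' z \<bullet> arr Y Z j = arr Y' Z' j' \<bullet> b"
    by (simp add: y(2) K_comp[OF chn_j[OF c] z(1)] K_comp[OF y(1) chn_j[OF c']] z(2))
  show ?thesis by (rule that[OF arr_Hom[OF z(1)] e1 e2])
qed

lemma std_endo:
  assumes c: "cone X Y f Z i j p q" and g: "g \<in> Hom K Z Z" and 1: "g \<bullet> arr Y Z j = arr Y Z j"
    and 2: "conn X Z p \<bullet> g = conn X Z p"
  shows "iso_arr K g"
proof -
  obtain z where z: "chn Z Z z" "g = arr Z Z z" using g by (rule K_HomE)
  have n: "null Y Z (z * j - j)"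
    using 1 arr_eq_iff[OF chn_mult[OF chn_j[OF c] z(1)] chn_j[OF c]] by (simp add: z K_comp[OF chn_j[OF c] z(1)])
  have m: "null Z (shift C X) (\<sigma> X * (p * z) - \<sigma> X * p)"
    using 2 arr_eq_iff[OF chn_mult[OF z(1) chn_p[OF c]] chn_p[OF c]] by (simp add: z K_comp[OF z(1) chn_p[OF c]] mult.assoc)
  obtain z' where z': "chn Z Z z'" "null Z Z (z' * z - e Z)" "null Z Z (z * z' - e Z)" by (rule cone_endo[OF c z(1) n m])
  note O = coneD(4)[OF c]
  have "arr Z Z z' \<bullet> g = Ident K Z" "g \<bullet> arr Z Z z' = Ident K Z"
    unfolding z(2) K_comp[OF z(1) z'(1)] K_comp[OF z'(1) z(1)] K_Ident[OF O]
    using z' arr_eq_iff[OF chn_mult[OF z(1) z'(1)] chn_e[OF O]] arr_eq_iff[OF chn_mult[OF z'(1) z(1)] chn_e[OF O]] by auto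
  then show ?thesis using K.iso_arrI[OF g arr_Hom[OF z'(1)]] by blast
qed

text \<open>The fillers in both directions compose to endomorphisms of cones that are the identity on the first two
  terms; such endomorphisms are invertible by \<open>std_endo\<close>.\<close>

lemma std_compare:
  assumes c: "cone X Y f Z i j p q" and c': "cone X' Y' f' Z' i' j' p' q'"
    and a: "a \<in> Hom K X X'" "iso_arr K a" and b: "b \<in> Hom K Y Y'" "iso_arr K b" and e: "arr X' Y' f' \<bullet> a = b \<bullet> arr X Y f"
  obtains g where "g \<in> Hom K Z Z'" "iso_arr K g" "g \<bullet> arr Y Z j = arr Y' Z' j' \<bullet> b"
    "ShA K a \<bullet> conn X Z p = conn X' Z' p' \<bullet> g"
proof -
  note H = a(1)[unfolded Hom_iff] b(1)[unfolded Hom_iff] coneD(1)[OF c] coneD(1)[OF c'] chn_j[OF c] chn_j[OF c'] chn_p[OF c] chn_p[OF c']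
    coneD(2-4)[OF c] coneD(2-4)[OF c']
  obtain a' where a': "a' \<in> Arr K" "Dom K a' = X'" "Cod K a' = X" "a' \<bullet> a = Ident K X" "a \<bullet> a' = Ident K X'"
    using K.iso_arrE[OF a(2)] H by metis
  obtain b' where b': "b' \<in> Arr K" "Dom K b' = Y'" "Cod K b' = Y" "b' \<bullet> b = Ident K Y" "b \<bullet> b' = Ident K Y'"
    using K.iso_arrE[OF b(2)] H by metis
  have "arr X Y f \<bullet> a' = b' \<bullet> ((b \<bullet> arr X Y f) \<bullet> a')"
    using H a'(1-3) b'(1-3) by (simp add: K.comp_assoc_eq[OF b'(4)])
  also have "\<dots> = b' \<bullet> arr X' Y' f'" unfolding e[symmetric] using H a' b'(1-3) by simp
  finally have e': "arr X Y f \<bullet> a' = b' \<bullet> arr X' Y' f'" .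
  obtain g where g: "g \<in> Hom K Z Z'" "g \<bullet> arr Y Z j = arr Y' Z' j' \<bullet> b"
    "ShA K a \<bullet> conn X Z p = conn X' Z' p' \<bullet> g"
    by (rule std_fill[OF c c' a(1) b(1) e])
  obtain g' where g': "g' \<in> Hom K Z' Z" "g' \<bullet> arr Y' Z' j' = arr Y Z j \<bullet> b'"
    "ShA K a' \<bullet> conn X' Z' p' = conn X Z p \<bullet> g'"
    by (rule std_fill[OF c' c _ _ e']) (use a' b' in \<open>auto simp: Hom_iff\<close>)
  note D = H a'(1-3) b'(1-3) g(1)[unfolded Hom_iff] g'(1)[unfolded Hom_iff]
  have sa: "ShA K a' \<bullet> ShA K a = Ident K (shift C X)" "ShA K a \<bullet> ShA K a' = Ident K (shift C X')"
    using D a'(4,5) by (simp_all flip: K.sha_comp)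
  have "iso_arr K (g' \<bullet> g)"
  proof (rule std_endo[OF c])
    show "g' \<bullet> g \<in> Hom K Z Z" using D by (simp add: Hom_iff)
    show "(g' \<bullet> g) \<bullet> arr Y Z j = arr Y Z j"
      using D b'(4) by (simp add: g(2) K.comp_assoc_eq[OF g'(2)])
    have "conn X Z p \<bullet> (g' \<bullet> g) = (conn X Z p \<bullet> g') \<bullet> g" using D by simp
    also have "\<dots> = ShA K a' \<bullet> (conn X' Z' p' \<bullet> g)" unfolding g'(3)[symmetric] using D by simp
    also have "\<dots> = conn X Z p" unfolding g(3)[symmetric] using D by (simp add: K.comp_assoc_eq[OF sa(1)])
    finally show "conn X Z p \<bullet> (g' \<bullet> g) = conn X Z p" .
  qed
  moreover have "iso_arr K (g \<bullet> g')"
  proof (rule std_endo[OF c'])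
    show "g \<bullet> g' \<in> Hom K Z' Z'" using D by (simp add: Hom_iff)
    show "(g \<bullet> g') \<bullet> arr Y' Z' j' = arr Y' Z' j'"
      using D b'(5) by (simp add: g'(2) K.comp_assoc_eq[OF g(2)])
    have "conn X' Z' p' \<bullet> (g \<bullet> g') = (conn X' Z' p' \<bullet> g) \<bullet> g'" using D by simp
    also have "\<dots> = ShA K a \<bullet> (conn X Z p \<bullet> g')" unfolding g(3)[symmetric] using D by simp
    also have "\<dots> = conn X' Z' p'" unfolding g'(3)[symmetric] using D by (simp add: K.comp_assoc_eq[OF sa(2)])
    finally show "conn X' Z' p' \<bullet> (g \<bullet> g') = conn X' Z' p'" .
  qed
  ultimately have "iso_arr K g" by (rule K.two_sided_iso[OF g(1) g'(1)])
  then show ?thesis using that g by blast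
qed

text \<open>All cones of one map give isomorphic triangles, so that any of them may be used for the standard triangle.\<close>

lemma std_Tri:
  assumes c: "cone X Y f Z i j p q"
  shows "std_triangle X Y Z f j p \<in> Tri K"
proof -
  obtain Z' i' j' p' q' where c': "cone X Y f Z' i' j' p' q'"
    and B: "std_triangle X Y Z' f j' p' \<in> {(hclass C X Y f, hclass C Y Z j, hclass C Z (shift C X) p) | X Y Z f j p.
        is_complex C X \<and> is_complex C Y \<and> f \<in> chain_maps C X Y \<and> is_cone C X Y f Z j p}" (is "_ \<in> ?B")
    using cone_exists[OF coneD(1)[OF c]] .
  obtain R where R: "K = with_triangles R ?B" unfolding homotopy_cat_def by blast
  have ti: "triangle_iso K = triangle_iso R" unfolding R by (rule triangle_iso_with_triangles)
  have T: "Tri K = {t. \<exists>t' \<in> ?B. triangle_iso K t t'}" unfolding ti unfolding R by (rule Tri_with_triangles)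
  note O = coneD(2-4)[OF c] coneD(4)[OF c']
  obtain g where g: "g \<in> Hom K Z Z'" "iso_arr K g" "g \<bullet> arr Y Z j = arr Y Z' j' \<bullet> Ident K Y"
    "ShA K (Ident K X) \<bullet> conn X Z p = conn X Z' p' \<bullet> g"
    by (rule std_compare[OF c c', of "Ident K X" "Ident K Y"]) (use O coneD(1)[OF c] in \<open>auto simp: Hom_iff\<close>)
  have "triangle_iso K (std_triangle X Y Z f j p) (std_triangle X Y Z' f j' p')"
    unfolding std_triangle_def triangle_iso_iff
    by (intro conjI std_typed[OF c] std_typed[OF c'] exI[of _ "Ident K X"] exI[of _ "Ident K Y"] exI[of _ g] g)
      (use O g(1) coneD(1)[OF c] in \<open>auto simp: Hom_iff\<close>)
  then show ?thesis using B unfolding T by blast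
qed

lemma Tri_I:
  assumes c: "cone X Y f Z i j p q" and h: "h \<in> Hom K Z Z'" "h' \<in> Hom K Z' Z" "h' \<bullet> h = Ident K Z" "h \<bullet> h' = Ident K Z'"
  shows "(arr X Y f, h \<bullet> arr Y Z j, conn X Z p \<bullet> h') \<in> Tri K"
proof -
  note H = h(1,2)[unfolded Hom_iff] coneD(1)[OF c] chn_j[OF c] chn_p[OF c] coneD(2-4)[OF c]
  have ty: "typed_triangle K (arr X Y f) (h \<bullet> arr Y Z j) (conn X Z p \<bullet> h')"
    unfolding typed_triangle_def using H by simp
  have "triangle_iso K (arr X Y f, h \<bullet> arr Y Z j, conn X Z p \<bullet> h') (std_triangle X Y Z f j p)"
    unfolding std_triangle_def triangle_iso_iff
    by (intro conjI ty std_typed[OF c] exI[of _ "Ident K X"] exI[of _ "Ident K Y"] exI[of _ h'] K.iso_arrI[OF h(2,1) h(4,3)])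
      (use H in \<open>auto simp: Hom_iff K.comp_assoc_eq[OF h(3)]\<close>)
  then show ?thesis using Tri_closed_K std_Tri[OF c] by blast
qed

lemma Tri_typed_K:
  assumes "(u, v, w) \<in> Tri K"
  shows "typed_triangle K u v w"
  using Tri_E[OF assms] by (metis triangle_iso_iff std_triangle_def)

lemma Tri_std:
  assumes T: "(u, v, w) \<in> Tri K"
  obtains X Y f Z i j p q h h' where "cone X Y f Z i j p q" "u = arr X Y f" "v = h \<bullet> arr Y Z j"
    "w = conn X Z p \<bullet> h'" "h \<in> Hom K Z (Cod K v)" "h' \<in> Hom K (Cod K v) Z"
    "h' \<bullet> h = Ident K Z" "h \<bullet> h' = Ident K (Cod K v)"
proof -
  note ty = Tri_typed_K[OF T, unfolded typed_triangle_def]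
  obtain X1 Y1 f1 Z1 i1 j1 p1 q1 where c1: "cone X1 Y1 f1 Z1 i1 j1 p1 q1" and ti: "triangle_iso K (u, v, w) (std_triangle X1 Y1 Z1 f1 j1 p1)"
    using Tri_E[OF T] .
  obtain a b c where 1: "iso_arr K a" "iso_arr K b" "iso_arr K c" "a \<in> Hom K (Dom K u) X1" "b \<in> Hom K (Cod K u) Y1" "c \<in> Hom K (Cod K v) Z1"
    "b \<bullet> u = arr X1 Y1 f1 \<bullet> a" "c \<bullet> v = arr Y1 Z1 j1 \<bullet> b"
    "ShA K a \<bullet> w = conn X1 Z1 p1 \<bullet> c"
    using ti unfolding std_triangle_def triangle_iso_iff by auto
  obtain X Y f where f: "chn X Y f" "u = arr X Y f" "Dom K u = X" "Cod K u = Y" using ty by (auto simp: K_Arr)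
  obtain Z i j p q where c0: "cone X Y f Z i j p q" using cone_ex[OF f(1)] .
  obtain g where g: "g \<in> Hom K Z Z1" "iso_arr K g" "g \<bullet> arr Y Z j = arr Y1 Z1 j1 \<bullet> b"
    "ShA K a \<bullet> conn X Z p = conn X1 Z1 p1 \<bullet> g"
    by (rule std_compare[OF c0 c1 _ 1(1) _ 1(2)]) (use 1(4,5,7) f in auto)
  note D = 1(4-6)[unfolded Hom_iff] g(1)[unfolded Hom_iff] ty f(1,3,4) coneD(1)[OF c1] chn_j[OF c1] chn_p[OF c1]
    chn_j[OF c0] chn_p[OF c0] coneD(2-4)[OF c0] coneD(2-4)[OF c1]
  obtain c' where c': "c' \<in> Arr K" "Dom K c' = Z1" "Cod K c' = Cod K v" "c' \<bullet> c = Ident K (Cod K v)" "c \<bullet> c' = Ident K Z1"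
    using K.iso_arrE[OF 1(3)] D by metis
  obtain g' where g': "g' \<in> Arr K" "Dom K g' = Z1" "Cod K g' = Z" "g' \<bullet> g = Ident K Z" "g \<bullet> g' = Ident K Z1"
    using K.iso_arrE[OF g(2)] D by metis
  obtain a' where a': "a' \<in> Arr K" "Dom K a' = X1" "Cod K a' = X" "a' \<bullet> a = Ident K X"
    using K.iso_arrE[OF 1(1)] D by metis
  note D = D c'(1-3) g'(1-3) a'(1-3)
  have sa: "ShA K a' \<bullet> ShA K a = Ident K (shift C X)" using D a'(4) by (simp flip: K.sha_comp)
  have cg: "c' \<bullet> g \<in> Hom K Z (Cod K v)" "g' \<bullet> c \<in> Hom K (Cod K v) Z" using D by (simp_all add: Hom_iff)
  have "v = c' \<bullet> (c \<bullet> v)" using D by (simp add: K.comp_assoc_eq[OF c'(4)])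
  also have "\<dots> = (c' \<bullet> g) \<bullet> arr Y Z j" unfolding 1(8) g(3)[symmetric] using D by simp
  finally have v: "v = (c' \<bullet> g) \<bullet> arr Y Z j" .
  have "w = ShA K a' \<bullet> (ShA K a \<bullet> w)" using D by (simp add: K.comp_assoc_eq[OF sa])
  also have "\<dots> = ShA K a' \<bullet> (conn X1 Z1 p1 \<bullet> (g \<bullet> (g' \<bullet> c)))"
    unfolding 1(9) using D by (simp add: K.comp_assoc_eq[OF g'(5)])
  also have "\<dots> = ShA K a' \<bullet> ((conn X1 Z1 p1 \<bullet> g) \<bullet> (g' \<bullet> c))" using D by simp
  also have "\<dots> = conn X Z p \<bullet> (g' \<bullet> c)"
    unfolding g(4)[symmetric] using D by (simp add: K.comp_assoc_eq[OF sa])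
  finally have w: "w = conn X Z p \<bullet> (g' \<bullet> c)" .
  have i: "(g' \<bullet> c) \<bullet> (c' \<bullet> g) = Ident K Z" "(c' \<bullet> g) \<bullet> (g' \<bullet> c) = Ident K (Cod K v)"
    using D c'(4,5) g'(4,5) by (simp_all add: K.comp_assoc_eq[OF c'(5)] K.comp_assoc_eq[OF g'(5)])
  show ?thesis by (rule that[OF c0 f(2) v w cg i])
qed

lemma K_zero:
  assumes "X \<in> Ob" "Y \<in> Ob"
  shows "arr X Y 0 \<in> Hom K X Y" "a \<in> Hom K Y Z \<Longrightarrow> a \<bullet> arr X Y 0 = arr X Z 0"
    "b \<in> Hom K W X \<Longrightarrow> arr X Y 0 \<bullet> b = arr W Y 0"
proof -
  note z = chn_zero[OF assms]
  show "arr X Y 0 \<in> Hom K X Y" by (rule arr_Hom[OF z])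
  show "a \<in> Hom K Y Z \<Longrightarrow> a \<bullet> arr X Y 0 = arr X Z 0" by (elim K_HomE) (simp add: K_comp[OF z])
  show "b \<in> Hom K W X \<Longrightarrow> arr X Y 0 \<bullet> b = arr W Y 0" by (elim K_HomE) (simp add: K_comp[OF _ z])
qed

lemma arr_zero_iff: "chn X Y x \<Longrightarrow> arr X Y x = arr X Y 0 \<longleftrightarrow> null X Y x"
  using arr_eq_iff[of X Y x 0] chn_zero chnD by simp

text \<open>The long exact Hom sequences of a distinguished triangle.\<close>

lemma K_comp_uv:
  assumes "(u, v, w) \<in> Tri K"
  shows "v \<bullet> u = arr (Dom K u) (Cod K v) 0"
proof -
  obtain X Y f Z i j p q h h' where S: "cone X Y f Z i j p q" "u = arr X Y f" "v = h \<bullet> arr Y Z j" "h \<in> Hom K Z (Cod K v)"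
    using Tri_std[OF assms] by metis
  note D = coneD(1)[OF S(1)] chn_j[OF S(1)] coneD(2-4)[OF S(1)] S(4)[unfolded Hom_iff]
  have "arr Y Z j \<bullet> arr X Y f = arr X Z 0"
    unfolding K_comp[OF D(1,2)] using arr_zero_iff[OF chn_mult[OF D(1,2)]] null_jf[OF S(1)] by simp
  then have "v \<bullet> u = h \<bullet> arr X Z 0" unfolding S(2) by (subst S(3)) (use D in simp)
  then show ?thesis using K_zero(2)[OF D(3,5) S(4)] S(2) by simp
qed

lemma K_comp_uw:
  assumes "(u, v, w) \<in> Tri K"
  shows "ShA K u \<bullet> w = arr (Cod K v) (shift C (Cod K u)) 0"
proof -
  obtain X Y f Z i j p q h h' where S: "cone X Y f Z i j p q" "u = arr X Y f" "w = conn X Z p \<bullet> h'" "h' \<in> Hom K (Cod K v) Z"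
    using Tri_std[OF assms] by metis
  note D = coneD(1)[OF S(1)] chn_p[OF S(1)] coneD(2-4)[OF S(1)] S(4)[unfolded Hom_iff]
  have n: "null Z (shift C Y) (\<sigma> Y * (f * \<tau> X) * (\<sigma> X * p))"
    using null_fp[OF S(1)] coneU[OF S(1)] by (simp add: mult.assoc sd[OF D(3)])
  have "ShA K u \<bullet> conn X Z p = arr Z (shift C Y) 0"
    unfolding S(2) K_ShA[OF D(1)] K_comp[OF D(2) chn_shift[OF D(1)]]
    using arr_zero_iff[OF chn_mult[OF D(2) chn_shift[OF D(1)]]] n by simp
  moreover have "ShA K u \<bullet> w = (ShA K u \<bullet> conn X Z p) \<bullet> h'" unfolding S(2,3) using D by simp
  ultimately show ?thesis using K_zero(3)[OF D(5) s_Ob[OF D(4)] S(4)] S(2) by simp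
qed

lemma K_factor_u:
  assumes T: "(u, v, w) \<in> Tri K" and x: "x \<in> Hom K W (Cod K u)" and n: "v \<bullet> x = arr W (Cod K v) 0"
  obtains a where "a \<in> Hom K W (Dom K u)" "u \<bullet> a = x"
proof -
  obtain X Y f Z i j p q h h' where S: "cone X Y f Z i j p q" "u = arr X Y f" "v = h \<bullet> arr Y Z j" "h \<in> Hom K Z (Cod K v)"
    "h' \<in> Hom K (Cod K v) Z" "h' \<bullet> h = Ident K Z" using Tri_std[OF T] by metis
  note D = coneD(1)[OF S(1)] chn_j[OF S(1)] coneD(2-4)[OF S(1)] S(4,5)[unfolded Hom_iff]
  obtain y where y: "chn W Y y" "x = arr W Y y" using x unfolding S(2) by (elim K_HomE) simp
  have W: "W \<in> Ob" "Cod K v \<in> Ob" using chnD[OF y(1)] D K.Cod_Obj[of h] by auto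
  have "arr Y Z j \<bullet> x = h' \<bullet> ((h \<bullet> arr Y Z j) \<bullet> x)" using D y by (simp add: K.comp_assoc_eq[OF S(6)])
  also have "\<dots> = arr W Z 0" unfolding S(3)[symmetric] n by (rule K_zero(2)[OF W S(5)])
  finally have "null W Z (j * y)" unfolding y(2) K_comp[OF y(1) D(2)] using arr_zero_iff[OF chn_mult[OF y(1) D(2)]] by simp
  then obtain a where a: "chn W X a" "null W Y (y - f * a)" by (rule cone_factor_through_f[OF S(1) y(1)])
  have "u \<bullet> arr W X a = x"
    unfolding S(2) y(2) K_comp[OF a(1) D(1)] using a(2) arr_eq_iff[OF y(1) chn_mult[OF a(1) D(1)]] by simp
  then show ?thesis using that arr_Hom[OF a(1)] S(2) by simp
qed

lemma K_factor_v:
  assumes T: "(u, v, w) \<in> Tri K" and x: "x \<in> Hom K (Cod K u) V" and n: "x \<bullet> u = arr (Dom K u) V 0"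
  obtains b where "b \<in> Hom K (Cod K v) V" "b \<bullet> v = x"
proof -
  obtain X Y f Z i j p q h h' where S: "cone X Y f Z i j p q" "u = arr X Y f" "v = h \<bullet> arr Y Z j" "h \<in> Hom K Z (Cod K v)"
    "h' \<in> Hom K (Cod K v) Z" "h' \<bullet> h = Ident K Z" using Tri_std[OF T] by metis
  note D = coneD(1)[OF S(1)] chn_j[OF S(1)] coneD(2-4)[OF S(1)] S(4,5)[unfolded Hom_iff]
  obtain y where y: "chn Y V y" "x = arr Y V y" using x unfolding S(2) by (elim K_HomE) simp
  have "null X V (y * f)" using n arr_zero_iff[OF chn_mult[OF D(1) y(1)]] by (simp add: S(2) y(2) K_comp[OF D(1) y(1)])
  then obtain b where b: "chn Z V b" "b * j = y" by (rule cone_factor_through_j[OF S(1) y(1)])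
  have "(arr Z V b \<bullet> h') \<bullet> v = arr Z V b \<bullet> arr Y Z j"
    by (subst S(3)) (use D b in \<open>simp add: K.comp_assoc_eq[OF S(6)]\<close>)
  also have "\<dots> = x" unfolding K_comp[OF D(2) b(1)] b(2) y(2) ..
  finally show ?thesis using that[of "arr Z V b \<bullet> h'"] D b by (simp add: Hom_iff)
qed

lemma K_factor_shift:
  assumes T: "(u, v, w) \<in> Tri K" and x: "x \<in> Hom K (Dom K u) V" and n: "ShA K x \<bullet> w = arr (Cod K v) (shift C V) 0"
  obtains b where "b \<in> Hom K (Cod K u) V" "b \<bullet> u = x"
proof -
  obtain X Y f Z i j p q h h' where S: "cone X Y f Z i j p q" "u = arr X Y f" "w = conn X Z p \<bullet> h'" "h \<in> Hom K Z (Cod K v)"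
    "h' \<in> Hom K (Cod K v) Z" "h' \<bullet> h = Ident K Z" using Tri_std[OF T] by metis
  note D = coneD(1)[OF S(1)] chn_p[OF S(1)] coneD(2-4)[OF S(1)] S(4,5)[unfolded Hom_iff]
  obtain y where y: "chn X V y" "x = arr X V y" using x unfolding S(2) by (elim K_HomE) simp
  have V: "V \<in> Ob" "Cod K v \<in> Ob" "shift C V \<in> Ob" using chnD[OF y(1)] D K.Cod_Obj[of h] s_Ob by auto
  have "ShA K x \<bullet> conn X Z p = (ShA K x \<bullet> w) \<bullet> h"
    unfolding S(3) using D y S(6) by (simp add: K_ShA[OF y(1)] chn_shift[OF y(1)])
  also have "\<dots> = arr Z (shift C V) 0" unfolding n by (rule K_zero(3)[OF V(2,3) S(4)])
  finally have "arr Z (shift C V) (\<sigma> V * (y * \<tau> X) * (\<sigma> X * p)) = arr Z (shift C V) 0"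
    unfolding y(2) K_ShA[OF y(1)] K_comp[OF D(2) chn_shift[OF y(1)]] .
  then have "null Z (shift C V) (\<sigma> V * (y * p))"
    using arr_zero_iff[OF chn_mult[OF D(2) chn_shift[OF y(1)]]] unit[OF chnD(3)[OF y(1)]] by (simp add: mult.assoc sd[OF D(3)])
  then obtain b where b: "chn Y V b" "null X V (y - b * f)" by (rule cone_factor_shift_through_f[OF S(1) y(1)])
  have "arr Y V b \<bullet> u = x"
    unfolding S(2) y(2) K_comp[OF D(1) b(1)] using b(2) arr_eq_iff[OF y(1) chn_mult[OF D(1) b(1)]] by simp
  then show ?thesis using that arr_Hom[OF b(1)] S(2) by simp
qed

lemma K_difference:
  assumes f: "f \<in> Hom K X Y" and g: "g \<in> Hom K X Y"
  obtains \<delta> where "\<delta> \<in> Hom K X Y"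
    "\<And>W a. a \<in> Hom K W X \<Longrightarrow> f \<bullet> a = g \<bullet> a \<longleftrightarrow> \<delta> \<bullet> a = arr W Y 0"
    "\<And>Z b. b \<in> Hom K Y Z \<Longrightarrow> b \<bullet> f = b \<bullet> g \<longleftrightarrow> b \<bullet> \<delta> = arr X Z 0"
proof -
  obtain x where x: "chn X Y x" "f = arr X Y x" using f by (rule K_HomE)
  obtain y where y: "chn X Y y" "g = arr X Y y" using g by (rule K_HomE)
  note xy = chn_diff[OF x(1) y(1)]
  have 1: "f \<bullet> a = g \<bullet> a \<longleftrightarrow> arr X Y (x - y) \<bullet> a = arr W Y 0" if a: "a \<in> Hom K W X" for W a
  proof -
    obtain z where z: "chn W X z" "a = arr W X z" using a by (rule K_HomE)
    show ?thesis unfolding x(2) y(2) z(2) K_comp[OF z(1) x(1)] K_comp[OF z(1) y(1)] K_comp[OF z(1) xy]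
      unfolding arr_eq_iff[OF chn_mult[OF z(1) x(1)] chn_mult[OF z(1) y(1)]] arr_zero_iff[OF chn_mult[OF z(1) xy]]
      by (simp add: algebra_simps)
  qed
  have 2: "b \<bullet> f = b \<bullet> g \<longleftrightarrow> b \<bullet> arr X Y (x - y) = arr X Z 0" if b: "b \<in> Hom K Y Z" for Z b
  proof -
    obtain z where z: "chn Y Z z" "b = arr Y Z z" using b by (rule K_HomE)
    show ?thesis unfolding x(2) y(2) z(2) K_comp[OF x(1) z(1)] K_comp[OF y(1) z(1)] K_comp[OF xy z(1)]
      unfolding arr_eq_iff[OF chn_mult[OF x(1) z(1)] chn_mult[OF y(1) z(1)]] arr_zero_iff[OF chn_mult[OF xy z(1)]]
      by (simp add: algebra_simps)
  qed
  show ?thesis by (rule that[OF arr_Hom[OF xy] 1 2])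
qed

lemma homotopy_equivalence:
  assumes "chn X Y x" "chn Y X y" "x * y = e Y" "null X X (e X - y * x)"
  shows "arr X Y x \<in> Hom K X Y" "arr Y X y \<in> Hom K Y X" "arr Y X y \<bullet> arr X Y x = Ident K X" "arr X Y x \<bullet> arr Y X y = Ident K Y"
  using arr_Hom[OF assms(1)] arr_Hom[OF assms(2)] chnD(1,2)[OF assms(1)]
    arr_eq_iff[OF chn_e chn_mult[OF assms(1,2)]] assms(3,4)
  by (simp_all add: K_comp[OF assms(1,2)] K_comp[OF assms(2,1)] K_Ident)

lemma extend_second_K:
  assumes "v \<in> Arr K"
  shows "\<exists>u w. (u, v, w) \<in> Tri K"
proof -
  obtain Y Z f where f: "chn Y Z f" "v = arr Y Z f" using assms by (auto simp: K_Arr)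
  obtain C' i j p q where c: "cone Y Z f C' i j p q" using cone_ex[OF f(1)] .
  obtain X where X: "X \<in> Ob" "shift C X = C'" using unshift_complex[OF coneD(4)[OF c]] by blast
  note c = c[folded X(2)]
  obtain W i' j' p' q' where c': "cone X Y (p * \<sigma> X) W i' j' p' q'" using cone_ex[OF chn_unrotate[OF c X(1)]] .
  obtain \<theta> \<psi> where t: "chn W Z \<theta>" "chn Z W \<psi>" "\<theta> * \<psi> = e Z" "null W W (e W - \<psi> * \<theta>)" "\<theta> * j' = f"
    by (rule cone_unrotate[OF c X(1) c'])
  have "arr W Z \<theta> \<bullet> arr Y W j' = v" unfolding f(2) K_comp[OF chn_j[OF c'] t(1)] t(5) ..
  then show ?thesis using Tri_I[OF c' homotopy_equivalence[OF t(1-4)]] by metis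
qed

theorem triangulated_K: "triangulated K"
proof
  show "typed_triangle K u v w" if "(u, v, w) \<in> Tri K" for u v w by (rule Tri_typed_K[OF that])
  show "t \<in> Tri K" if "triangle_iso K t t'" "t' \<in> Tri K" for t t' by (rule Tri_closed_K[OF that])
next
  fix X assume "X \<in> Obj K"
  then have X: "X \<in> Ob" by simp
  obtain Z i j p q where c: "cone X X (e X) Z i j p q" using cone_ex[OF chn_e[OF X]] .
  have T: "(Ident K X, arr X Z j, conn X Z p) \<in> Tri K"
    using std_Tri[OF c] unfolding std_triangle_def K_Ident[OF X] .
  note Z = coneD(4)[OF c]
  have n: "null Z Z (e Z)" by (rule cone_identity[OF c])
  have "f = arr W Z 0" if f: "f \<in> Hom K W Z" for W f
  proof -
    obtain x where x: "chn W Z x" "f = arr W Z x" using f by (rule K_HomE)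
    show ?thesis using null_mult_right[OF n x(1)] unit(1)[OF chnD(3)[OF x(1)]] arr_zero_iff[OF x(1)] x(2) by simp
  qed
  moreover have "f = arr Z W 0" if f: "f \<in> Hom K Z W" for W f
  proof -
    obtain x where x: "chn Z W x" "f = arr Z W x" using f by (rule K_HomE)
    show ?thesis using null_mult_left[OF n x(1)] unit(2)[OF chnD(3)[OF x(1)]] arr_zero_iff[OF x(1)] x(2) by simp
  qed
  ultimately have "zero_object K Z" unfolding zero_object_def using Z K_zero(1) by (auto intro!: ex1I)
  then show "\<exists>v w. (Ident K X, v, w) \<in> Tri K \<and> zero_object K (Cod K v)" using T by (intro exI conjI) auto
next
  fix u assume "u \<in> Arr K"
  then obtain X Y f where f: "chn X Y f" "u = arr X Y f" by (auto simp: K_Arr)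
  obtain Z i j p q where c: "cone X Y f Z i j p q" using cone_ex[OF f(1)] .
  show "\<exists>v w. (u, v, w) \<in> Tri K" using std_Tri[OF c] unfolding std_triangle_def f(2) by blast
next
  fix v assume "v \<in> Arr K" then show "\<exists>u w. (u, v, w) \<in> Tri K" by (rule extend_second_K)
next
  fix X w assume "X \<in> Obj K" "w \<in> Arr K" "Cod K w = Sh K X"
  then obtain Z g where X: "X \<in> Ob" and g: "chn Z (shift C X) g" "w = arr Z (shift C X) g" by (auto simp: K_Arr)
  obtain Z' where Z': "Z' \<in> Ob" "shift C Z' = Z" using unshift_complex chnD[OF g(1)] by blast
  note g = g[folded Z'(2)]
  obtain Y i j p q where c: "cone Z' X (- (\<tau> X * (g * \<sigma> Z'))) Y i j p q"
    using cone_ex[OF chn_neg[OF chn_unshift[OF g(1) Z'(1) X]]] .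
  obtain W i' j' p' q' where c': "cone X Y j W i' j' p' q'" using cone_ex[OF chn_j[OF c]] .
  obtain \<theta> \<psi> where t: "chn W (shift C Z') \<theta>" "chn (shift C Z') W \<psi>" "\<theta> * \<psi> = e (shift C Z')" "null W W (e W - \<psi> * \<theta>)"
    "\<theta> * j' = \<sigma> Z' * p" "(\<sigma> X * p') * \<psi> = - (\<sigma> X * (- (\<tau> X * (g * \<sigma> Z')) * \<tau> Z'))"
    by (rule cone_rotate[OF c c'])
  have "(\<sigma> X * p') * \<psi> = g" unfolding t(6) using unit[OF chnD(3)[OF g(1)]]
    by (simp add: mult.assoc sd[OF X] sd[OF Z'(1)])
  then have "conn X W p' \<bullet> arr (shift C Z') W \<psi> = w"
    unfolding g(2) K_comp[OF t(2) chn_p[OF c']] by simp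
  then show "\<exists>u v. (u, v, w) \<in> Tri K \<and> Dom K u = X"
    using Tri_I[OF c' homotopy_equivalence[OF t(1-4)]] by (intro exI conjI) auto
next
  fix u v w assume T: "(u, v, w) \<in> Tri K"
  obtain X Y f Z i j p q h h' where S: "cone X Y f Z i j p q" "u = arr X Y f" "v = h \<bullet> arr Y Z j"
    "w = conn X Z p \<bullet> h'" "h \<in> Hom K Z (Cod K v)" "h' \<in> Hom K (Cod K v) Z"
    "h' \<bullet> h = Ident K Z" "h \<bullet> h' = Ident K (Cod K v)" by (rule Tri_std[OF T])
  obtain W i' j' p' q' where c': "cone Y Z j W i' j' p' q'" using cone_ex[OF chn_j[OF S(1)]] .
  obtain \<theta> \<psi> where t: "chn W (shift C X) \<theta>" "chn (shift C X) W \<psi>" "\<theta> * \<psi> = e (shift C X)" "null W W (e W - \<psi> * \<theta>)"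
    "\<theta> * j' = \<sigma> X * p" by (rule cone_rotate[OF S(1) c'])
  note D = chn_j[OF S(1)] chn_p[OF S(1)] coneD(2-4)[OF S(1)] s_Ob[OF coneD(2)[OF S(1)]] S(5,6)[unfolded Hom_iff]
  obtain x where x: "(arr Y Z j, arr W (shift C X) \<theta> \<bullet> arr Z W j', x) \<in> Tri K"
    using Tri_I[OF c' homotopy_equivalence[OF t(1-4)]] by blast
  have "arr W (shift C X) \<theta> \<bullet> arr Z W j' = conn X Z p" unfolding K_comp[OF chn_j[OF c'] t(1)] t(5) ..
  note x = x[unfolded this]
  note xt = Tri_typed_K[OF x, unfolded typed_triangle_def]
  have uX: "Dom K u = X" "Cod K u = Y" using S(2) by simp_all
  note vt = Tri_typed_K[OF T, unfolded typed_triangle_def uX]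
  have ty: "typed_triangle K v w x" using xt vt D unfolding typed_triangle_def by simp
  have iso: "iso_arr K h'" by (rule K.iso_arrI[OF S(6,5) S(8,7)])
  have "triangle_iso K (v, w, x) (arr Y Z j, conn X Z p, x)"
    unfolding triangle_iso_iff
  proof (intro conjI ty Tri_typed_K[OF x], rule exI[of _ "Ident K Y"], rule exI[of _ h'],
      rule exI[of _ "Ident K (shift C X)"], intro conjI iso)
    show "h' \<bullet> v = arr Y Z j \<bullet> Ident K Y" by (subst S(3)) (use D in \<open>simp add: K.comp_assoc_eq[OF S(7)]\<close>)
    show "Ident K (shift C X) \<bullet> w = conn X Z p \<bullet> h'" using S(4) D by simp
    show "Ident K Y \<in> Hom K (Dom K v) (Dom K (arr Y Z j))" using vt D by (simp add: Hom_iff)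
    show "Ident K (shift C X) \<in> Hom K (Cod K w) (Cod K (conn X Z p))"
      using vt D by (simp add: Hom_iff)
  qed (use D xt vt in \<open>simp_all add: Hom_iff\<close>)
  then show "\<exists>x. (v, w, x) \<in> Tri K" using Tri_closed_K x by blast
next
  fix u v w u' v' w' b c
  assume T: "(u, v, w) \<in> Tri K" "(u', v', w') \<in> Tri K" and b: "b \<in> Hom K (Cod K u) (Cod K u')" and c: "c \<in> Hom K (Cod K v) (Cod K v')"
    and e: "c \<bullet> v = v' \<bullet> b"
  note D = Tri_typed_K[OF T(1), unfolded typed_triangle_def] Tri_typed_K[OF T(2), unfolded typed_triangle_def] b[unfolded Hom_iff] c[unfolded Hom_iff]
  have O: "Dom K u \<in> Ob" "Cod K v \<in> Ob" using D K.Dom_Obj[of u] K.Cod_Obj[of v] by auto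
  have "v' \<bullet> (b \<bullet> u) = (c \<bullet> v) \<bullet> u" unfolding e using D by simp
  also have "\<dots> = c \<bullet> (v \<bullet> u)" using D by simp
  also have "\<dots> = arr (Dom K u) (Cod K v') 0" unfolding K_comp_uv[OF T(1)] by (rule K_zero(2)[OF O c])
  finally have z: "v' \<bullet> (b \<bullet> u) = arr (Dom K u) (Cod K v') 0" .
  have "b \<bullet> u \<in> Hom K (Dom K u) (Cod K u')" using D by (simp add: Hom_iff)
  then obtain a where "a \<in> Hom K (Dom K u) (Dom K u')" "u' \<bullet> a = b \<bullet> u" by (rule K_factor_u[OF T(2) _ z])
  then show "\<exists>a \<in> Hom K (Dom K u) (Dom K u'). b \<bullet> u = u' \<bullet> a" by metis
next
  fix u v w u' v' w' a c
  assume T: "(u, v, w) \<in> Tri K" "(u', v', w') \<in> Tri K" and a: "a \<in> Hom K (Dom K u) (Dom K u')" and c: "c \<in> Hom K (Cod K v) (Cod K v')"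
    and e: "ShA K a \<bullet> w = w' \<bullet> c"
  note D = Tri_typed_K[OF T(1), unfolded typed_triangle_def] Tri_typed_K[OF T(2), unfolded typed_triangle_def] a[unfolded Hom_iff] c[unfolded Hom_iff]
  have O: "Cod K v' \<in> Ob" "shift C (Cod K u') \<in> Ob" using D K.Cod_Obj[of v'] K.Cod_Obj[of u'] s_Ob by auto
  have "ShA K (u' \<bullet> a) \<bullet> w = ShA K u' \<bullet> (ShA K a \<bullet> w)" using D by simp
  also have "\<dots> = (ShA K u' \<bullet> w') \<bullet> c" unfolding e using D by simp
  also have "\<dots> = arr (Cod K v) (shift C (Cod K u')) 0" unfolding K_comp_uw[OF T(2)] by (rule K_zero(3)[OF O c])
  finally have z: "ShA K (u' \<bullet> a) \<bullet> w = arr (Cod K v) (shift C (Cod K u')) 0" .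
  have "u' \<bullet> a \<in> Hom K (Dom K u) (Cod K u')" using D by (simp add: Hom_iff)
  then obtain b where "b \<in> Hom K (Cod K u) (Cod K u')" "b \<bullet> u = u' \<bullet> a" by (rule K_factor_shift[OF T(1) _ z])
  then show "\<exists>b \<in> Hom K (Cod K u) (Cod K u'). b \<bullet> u = u' \<bullet> a" by blast
next
  fix u v w v' w'
  assume T: "(u, v, w) \<in> Tri K" "(u, v', w') \<in> Tri K"
  obtain X Y f Z i j p q h h' where S: "cone X Y f Z i j p q" "u = arr X Y f" "v = h \<bullet> arr Y Z j"
    "w = conn X Z p \<bullet> h'" "h \<in> Hom K Z (Cod K v)" "h' \<in> Hom K (Cod K v) Z"
    "h' \<bullet> h = Ident K Z" "h \<bullet> h' = Ident K (Cod K v)" by (rule Tri_std[OF T(1)])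
  obtain X1 Y1 f1 Z1 i1 j1 p1 q1 h1 h1' where S1: "cone X1 Y1 f1 Z1 i1 j1 p1 q1" "u = arr X1 Y1 f1" "v' = h1 \<bullet> arr Y1 Z1 j1"
    "w' = conn X1 Z1 p1 \<bullet> h1'" "h1 \<in> Hom K Z1 (Cod K v')" "h1' \<in> Hom K (Cod K v') Z1"
    "h1' \<bullet> h1 = Ident K Z1" "h1 \<bullet> h1' = Ident K (Cod K v')" by (rule Tri_std[OF T(2)])
  have XY: "X1 = X" "Y1 = Y" using arg_cong[OF S(2)[symmetric, unfolded S1(2)], of "Dom K"] arg_cong[OF S(2)[symmetric, unfolded S1(2)], of "Cod K"] by auto
  note S1 = S1[unfolded XY]
  have O: "X \<in> Ob" "Y \<in> Ob" using coneD[OF S(1)] by auto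
  obtain g where g: "g \<in> Hom K Z Z1" "iso_arr K g" "g \<bullet> arr Y Z j = arr Y Z1 j1 \<bullet> Ident K Y"
    "ShA K (Ident K X) \<bullet> conn X Z p = conn X Z1 p1 \<bullet> g"
    by (rule std_compare[OF S(1) S1(1), of "Ident K X" "Ident K Y"])
      (use O S(2) S1(2) coneD(1)[OF S(1)] in \<open>auto simp: Hom_iff\<close>)
  note D = chn_j[OF S(1)] chn_p[OF S(1)] chn_j[OF S1(1)] chn_p[OF S1(1)] coneD(2-4)[OF S(1)] S(5,6)[unfolded Hom_iff] S1(5,6)[unfolded Hom_iff] g(1)[unfolded Hom_iff]
    s_Ob[OF O(1)]
  have g': "g \<bullet> arr Y Z j = arr Y Z1 j1" "conn X Z1 p1 \<bullet> g = conn X Z p"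
    using g(3,4) D by simp_all
  show "\<exists>c \<in> Hom K (Cod K v) (Cod K v'). iso_arr K c \<and> c \<bullet> v = v' \<and> w = w' \<bullet> c"
  proof (intro bexI[of _ "h1 \<bullet> (g \<bullet> h')"] conjI)
    have "iso_arr K h'" "iso_arr K h1" by (rule K.iso_arrI[OF S(6,5) S(8,7)], rule K.iso_arrI[OF S1(5,6) S1(7,8)])
    then show "iso_arr K (h1 \<bullet> (g \<bullet> h'))" using g(2) D by (intro K.iso_comp) simp_all
    show "(h1 \<bullet> (g \<bullet> h')) \<bullet> v = v'"
      by (subst S(3), subst S1(3)) (use D g' in \<open>simp add: K.comp_assoc_eq[OF S(7)]\<close>)
    show "w = w' \<bullet> (h1 \<bullet> (g \<bullet> h'))"
      unfolding S(4) S1(4) using D by (simp add: K.comp_assoc_eq[OF S1(7)] K.comp_assoc_eq[OF g'(2)])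
    show "h1 \<bullet> (g \<bullet> h') \<in> Hom K (Cod K v) (Cod K v')" using D by (simp add: Hom_iff)
  qed
next
  fix f g assume "f \<in> Arr K" "g \<in> Arr K" "Cod K f = Dom K g"
  then obtain X Y Z x y where x: "chn X Y x" "f = arr X Y x" and y: "chn Y Z y" "g = arr Y Z y" by (auto simp: K_Arr)
  obtain Z1 i1 j1 p1 q1 where c1: "cone X Y x Z1 i1 j1 p1 q1" using cone_ex[OF x(1)] .
  obtain Z2 i2 j2 p2 q2 where c2: "cone Y Z y Z2 i2 j2 p2 q2" using cone_ex[OF y(1)] .
  obtain Z3 i3 j3 p3 q3 where c3: "cone X Z (y * x) Z3 i3 j3 p3 q3" using cone_ex[OF chn_mult[OF x(1) y(1)]] .
  define F H where "F = i3 * p1 + j3 * (y * q1)" and "H = i2 * (x * p3) + j2 * q3"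
  note oct = cone_octahedron[OF c1 c2 c3 F_def H_def]
  obtain W iw jw pw qw where c4: "cone Z1 Z3 F W iw jw pw qw" using cone_ex[OF oct(1)] .
  obtain \<theta> \<psi> where t: "chn W Z2 \<theta>" "chn Z2 W \<psi>" "\<theta> * \<psi> = e Z2" "null W W (e W - \<psi> * \<theta>)" "\<theta> * jw = H"
    using oct(7)[OF c4] by blast
  have tH: "arr W Z2 \<theta> \<bullet> arr Z3 W jw = arr Z3 Z2 H" unfolding K_comp[OF chn_j[OF c4] t(1)] t(5) ..
  have T4: "(arr Z1 Z3 F, arr Z3 Z2 H, conn Z1 W pw \<bullet> arr Z2 W \<psi>) \<in> Tri K"
    using Tri_I[OF c4 homotopy_equivalence[OF t(1-4)]] unfolding tH .
  have T: "(f, arr Y Z1 j1, conn X Z1 p1) \<in> Tri K" "(g, arr Z Z2 j2, conn Y Z2 p2) \<in> Tri K"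
    "(g \<bullet> f, arr Z Z3 j3, conn X Z3 p3) \<in> Tri K"
    using std_Tri[OF c1] std_Tri[OF c2] std_Tri[OF c3] unfolding std_triangle_def x(2) y(2) K_comp[OF x(1) y(1)] by auto
  note js = chn_j[OF c1] chn_j[OF c2] chn_j[OF c3] and ps = chn_p[OF c1] chn_p[OF c2] chn_p[OF c3]
  have "\<sigma> Y * p2 * H = \<sigma> Y * (x * \<tau> X) * (\<sigma> X * p3)"
    using oct(6) unit[OF chnD(3)[OF x(1)]] by (simp add: mult.assoc sd[OF chnD(1)[OF x(1)]])
  then have e: "arr Z1 Z3 F \<bullet> arr Y Z1 j1 = arr Z Z3 j3 \<bullet> g"
    "conn X Z3 p3 \<bullet> arr Z1 Z3 F = conn X Z1 p1"
    "arr Z3 Z2 H \<bullet> arr Z Z3 j3 = arr Z Z2 j2"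
    "conn Y Z2 p2 \<bullet> arr Z3 Z2 H = ShA K f \<bullet> conn X Z3 p3"
    unfolding x(2) y(2) K_ShA[OF x(1)] K_comp[OF js(1) oct(1)] K_comp[OF y(1) js(3)] K_comp[OF oct(1) ps(3)] K_comp[OF js(3) oct(2)]
      K_comp[OF oct(2) ps(2)] K_comp[OF ps(3) chn_shift[OF x(1)]]
    using oct(3-5) by simp_all
  show "\<exists>j k l i m n a b x. (f, j, k) \<in> Tri K \<and> (g, l, i) \<in> Tri K \<and> (g \<bullet> f, m, n) \<in> Tri K \<and> (a, b, x) \<in> Tri K \<and>
           a \<in> Hom K (Cod K j) (Cod K m) \<and> b \<in> Hom K (Cod K m) (Cod K l) \<and>
           a \<bullet> j = m \<bullet> g \<and> n \<bullet> a = k \<and> b \<bullet> m = l \<and> i \<bullet> b = ShA K f \<bullet> n"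
    by (intro exI conjI, rule T(1), rule T(2), rule T(3), rule T4) (use e arr_Hom[OF oct(1)] arr_Hom[OF oct(2)] in simp_all)
next
  fix u t w f X g
  assume T: "(u, t, w) \<in> Tri K" and f: "f \<in> Hom K X (Dom K t)" and g: "g \<in> Hom K X (Dom K t)" and e: "t \<bullet> f = t \<bullet> g"
  note D = Tri_typed_K[OF T, unfolded typed_triangle_def]
  obtain \<delta> where \<delta>: "\<delta> \<in> Hom K X (Dom K t)"
    "\<And>W a. a \<in> Hom K W X \<Longrightarrow> f \<bullet> a = g \<bullet> a \<longleftrightarrow> \<delta> \<bullet> a = arr W (Dom K t) 0"
    "\<And>Z b. b \<in> Hom K (Dom K t) Z \<Longrightarrow> b \<bullet> f = b \<bullet> g \<longleftrightarrow> b \<bullet> \<delta> = arr X Z 0"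
    using K_difference[OF f g] by metis
  \<comment> \<open>The difference \<open>\<delta>\<close> of \<open>f\<close> and \<open>g\<close> factors as \<open>u h\<close>, and \<open>s\<close> is the fibre of \<open>h\<close>.\<close>
  have "t \<bullet> \<delta> = arr X (Cod K t) 0" using \<delta>(3)[of t "Cod K t"] e D by (simp add: Hom_iff)
  then obtain h where h: "h \<in> Hom K X (Dom K u)" "u \<bullet> h = \<delta>" using K_factor_u[OF T, of \<delta> X] \<delta>(1) D by auto
  then obtain s w' where s: "(s, h, w') \<in> Tri K" using extend_second_K[of h] by (auto simp: Hom_iff)
  note Ds = Tri_typed_K[OF s, unfolded typed_triangle_def]
  have sH: "s \<in> Hom K (Dom K s) X" using Ds h(1) by (simp add: Hom_iff)
  have O: "Dom K s \<in> Ob" "Dom K u \<in> Ob" using Ds D K.Dom_Obj[of s] K.Dom_Obj[of u] by auto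
  have "\<delta> \<bullet> s = u \<bullet> (h \<bullet> s)" unfolding h(2)[symmetric] using D Ds h(1) by (simp add: Hom_iff)
  also have "\<dots> = arr (Dom K s) (Dom K t) 0"
    unfolding K_comp_uv[OF s] using K_zero(2)[OF O, of u "Cod K u"] h(1) D by (simp add: Hom_iff)
  finally have "f \<bullet> s = g \<bullet> s" using \<delta>(2)[OF sH] by simp
  then show "\<exists>s h w'. (s, h, w') \<in> Tri K \<and> Dom K h = X \<and> Cod K h = Dom K u \<and> f \<bullet> s = g \<bullet> s"
    using s h(1) unfolding Hom_iff by blast
next
  fix s v w f Y g
  assume T: "(s, v, w) \<in> Tri K" and f: "f \<in> Hom K (Cod K s) Y" and g: "g \<in> Hom K (Cod K s) Y" and e: "f \<bullet> s = g \<bullet> s"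
  note D = Tri_typed_K[OF T, unfolded typed_triangle_def]
  obtain \<delta> where \<delta>: "\<delta> \<in> Hom K (Cod K s) Y"
    "\<And>W a. a \<in> Hom K W (Cod K s) \<Longrightarrow> f \<bullet> a = g \<bullet> a \<longleftrightarrow> \<delta> \<bullet> a = arr W Y 0"
    "\<And>Z b. b \<in> Hom K Y Z \<Longrightarrow> b \<bullet> f = b \<bullet> g \<longleftrightarrow> b \<bullet> \<delta> = arr (Cod K s) Z 0"
    using K_difference[OF f g] by metis
  \<comment> \<open>Dually, \<open>\<delta>\<close> factors as \<open>h v\<close>, and \<open>t\<close> is the map to the cone of \<open>h\<close>.\<close>
  have "\<delta> \<bullet> s = arr (Dom K s) Y 0" using \<delta>(2)[of s "Dom K s"] e D by (simp add: Hom_iff)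
  then obtain h where h: "h \<in> Hom K (Cod K v) Y" "h \<bullet> v = \<delta>" using K_factor_v[OF T \<delta>(1)] by metis
  obtain x where x: "chn (Cod K v) Y x" "h = arr (Cod K v) Y x" using h(1) by (rule K_HomE)
  obtain Z i j p q where c: "cone (Cod K v) Y x Z i j p q" using cone_ex[OF x(1)] .
  have t: "(h, arr Y Z j, arr Z (shift C (Cod K v)) (\<sigma> (Cod K v) * p)) \<in> Tri K"
    using std_Tri[OF c] unfolding std_triangle_def x(2) .
  note j = chn_j[OF c] and O = coneD(2-4)[OF c]
  have "arr Y Z j \<bullet> \<delta> = (arr Y Z j \<bullet> h) \<bullet> v" unfolding h(2)[symmetric] using D h(1) j by (simp add: Hom_iff)
  also have "\<dots> = arr (Cod K s) Z 0"
    unfolding K_comp_uv[OF t] using K_zero(3)[OF O(1,3), of v "Cod K s"] h(1) D by (simp add: Hom_iff)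
  finally have "arr Y Z j \<bullet> f = arr Y Z j \<bullet> g" using \<delta>(3)[OF arr_Hom[OF j]] by simp
  then show "\<exists>h t x. (h, t, x) \<in> Tri K \<and> Dom K h = Cod K v \<and> Cod K h = Y \<and> t \<bullet> f = t \<bullet> g"
    using t h(1) arr_Hom[OF j] unfolding Hom_iff by blast
next
  fix u v w assume T: "(u, v, w) \<in> Tri K"
  obtain X Y f Z i j p q h h' where S: "cone X Y f Z i j p q" "u = arr X Y f" "h \<in> Hom K Z (Cod K v)" "h' \<in> Hom K (Cod K v) Z"
    "h' \<bullet> h = Ident K Z" "h \<bullet> h' = Ident K (Cod K v)" by (rule Tri_std[OF T]) blast
  note D = S(3,4)[unfolded Hom_iff] coneD(4)[OF S(1)]
  have O: "Cod K v \<in> Ob" using D K.Cod_Obj[of h] by auto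
  note c = cone_shift[OF S(1)]
  have "ShA K h' \<bullet> ShA K h = Ident K (shift C Z)" "ShA K h \<bullet> ShA K h' = Ident K (shift C (Cod K v))"
    using D S(5,6) O by (simp_all flip: K.sha_comp)
  from Tri_I[OF c _ _ this] obtain w' where
    "(ShA K u, ShA K h \<bullet> arr (shift C Y) (shift C Z) (\<sigma> Z * (j * \<tau> Y)), w') \<in> Tri K"
    using D unfolding S(2) K_ShA[OF coneD(1)[OF S(1)]] by (simp add: Hom_iff)
  moreover have "Cod K (ShA K h \<bullet> arr (shift C Y) (shift C Z) (\<sigma> Z * (j * \<tau> Y))) = Sh K (Cod K v)"
    using D chn_j[OF c] by simp
  ultimately show "\<exists>v' w'. (ShA K u, v', w') \<in> Tri K \<and> Cod K v' = Sh K (Cod K v)" by blast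
qed

end

section \<open>Exactness in abelian categories\<close>

context preadditive_acat
begin

text \<open>A single arrow becomes an element of the ring as the graded map that is constant. Equations between arrows
  can then be proved by ring arithmetic.\<close>

definition ring_of where
  "ring_of f = act C (\<lambda>_. Dom C f) (\<lambda>_. Cod C f) 0 (\<lambda>_. f)"

lemma const_graded: "f \<in> Arr C \<Longrightarrow> (\<lambda>_. f) \<in> graded_hom C (\<lambda>_. Dom C f) (\<lambda>_. Cod C f) 0"
  by (simp add: graded_hom_def Hom_def)

lemma ring_of_comp:
  assumes "f \<in> Arr C" "g \<in> Arr C" "Cod C f = Dom C g"
  shows "ring_of (g \<cdot> f) = ring_of g * ring_of f"
  using act_mult[OF const_graded[OF assms(1)], of "\<lambda>_. g" "\<lambda>_. Cod C g" 0] const_graded[OF assms(2)] assms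
  by (simp add: ring_of_def)

lemma ring_of_inject:
  assumes "ring_of f = ring_of g" "f \<in> Arr C" "g \<in> Arr C" "Dom C f = Dom C g" "Cod C f = Cod C g"
  shows "f = g"
proof -
  have "(\<lambda>_::int. f) = (\<lambda>_. g)"
    by (rule act_inject[of _ "\<lambda>_. Dom C g" "\<lambda>_. Cod C g" 0])
      (use assms const_graded[OF assms(2)] const_graded[OF assms(3)] in \<open>simp_all add: ring_of_def\<close>)
  then show ?thesis by (rule fun_cong)
qed

lemma add_arr:
  assumes "f \<in> Arr C" "g \<in> Arr C" "Dom C f = Dom C g" "Cod C f = Cod C g"
  shows "f \<boxplus> g \<in> Arr C" "Dom C (f \<boxplus> g) = Dom C g" "Cod C (f \<boxplus> g) = Cod C g"
  using add_Hom[of "Dom C g" "Cod C g" f g] assms by (auto simp: Hom_def)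

lemma neg_arr:
  assumes "f \<in> Arr C"
  shows "Neg C f \<in> Arr C" "Dom C (Neg C f) = Dom C f" "Cod C (Neg C f) = Cod C f"
  using neg_Hom[of "Dom C f" "Cod C f" f] assms by (auto simp: Hom_def)

lemma zero_arr:
  assumes "X \<in> Obj C" "Y \<in> Obj C"
  shows "Zero C X Y \<in> Arr C" "Dom C (Zero C X Y) = X" "Cod C (Zero C X Y) = Y"
  using zero_Hom[OF assms] by (auto simp: Hom_def)

lemma ring_of_add:
  assumes "f \<in> Arr C" "g \<in> Arr C" "Dom C f = Dom C g" "Cod C f = Cod C g"
  shows "ring_of (f \<boxplus> g) = ring_of f + ring_of g"
  using act_add[of "\<lambda>_. f" "\<lambda>_. Dom C g" "\<lambda>_. Cod C g" 0 "\<lambda>_. g"] const_graded[OF assms(1)] const_graded[OF assms(2)]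
    add_arr[OF assms] assms by (simp add: ring_of_def)

lemma ring_of_neg: "f \<in> Arr C \<Longrightarrow> ring_of (Neg C f) = - ring_of f"
  using act_neg[OF const_graded[of f]] neg_arr[of f] by (simp add: ring_of_def)

lemma ring_of_zero: "X \<in> Obj C \<Longrightarrow> Y \<in> Obj C \<Longrightarrow> ring_of (Zero C X Y) = 0"
  using act_zero[of "\<lambda>_. X" "\<lambda>_. Y" 0] zero_arr[of X Y] by (simp add: ring_of_def)

lemma ring_of_ident:
  "f \<in> Arr C \<Longrightarrow> Cod C f = X \<Longrightarrow> ring_of (Ident C X) * ring_of f = ring_of f"
  "f \<in> Arr C \<Longrightarrow> Dom C f = X \<Longrightarrow> ring_of f * ring_of (Ident C X) = ring_of f"
  using ring_of_comp[of f "Ident C X"] ring_of_comp[of "Ident C X" f] by auto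

lemma ring_of_comp_eq:
  assumes "g \<cdot> f = k" "f \<in> Arr C" "g \<in> Arr C" "Cod C f = Dom C g"
  shows "ring_of g * ring_of f = ring_of k" "ring_of g * (ring_of f * z) = ring_of k * z"
  using ring_of_comp[OF assms(2-4)] assms(1) by (simp_all flip: mult.assoc)

lemma ring_of_zero_iff: "f \<in> Hom C X Y \<Longrightarrow> f = Zero C X Y \<longleftrightarrow> ring_of f = 0"
  using ring_of_inject[of f "Zero C X Y"] ring_of_zero[of X Y] zero_arr[of X Y] Hom_objs[of f X Y]
  by (auto simp: Hom_iff)

lemmas ring_arr = comp_arr ident_arr add_arr neg_arr zero_arr
lemmas ring_of_simps = ring_of_comp ring_of_add ring_of_neg ring_of_zero ring_of_ident

lemma epi_zero:
  assumes "f \<in> Hom C X Y" "\<And>Z t. t \<in> Hom C Y Z \<Longrightarrow> t \<cdot> f = Zero C X Z \<Longrightarrow> t = Zero C Y Z"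
  shows "is_epi C f"
  unfolding is_epi_def
proof (intro conjI allI ballI impI)
  note f = assms(1)[unfolded Hom_iff]
  show "f \<in> Arr C" using f by simp
  fix W g h assume "g \<in> Hom C (Cod C f) W" "h \<in> Hom C (Cod C f) W" and e: "g \<cdot> f = h \<cdot> f"
  then have g: "g \<in> Arr C" "Dom C g = Y" "Cod C g = W" and h: "h \<in> Arr C" "Dom C h = Y" "Cod C h = W"
    using f by (auto simp: Hom_iff)
  have O: "X \<in> Obj C" "Y \<in> Obj C" "W \<in> Obj C" using f g by (auto dest: Dom_Obj Cod_Obj)
  have r: "ring_of g * ring_of f = ring_of h * ring_of f" using arg_cong[OF e, of ring_of] f g h by (simp add: ring_of_comp)
  have t: "g \<boxplus> Neg C h \<in> Hom C Y W" using g h by (simp add: Hom_iff ring_arr)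
  have "(g \<boxplus> Neg C h) \<cdot> f = Zero C X W"
    by (rule ring_of_inject) (use f g h O r in \<open>simp_all add: ring_arr ring_of_simps algebra_simps\<close>)
  then have "g \<boxplus> Neg C h = Zero C Y W" by (rule assms(2)[OF t])
  then have "ring_of (g \<boxplus> Neg C h) = 0" using O by (simp add: ring_of_zero)
  then have "ring_of g = ring_of h" using g h by (simp add: ring_arr ring_of_simps)
  then show "g = h" by (rule ring_of_inject) (use g h in simp_all)
qed

lemma epi_cancel_zero:
  assumes "is_epi C f" "f \<in> Hom C X Y" "t \<in> Hom C Y Z" "t \<cdot> f = Zero C X Z"
  shows "t = Zero C Y Z"
proof -
  have "Zero C Y Z \<cdot> f = Zero C X Z" using zero_comp[OF assms(2)] Hom_objs[OF assms(3)] by simp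
  moreover have "Zero C Y Z \<in> Hom C Y Z" using zero_Hom Hom_objs[OF assms(3)] by simp
  ultimately show ?thesis using assms unfolding is_epi_def Ball_def Hom_iff by metis
qed

lemma epi_comp:
  assumes "is_epi C f" "is_epi C g" "f \<in> Hom C X Y" "g \<in> Hom C Y Z"
  shows "is_epi C (g \<cdot> f)"
proof (rule epi_zero[OF Comp_Hom[OF assms(3,4)]])
  fix W t assume t: "t \<in> Hom C Z W" and e: "t \<cdot> (g \<cdot> f) = Zero C X W"
  have "(t \<cdot> g) \<cdot> f = Zero C X W" using e Comp_assoc[OF assms(3,4) t] by simp
  then have "t \<cdot> g = Zero C Y W" by (rule epi_cancel_zero[OF assms(1,3) Comp_Hom[OF assms(4) t]])
  then show "t = Zero C Z W" by (rule epi_cancel_zero[OF assms(2,4) t])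
qed

lemma epi_ident: "X \<in> Obj C \<Longrightarrow> is_epi C (Ident C X)"
  by (rule epi_zero[OF Ident_Hom]) (simp_all add: Comp_Ident)

end

locale abelian_acat = abelian_category A for A :: "('o, 'm) acat" (structure)
begin

sublocale preadditive_acat A by unfold_locales

lemma kernel_factor:
  assumes "is_kernel A f k" "g \<in> Arr A" "Cod A g = Dom A f" "f \<cdot> g = Zero A (Dom A g) (Cod A f)"
  obtains u where "u \<in> Hom A (Dom A g) (Dom A k)" "k \<cdot> u = g"
  using assms unfolding is_kernel_def by metis

text \<open>An epimorphism is a cokernel of some \<open>g\<close>, and \<open>g\<close> factors through the kernel \<open>k\<close>, so that \<open>h\<close> annihilates \<open>g\<close>
  as well.\<close>

lemma epi_cokernel_of_kernel:
  assumes w: "is_epi A w" and k: "is_kernel A w k" and h: "h \<in> Hom A (Dom A w) D" "h \<cdot> k = Zero A (Dom A k) D"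
  obtains t where "t \<in> Hom A (Cod A w) D" "h = t \<cdot> w"
proof -
  obtain g where g: "is_cokernel A g w" using epi_normal[OF w] by blast
  then have g': "g \<in> Arr A" "w \<in> Arr A" "Dom A w = Cod A g" "w \<cdot> g = Zero A (Dom A g) (Cod A w)" by (auto simp: is_cokernel_def)
  obtain u where u: "u \<in> Hom A (Dom A g) (Dom A k)" "k \<cdot> u = g" using kernel_factor[OF k g'(1)] g' by metis
  have k': "k \<in> Hom A (Dom A k) (Dom A w)" using k by (auto simp: is_kernel_def Hom_iff)
  have D: "D \<in> Obj A" using Hom_objs[OF h(1)] by simp
  have "h \<cdot> g = (h \<cdot> k) \<cdot> u" using Comp_assoc[OF u(1) k' h(1)] u(2) by simp
  also have "\<dots> = Zero A (Dom A g) D" unfolding h(2) by (rule zero_comp[OF u(1) D])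
  finally have "h \<in> Arr A \<and> Dom A h = Cod A g \<and> h \<cdot> g = Zero A (Dom A g) (Cod A h)" using h(1) g' by (simp add: Hom_iff)
  then obtain t where "t \<in> Hom A (Cod A w) (Cod A h)" "t \<cdot> w = h" using g unfolding is_cokernel_def by metis
  then show ?thesis using that h(1) by (simp add: Hom_iff)
qed

text \<open>The pullback is the kernel of \<open>w = u p - g q\<close> on the biproduct. An arrow \<open>h\<close> that annihilates its projection to
  \<open>Y\<close> makes \<open>h q\<close> factor through \<open>w\<close> as \<open>t w\<close>; restriction to \<open>X\<close> gives \<open>t u = 0\<close>, hence \<open>t = 0\<close> and \<open>h = 0\<close>.\<close>

lemma pullback_epi:
  assumes u: "is_epi A u" "u \<in> Hom A X B" and g: "g \<in> Hom A Y B"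
  obtains P a e where "is_epi A e" "e \<in> Hom A P Y" "a \<in> Hom A P X" "u \<cdot> a = g \<cdot> e"
proof -
  note O = Hom_objs[OF u(2)] Hom_objs[OF g]
  obtain S i j p q where S: "S \<in> Obj A" "is_biproduct A X Y S i j p q" using ex_biproduct[of X Y] O by blast
  note b = S(2)[unfolded is_biproduct_def Hom_iff] u(2)[unfolded Hom_iff] g[unfolded Hom_iff]
  have bH: "i \<in> Hom A X S" "j \<in> Hom A Y S" "p \<in> Hom A S X" "q \<in> Hom A S Y" using b by (auto simp: Hom_iff)
  define w where "w = (u \<cdot> p) \<boxplus> Neg A (g \<cdot> q)"
  have w: "w \<in> Hom A S B" using b by (simp add: w_def Hom_iff ring_arr)
  have rw: "ring_of w = ring_of u * ring_of p - ring_of g * ring_of q"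
    using b O by (simp add: w_def ring_arr ring_of_simps)
  have r: "ring_of p * ring_of j = 0" "ring_of q * ring_of i = 0" "ring_of p * ring_of i = ring_of (Ident A X)"
    "ring_of q * ring_of j = ring_of (Ident A Y)"
    using b O ring_of_comp_eq(1)[of p j] ring_of_comp_eq(1)[of q i] ring_of_comp_eq(1)[of p i] ring_of_comp_eq(1)[of q j]
    by (auto simp: ring_of_zero)
  have wi: "w \<cdot> i = u"
    by (rule ring_of_inject) (use b w[unfolded Hom_iff] r in \<open>simp_all add: ring_of_comp rw algebra_simps ring_of_ident\<close>)
  have wj: "w \<cdot> j = Neg A g"
    by (rule ring_of_inject) (use b w[unfolded Hom_iff] r in \<open>simp_all add: ring_of_comp rw algebra_simps ring_of_ident ring_arr ring_of_neg\<close>)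
  have ew: "is_epi A w"
  proof (rule epi_zero[OF w])
    fix Z t assume t: "t \<in> Hom A B Z" and e: "t \<cdot> w = Zero A S Z"
    have Z: "Z \<in> Obj A" using Hom_objs[OF t] by simp
    have "t \<cdot> u = (t \<cdot> w) \<cdot> i" unfolding wi[symmetric] using Comp_assoc[OF bH(1) w t] by simp
    also have "\<dots> = Zero A X Z" unfolding e by (rule zero_comp[OF bH(1) Z])
    finally show "t = Zero A B Z" by (rule epi_cancel_zero[OF u t])
  qed
  obtain k where k: "is_kernel A w k" using ex_kernel[of w] w by (auto simp: Hom_iff)
  define P where "P = Dom A k"
  have kH: "k \<in> Hom A P S" and wk: "w \<cdot> k = Zero A P B" using k w by (auto simp: is_kernel_def Hom_iff P_def)
  note kk = kH[unfolded Hom_iff]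
  have P: "P \<in> Obj A" using Hom_objs[OF kH] by simp
  have "u \<cdot> (p \<cdot> k) = g \<cdot> (q \<cdot> k)"
  proof (rule ring_of_inject)
    have "ring_of w * ring_of k = 0" using ring_of_comp_eq(1)[OF wk] kk w O P by (simp add: Hom_iff ring_of_zero)
    then show "ring_of (u \<cdot> (p \<cdot> k)) = ring_of (g \<cdot> (q \<cdot> k))" using b kk by (simp add: ring_of_comp rw algebra_simps)
  qed (use b kk in simp_all)
  moreover have "is_epi A (q \<cdot> k)"
  proof (rule epi_zero[OF Comp_Hom[OF kH bH(4)]])
    fix D h assume h: "h \<in> Hom A Y D" and e: "h \<cdot> (q \<cdot> k) = Zero A P D"
    have D: "D \<in> Obj A" using Hom_objs[OF h] by simp
    have hq: "h \<cdot> q \<in> Hom A (Dom A w) D" using Comp_Hom[OF bH(4) h] w by (simp add: Hom_iff)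
    have "(h \<cdot> q) \<cdot> k = Zero A (Dom A k) D" using e Comp_assoc[OF kH bH(4) h] by (simp add: P_def)
    then obtain t where t: "t \<in> Hom A (Cod A w) D" "h \<cdot> q = t \<cdot> w" by (rule epi_cokernel_of_kernel[OF ew k hq])
    have tB: "t \<in> Hom A B D" using t(1) w by (simp add: Hom_iff)
    have "t \<cdot> u = (t \<cdot> w) \<cdot> i" unfolding wi[symmetric] using Comp_assoc[OF bH(1) w tB] by simp
    also have "\<dots> = h \<cdot> (q \<cdot> i)" unfolding t(2)[symmetric] using Comp_assoc[OF bH(1,4) h] by simp
    also have "\<dots> = Zero A X D" using b O comp_zero[OF h, of X] by simp
    finally have t0: "t = Zero A B D" by (rule epi_cancel_zero[OF u tB])
    have "h = h \<cdot> (q \<cdot> j)" using b Comp_Ident[OF h] by simp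
    also have "\<dots> = (h \<cdot> q) \<cdot> j" using Comp_assoc[OF bH(2,4) h] by simp
    also have "\<dots> = Zero A Y D" unfolding t(2) t0 zero_comp[OF w D] by (rule zero_comp[OF bH(2) D])
    finally show "h = Zero A Y D" .
  qed
  ultimately show ?thesis using that[of "q \<cdot> k" P "p \<cdot> k"] Comp_Hom[OF kH bH(4)] Comp_Hom[OF kH bH(3)] by simp
qed

text \<open>Exactness at \<open>X n\<close> in terms of generalised elements: a cycle is a boundary after composition with an
  epimorphism. In this form exactness can be chased through cones and truncations.\<close>

definition exact_at :: "('o, 'm) cochain \<Rightarrow> int \<Rightarrow> bool" where
  "exact_at X n \<longleftrightarrow> (\<forall>W. \<forall>g \<in> Hom A W (cobj X n). cdiff X n \<cdot> g = Zero A W (cobj X (n + 1)) \<longrightarrow>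
     (\<exists>P e g'. is_epi A e \<and> e \<in> Hom A P W \<and> g' \<in> Hom A P (cobj X (n - 1)) \<and> g \<cdot> e = cdiff X (n - 1) \<cdot> g'))"

text \<open>The cohomology vanishes iff \<open>u : X\<^sup>n\<^sup>-\<^sup>1 \<rightarrow> Ker d\<^sup>n\<close> is an epimorphism. In that case cycles lift along pullbacks of
  \<open>u\<close>; conversely a lift of the universal cycle, the kernel itself, makes \<open>u\<close> an epimorphism.\<close>

lemma zero_cohomology_iff:
  assumes X: "is_complex A X"
  shows "zero_object A (cohomology A X n) \<longleftrightarrow> exact_at X n"
proof -
  have dn: "cdiff X n \<in> Hom A (cobj X n) (cobj X (n + 1))" and O: "cobj X k \<in> Obj A" for k using X by (auto simp: is_complex_def)
  have dm: "cdiff X (n - 1) \<in> Hom A (cobj X (n - 1)) (cobj X n)"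
    using X[unfolded is_complex_def, rule_format, of "n - 1"] by simp
  have dd: "cdiff X n \<cdot> cdiff X (n - 1) = Zero A (cobj X (n - 1)) (cobj X (n + 1))"
    using X[unfolded is_complex_def, rule_format, of "n - 1"] by (simp add: add.commute)
  let ?P = "\<lambda>H. \<exists>k u c. is_kernel A (cdiff X n) k \<and> u \<in> Hom A (cobj X (n - 1)) (Dom A k) \<and> k \<cdot> u = cdiff X (n - 1) \<and>
     is_cokernel A u c \<and> H = Cod A c"
  have "\<exists>H. ?P H"
  proof -
    obtain k where k: "is_kernel A (cdiff X n) k" using ex_kernel[of "cdiff X n"] dn by (auto simp: Hom_iff)
    obtain u where u: "u \<in> Hom A (Dom A (cdiff X (n - 1))) (Dom A k)" "k \<cdot> u = cdiff X (n - 1)"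
      by (rule kernel_factor[OF k, of "cdiff X (n - 1)"]) (use dm dn dd in \<open>auto simp: Hom_iff\<close>)
    obtain c where "is_cokernel A u c" using ex_cokernel[of u] u by (auto simp: Hom_iff)
    then show ?thesis using k u dm by (auto simp: Hom_iff)
  qed
  then have "?P (cohomology A X n)" unfolding cohomology_def by (rule someI_ex)
  then obtain k u c where k: "is_kernel A (cdiff X n) k" and u: "u \<in> Hom A (cobj X (n - 1)) (Dom A k)" "k \<cdot> u = cdiff X (n - 1)"
    and c: "is_cokernel A u c" "cohomology A X n = Cod A c" by blast
  have kH: "k \<in> Hom A (Dom A k) (cobj X n)" and dk: "cdiff X n \<cdot> k = Zero A (Dom A k) (cobj X (n + 1))"
    using k dn by (auto simp: is_kernel_def Hom_iff)
  have cH: "c \<in> Hom A (Dom A k) (Cod A c)" and cu: "c \<cdot> u = Zero A (cobj X (n - 1)) (Cod A c)"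
    using c(1) u(1) by (auto simp: is_cokernel_def Hom_iff)
  have cO: "Cod A c \<in> Obj A" "Dom A k \<in> Obj A" using Hom_objs[OF cH] by auto
  have "zero_object A (Cod A c) \<longleftrightarrow> is_epi A u"
  proof
    assume z: "zero_object A (Cod A c)"
    show "is_epi A u"
    proof (rule epi_zero[OF u(1)])
      fix Z t assume t: "t \<in> Hom A (Dom A k) Z" "t \<cdot> u = Zero A (cobj X (n - 1)) Z"
      have Z: "Z \<in> Obj A" using Hom_objs[OF t(1)] by simp
      have "t \<in> Arr A \<and> Dom A t = Cod A u \<and> t \<cdot> u = Zero A (Dom A u) (Cod A t)" using t u(1) by (simp add: Hom_iff)
      then obtain s where s: "s \<in> Hom A (Cod A c) (Cod A t)" "s \<cdot> c = t"
        using c(1) unfolding is_cokernel_def by blast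
      have sZ: "s \<in> Hom A (Cod A c) Z" using s(1) t(1) by (simp add: Hom_iff)
      have "\<exists>!f. f \<in> Hom A (Cod A c) Z" using z Z unfolding zero_object_def by blast
      then have "s = Zero A (Cod A c) Z" using sZ zero_Hom[OF cO(1) Z] by blast
      then show "t = Zero A (Dom A k) Z" using s(2) zero_comp[OF cH Z] by simp
    qed
  next
    assume "is_epi A u"
    then have c0: "c = Zero A (Dom A k) (Cod A c)" by (rule epi_cancel_zero[OF _ u(1) cH cu])
    have "c \<in> Arr A \<and> Dom A c = Cod A u \<and> c \<cdot> u = Zero A (Dom A u) (Cod A c)" using cH cu u(1) by (simp add: Hom_iff)
    then have "\<exists>!s. s \<in> Hom A (Cod A c) (Cod A c) \<and> s \<cdot> c = c" using c(1) unfolding is_cokernel_def by blast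
    moreover have "Ident A (Cod A c) \<cdot> c = c" by (rule Ident_Comp[OF cH])
    moreover have "Zero A (Cod A c) (Cod A c) \<cdot> c = c" using zero_comp[OF cH cO(1)] c0 by simp
    ultimately have "Ident A (Cod A c) = Zero A (Cod A c) (Cod A c)" using Ident_Hom[OF cO(1)] zero_Hom[OF cO(1) cO(1)] by blast
    then show "zero_object A (Cod A c)" using cO by (simp add: zero_object_iff)
  qed
  also have "\<dots> \<longleftrightarrow> exact_at X n"
  proof
    assume eu: "is_epi A u"
    show "exact_at X n" unfolding exact_at_def
    proof (intro allI ballI impI)
      fix W g assume g: "g \<in> Hom A W (cobj X n)" "cdiff X n \<cdot> g = Zero A W (cobj X (n + 1))"
      obtain g1 where g1: "g1 \<in> Hom A (Dom A g) (Dom A k)" "k \<cdot> g1 = g"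
        by (rule kernel_factor[OF k, of g]) (use g dn in \<open>auto simp: Hom_iff\<close>)
      have g1': "g1 \<in> Hom A W (Dom A k)" using g1 g by (simp add: Hom_iff)
      obtain P a e where P: "is_epi A e" "e \<in> Hom A P W" "a \<in> Hom A P (cobj X (n - 1))" "u \<cdot> a = g1 \<cdot> e"
        by (rule pullback_epi[OF eu u(1) g1'])
      have "g \<cdot> e = k \<cdot> (u \<cdot> a)" unfolding P(4) g1(2)[symmetric] by (rule Comp_assoc[OF P(2) g1' kH])
      also have "\<dots> = cdiff X (n - 1) \<cdot> a" unfolding u(2)[symmetric] by (rule Comp_assoc[OF P(3) u(1) kH, symmetric])
      finally show "\<exists>P e g'. is_epi A e \<and> e \<in> Hom A P W \<and> g' \<in> Hom A P (cobj X (n - 1)) \<and> g \<cdot> e = cdiff X (n - 1) \<cdot> g'"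
        using P by blast
    qed
  next
    assume "exact_at X n"
    then obtain P e g' where e: "is_epi A e" "e \<in> Hom A P (Dom A k)" "g' \<in> Hom A P (cobj X (n - 1))" "k \<cdot> e = cdiff X (n - 1) \<cdot> g'"
      using kH dk unfolding exact_at_def by blast
    have "k \<cdot> e = k \<cdot> (u \<cdot> g')" using e(4) u(2) Comp_assoc[OF e(3) u(1) kH] by simp
    moreover have kk: "\<exists>!v. v \<in> Hom A P (Dom A k) \<and> k \<cdot> v = k \<cdot> e"
    proof -
      have ke: "k \<cdot> e \<in> Hom A P (cobj X n)" by (rule Comp_Hom[OF e(2) kH])
      have "cdiff X n \<cdot> (k \<cdot> e) = (cdiff X n \<cdot> k) \<cdot> e" by (rule Comp_assoc[OF e(2) kH dn, symmetric])
      also have "\<dots> = Zero A P (cobj X (n + 1))" unfolding dk by (rule zero_comp[OF e(2) O])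
      finally have "k \<cdot> e \<in> Arr A \<and> Cod A (k \<cdot> e) = Dom A (cdiff X n) \<and>
        cdiff X n \<cdot> (k \<cdot> e) = Zero A (Dom A (k \<cdot> e)) (Cod A (cdiff X n))" "Dom A (k \<cdot> e) = P"
        using ke dn by (simp_all add: Hom_iff)
      then show ?thesis using k unfolding is_kernel_def by metis
    qed
    ultimately have eu: "e = u \<cdot> g'" using e(2) Comp_Hom[OF e(3) u(1)] by metis
    show "is_epi A u"
    proof (rule epi_zero[OF u(1)])
      fix Z t assume t: "t \<in> Hom A (Dom A k) Z" "t \<cdot> u = Zero A (cobj X (n - 1)) Z"
      have Z: "Z \<in> Obj A" using Hom_objs[OF t(1)] by simp
      have "t \<cdot> e = (t \<cdot> u) \<cdot> g'" unfolding eu by (rule Comp_assoc[OF e(3) u(1) t(1), symmetric])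
      also have "\<dots> = Zero A P Z" unfolding t(2) by (rule zero_comp[OF e(3) Z])
      finally show "t = Zero A (Dom A k) Z" by (rule epi_cancel_zero[OF e(1,2) t(1)])
    qed
  qed
  finally show ?thesis unfolding c(2) .
qed

end

section \<open>Triangulated subcategories of the homotopy category\<close>

context additive_acat
begin

text \<open>Multiplication by the projection to degree \<open>n\<close> turns statements about single degrees into equations of
  the ring.\<close>

definition pr :: "('o, 'm) cochain \<Rightarrow> int \<Rightarrow> ('o, 'm) gop" where
  "pr X n = act C (cobj X) (cobj X) 0 (\<lambda>k. if k = n then Ident C (cobj X k) else Zero C (cobj X k) (cobj X k))"

definition cut where
  "cut X Y k f n = (\<lambda>m. if m = n then f m else Zero C (cobj X m) (cobj Y (m + k)))"

lemma cut_graded: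
  assumes "X \<in> Ob" "Y \<in> Ob" "f \<in> graded_hom C (cobj X) (cobj Y) k"
  shows "cut X Y k f n \<in> graded_hom C (cobj X) (cobj Y) k"
  using assms complexD(1)[OF assms(1)] complexD(1)[OF assms(2)] by (simp add: graded_hom_def cut_def zero_Hom)

lemma pr_graded:
  assumes "X \<in> Ob"
  shows "(\<lambda>k. if k = n then Ident C (cobj X k) else Zero C (cobj X k) (cobj X k)) \<in> graded_hom C (cobj X) (cobj X) 0"
  using complexD(1)[OF assms] by (simp add: graded_hom_def Ident_Hom zero_Hom)

lemma act_pr:
  assumes "X \<in> Ob" "Y \<in> Ob" and f: "f \<in> graded_hom C (cobj X) (cobj Y) k"
  shows "act C (cobj X) (cobj Y) k f * pr X n = act C (cobj X) (cobj Y) k (cut X Y k f n)"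
    "pr Y (n + k) * act C (cobj X) (cobj Y) k f = act C (cobj X) (cobj Y) k (cut X Y k f n)"
proof -
  note F = graded_homD[OF f] and O = complexD(1)[OF assms(1)] complexD(1)[OF assms(2)]
  have "(\<lambda>m. f m \<cdot> (if m = n then Ident C (cobj X m) else Zero C (cobj X m) (cobj X m))) = cut X Y k f n"
    using Comp_Ident[OF F] comp_zero[OF F O(1)] by (auto simp: cut_def fun_eq_iff)
  then show "act C (cobj X) (cobj Y) k f * pr X n = act C (cobj X) (cobj Y) k (cut X Y k f n)"
    unfolding pr_def act_mult[OF pr_graded[OF assms(1)] f] by simp
  have "(\<lambda>m. (if m + k = n + k then Ident C (cobj Y (m + k)) else Zero C (cobj Y (m + k)) (cobj Y (m + k))) \<cdot> f m) = cut X Y k f n"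
    using Ident_Comp[OF F] zero_comp[OF F O(2)] by (auto simp: cut_def fun_eq_iff)
  then show "pr Y (n + k) * act C (cobj X) (cobj Y) k f = act C (cobj X) (cobj Y) k (cut X Y k f n)"
    unfolding pr_def act_mult[OF f pr_graded[OF assms(2)]] by simp
qed

lemma pr_G: "X \<in> Ob \<Longrightarrow> pr X n \<in> G X X 0"
  unfolding pr_def by (rule GI[OF pr_graded])

lemma pr_commute: "X \<in> Ob \<Longrightarrow> Y \<in> Ob \<Longrightarrow> x \<in> G X Y k \<Longrightarrow> x * pr X n = pr Y (n + k) * x"
  by (elim GE) (simp add: act_pr)

lemma pr_eq_iff:
  assumes "X \<in> Ob" "Y \<in> Ob" "f \<in> graded_hom C (cobj X) (cobj Y) k" "g \<in> graded_hom C (cobj X) (cobj Y) k"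
  shows "act C (cobj X) (cobj Y) k f * pr X n = act C (cobj X) (cobj Y) k g * pr X n \<longleftrightarrow> f n = g n"
proof -
  have "act C (cobj X) (cobj Y) k (cut X Y k f n) = act C (cobj X) (cobj Y) k (cut X Y k g n) \<longleftrightarrow> f n = g n"
  proof
    assume "act C (cobj X) (cobj Y) k (cut X Y k f n) = act C (cobj X) (cobj Y) k (cut X Y k g n)"
    then have "cut X Y k f n = cut X Y k g n" by (rule act_inject[OF cut_graded[OF assms(1-3)] cut_graded[OF assms(1,2,4)]])
    then have "cut X Y k f n n = cut X Y k g n n" by simp
    then show "f n = g n" by (simp add: cut_def)
  next
    assume "f n = g n"
    then have "cut X Y k f n = cut X Y k g n" by (auto simp: cut_def)
    then show "act C (cobj X) (cobj Y) k (cut X Y k f n) = act C (cobj X) (cobj Y) k (cut X Y k g n)" by simp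
  qed
  then show ?thesis unfolding act_pr(1)[OF assms(1-3)] act_pr(1)[OF assms(1,2,4)] .
qed

lemma pr_zero_iff:
  assumes "X \<in> Ob"
  shows "pr X n = 0 \<longleftrightarrow> zero_object C (cobj X n)"
proof -
  note O = complexD(1)[OF assms]
  have z: "(\<lambda>n. Zero C (cobj X n) (cobj X n)) \<in> graded_hom C (cobj X) (cobj X) 0"
    using graded_hom_zero[of "cobj X" "cobj X" 0] O by simp
  have "pr X n = 0 \<longleftrightarrow> pr X n = act C (cobj X) (cobj X) 0 (\<lambda>n. Zero C (cobj X n) (cobj X n))"
    using act_zero[of "cobj X" "cobj X" 0] O by simp
  also have "\<dots> \<longleftrightarrow> (\<lambda>k. if k = n then Ident C (cobj X k) else Zero C (cobj X k) (cobj X k)) = (\<lambda>n. Zero C (cobj X n) (cobj X n))"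
    unfolding pr_def using act_inject[OF pr_graded[OF assms] z, of n] by auto
  also have "\<dots> \<longleftrightarrow> zero_object C (cobj X n)" using O by (auto simp: zero_object_iff fun_eq_iff)
  finally show ?thesis .
qed

lemma cone_object_zero:
  assumes c: "cone X Y f Z i j p q" and "zero_object C (cobj X (n + 1))" "zero_object C (cobj Y n)"
  shows "zero_object C (cobj Z n)"
proof -
  note O = coneD(2-4)[OF c] and t = coneD(6-9)[OF c]
  have p: "p * pr Z n = 0" using pr_commute[OF O(3,1) t(3), of n] pr_zero_iff[OF O(1), of "n + 1"] assms(2) by simp
  have q: "q * pr Z n = 0" using pr_commute[OF O(3,2) t(4), of n] pr_zero_iff[OF O(2), of n] assms(3) by simp
  have "pr Z n = (i * p + j * q) * pr Z n" using e_left[OF pr_G[OF O(3)]] unfolding coneD(10)[OF c] by simp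
  also have "\<dots> = 0" using p q by (simp add: algebra_simps)
  finally show ?thesis using pr_zero_iff[OF O(3)] by simp
qed

lemma isomorphic_K_iff:
  "isomorphic K X Y \<longleftrightarrow> (\<exists>x y. chn X Y x \<and> chn Y X y \<and> null X X (e X - y * x) \<and> null Y Y (e Y - x * y))"
proof
  assume "isomorphic K X Y"
  then obtain f g where f: "f \<in> Hom K X Y" "g \<in> Hom K Y X" "g \<bullet> f = Ident K X" "f \<bullet> g = Ident K Y"
    unfolding isomorphic_def iso_arr_def Bex_def Hom_iff by blast
  obtain x where x: "chn X Y x" "f = arr X Y x" using f(1) by (rule K_HomE)
  obtain y where y: "chn Y X y" "g = arr Y X y" using f(2) by (rule K_HomE)
  note O = chnD(1,2)[OF x(1)]
  have "null X X (e X - y * x)" "null Y Y (e Y - x * y)"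
    using f(3,4) unfolding x(2) y(2) K_comp[OF x(1) y(1)] K_comp[OF y(1) x(1)] K_Ident[OF O(1)] K_Ident[OF O(2)]
    unfolding arr_eq_iff[OF chn_mult[OF x(1) y(1)] chn_e[OF O(1)]] arr_eq_iff[OF chn_mult[OF y(1) x(1)] chn_e[OF O(2)]]
    using null_neg[of X X "y * x - e X"] null_neg[of Y Y "x * y - e Y"] by simp_all
  then show "\<exists>x y. chn X Y x \<and> chn Y X y \<and> null X X (e X - y * x) \<and> null Y Y (e Y - x * y)" using x y by blast
next
  assume "\<exists>x y. chn X Y x \<and> chn Y X y \<and> null X X (e X - y * x) \<and> null Y Y (e Y - x * y)"
  then obtain x y where x: "chn X Y x" and y: "chn Y X y" and n: "null X X (e X - y * x)" "null Y Y (e Y - x * y)" by blast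
  note O = chnD(1,2)[OF x]
  have "arr Y X y \<bullet> arr X Y x = Ident K X" "arr X Y x \<bullet> arr Y X y = Ident K Y"
    unfolding K_comp[OF x y] K_comp[OF y x] K_Ident[OF O(1)] K_Ident[OF O(2)]
    using n arr_eq_iff[OF chn_e[OF O(1)] chn_mult[OF x y]] arr_eq_iff[OF chn_e[OF O(2)] chn_mult[OF y x]] by auto
  then have "iso_arr K (arr X Y x)" using category.iso_arrI[OF category_K arr_Hom[OF x] arr_Hom[OF y]] by blast
  then show "isomorphic K X Y" unfolding isomorphic_def using arr_Hom[OF x] by blast
qed

lemma isomorphic_shift_iff:
  assumes O: "X \<in> Ob" "Y \<in> Ob"
  shows "isomorphic K (shift C X) (shift C Y) \<longleftrightarrow> isomorphic K X Y"
proof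
  assume "isomorphic K X Y"
  then obtain x y where x: "chn X Y x" and y: "chn Y X y" and n: "null X X (e X - y * x)" "null Y Y (e Y - x * y)"
    unfolding isomorphic_K_iff by blast
  have "\<sigma> X * ((e X - y * x) * \<tau> X) = e (shift C X) - \<sigma> X * (y * \<tau> Y) * (\<sigma> Y * (x * \<tau> X))"
    "\<sigma> Y * ((e Y - x * y) * \<tau> Y) = e (shift C Y) - \<sigma> Y * (x * \<tau> X) * (\<sigma> X * (y * \<tau> Y))"
    using unit[OF chnD(3)[OF x]] unit[OF chnD(3)[OF y]] by (simp_all add: algebra_simps sd O obU)
  then show "isomorphic K (shift C X) (shift C Y)"
    unfolding isomorphic_K_iff using chn_shift[OF x] chn_shift[OF y] null_shift[OF n(1) O(1,1)] null_shift[OF n(2) O(2,2)] by metis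
next
  assume "isomorphic K (shift C X) (shift C Y)"
  then obtain x y where x: "chn (shift C X) (shift C Y) x" and y: "chn (shift C Y) (shift C X) y"
    and n: "null (shift C X) (shift C X) (e (shift C X) - y * x)" "null (shift C Y) (shift C Y) (e (shift C Y) - x * y)"
    unfolding isomorphic_K_iff by blast
  let ?x = "\<tau> Y * (x * \<sigma> X)" and ?y = "\<tau> X * (y * \<sigma> Y)"
  note c = chn_unshift[OF x O] chn_unshift[OF y O(2,1)]
  note U = unit[OF chnD(3)[OF x]] unit[OF chnD(3)[OF y]]
  have 1: "\<sigma> X * ((e X - ?y * ?x) * \<tau> X) = e (shift C X) - y * x"
    using U unit[OF e_G[OF s_Ob[OF O(1)]]] by (simp add: algebra_simps sd O obU)
  have 2: "\<sigma> Y * ((e Y - ?x * ?y) * \<tau> Y) = e (shift C Y) - x * y"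
    using U by (simp add: algebra_simps sd O obU)
  have "null X X (e X - ?y * ?x)"
    using null_unshift[OF _ _ O(1,1), of "e X - ?y * ?x"] n(1) unfolding 1
    using chnD(3)[OF chn_diff[OF chn_e[OF O(1)] chn_mult[OF c]]] by blast
  moreover have "null Y Y (e Y - ?x * ?y)"
    using null_unshift[OF _ _ O(2,2), of "e Y - ?x * ?y"] n(2) unfolding 2
    using chnD(3)[OF chn_diff[OF chn_e[OF O(2)] chn_mult[OF c(2,1)]]] by blast
  ultimately show "isomorphic K X Y" unfolding isomorphic_K_iff using c by blast
qed

lemma zero_complex:
  assumes "zero_object C N"
  shows "Cochain (\<lambda>_. N) (\<lambda>_. Zero C N N) \<in> Ob" "zero_object K (Cochain (\<lambda>_. N) (\<lambda>_. Zero C N N))"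
proof -
  let ?Z = "Cochain (\<lambda>_::int. N) (\<lambda>_. Zero C N N)"
  have N: "N \<in> Obj C" "Zero C N N = Ident C N" using assms by (auto simp: zero_object_iff)
  show Z: "?Z \<in> Ob" unfolding Ob_def is_complex_def using N zero_Hom[OF N(1) N(1)] comp_zero[OF zero_Hom[OF N(1) N(1)] N(1)] by simp
  have ez: "e ?Z = 0" unfolding e_def using act_zero[of "\<lambda>_::int. N" "\<lambda>_. N" 0] N by simp
  have a: "a = arr W ?Z 0" if a: "a \<in> Hom K W ?Z" for W a
  proof -
    obtain x where x: "chn W ?Z x" "a = arr W ?Z x" using a by (rule K_HomE)
    then show ?thesis using unit(1)[OF chnD(3)[OF x(1)]] ez by simp
  qed
  have b: "a = arr ?Z W 0" if a: "a \<in> Hom K ?Z W" for W a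
  proof -
    obtain x where x: "chn ?Z W x" "a = arr ?Z W x" using a by (rule K_HomE)
    then show ?thesis using unit(2)[OF chnD(3)[OF x(1)]] ez by simp
  qed
  show "zero_object K ?Z" unfolding zero_object_def using Z K_zero(1) a b by (auto simp: K_basic intro!: ex1I)
qed

text \<open>A distinguished triangle is isomorphic to the triangle of the cone of any map that represents its first
  arrow. When the first two terms are homotopy equivalent to complexes with \<open>P\<close>, such a map can be
  chosen between the latter. The other two cases of the two-out-of-three property follow by rotation.\<close>

lemma iso_closure_triangulated:
  assumes zero: "\<And>N. zero_object C N \<Longrightarrow> P (Cochain (\<lambda>_. N) (\<lambda>_. Zero C N N))"
    and shift: "\<And>X. X \<in> Ob \<Longrightarrow> P (shift C X) \<longleftrightarrow> P X"
    and cone: "\<And>X Y f Z i j p q. cone X Y f Z i j p q \<Longrightarrow> P X \<Longrightarrow> P Y \<Longrightarrow> P Z"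
  shows "triangulated_subcat K {X \<in> Ob. \<exists>Y \<in> Ob. P Y \<and> isomorphic K X Y}" (is "triangulated_subcat K ?U")
proof -
  interpret K: triangulated K by (rule triangulated_K)
  have sh: "shift C X \<in> ?U \<longleftrightarrow> X \<in> ?U" if X: "X \<in> Ob" for X
  proof
    assume "X \<in> ?U"
    then obtain Y where Y: "Y \<in> Ob" "P Y" "isomorphic K X Y" by blast
    then show "shift C X \<in> ?U" using X shift[OF Y(1)] isomorphic_shift_iff[OF X Y(1)] s_Ob by blast
  next
    assume "shift C X \<in> ?U"
    then obtain Y where Y: "Y \<in> Ob" "P Y" "isomorphic K (shift C X) Y" by blast
    obtain Y' where Y': "Y' \<in> Ob" "shift C Y' = Y" using unshift_complex[OF Y(1)] by blast
    then show "X \<in> ?U" using X Y shift[OF Y'(1)] isomorphic_shift_iff[OF X Y'(1)] by blast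
  qed
  have main: "Cod K v \<in> ?U" if T: "(u, v, w) \<in> Tri K" and XY: "Dom K u \<in> ?U" "Cod K u \<in> ?U" for u v w
  proof -
    obtain X Y f Z i j p q h h' where S: "dg_category.cone Ob G e d X Y f Z i j p q" "u = arr X Y f" "h \<in> Hom K Z (Cod K v)" "h' \<in> Hom K (Cod K v) Z"
      "h' \<bullet> h = Ident K Z" "h \<bullet> h' = Ident K (Cod K v)" by (rule Tri_std[OF T]) blast
    note f = coneD(1)[OF S(1)]
    have "X \<in> ?U" "Y \<in> ?U" using XY S(2) by (auto simp: K_basic)
    then obtain X' Y' where X': "X' \<in> Ob" "P X'" "isomorphic K X X'" and Y': "Y' \<in> Ob" "P Y'" "isomorphic K Y Y'" by blast
    obtain a a' where a: "a \<in> Hom K X X'" "iso_arr K a" "a' \<in> Hom K X' X" "a' \<bullet> a = Ident K X"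
      using X'(3) unfolding isomorphic_def iso_arr_def Bex_def Hom_iff by blast
    obtain b where b: "b \<in> Hom K Y Y'" "iso_arr K b" using Y'(3) unfolding isomorphic_def by blast
    note H = a(1,3)[unfolded Hom_iff] b(1)[unfolded Hom_iff] arr_Hom[OF f, unfolded Hom_iff]
    have "(b \<bullet> arr X Y f) \<bullet> a' \<in> Hom K X' Y'" using H by (simp add: Hom_iff)
    then obtain f' where f': "chn X' Y' f'" "(b \<bullet> arr X Y f) \<bullet> a' = arr X' Y' f'" by (rule K_HomE)
    obtain Z' i' j' p' q' where c': "dg_category.cone Ob G e d X' Y' f' Z' i' j' p' q'" using cone_ex[OF f'(1)] .
    have "arr X' Y' f' \<bullet> a = b \<bullet> arr X Y f"
      unfolding f'(2)[symmetric] using H a(4) by simp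
    then obtain g where g: "g \<in> Hom K Z Z'" "iso_arr K g" by (rule std_compare[OF S(1) c' a(1,2) b])
    have hi: "iso_arr K h'" by (rule K.iso_arrI[OF S(4,3) S(6,5)])
    have "isomorphic K (Cod K v) Z" "isomorphic K Z Z'" unfolding isomorphic_def using S(4) hi g by blast+
    then have "isomorphic K (Cod K v) Z'" by (rule K.isomorphic_trans)
    moreover have "Cod K v \<in> Ob" using S(4) K.Dom_Obj[of h'] by (auto simp: Hom_iff K_basic)
    ultimately show ?thesis using cone[OF c' X'(2) Y'(2)] coneD(4)[OF c'] by blast
  qed
  show ?thesis
  proof (rule triangulated_subcatI)
    show "?U \<subseteq> Obj K" by (auto simp: K_basic)
    fix Z assume Z: "zero_object K Z"
    obtain N where N: "zero_object C N" using ex_zero by blast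
    have "isomorphic K Z (Cochain (\<lambda>_. N) (\<lambda>_. Zero C N N))" by (rule K.zero_objects_isomorphic[OF Z zero_complex(2)[OF N]])
    then show "Z \<in> ?U" using Z zero_complex(1)[OF N] zero[OF N] by (auto simp: zero_object_def K_basic)
  next
    fix X assume "X \<in> Obj K" then show "Sh K X \<in> ?U \<longleftrightarrow> X \<in> ?U" using sh by (simp add: K_basic)
  next
    fix u v w assume T: "(u, v, w) \<in> Tri K"
    obtain x where T2: "(v, w, x) \<in> Tri K" using K.rotate[OF T] by blast
    obtain y where T3: "(w, x, y) \<in> Tri K" using K.rotate[OF T2] by blast
    note t = K.tri[OF T] K.tri[OF T2] K.tri[OF T3]
    have O: "Dom K u \<in> Ob" "Cod K u \<in> Ob" using t K.Dom_Obj[of u] K.Cod_Obj[of u] by (auto simp: K_basic)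
    show "Dom K u \<in> ?U \<Longrightarrow> Cod K u \<in> ?U \<Longrightarrow> Cod K v \<in> ?U" by (rule main[OF T])
    show "Dom K u \<in> ?U" if "Cod K u \<in> ?U" "Cod K v \<in> ?U"
      using main[OF T2] that t sh[OF O(1)] by (simp only: K_basic)
    show "Cod K u \<in> ?U" if "Dom K u \<in> ?U" "Cod K v \<in> ?U"
      using main[OF T3] that t sh[OF O(1)] sh[OF O(2)] by (simp only: K_basic)
  qed
qed

section \<open>Splitting off contractible ends\<close>

text \<open>The identity of \<open>X\<^sup>n\<close> equals \<open>d h + h d\<close>; no condition is imposed in the other degrees.\<close>

definition contractible_in :: "('o, 'm) cochain \<Rightarrow> ('o, 'm) gop \<Rightarrow> int \<Rightarrow> bool" where
  "contractible_in X h n \<longleftrightarrow> (e X - (d X * h + h * d X)) * pr X n = 0"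

lemma contractible_of_isomorphic:
  assumes "isomorphic K X Y"
  obtains h where "h \<in> G X X (-1)" "\<And>n. zero_object C (cobj Y n) \<Longrightarrow> contractible_in X h n"
proof -
  obtain x y where x: "chn X Y x" and y: "chn Y X y" and n: "null X X (e X - y * x)" using assms isomorphic_K_iff by blast
  note O = chnD(1,2)[OF x]
  obtain h where h: "h \<in> G X X (-1)" "e X - y * x = d X * h + h * d X" using n unfolding null_def by blast
  have "contractible_in X h n" if "zero_object C (cobj Y n)" for n
  proof -
    have "(e X - (d X * h + h * d X)) * pr X n = y * (x * pr X n)" unfolding h(2)[symmetric] by (simp add: algebra_simps)
    also have "\<dots> = 0" using pr_commute[OF O chnD(3)[OF x], of n] pr_zero_iff[OF O(2), of n] that by simp
    finally show ?thesis by (simp add: contractible_in_def)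
  qed
  then show ?thesis using that h(1) by blast
qed

text \<open>If \<open>f\<close> is invertible in certain degrees, its cone is contractible wherever both of its components come
  from such degrees; the homotopy is \<open>(x, y) \<mapsto> (f\<inverse> y, 0)\<close>.\<close>

lemma cone_contractible:
  assumes c: "cone X Y f Z i j p q" and g: "g \<in> G Y X 0"
    and inv: "\<And>k. k \<in> {n, n + 1} \<Longrightarrow> (e X - g * f) * pr X k = 0" "\<And>k. k \<in> {n, n + 1} \<Longrightarrow> (e Y - f * g) * pr Y k = 0"
  shows "i * (g * q) \<in> G Z Z (-1)" "contractible_in Z (i * (g * q)) n"
proof -
  note O = coneD(2-4)[OF c] and t = coneD(5-9)[OF c]
  note R = cone_rules[OF c] coneU[OF c] obU[OF O(1)] obU[OF O(2)] obU[OF O(3)] unit[OF g]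
  show h: "i * (g * q) \<in> G Z Z (-1)" by (rule G_multI[OF t(2) G_multI[OF g t(5) refl]]) simp
  have P: "p * pr Z n = pr X (n + 1) * p" "q * pr Z n = pr Y n * q"
    using pr_commute[OF O(3,1) t(4), of n] pr_commute[OF O(3,2) t(5), of n] by simp_all
  have gf: "g * (f * pr X k) = pr X k" if "k \<in> {n, n + 1}" for k
    using inv(1)[OF that] unit(1)[OF pr_G[OF O(1)]] by (simp add: algebra_simps)
  have fg: "f * (g * pr Y k) = pr Y k" if "k \<in> {n, n + 1}" for k
    using inv(2)[OF that] unit(1)[OF pr_G[OF O(2)]] by (simp add: algebra_simps)
  \<comment> \<open>The inverse of a chain map commutes with the differential where both degrees involved are inverted.\<close>
  have dg: "d X * (g * pr Y n) = g * (d Y * pr Y n)"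
  proof -
    have dgG: "d X * g \<in> G Y X 1" by (rule G_multI[OF d_G[OF O(1)] g]) simp
    have "(d X * g) * pr Y n = pr X (n + 1) * (d X * g)" by (rule pr_commute[OF O(2,1) dgG])
    also have "\<dots> = g * (f * (pr X (n + 1) * (d X * g)))" using arg_cong[OF gf[of "n + 1"], of "\<lambda>z. z * (d X * g)"] by (simp add: mult.assoc)
    also have "\<dots> = g * (f * ((d X * g) * pr Y n))" unfolding pr_commute[OF O(2,1) dgG] ..
    also have "\<dots> = g * (d Y * (f * (g * pr Y n)))" by (simp add: mult.assoc R)
    also have "\<dots> = g * (d Y * pr Y n)" using fg[of n] by simp
    finally show ?thesis by (simp add: mult.assoc)
  qed
  have "(e Z - (d Z * (i * (g * q)) + i * (g * q) * d Z)) * pr Z n =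
    i * ((e X - g * f) * (p * pr Z n)) + j * ((e Y - f * g) * (q * pr Z n)) + i * ((d X * g - g * d Y) * (q * pr Z n))"
    unfolding coneD(10)[OF c] by (simp add: ring_distribs mult.assoc R)
  also have "\<dots> = i * (((e X - g * f) * pr X (n + 1)) * p) + j * (((e Y - f * g) * pr Y n) * q) + i * (((d X * g - g * d Y) * pr Y n) * q)"
    unfolding P by (simp add: mult.assoc)
  also have "\<dots> = 0" using inv(1)[of "n + 1"] inv(2)[of n] dg by (simp add: algebra_simps)
  finally show "contractible_in Z (i * (g * q)) n" by (simp add: contractible_in_def)
qed

lemma contractible_components:
  assumes X: "X \<in> Ob" and h: "h \<in> G X X (-1)"
  obtains k where "\<And>n. k n \<in> Hom C (cobj X n) (cobj X (n - 1))"
    "\<And>n. contractible_in X h n \<Longrightarrow> Ident C (cobj X n) = (cdiff X (n - 1) \<cdot> k n) \<boxplus> (k (n + 1) \<cdot> cdiff X n)"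
proof -
  obtain k where k: "k \<in> graded_hom C (cobj X) (cobj X) (-1)" "h = act C (cobj X) (cobj X) (-1) k" using h by (rule GE)
  note i = id_graded[OF X]
  let ?a = "\<lambda>n. cdiff X (n - 1) \<cdot> k n" and ?b = "\<lambda>n. k (n + 1) \<cdot> cdiff X n"
  have ab: "?a \<in> graded_hom C (cobj X) (cobj X) 0" "?b \<in> graded_hom C (cobj X) (cobj X) 0"
    using graded_hom_comp[OF k(1) i(4)] graded_hom_comp[OF i(4) k(1)] by simp_all
  have "d X * h + h * d X = act C (cobj X) (cobj X) 0 (\<lambda>n. ?a n \<boxplus> ?b n)"
    unfolding act_add[OF ab, symmetric] d_def k(2) using act_mult[OF k(1) i(4)] act_mult[OF i(4) k(1)] by simp
  then have "contractible_in X h n \<Longrightarrow> Ident C (cobj X n) = ?a n \<boxplus> ?b n" for n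
    using pr_eq_iff[OF X X i(1) graded_hom_add[OF ab], of n] by (simp add: contractible_in_def e_def left_diff_distrib)
  moreover have "k n \<in> Hom C (cobj X n) (cobj X (n - 1))" for n using graded_homD[OF k(1), of n] by simp
  ultimately show ?thesis using that by blast
qed

text \<open>\<open>W\<close> is a deformation retract of \<open>X\<close>, with the homotopy \<open>H\<close>.\<close>

lemma isomorphic_of_retraction:
  assumes O: "X \<in> Ob" "W \<in> Ob" and r: "r \<in> chain_maps C X W" and t: "t \<in> chain_maps C W X"
    and rt: "\<And>n. r n \<cdot> t n = Ident C (cobj W n)"
    and H: "\<And>n. H n \<in> Hom C (cobj X n) (cobj X (n - 1))"
      "\<And>n. Ident C (cobj X n) = (t n \<cdot> r n) \<boxplus> ((cdiff X (n - 1) \<cdot> H n) \<boxplus> (H (n + 1) \<cdot> cdiff X n))"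
  shows "isomorphic K X W"
proof -
  let ?r = "act C (cobj X) (cobj W) 0 r" and ?t = "act C (cobj W) (cobj X) 0 t"
  have c: "chn X W ?r" "chn W X ?t" and g: "r \<in> graded_hom C (cobj X) (cobj W) 0" "t \<in> graded_hom C (cobj W) (cobj X) 0"
    using r t by (auto simp: chain_maps_iff O)
  have 1: "?r * ?t = e W" unfolding e_def act_mult[OF g(2,1)] using rt by simp
  have tr: "(\<lambda>n. t n \<cdot> r n) \<in> graded_hom C (cobj X) (cobj X) 0" using graded_hom_comp[OF g] by simp
  have "homotopic C X X (\<lambda>n. Ident C (cobj X n)) (\<lambda>n. t n \<cdot> r n)" unfolding homotopic_def using H by blast
  then have "null X X (e X - ?t * ?r)"
    using homotopic_iff[OF O(1,1) id_graded(1)[OF O(1)] tr] act_mult[OF g] by (simp add: e_def)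
  then show ?thesis unfolding isomorphic_K_iff using c 1 null_zero[OF O(2,2)] by (intro exI[of _ ?r] exI[of _ ?t]) simp
qed


text \<open>An object \<open>I\<close> is spliced in at degree \<open>n\<close> of \<open>X\<close>, and the zero object \<open>N\<close> fills one side. Brutal truncations, good truncations and the removal of a contractible end are all of this form, or of
  the mirror form \<open>high\<close>.\<close>

definition low :: "('o, 'm) cochain \<Rightarrow> int \<Rightarrow> 'o \<Rightarrow> 'o \<Rightarrow> 'm \<Rightarrow> ('o, 'm) cochain" where
  "low X n N I \<delta> = (let W = (\<lambda>k. if k < n then N else if k = n then I else cobj X k)
     in Cochain W (\<lambda>k. if k < n then Zero C (W k) (W (k + 1)) else if k = n then \<delta> else cdiff X k))"

definition to_low :: "('o, 'm) cochain \<Rightarrow> int \<Rightarrow> 'o \<Rightarrow> 'm \<Rightarrow> int \<Rightarrow> 'm" where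
  "to_low X n N \<pi> = (\<lambda>k. if k < n then Zero C (cobj X k) N else if k = n then \<pi> else Ident C (cobj X k))"

definition from_low :: "('o, 'm) cochain \<Rightarrow> int \<Rightarrow> 'o \<Rightarrow> 'm \<Rightarrow> int \<Rightarrow> 'm" where
  "from_low X n N \<iota> = (\<lambda>k. if k < n then Zero C N (cobj X k) else if k = n then \<iota> else Ident C (cobj X k))"

definition high :: "('o, 'm) cochain \<Rightarrow> int \<Rightarrow> 'o \<Rightarrow> 'o \<Rightarrow> 'm \<Rightarrow> ('o, 'm) cochain" where
  "high X n N I \<delta> = (let W = (\<lambda>k. if k < n then cobj X k else if k = n then I else N)
     in Cochain W (\<lambda>k. if k < n - 1 then cdiff X k else if k = n - 1 then \<delta> else Zero C (W k) (W (k + 1))))"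

definition to_high :: "('o, 'm) cochain \<Rightarrow> int \<Rightarrow> 'o \<Rightarrow> 'm \<Rightarrow> int \<Rightarrow> 'm" where
  "to_high X n N \<pi> = (\<lambda>k. if k < n then Ident C (cobj X k) else if k = n then \<pi> else Zero C (cobj X k) N)"

definition from_high :: "('o, 'm) cochain \<Rightarrow> int \<Rightarrow> 'o \<Rightarrow> 'm \<Rightarrow> int \<Rightarrow> 'm" where
  "from_high X n N \<iota> = (\<lambda>k. if k < n then Ident C (cobj X k) else if k = n then \<iota> else Zero C N (cobj X k))"

lemma cobj_low: "cobj (low X n N I \<delta>) k = (if k < n then N else if k = n then I else cobj X k)"
  by (simp add: low_def Let_def)

lemma cdiff_low:
  "k < n \<Longrightarrow> cdiff (low X n N I \<delta>) k = Zero C N (cobj (low X n N I \<delta>) (k + 1))"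
  "cdiff (low X n N I \<delta>) n = \<delta>"
  "k > n \<Longrightarrow> cdiff (low X n N I \<delta>) k = cdiff X k"
  by (simp_all add: low_def Let_def)

lemma cobj_high: "cobj (high X n N I \<delta>) k = (if k < n then cobj X k else if k = n then I else N)"
  by (simp add: high_def Let_def)

lemma cdiff_high:
  "k < n - 1 \<Longrightarrow> cdiff (high X n N I \<delta>) k = cdiff X k"
  "cdiff (high X n N I \<delta>) (n - 1) = \<delta>"
  "k \<ge> n \<Longrightarrow> cdiff (high X n N I \<delta>) k = Zero C (cobj (high X n N I \<delta>) k) N"
  by (simp_all add: high_def Let_def)

context
  fixes X :: "('o, 'm) cochain" and n :: int and N I :: 'o
  assumes X: "X \<in> Ob" and N: "zero_object C N" and I: "I \<in> Obj C"
begin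

lemma splice_objects: "cobj X k \<in> Obj C" "N \<in> Obj C" "Ident C N = Zero C N N"
  "cobj (low X n N I \<delta>) k \<in> Obj C" "cobj (high X n N I \<delta>) k \<in> Obj C"
  using complexD(1)[OF X] N I by (auto simp: zero_object_iff cobj_low cobj_high)

lemma splice_ident: "Ident C (cobj X (k + 1)) \<cdot> cdiff X k = cdiff X k" "cdiff X k \<cdot> Ident C (cobj X k) = cdiff X k"
  using Ident_Comp[OF complexD(2)[OF X]] Comp_Ident[OF complexD(2)[OF X]] by auto

lemma low_complex:
  assumes \<delta>: "\<delta> \<in> Hom C I (cobj X (n + 1))" "cdiff X (n + 1) \<cdot> \<delta> = Zero C I (cobj X (n + 2))"
  shows "low X n N I \<delta> \<in> Ob"
proof -
  let ?W = "low X n N I \<delta>"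
  have H: "cdiff ?W k \<in> Hom C (cobj ?W k) (cobj ?W (k + 1))" for k
  proof -
    consider "k < n" | "k = n" | "k > n" by linarith
    then show ?thesis
    proof cases
      case 1 then show ?thesis using zero_Hom[OF splice_objects(2) splice_objects(4)[of \<delta> "k + 1"]] by (simp add: cdiff_low cobj_low[of _ _ _ _ _ k])
    next
      case 2 then show ?thesis using \<delta> by (simp add: cdiff_low cobj_low)
    next
      case 3 then show ?thesis using complexD(2)[OF X, of k] by (simp add: cdiff_low cobj_low)
    qed
  qed
  moreover have "cdiff ?W (k + 1) \<cdot> cdiff ?W k = Zero C (cobj ?W k) (cobj ?W (k + 2))" for k
  proof -
    consider "k < n" | "k = n" | "k > n" by linarith
    then show ?thesis
    proof cases
      case 1 then show ?thesis using comp_zero[OF H[of "k + 1"] splice_objects(2)] by (simp add: cdiff_low(1)[of k] cobj_low[of _ _ _ _ _ k] add.assoc)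
    next
      case 2 then show ?thesis using \<delta> by (simp add: cdiff_low cobj_low)
    next
      case 3 then show ?thesis using complexD(3)[OF X, of k] by (simp add: cdiff_low cobj_low)
    qed
  qed
  ultimately show ?thesis unfolding Ob_def is_complex_def using splice_objects(4) by blast
qed

lemma to_low:
  assumes \<delta>: "\<delta> \<in> Hom C I (cobj X (n + 1))" "cdiff X (n + 1) \<cdot> \<delta> = Zero C I (cobj X (n + 2))"
    and \<pi>: "\<pi> \<in> Hom C (cobj X n) I" "\<delta> \<cdot> \<pi> = cdiff X n" "\<pi> \<cdot> cdiff X (n - 1) = Zero C (cobj X (n - 1)) I"
  shows "to_low X n N \<pi> \<in> chain_maps C X (low X n N I \<delta>)"
proof -
  let ?W = "low X n N I \<delta>" and ?r = "to_low X n N \<pi>"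
  have rH: "?r k \<in> Hom C (cobj X k) (cobj ?W k)" for k
    using \<pi>(1) splice_objects by (auto simp: to_low_def cobj_low zero_Hom Ident_Hom)
  have W: "cdiff ?W k \<in> Hom C (cobj ?W k) (cobj ?W (k + 1))" for k using complexD(2)[OF low_complex[OF \<delta>]] .
  have "cdiff ?W k \<cdot> ?r k = ?r (k + 1) \<cdot> cdiff X k" for k
  proof -
    consider "k < n - 1" | "k = n - 1" | "k = n" | "k > n" by linarith
    then show ?thesis
    proof cases
      case 1
      then show ?thesis
        using comp_zero[OF W[of k] splice_objects(1)[of k]] zero_comp[OF complexD(2)[OF X, of k] splice_objects(2)] by (simp add: to_low_def cobj_low)
    next
      case 2
      then show ?thesis using comp_zero[OF W[of k] splice_objects(1)[of k]] \<pi> by (simp add: to_low_def cobj_low)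
    next
      case 3
      then show ?thesis using \<pi> splice_ident(1)[of n] by (simp add: to_low_def cdiff_low)
    next
      case 4
      then show ?thesis using splice_ident[of k] by (simp add: to_low_def cdiff_low)
    qed
  qed
  then show ?thesis unfolding chain_maps_def using rH by simp
qed

lemma from_low:
  assumes \<delta>: "\<delta> \<in> Hom C I (cobj X (n + 1))" and \<iota>: "\<iota> \<in> Hom C I (cobj X n)" "cdiff X n \<cdot> \<iota> = \<delta>"
  shows "from_low X n N \<iota> \<in> chain_maps C (low X n N I \<delta>) X"
proof -
  let ?W = "low X n N I \<delta>" and ?t = "from_low X n N \<iota>"
  have tH: "?t k \<in> Hom C (cobj ?W k) (cobj X k)" for k
    using \<iota>(1) splice_objects by (auto simp: from_low_def cobj_low zero_Hom Ident_Hom)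
  have "cdiff X k \<cdot> ?t k = ?t (k + 1) \<cdot> cdiff ?W k" for k
  proof -
    consider "k < n" | "k = n" | "k > n" by linarith
    then show ?thesis
    proof cases
      case 1
      then show ?thesis
        using comp_zero[OF tH[of "k + 1"] splice_objects(2)] comp_zero[OF complexD(2)[OF X, of k] splice_objects(2)] by (simp add: from_low_def cdiff_low)
    next
      case 2
      then show ?thesis using Ident_Comp[OF \<delta>] \<iota> by (simp add: from_low_def cdiff_low)
    next
      case 3
      then show ?thesis using splice_ident[of k] by (simp add: from_low_def cdiff_low)
    qed
  qed
  then show ?thesis unfolding chain_maps_def using tH by simp
qed

lemma high_complex:
  assumes \<delta>: "\<delta> \<in> Hom C (cobj X (n - 1)) I" "\<delta> \<cdot> cdiff X (n - 2) = Zero C (cobj X (n - 2)) I"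
  shows "high X n N I \<delta> \<in> Ob"
proof -
  let ?W = "high X n N I \<delta>"
  have H: "cdiff ?W k \<in> Hom C (cobj ?W k) (cobj ?W (k + 1))" for k
  proof -
    consider "k < n - 1" | "k = n - 1" | "k \<ge> n" by linarith
    then show ?thesis
    proof cases
      case 1 then show ?thesis using complexD(2)[OF X, of k] by (simp add: cdiff_high cobj_high)
    next
      case 2 then show ?thesis using \<delta> by (simp add: cdiff_high cobj_high)
    next
      case 3 then show ?thesis using zero_Hom[OF splice_objects(5)[of \<delta> k] splice_objects(2)] by (simp add: cdiff_high cobj_high[of _ _ _ _ _ "k + 1"])
    qed
  qed
  moreover have "cdiff ?W (k + 1) \<cdot> cdiff ?W k = Zero C (cobj ?W k) (cobj ?W (k + 2))" for k
  proof -
    consider "k < n - 2" | "k = n - 2" | "k \<ge> n - 1" by linarith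
    then show ?thesis
    proof cases
      case 1 then show ?thesis using complexD(3)[OF X, of k] by (simp add: cdiff_high cobj_high)
    next
      case 2 then show ?thesis using \<delta> cdiff_high(1)[of "n - 2" n X N I \<delta>] by (simp add: cdiff_high(2) cobj_high)
    next
      case 3 then show ?thesis
        using zero_comp[OF H[of k] splice_objects(2)] by (simp add: cdiff_high(3)[of n "k + 1"] cobj_high[of _ _ _ _ _ "k + 2"])
    qed
  qed
  ultimately show ?thesis unfolding Ob_def is_complex_def using splice_objects(5) by blast
qed

lemma to_high:
  assumes \<delta>: "\<delta> \<in> Hom C (cobj X (n - 1)) I" and \<pi>: "\<pi> \<in> Hom C (cobj X n) I" "\<pi> \<cdot> cdiff X (n - 1) = \<delta>"
  shows "to_high X n N \<pi> \<in> chain_maps C X (high X n N I \<delta>)"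
proof -
  let ?W = "high X n N I \<delta>" and ?r = "to_high X n N \<pi>"
  have rH: "?r k \<in> Hom C (cobj X k) (cobj ?W k)" for k
    using \<pi>(1) splice_objects by (auto simp: to_high_def cobj_high zero_Hom Ident_Hom)
  have "cdiff ?W k \<cdot> ?r k = ?r (k + 1) \<cdot> cdiff X k" for k
  proof -
    consider "k < n - 1" | "k = n - 1" | "k \<ge> n" by linarith
    then show ?thesis
    proof cases
      case 1
      then show ?thesis using splice_ident[of k] by (simp add: to_high_def cdiff_high)
    next
      case 2
      then show ?thesis using Comp_Ident[OF \<delta>] \<pi> by (simp add: to_high_def cdiff_high)
    next
      case 3
      then show ?thesis
        using zero_comp[OF rH[of k] splice_objects(2)] zero_comp[OF complexD(2)[OF X, of k] splice_objects(2)]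
        by (simp add: to_high_def cdiff_high)
    qed
  qed
  then show ?thesis unfolding chain_maps_def using rH by simp
qed

lemma from_high:
  assumes \<delta>: "\<delta> \<in> Hom C (cobj X (n - 1)) I" and \<iota>: "\<iota> \<in> Hom C I (cobj X n)" "\<iota> \<cdot> \<delta> = cdiff X (n - 1)"
    "cdiff X n \<cdot> \<iota> = Zero C I (cobj X (n + 1))"
  shows "from_high X n N \<iota> \<in> chain_maps C (high X n N I \<delta>) X"
proof -
  let ?W = "high X n N I \<delta>" and ?t = "from_high X n N \<iota>"
  have tH: "?t k \<in> Hom C (cobj ?W k) (cobj X k)" for k
    using \<iota>(1) splice_objects by (auto simp: from_high_def cobj_high zero_Hom Ident_Hom)
  have "cdiff X k \<cdot> ?t k = ?t (k + 1) \<cdot> cdiff ?W k" for k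
  proof -
    consider "k < n - 1" | "k = n - 1" | "k = n" | "k > n" by linarith
    then show ?thesis
    proof cases
      case 1
      then show ?thesis using splice_ident[of k] by (simp add: from_high_def cdiff_high)
    next
      case 2
      then show ?thesis using \<iota> splice_ident(2)[of k] by (simp add: from_high_def cdiff_high)
    next
      case 3
      then show ?thesis using \<iota> comp_zero[OF tH[of "n + 1"] I] by (simp add: from_high_def cdiff_high cobj_high)
    next
      case 4
      then show ?thesis
        using comp_zero[OF tH[of "k + 1"] splice_objects(2)] comp_zero[OF complexD(2)[OF X, of k] splice_objects(2)]
        by (simp add: from_high_def cdiff_high cobj_high)
    qed
  qed
  then show ?thesis unfolding chain_maps_def using tH by simp
qed

end

text \<open>Where a complex \<open>X \<rightarrow> Y \<rightarrow> Z\<close> contracts in the middle, \<open>p a\<close> and \<open>b q\<close> are complementary idempotents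
  of \<open>Y\<close>: the first projects onto a complement of the cycles, the second onto the boundaries.\<close>

lemma split_middle:
  assumes kar: "karoubian C" and b: "b \<in> Hom C X Y" and a: "a \<in> Hom C Y Z" and ab: "a \<cdot> b = Zero C X Z"
    and q: "q \<in> Hom C Y X" and p: "p \<in> Hom C Z Y" and id: "Ident C Y = (b \<cdot> q) \<boxplus> (p \<cdot> a)"
  shows "\<exists>I \<pi> \<iota>. I \<in> Obj C \<and> \<pi> \<in> Hom C Y I \<and> \<iota> \<in> Hom C I Y \<and> \<iota> \<cdot> \<pi> = p \<cdot> a \<and> \<pi> \<cdot> \<iota> = Ident C I \<and>
      \<pi> \<cdot> b = Zero C X I \<and> (a \<cdot> \<iota>) \<cdot> \<pi> = a" (is ?cycles)
    and "\<exists>I \<pi> \<iota>. I \<in> Obj C \<and> \<pi> \<in> Hom C Y I \<and> \<iota> \<in> Hom C I Y \<and> \<iota> \<cdot> \<pi> = b \<cdot> q \<and> \<pi> \<cdot> \<iota> = Ident C I \<and>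
      a \<cdot> \<iota> = Zero C I Z \<and> \<iota> \<cdot> (\<pi> \<cdot> b) = b" (is ?boundaries)
proof -
  note O = Hom_objs[OF a] Hom_objs[OF b]
  note H = a[unfolded Hom_iff] b[unfolded Hom_iff] p[unfolded Hom_iff] q[unfolded Hom_iff]
  let ?r = ring_of
  have ab': "?r a * ?r b = 0" "?r a * (?r b * z) = 0" for z using ring_of_comp_eq[OF ab] H O by (simp_all add: ring_of_zero)
  have rid: "?r (Ident C Y) = ?r b * ?r q + ?r p * ?r a" using arg_cong[OF id, of ?r] H by (simp add: ring_arr ring_of_simps)
  have ra: "?r a * (?r p * ?r a) = ?r a" using ring_of_ident(2)[of a Y] H unfolding rid by (simp add: algebra_simps ab')
  have rb: "?r b * (?r q * ?r b) = ?r b" using ring_of_ident(1)[of b Y] H unfolding rid by (simp add: algebra_simps ab')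
  have split: "\<exists>I \<pi> \<iota>. I \<in> Obj C \<and> \<pi> \<in> Hom C Y I \<and> \<iota> \<in> Hom C I Y \<and> \<iota> \<cdot> \<pi> = \<epsilon> \<and> \<pi> \<cdot> \<iota> = Ident C I \<and>
      ?r \<pi> = ?r \<pi> * ?r \<epsilon> \<and> ?r \<iota> = ?r \<epsilon> * ?r \<iota>"
    if e: "\<epsilon> \<in> Hom C Y Y" "?r \<epsilon> * ?r \<epsilon> = ?r \<epsilon>" for \<epsilon>
  proof -
    have "\<epsilon> \<cdot> \<epsilon> = \<epsilon>" by (rule ring_of_inject) (use e in \<open>simp_all add: Hom_iff ring_of_comp\<close>)
    then obtain I \<pi> \<iota> where I: "I \<in> Obj C" "\<pi> \<in> Hom C Y I" "\<iota> \<in> Hom C I Y" "\<iota> \<cdot> \<pi> = \<epsilon>" "\<pi> \<cdot> \<iota> = Ident C I"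
      using kar e(1) O unfolding karoubian_def by blast
    note pi = I(2,3)[unfolded Hom_iff]
    have 1: "?r \<iota> * ?r \<pi> = ?r \<epsilon>" using ring_of_comp_eq(1)[OF I(4)] pi by simp
    have "?r \<pi> * (?r \<iota> * ?r \<pi>) = ?r \<pi>" using ring_of_comp_eq(1)[OF I(5)] pi by (simp add: ring_of_ident flip: mult.assoc)
    moreover have "(?r \<iota> * ?r \<pi>) * ?r \<iota> = ?r \<iota>" using ring_of_comp_eq(1)[OF I(5)] pi by (simp add: ring_of_ident mult.assoc)
    ultimately have "?r \<pi> = ?r \<pi> * ?r \<epsilon>" "?r \<iota> = ?r \<epsilon> * ?r \<iota>" unfolding 1 by simp_all
    then show ?thesis using I by blast
  qed
  have pa: "p \<cdot> a \<in> Hom C Y Y" "?r (p \<cdot> a) = ?r p * ?r a" and bq: "b \<cdot> q \<in> Hom C Y Y" "?r (b \<cdot> q) = ?r b * ?r q"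
    using H by (simp_all add: Hom_iff ring_of_comp)
  have "?r (p \<cdot> a) * ?r (p \<cdot> a) = ?r (p \<cdot> a)" "?r (b \<cdot> q) * ?r (b \<cdot> q) = ?r (b \<cdot> q)"
    unfolding pa bq using ra arg_cong[OF rb, of "\<lambda>z. z * ?r q"] by (simp_all add: mult.assoc)
  note s = split[OF pa(1) this(1)] split[OF bq(1) this(2)]
  obtain I \<pi> \<iota> where I: "I \<in> Obj C" "\<pi> \<in> Hom C Y I" "\<iota> \<in> Hom C I Y" "\<iota> \<cdot> \<pi> = p \<cdot> a" "\<pi> \<cdot> \<iota> = Ident C I"
    "?r \<pi> = ?r \<pi> * ?r (p \<cdot> a)" using s(1) by blast
  have "?r \<pi> * ?r b = 0" by (subst I(6)) (simp add: mult.assoc ab' pa)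
  then have "\<pi> \<cdot> b = Zero C X I"
    by (intro ring_of_inject) (use I(1-3) H O in \<open>simp_all add: Hom_iff ring_arr ring_of_comp ring_of_zero\<close>)
  moreover have "(a \<cdot> \<iota>) \<cdot> \<pi> = a \<cdot> (p \<cdot> a)" using Comp_assoc[OF I(2,3) a] I(4) by simp
  moreover have "a \<cdot> (p \<cdot> a) = a" by (rule ring_of_inject) (use ra H in \<open>simp_all add: ring_of_comp\<close>)
  ultimately show ?cycles using I(1-5) by (intro exI[of _ I] exI[of _ \<pi>] exI[of _ \<iota>]) simp
  obtain I \<pi> \<iota> where I: "I \<in> Obj C" "\<pi> \<in> Hom C Y I" "\<iota> \<in> Hom C I Y" "\<iota> \<cdot> \<pi> = b \<cdot> q" "\<pi> \<cdot> \<iota> = Ident C I"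
    "?r \<iota> = ?r (b \<cdot> q) * ?r \<iota>" using s(2) by blast
  have "?r a * ?r \<iota> = 0" by (subst I(6)) (simp add: mult.assoc ab' bq)
  then have "a \<cdot> \<iota> = Zero C I Z"
    by (intro ring_of_inject) (use I(1-3) H O in \<open>simp_all add: Hom_iff ring_arr ring_of_comp ring_of_zero\<close>)
  moreover have "\<iota> \<cdot> (\<pi> \<cdot> b) = (b \<cdot> q) \<cdot> b" using Comp_assoc[OF b I(2,3)] I(4) by simp
  moreover have "(b \<cdot> q) \<cdot> b = b" by (rule ring_of_inject) (use rb H in \<open>simp_all add: ring_of_comp\<close>)
  ultimately show ?boundaries using I(1-5) by (intro exI[of _ I] exI[of _ \<pi>] exI[of _ \<iota>]) simp
qed

text \<open>In the degree where the contraction ends, the image of the idempotent takes the place of the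
  contractible part; this is the only point where idempotents have to split.\<close>

lemma split_low:
  assumes kar: "karoubian C" and X: "X \<in> Ob" and h: "h \<in> G X X (-1)" "\<And>n. n < m \<Longrightarrow> contractible_in X h n"
  obtains W where "W \<in> Ob" "isomorphic K X W" "\<And>n. n < m - 1 \<Longrightarrow> zero_object C (cobj W n)" "\<And>n. n \<ge> m \<Longrightarrow> cobj W n = cobj X n"
proof -
  obtain k where kH: "\<And>n. k n \<in> Hom C (cobj X n) (cobj X (n - 1))"
    and kI: "\<And>n. n < m \<Longrightarrow> Ident C (cobj X n) = (cdiff X (n - 1) \<cdot> k n) \<boxplus> (k (n + 1) \<cdot> cdiff X n)"
    using contractible_components[OF X h(1)] h(2) by metis
  define l where "l = m - 1"
  note O = complexD(1)[OF X]
  have D: "cdiff X n \<in> Arr C" "Dom C (cdiff X n) = cobj X n" "Cod C (cdiff X n) = cobj X (n + 1)" for n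
    using complexD(2)[OF X, of n] by (auto simp: Hom_iff)
  have dd: "cdiff X n \<cdot> cdiff X (n - 1) = Zero C (cobj X (n - 1)) (cobj X (n + 1))" for n
    using complexD(3)[OF X, of "n - 1"] by (simp add: add.commute)
  have K: "k n \<in> Arr C" "Dom C (k n) = cobj X n" "Cod C (k n) = cobj X (n - 1)" for n using kH[of n] by (auto simp: Hom_iff)
  have D': "cdiff X (l - 1) \<in> Hom C (cobj X (l - 1)) (cobj X l)" using complexD(2)[OF X, of "l - 1"] by simp
  have k': "k (l + 1) \<in> Hom C (cobj X (l + 1)) (cobj X l)" using kH[of "l + 1"] by simp
  have "l < m" by (simp add: l_def)
  obtain I \<pi> \<iota> where I: "I \<in> Obj C" "\<pi> \<in> Hom C (cobj X l) I" "\<iota> \<in> Hom C I (cobj X l)" "\<iota> \<cdot> \<pi> = k (l + 1) \<cdot> cdiff X l"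
    "\<pi> \<cdot> \<iota> = Ident C I" "\<pi> \<cdot> cdiff X (l - 1) = Zero C (cobj X (l - 1)) I" "(cdiff X l \<cdot> \<iota>) \<cdot> \<pi> = cdiff X l"
    using split_middle(1)[OF kar D' complexD(2)[OF X] dd kH k' kI[OF \<open>l < m\<close>]] by blast
  obtain N where N: "zero_object C N" using ex_zero by blast
  then have N': "N \<in> Obj C" "Ident C N = Zero C N N" by (auto simp: zero_object_iff)
  define \<delta> where "\<delta> = cdiff X l \<cdot> \<iota>"
  let ?W = "low X l N I \<delta>" and ?r = "to_low X l N \<pi>" and ?t = "from_low X l N \<iota>"
  define H where "H n = (if n \<le> l then k n else Zero C (cobj X n) (cobj X (n - 1)))" for n
  have dH: "\<delta> \<in> Hom C I (cobj X (l + 1))" unfolding \<delta>_def by (rule Comp_Hom[OF I(3) complexD(2)[OF X]])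
  have "cdiff X (l + 1) \<cdot> \<delta> = (cdiff X (l + 1) \<cdot> cdiff X l) \<cdot> \<iota>"
    unfolding \<delta>_def by (rule Comp_assoc[OF I(3) complexD(2)[OF X] complexD(2)[OF X], symmetric])
  also have "\<dots> = Zero C I (cobj X (l + 2))" unfolding complexD(3)[OF X] by (rule zero_comp[OF I(3) O])
  finally have dd': "cdiff X (l + 1) \<cdot> \<delta> = Zero C I (cobj X (l + 2))" .
  note pid = I(6) and de = I(7)[folded \<delta>_def]
  have rt: "?r n \<cdot> ?t n = Ident C (cobj ?W n)" for n
    using I(5) N' comp_zero[OF zero_Hom[OF O N'(1)] N'(1)] Comp_Ident[OF Ident_Hom[OF O[of n]]]
    by (auto simp: to_low_def from_low_def cobj_low)
  have HH: "H n \<in> Hom C (cobj X n) (cobj X (n - 1))" for n using kH zero_Hom[OF O O] by (simp add: H_def)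
  have Hom: "Ident C (cobj X n) = (?t n \<cdot> ?r n) \<boxplus> ((cdiff X (n - 1) \<cdot> H n) \<boxplus> (H (n + 1) \<cdot> cdiff X n))" for n
  proof -
    have a: "cdiff X (n - 1) \<cdot> k n \<in> Hom C (cobj X n) (cobj X n)" "k (n + 1) \<cdot> cdiff X n \<in> Hom C (cobj X n) (cobj X n)"
      using D[of n] D[of "n - 1"] K[of n] K[of "n + 1"] by (auto simp: Hom_iff)
    have z: "Zero C (cobj X (n + 1)) (cobj X n) \<cdot> cdiff X n = Zero C (cobj X n) (cobj X n)"
      "cdiff X (n - 1) \<cdot> Zero C (cobj X n) (cobj X (n - 1)) = Zero C (cobj X n) (cobj X n)"
      using zero_comp[OF complexD(2)[OF X, of n] O] comp_zero[OF complexD(2)[OF X, of "n - 1"] O] by simp_all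
    note zz = zero_Hom[OF O[of n] O[of n]]
    have iz: "f \<boxplus> Zero C (cobj X n) (cobj X n) = f" if "f \<in> Hom C (cobj X n) (cobj X n)" for f
      using zero_add[OF O O that] add_commute[OF O O that zz] by simp
    consider "n < l" | "n = l" | "n > l" by linarith
    then show ?thesis
    proof cases
      case 1
      then show ?thesis
        using kI[of n] comp_zero[OF zero_Hom[OF N'(1) O[of n]] O[of n]] zero_add[OF O O add_Hom[OF O O a]]
        by (simp add: from_low_def to_low_def H_def l_def)
    next
      case 2
      then show ?thesis using kI[of n] I(4) a z iz add_commute[OF O O a] by (simp add: from_low_def to_low_def H_def l_def)
    next
      case 3
      then show ?thesis
        using z iz[OF zz] iz[OF Ident_Hom[OF O]] Comp_Ident[OF Ident_Hom[OF O[of n]]] by (simp add: from_low_def to_low_def H_def)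
    qed
  qed
  have "isomorphic K X ?W" by (rule isomorphic_of_retraction[OF X low_complex[OF X N I(1) dH dd'] to_low[OF X N I(1) dH dd' I(2) de pid]
      from_low[OF X N I(1) dH I(3) \<delta>_def[symmetric]] rt HH Hom])
  moreover have "zero_object C (cobj ?W n)" if "n < m - 1" for n using that N by (simp add: cobj_low l_def)
  moreover have "cobj ?W n = cobj X n" if "n \<ge> m" for n using that by (simp add: cobj_low l_def)
  ultimately show ?thesis using that low_complex[OF X N I(1) dH dd'] by blast
qed

lemma split_high:
  assumes kar: "karoubian C" and X: "X \<in> Ob" and h: "h \<in> G X X (-1)" "\<And>n. n > m \<Longrightarrow> contractible_in X h n"
  obtains W where "W \<in> Ob" "isomorphic K X W" "\<And>n. n > m + 1 \<Longrightarrow> zero_object C (cobj W n)"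
proof -
  obtain k where kH: "\<And>n. k n \<in> Hom C (cobj X n) (cobj X (n - 1))"
    and kI: "\<And>n. n > m \<Longrightarrow> Ident C (cobj X n) = (cdiff X (n - 1) \<cdot> k n) \<boxplus> (k (n + 1) \<cdot> cdiff X n)"
    using contractible_components[OF X h(1)] h(2) by metis
  define l where "l = m + 1"
  then have "m < l" by simp
  note O = complexD(1)[OF X]
  have D: "cdiff X n \<in> Arr C" "Dom C (cdiff X n) = cobj X n" "Cod C (cdiff X n) = cobj X (n + 1)" for n
    using complexD(2)[OF X, of n] by (auto simp: Hom_iff)
  have dd: "cdiff X n \<cdot> cdiff X (n - 1) = Zero C (cobj X (n - 1)) (cobj X (n + 1))" for n
    using complexD(3)[OF X, of "n - 1"] by (simp add: add.commute)
  have K: "k n \<in> Arr C" "Dom C (k n) = cobj X n" "Cod C (k n) = cobj X (n - 1)" for n using kH[of n] by (auto simp: Hom_iff)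
  have D1: "cdiff X (l - 1) \<in> Hom C (cobj X (l - 1)) (cobj X l)" using complexD(2)[OF X, of "l - 1"] by simp
  have D2: "cdiff X (l - 2) \<in> Hom C (cobj X (l - 2)) (cobj X (l - 1))" using complexD(2)[OF X, of "l - 2"] by simp
  have k': "k (l + 1) \<in> Hom C (cobj X (l + 1)) (cobj X l)" using kH[of "l + 1"] by simp
  obtain I \<pi> \<iota> where I: "I \<in> Obj C" "\<pi> \<in> Hom C (cobj X l) I" "\<iota> \<in> Hom C I (cobj X l)" "\<iota> \<cdot> \<pi> = cdiff X (l - 1) \<cdot> k l"
    "\<pi> \<cdot> \<iota> = Ident C I" "cdiff X l \<cdot> \<iota> = Zero C I (cobj X (l + 1))" "\<iota> \<cdot> (\<pi> \<cdot> cdiff X (l - 1)) = cdiff X (l - 1)"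
    using split_middle(2)[OF kar D1 complexD(2)[OF X] dd kH k' kI[OF \<open>m < l\<close>]] by blast
  obtain N where N: "zero_object C N" using ex_zero by blast
  then have N': "N \<in> Obj C" "Ident C N = Zero C N N" by (auto simp: zero_object_iff)
  define \<delta> where "\<delta> = \<pi> \<cdot> cdiff X (l - 1)"
  let ?W = "high X l N I \<delta>" and ?r = "to_high X l N \<pi>" and ?t = "from_high X l N \<iota>"
  define H where "H n = (if n \<le> l then Zero C (cobj X n) (cobj X (n - 1)) else k n)" for n
  have dH: "\<delta> \<in> Hom C (cobj X (l - 1)) I" unfolding \<delta>_def by (rule Comp_Hom[OF D1 I(2)])
  have "\<delta> \<cdot> cdiff X (l - 2) = \<pi> \<cdot> (cdiff X (l - 1) \<cdot> cdiff X (l - 2))"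
    unfolding \<delta>_def by (rule Comp_assoc[OF D2 D1 I(2)])
  also have "\<dots> = Zero C (cobj X (l - 2)) I" using comp_zero[OF I(2) O] dd[of "l - 1"] by simp
  finally have dd': "\<delta> \<cdot> cdiff X (l - 2) = Zero C (cobj X (l - 2)) I" .
  note di = I(6) and ed = I(7)[folded \<delta>_def]
  have rt: "?r n \<cdot> ?t n = Ident C (cobj ?W n)" for n
    using I(5) N' comp_zero[OF zero_Hom[OF O N'(1)] N'(1)] Comp_Ident[OF Ident_Hom[OF O[of n]]]
    by (auto simp: to_high_def from_high_def cobj_high)
  have HH: "H n \<in> Hom C (cobj X n) (cobj X (n - 1))" for n using kH zero_Hom[OF O O] by (simp add: H_def)
  have Hom: "Ident C (cobj X n) = (?t n \<cdot> ?r n) \<boxplus> ((cdiff X (n - 1) \<cdot> H n) \<boxplus> (H (n + 1) \<cdot> cdiff X n))" for n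
  proof -
    have a: "cdiff X (n - 1) \<cdot> k n \<in> Hom C (cobj X n) (cobj X n)" "k (n + 1) \<cdot> cdiff X n \<in> Hom C (cobj X n) (cobj X n)"
      using D[of n] D[of "n - 1"] K[of n] K[of "n + 1"] by (auto simp: Hom_iff)
    have z: "Zero C (cobj X (n + 1)) (cobj X n) \<cdot> cdiff X n = Zero C (cobj X n) (cobj X n)"
      "cdiff X (n - 1) \<cdot> Zero C (cobj X n) (cobj X (n - 1)) = Zero C (cobj X n) (cobj X n)"
      using zero_comp[OF complexD(2)[OF X, of n] O] comp_zero[OF complexD(2)[OF X, of "n - 1"] O] by simp_all
    note zz = zero_Hom[OF O[of n] O[of n]]
    have iz: "f \<boxplus> Zero C (cobj X n) (cobj X n) = f" if "f \<in> Hom C (cobj X n) (cobj X n)" for f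
      using zero_add[OF O O that] add_commute[OF O O that zz] by simp
    consider "n < l" | "n = l" | "n > l" by linarith
    then show ?thesis
    proof cases
      case 1
      then show ?thesis
        using z iz[OF zz] iz[OF Ident_Hom[OF O]] Comp_Ident[OF Ident_Hom[OF O[of n]]] by (simp add: from_high_def to_high_def H_def)
    next
      case 2
      then show ?thesis using kI[of n] I(4) a z zero_add[OF O O a(2)] by (simp add: from_high_def to_high_def H_def l_def)
    next
      case 3
      then show ?thesis
        using kI[of n] comp_zero[OF zero_Hom[OF N'(1) O[of n]] O[of n]] zero_add[OF O O add_Hom[OF O O a]]
        by (simp add: from_high_def to_high_def H_def l_def)
    qed
  qed
  have "isomorphic K X ?W" by (rule isomorphic_of_retraction[OF X high_complex[OF X N I(1) dH dd'] to_high[OF X N I(1) dH I(2) \<delta>_def[symmetric]]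
      from_high[OF X N I(1) dH I(3) ed di] rt HH Hom])
  moreover have "zero_object C (cobj ?W n)" if "n > m + 1" for n using that N by (simp add: cobj_high l_def)
  ultimately show ?thesis using that high_complex[OF X N I(1) dH dd'] by blast
qed

end

section \<open>Exactness of complexes over a full subcategory\<close>

context additive_acat
begin

definition components :: "('o, 'm) cochain \<Rightarrow> ('o, 'm) cochain \<Rightarrow> int \<Rightarrow> ('o, 'm) gop \<Rightarrow> int \<Rightarrow> 'm" where
  "components X Y k x = inv_into (graded_hom C (cobj X) (cobj Y) k) (act C (cobj X) (cobj Y) k) x"

lemma components_act: "f \<in> graded_hom C (cobj X) (cobj Y) k \<Longrightarrow> components X Y k (act C (cobj X) (cobj Y) k f) = f"
  unfolding components_def by (rule inv_into_f_f) (auto intro: inj_onI act_inject)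

lemma components_Hom: "x \<in> G X Y k \<Longrightarrow> components X Y k x n \<in> Hom C (cobj X n) (cobj Y (n + k))"
  by (elim GE) (simp add: components_act graded_homD)

lemma components_mult:
  assumes "x \<in> G X Y k" "y \<in> G Y Z l"
  shows "components X Z (k + l) (y * x) n = components Y Z l y (n + k) \<cdot> components X Y k x n"
proof -
  obtain f where f: "f \<in> graded_hom C (cobj X) (cobj Y) k" "x = act C (cobj X) (cobj Y) k f" using assms(1) by (rule GE)
  obtain g where g: "g \<in> graded_hom C (cobj Y) (cobj Z) l" "y = act C (cobj Y) (cobj Z) l g" using assms(2) by (rule GE)
  show ?thesis unfolding f(2) g(2) act_mult[OF f(1) g(1)] components_act[OF graded_hom_comp[OF f(1) g(1)]]
    components_act[OF f(1)] components_act[OF g(1)] ..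
qed

lemma components_add:
  assumes "x \<in> G X Y k" "y \<in> G X Y k"
  shows "components X Y k (x + y) n = components X Y k x n \<boxplus> components X Y k y n"
proof -
  obtain f where f: "f \<in> graded_hom C (cobj X) (cobj Y) k" "x = act C (cobj X) (cobj Y) k f" using assms(1) by (rule GE)
  obtain g where g: "g \<in> graded_hom C (cobj X) (cobj Y) k" "y = act C (cobj X) (cobj Y) k g" using assms(2) by (rule GE)
  show ?thesis unfolding f(2) g(2) act_add[OF f(1) g(1)] components_act[OF graded_hom_add[OF f(1) g(1)]]
    components_act[OF f(1)] components_act[OF g(1)] ..
qed

lemma components_e: "X \<in> Ob \<Longrightarrow> components X X 0 (e X) n = Ident C (cobj X n)"
  unfolding e_def components_act[OF id_graded(1)] ..

lemma components_d: "X \<in> Ob \<Longrightarrow> components X X 1 (d X) n = cdiff X n"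
  unfolding d_def components_act[OF id_graded(4)] ..

lemma components_zero:
  assumes "X \<in> Ob" "Y \<in> Ob"
  shows "components X Y k 0 n = Zero C (cobj X n) (cobj Y (n + k))"
  using components_act[OF graded_hom_zero[of "cobj X" "cobj Y" k]] act_zero[of "cobj X" "cobj Y" k] complexD(1)[OF assms(1)] complexD(1)[OF assms(2)]
  by simp

end

locale karoubian_subcategory = A: abelian_acat A for A :: "('o, 'm) acat" +
  fixes E :: "'o set"
  assumes E_Obj: "E \<subseteq> Obj A"
    and additive_sub: "additive_category (full_subcat A E)"
    and karoubian_sub: "karoubian (full_subcat A E)"
begin

abbreviation C where "C \<equiv> full_subcat A E"

sublocale additive_acat C by (rule additive_acat.intro, rule additive_sub)

lemma sub_simps [simp]:
  "Obj C = E" "Dom C = Dom A" "Cod C = Cod A" "Ident C = Ident A" "Comp C = Comp A" "Add C = Add A" "Zero C = Zero A"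
  by (simp_all add: full_subcat_def)

lemma sub_Arr: "f \<in> Arr C \<longleftrightarrow> f \<in> Arr A \<and> Dom A f \<in> E \<and> Cod A f \<in> E"
  by (simp add: full_subcat_def)

lemma sub_Hom: "Hom C X Y = {f \<in> Hom A X Y. X \<in> E \<and> Y \<in> E}"
  by (auto simp: Hom_def sub_Arr)

lemma sub_zero_object: "zero_object C Z \<longleftrightarrow> Z \<in> E \<and> zero_object A Z"
  unfolding zero_object_iff A.zero_object_iff using E_Obj by auto

abbreviation A_comp (infixr "\<odot>" 70) where "g \<odot> f \<equiv> g \<cdot>\<^bsub>A\<^esub> f"

abbreviation r where "r \<equiv> A.ring_of"

abbreviation D where "D X n \<equiv> r (cdiff X n)"

lemma diff_Hom: "X \<in> Ob \<Longrightarrow> cdiff X n \<in> Hom A (cobj X n) (cobj X (n + 1))" "X \<in> Ob \<Longrightarrow> cdiff X (n - 1) \<in> Hom A (cobj X (n - 1)) (cobj X n)"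
  using complexD(2)[of X n] complexD(2)[of X "n - 1"] by (auto simp: sub_Hom)

lemma sub_complex: "X \<in> Ob \<Longrightarrow> is_complex A X"
  unfolding is_complex_def using complexD[of X] E_Obj by (auto simp: sub_Hom)

lemma obj_A: "X \<in> Ob \<Longrightarrow> cobj X n \<in> Obj A"
  using complexD(1)[of X n] E_Obj by auto

lemma exact_at_ring:
  assumes X: "X \<in> Ob"
  shows "A.exact_at X n \<longleftrightarrow> (\<forall>W. \<forall>g \<in> Hom A W (cobj X n). D X n * r g = 0 \<longrightarrow>
     (\<exists>P e g'. is_epi A e \<and> e \<in> Hom A P W \<and> g' \<in> Hom A P (cobj X (n - 1)) \<and> r g * r e = D X (n - 1) * r g'))"
proof -
  have 1: "cdiff X n \<odot> g = Zero A W (cobj X (n + 1)) \<longleftrightarrow> D X n * r g = 0" if "g \<in> Hom A W (cobj X n)" for W g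
    using A.ring_of_zero_iff[OF A.Comp_Hom[OF that diff_Hom(1)[OF X]]] that diff_Hom(1)[OF X, of n] by (simp add: Hom_iff A.ring_of_comp)
  have 2: "g \<odot> e = cdiff X (n - 1) \<odot> g' \<longleftrightarrow> r g * r e = D X (n - 1) * r g'"
    if "g \<in> Hom A W (cobj X n)" "e \<in> Hom A P W" "g' \<in> Hom A P (cobj X (n - 1))" for W P g e g'
  proof -
    note h = that[unfolded Hom_iff] diff_Hom(2)[OF X, of n, unfolded Hom_iff]
    have "r g * r e = r (g \<odot> e)" "D X (n - 1) * r g' = r (cdiff X (n - 1) \<odot> g')" using h by (simp_all add: A.ring_of_comp)
    then show ?thesis using h A.ring_of_inject[of "g \<odot> e" "cdiff X (n - 1) \<odot> g'"] by auto
  qed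
  show ?thesis unfolding A.exact_at_def
    by (intro all_cong1 ball_cong refl imp_cong 1 ex_cong1 conj_cong 2) assumption+
qed

lemma zero_exact:
  assumes X: "X \<in> Ob" and z: "zero_object A (cobj X n)"
  shows "A.exact_at X n"
  unfolding exact_at_ring[OF X]
proof (intro allI ballI impI)
  fix W g assume g: "g \<in> Hom A W (cobj X n)"
  have W: "W \<in> Obj A" using A.Hom_objs[OF g] by simp
  have "r (Ident A (cobj X n)) = 0" using z A.ring_of_zero[of "cobj X n" "cobj X n"] by (simp add: A.zero_object_iff)
  then have "r g = 0" using A.ring_of_ident(1)[of g "cobj X n"] g by (simp add: Hom_iff)
  then show "\<exists>P e g'. is_epi A e \<and> e \<in> Hom A P W \<and> g' \<in> Hom A P (cobj X (n - 1)) \<and> r g * r e = D X (n - 1) * r g'"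
    using A.epi_ident[OF W] A.Ident_Hom[OF W] A.zero_Hom[OF W obj_A[OF X, of "n - 1"]] A.ring_of_zero[OF W obj_A[OF X, of "n - 1"]]
    by (intro exI[of _ W] exI[of _ "Ident A W"] exI[of _ "Zero A W (cobj X (n - 1))"]) simp
qed

definition at :: "('o, 'm) cochain \<Rightarrow> ('o, 'm) cochain \<Rightarrow> int \<Rightarrow> ('o, 'm) gop \<Rightarrow> int \<Rightarrow> ('o, 'm) gop" where
  "at X Y k x n = r (components X Y k x n)"

lemma components_A: "x \<in> G X Y k \<Longrightarrow> components X Y k x n \<in> Hom A (cobj X n) (cobj Y (n + k))"
  using components_Hom[of x X Y k n] by (simp add: sub_Hom)

lemma at_mult: "x \<in> G X Y k \<Longrightarrow> y \<in> G Y Z l \<Longrightarrow> at X Z (k + l) (y * x) n = at Y Z l y (n + k) * at X Y k x n"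
  using components_A[of x X Y k n] components_A[of y Y Z l "n + k"] by (simp add: at_def components_mult A.ring_of_comp Hom_iff)

lemma at_add: "x \<in> G X Y k \<Longrightarrow> y \<in> G X Y k \<Longrightarrow> at X Y k (x + y) n = at X Y k x n + at X Y k y n"
  using components_A[of x X Y k n] components_A[of y X Y k n] by (simp add: at_def components_add A.ring_of_add Hom_iff)

lemma at_e: "X \<in> Ob \<Longrightarrow> at X X 0 (e X) n = r (Ident A (cobj X n))"
  by (simp add: at_def components_e)

lemma at_d: "X \<in> Ob \<Longrightarrow> at X X 1 (d X) n = D X n"
  by (simp add: at_def components_d)

lemma at_zero: "X \<in> Ob \<Longrightarrow> Y \<in> Ob \<Longrightarrow> at X Y k 0 n = 0"
  using obj_A[of X n] obj_A[of Y "n + k"] by (simp add: at_def components_zero A.ring_of_zero)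

lemma at_chn: "chn X Y x \<Longrightarrow> D Y n * at X Y 0 x n = at X Y 0 x (n + 1) * D X n"
  using at_mult[of x X Y 0 "d Y" Y 1 n] at_mult[of "d X" X X 1 x Y 0 n] chnD[of X Y x] d_G[of X] d_G[of Y] at_d[of X n] at_d[of Y n] by simp

text \<open>A cycle of the cone is a pair \<open>(a, b)\<close> with \<open>d a = 0\<close> and \<open>f a + d b = 0\<close>, and the boundary of \<open>(a', b')\<close> is
  \<open>(- d a', f a' + d b')\<close>.\<close>

lemma cone_exact_at:
  assumes c: "cone X Y f Z i j p q"
    and lift: "\<And>W a b. a \<in> Hom A W (cobj X (m + 1)) \<Longrightarrow> b \<in> Hom A W (cobj Y m) \<Longrightarrow> D X (m + 1) * r a = 0 \<Longrightarrow>
      at X Y 0 f (m + 1) * r a + D Y m * r b = 0 \<Longrightarrow>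
      \<exists>P e a' b'. is_epi A e \<and> e \<in> Hom A P W \<and> a' \<in> Hom A P (cobj X m) \<and> b' \<in> Hom A P (cobj Y (m - 1)) \<and>
        r a * r e = - (D X m * r a') \<and> r b * r e = at X Y 0 f m * r a' + D Y (m - 1) * r b'"
  shows "A.exact_at Z m"
  unfolding exact_at_ring[OF coneD(4)[OF c]]
proof (intro allI ballI impI)
  fix W g assume g: "g \<in> Hom A W (cobj Z m)" "D Z m * r g = 0"
  note O = coneD(2-4)[OF c] and t = coneD(5-9)[OF c]
  note dG = d_G[OF O(1)] d_G[OF O(2)] d_G[OF O(3)]
  let ?I = "at X Z (-1) i" and ?J = "at Y Z 0 j" and ?P = "at Z X 1 p" and ?Q = "at Z Y 0 q" and ?F = "at X Y 0 f"
  have 1: "D X (m + 1) * ?P m + ?P (m + 1) * D Z m = 0"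
  proof -
    have "d X * p + p * d Z = 0" by (simp add: cone_rules[OF c])
    then have "at Z X 2 (d X * p + p * d Z) m = 0" using at_zero[OF O(3,1)] by simp
    moreover have "d X * p \<in> G Z X 2" "p * d Z \<in> G Z X 2" by (rule G_multI[OF dG(1) t(4)], simp) (rule G_multI[OF t(4) dG(3)], simp)
    ultimately show ?thesis using at_mult[OF t(4) dG(1), of m] at_mult[OF dG(3) t(4), of m] by (simp add: at_add at_d O)
  qed
  have 2: "?F (m + 1) * ?P m + D Y m * ?Q m = ?Q (m + 1) * D Z m"
  proof -
    have "at Z Y 1 (q * d Z) m = at Z Y 1 (f * p + d Y * q) m" by (simp add: cone_rules[OF c])
    moreover have "f * p \<in> G Z Y 1" "d Y * q \<in> G Z Y 1" by (rule G_multI[OF t(1,4)], simp) (rule G_multI[OF dG(2) t(5)], simp)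
    ultimately show ?thesis
      using at_mult[OF t(4,1), of m] at_mult[OF t(5) dG(2), of m] at_mult[OF dG(3) t(5), of m] by (simp add: at_add at_d O)
  qed
  have 3: "D Z (m - 1) * ?I m + ?I (m + 1) * D X m = ?J m * ?F m"
  proof -
    have "at X Z 0 (d Z * i + i * d X) m = at X Z 0 (j * f) m" by (simp add: cone_rules[OF c])
    moreover have "d Z * i \<in> G X Z 0" "i * d X \<in> G X Z 0" by (rule G_multI[OF dG(3) t(2)], simp) (rule G_multI[OF t(2) dG(1)], simp)
    ultimately show ?thesis
      using at_mult[OF t(2) dG(3), of m] at_mult[OF dG(1) t(2), of m] at_mult[OF t(1,3), of m] by (simp add: at_add at_d O)
  qed
  have 4: "D Z (m - 1) * ?J (m - 1) = ?J m * D Y (m - 1)" using at_chn[OF chn_j[OF c], of "m - 1"] by simp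
  have 5: "?I (m + 1) * ?P m + ?J m * ?Q m = r (Ident A (cobj Z m))"
  proof -
    have "at Z Z 0 (e Z) m = at Z Z 0 (i * p + j * q) m" using coneD(10)[OF c] by simp
    moreover have "i * p \<in> G Z Z 0" "j * q \<in> G Z Z 0" by (rule G_multI[OF t(2,4)], simp) (rule G_multI[OF t(3,5)], simp)
    ultimately show ?thesis using at_mult[OF t(4,2), of m] at_mult[OF t(5,3), of m] by (simp add: at_add at_e O)
  qed
  define a where "a = components Z X 1 p m \<odot> g"
  define b where "b = components Z Y 0 q m \<odot> g"
  note cp = components_A[OF t(4), of m] components_A[OF t(5), of m]
  have ab: "a \<in> Hom A W (cobj X (m + 1))" "b \<in> Hom A W (cobj Y m)"
    using A.Comp_Hom[OF g(1) cp(1)] A.Comp_Hom[OF g(1) cp(2)] by (simp_all add: a_def b_def)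
  have rab: "r a = ?P m * r g" "r b = ?Q m * r g"
    using cp g(1) by (simp_all add: a_def b_def at_def Hom_iff A.ring_of_comp)
  have z: "x * (D Z m * r g) = 0" for x using g(2) by simp
  have "D X (m + 1) * r a = (D X (m + 1) * ?P m + ?P (m + 1) * D Z m) * r g" unfolding rab by (simp add: ring_distribs mult.assoc z)
  then have c1: "D X (m + 1) * r a = 0" unfolding 1 by simp
  have "?F (m + 1) * r a + D Y m * r b = (?F (m + 1) * ?P m + D Y m * ?Q m) * r g" unfolding rab by (simp add: ring_distribs mult.assoc)
  then have c2: "?F (m + 1) * r a + D Y m * r b = 0" unfolding 2 by (simp add: mult.assoc g(2))
  obtain P e a' b' where e: "is_epi A e" "e \<in> Hom A P W" and ab': "a' \<in> Hom A P (cobj X m)" "b' \<in> Hom A P (cobj Y (m - 1))"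
    and l: "r a * r e = - (D X m * r a')" "r b * r e = ?F m * r a' + D Y (m - 1) * r b'"
    using lift[OF ab c1 c2] by blast
  define g' where "g' = (components X Z (-1) i m \<odot> a') \<boxplus>\<^bsub>A\<^esub> (components Y Z 0 j (m - 1) \<odot> b')"
  note cq = components_A[OF t(2), of m] components_A[OF t(3), of "m - 1"]
  have h: "components X Z (-1) i m \<odot> a' \<in> Hom A P (cobj Z (m - 1))" "components Y Z 0 j (m - 1) \<odot> b' \<in> Hom A P (cobj Z (m - 1))"
    using A.Comp_Hom[OF ab'(1) cq(1)] A.Comp_Hom[OF ab'(2) cq(2)] by simp_all
  have g': "g' \<in> Hom A P (cobj Z (m - 1))" "r g' = ?I m * r a' + ?J (m - 1) * r b'"
    using h cq ab' by (simp_all add: g'_def at_def Hom_iff A.ring_arr A.ring_of_add A.ring_of_comp)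
  have "D Z (m - 1) * r g' = (D Z (m - 1) * ?I m + ?I (m + 1) * D X m) * r a' + ?I (m + 1) * (- (D X m * r a')) + (D Z (m - 1) * ?J (m - 1)) * r b'"
    unfolding g'(2) by (simp add: ring_distribs mult.assoc)
  also have "\<dots> = ?I (m + 1) * (r a * r e) + ?J m * (r b * r e)"
    unfolding 3 4 l by (simp add: ring_distribs mult.assoc)
  also have "\<dots> = (?I (m + 1) * ?P m + ?J m * ?Q m) * (r g * r e)" unfolding rab by (simp add: ring_distribs mult.assoc)
  also have "\<dots> = r g * r e" unfolding 5 using A.ring_of_ident(1)[of g "cobj Z m"] g(1) by (simp add: Hom_iff flip: mult.assoc)
  finally show "\<exists>P e g'. is_epi A e \<and> e \<in> Hom A P W \<and> g' \<in> Hom A P (cobj Z (m - 1)) \<and> r g * r e = D Z (m - 1) * r g'"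
    using e g'(1) by metis
qed

text \<open>Exactness of \<open>X\<close> makes \<open>a\<close> a boundary \<open>d a1\<close>. Then \<open>b + f a1\<close> is a cycle of \<open>Y\<close>, hence a boundary.\<close>

lemma cone_exact_of_exact:
  assumes c: "cone X Y f Z i j p q" and X: "A.exact_at X (m + 1)" and Y: "A.exact_at Y m"
  shows "A.exact_at Z m"
proof (rule cone_exact_at[OF c])
  note O = coneD(2-4)[OF c] and t = coneD(5-9)[OF c]
  let ?F = "at X Y 0 f"
  fix W a b assume a: "a \<in> Hom A W (cobj X (m + 1))" and b: "b \<in> Hom A W (cobj Y m)"
    and ca: "D X (m + 1) * r a = 0" and cb: "?F (m + 1) * r a + D Y m * r b = 0"
  obtain P1 e1 a1 where e1: "is_epi A e1" "e1 \<in> Hom A P1 W" "a1 \<in> Hom A P1 (cobj X m)" "r a * r e1 = D X m * r a1"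
    using X a ca unfolding exact_at_ring[OF O(1)] add_diff_cancel_right' by blast
  define h where "h = (b \<odot> e1) \<boxplus>\<^bsub>A\<^esub> (components X Y 0 f m \<odot> a1)"
  note cf = components_A[OF t(1), of m]
  have h: "h \<in> Hom A P1 (cobj Y m)" "r h = r b * r e1 + ?F m * r a1"
    using cf b e1 by (simp_all add: h_def at_def Hom_iff A.ring_arr A.ring_of_add A.ring_of_comp)
  have "D Y m * r h = D Y m * (r b * r e1) + (D Y m * ?F m) * r a1" unfolding h(2) by (simp add: ring_distribs mult.assoc)
  also have "\<dots> = D Y m * (r b * r e1) + ?F (m + 1) * (r a * r e1)" unfolding at_chn[OF coneD(1)[OF c]] e1(4) by (simp add: mult.assoc)
  also have "\<dots> = (?F (m + 1) * r a + D Y m * r b) * r e1" by (simp add: ring_distribs mult.assoc)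
  finally have "D Y m * r h = 0" unfolding cb by simp
  then obtain P e2 b2 where e2: "is_epi A e2" "e2 \<in> Hom A P P1" "b2 \<in> Hom A P (cobj Y (m - 1))" "r h * r e2 = D Y (m - 1) * r b2"
    using Y h(1) unfolding exact_at_ring[OF O(2)] by blast
  have ee: "is_epi A (e1 \<odot> e2)" "e1 \<odot> e2 \<in> Hom A P W" "r (e1 \<odot> e2) = r e1 * r e2"
    using A.epi_comp[OF e2(1) e1(1) e2(2) e1(2)] A.Comp_Hom[OF e2(2) e1(2)] e1(2) e2(2) by (simp_all add: A.ring_of_comp Hom_iff)
  have aa: "Neg A (a1 \<odot> e2) \<in> Hom A P (cobj X m)" "r (Neg A (a1 \<odot> e2)) = - (r a1 * r e2)"
    using e1(3) e2(2) by (simp_all add: A.ring_of_simps A.ring_arr Hom_iff)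
  have "r a * r (e1 \<odot> e2) = (r a * r e1) * r e2" unfolding ee(3) by (simp add: mult.assoc)
  then have l1: "r a * r (e1 \<odot> e2) = - (D X m * r (Neg A (a1 \<odot> e2)))" unfolding aa(2) e1(4) by (simp add: mult.assoc)
  have "r b * r (e1 \<odot> e2) = r h * r e2 - ?F m * (r a1 * r e2)" unfolding ee(3) h(2) by (simp add: ring_distribs mult.assoc)
  then have l2: "r b * r (e1 \<odot> e2) = ?F m * r (Neg A (a1 \<odot> e2)) + D Y (m - 1) * r b2"
    unfolding aa(2) e2(4) by simp
  show "\<exists>P e a' b'. is_epi A e \<and> e \<in> Hom A P W \<and> a' \<in> Hom A P (cobj X m) \<and> b' \<in> Hom A P (cobj Y (m - 1)) \<and>
        r a * r e = - (D X m * r a') \<and> r b * r e = ?F m * r a' + D Y (m - 1) * r b'"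
    using ee(1,2) aa(1) e2(3) l1 l2 by blast
qed

text \<open>The second component \<open>b\<close> of a cycle lifts to some \<open>x\<close> along the epimorphism; what remains of the first
  component, \<open>a + d x\<close>, is annihilated by the monomorphism.\<close>

lemma cone_exact_of_epi_mono:
  assumes c: "cone X Y f Z i j p q" and ep: "is_epi A (components X Y 0 f m)" and mo: "is_mono A (components X Y 0 f (m + 1))"
  shows "A.exact_at Z m"
proof (rule cone_exact_at[OF c])
  note O = coneD(2-4)[OF c] and t = coneD(5-9)[OF c]
  let ?F = "at X Y 0 f"
  fix W a b assume a: "a \<in> Hom A W (cobj X (m + 1))" and b: "b \<in> Hom A W (cobj Y m)"
    and ca: "D X (m + 1) * r a = 0" and cb: "?F (m + 1) * r a + D Y m * r b = 0"
  have cf: "components X Y 0 f n \<in> Hom A (cobj X n) (cobj Y n)" for n using components_A[OF t(1), of n] by simp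
  obtain P x e where e: "is_epi A e" "e \<in> Hom A P W" "x \<in> Hom A P (cobj X m)" "components X Y 0 f m \<odot> x = b \<odot> e"
    by (rule A.pullback_epi[OF ep cf b])
  have P: "P \<in> Obj A" using A.Hom_objs[OF e(3)] by simp
  have re: "?F m * r x = r b * r e"
    using arg_cong[OF e(4), of r] e(2,3) b cf[of m] by (simp add: at_def Hom_iff A.ring_of_comp)
  define y where "y = (a \<odot> e) \<boxplus>\<^bsub>A\<^esub> (cdiff X m \<odot> x)"
  have y: "y \<in> Hom A P (cobj X (m + 1))" "r y = r a * r e + D X m * r x"
    using diff_Hom(1)[OF O(1), of m] a e by (simp_all add: y_def Hom_iff A.ring_arr A.ring_of_add A.ring_of_comp)
  have "?F (m + 1) * r y = ?F (m + 1) * (r a * r e) + (?F (m + 1) * D X m) * r x" unfolding y(2) by (simp add: ring_distribs mult.assoc)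
  also have "\<dots> = ?F (m + 1) * (r a * r e) + D Y m * (r b * r e)" unfolding at_chn[OF coneD(1)[OF c], symmetric] re[symmetric] by (simp add: mult.assoc)
  also have "\<dots> = (?F (m + 1) * r a + D Y m * r b) * r e" by (simp add: ring_distribs mult.assoc)
  finally have Fy: "?F (m + 1) * r y = 0" unfolding cb by simp
  let ?z = "Zero A P (cobj X (m + 1))"
  have z: "?z \<in> Hom A P (cobj X (m + 1))" "r ?z = 0" using A.zero_Hom[OF P obj_A[OF O(1)]] A.ring_of_zero[OF P obj_A[OF O(1)]] by auto
  have "components X Y 0 f (m + 1) \<odot> y = components X Y 0 f (m + 1) \<odot> ?z"
    by (rule A.ring_of_inject) (use Fy z y(1) cf[of "m + 1"] in \<open>simp_all add: at_def Hom_iff A.ring_of_comp\<close>)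
  then have "y = ?z" using mo y(1) z(1) cf[of "m + 1"] unfolding is_mono_def by (auto simp: Hom_iff)
  then have "r a * r e = - (D X m * r x)" using y(2) z(2) by (simp add: eq_neg_iff_add_eq_0)
  moreover have "r b * r e = ?F m * r x + D Y (m - 1) * r (Zero A P (cobj Y (m - 1)))"
    using re A.ring_of_zero[OF P obj_A[OF O(2)]] by simp
  ultimately show "\<exists>P e a' b'. is_epi A e \<and> e \<in> Hom A P W \<and> a' \<in> Hom A P (cobj X m) \<and> b' \<in> Hom A P (cobj Y (m - 1)) \<and>
        r a * r e = - (D X m * r a') \<and> r b * r e = ?F m * r a' + D Y (m - 1) * r b'"
    using e A.zero_Hom[OF P obj_A[OF O(2)]] by blast
qed

text \<open>A cycle \<open>g\<close> of \<open>X\<close> is homologous to \<open>y (x g)\<close>, and \<open>x g\<close> is a boundary in \<open>Y\<close>.\<close>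

lemma exact_of_isomorphic:
  assumes "isomorphic K X Y" "A.exact_at Y n"
  shows "A.exact_at X n"
proof -
  obtain x y where x: "chn X Y x" and y: "chn Y X y" and nl: "null X X (e X - y * x)" using assms(1) isomorphic_K_iff by blast
  note O = chnD(1,2)[OF x]
  obtain h where h: "h \<in> G X X (-1)" "e X - y * x = d X * h + h * d X" using nl unfolding null_def by blast
  let ?x = "at X Y 0 x" and ?y = "at Y X 0 y" and ?h = "at X X (-1) h"
  have id: "r (Ident A (cobj X n)) = ?y n * ?x n + (D X (n - 1) * ?h n + ?h (n + 1) * D X n)"
  proof -
    have "at X X 0 (e X) n = at X X 0 (y * x + (d X * h + h * d X)) n" using h(2) by (simp add: algebra_simps)
    moreover have "y * x \<in> G X X 0" "d X * h \<in> G X X 0" "h * d X \<in> G X X 0"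
      by (rule G_multI[OF chnD(3)[OF y] chnD(3)[OF x]], simp) (rule G_multI[OF d_G[OF O(1)] h(1)], simp, rule G_multI[OF h(1) d_G[OF O(1)]], simp)
    ultimately show ?thesis
      using at_mult[OF chnD(3)[OF x] chnD(3)[OF y], of n] at_mult[OF h(1) d_G[OF O(1)], of n] at_mult[OF d_G[OF O(1)] h(1), of n]
      by (simp add: at_add at_e at_d O G_add)
  qed
  show ?thesis unfolding exact_at_ring[OF O(1)]
  proof (intro allI ballI impI)
    fix W g assume g: "g \<in> Hom A W (cobj X n)" "D X n * r g = 0"
    have cx: "components X Y 0 x n \<in> Hom A (cobj X n) (cobj Y n)" using components_A[OF chnD(3)[OF x], of n] by simp
    have cy: "components Y X 0 y (n - 1) \<in> Hom A (cobj Y (n - 1)) (cobj X (n - 1))" using components_A[OF chnD(3)[OF y], of "n - 1"] by simp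
    have ch: "components X X (-1) h n \<in> Hom A (cobj X n) (cobj X (n - 1))" using components_A[OF h(1), of n] by simp
    have xg: "components X Y 0 x n \<odot> g \<in> Hom A W (cobj Y n)" "r (components X Y 0 x n \<odot> g) = ?x n * r g"
      using g(1) cx by (simp_all add: at_def Hom_iff A.ring_of_comp)
    have "D Y n * (?x n * r g) = (D Y n * ?x n) * r g" by (simp add: mult.assoc)
    also have "\<dots> = 0" unfolding at_chn[OF x] by (simp add: mult.assoc g(2))
    finally obtain P e g1 where e: "is_epi A e" "e \<in> Hom A P W" "g1 \<in> Hom A P (cobj Y (n - 1))" "?x n * r g * r e = D Y (n - 1) * r g1"
      using assms(2) xg unfolding exact_at_ring[OF O(2)] by metis
    define g' where "g' = (components Y X 0 y (n - 1) \<odot> g1) \<boxplus>\<^bsub>A\<^esub> (components X X (-1) h n \<odot> (g \<odot> e))"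
    have g': "g' \<in> Hom A P (cobj X (n - 1))" "r g' = ?y (n - 1) * r g1 + ?h n * (r g * r e)"
      using cy ch e g(1) by (simp_all add: g'_def at_def Hom_iff A.ring_arr A.ring_of_add A.ring_of_comp)
    have yd: "D X (n - 1) * ?y (n - 1) = ?y n * D Y (n - 1)" using at_chn[OF y, of "n - 1"] by simp
    have "r g * r e = r (Ident A (cobj X n)) * (r g * r e)" using A.ring_of_ident(1)[of g "cobj X n"] g(1) by (simp add: Hom_iff flip: mult.assoc)
    also have "\<dots> = ?y n * (?x n * r g * r e) + D X (n - 1) * (?h n * (r g * r e)) + ?h (n + 1) * ((D X n * r g) * r e)"
      unfolding id by (simp add: ring_distribs mult.assoc)
    also have "\<dots> = (?y n * D Y (n - 1)) * r g1 + D X (n - 1) * (?h n * (r g * r e))" unfolding e(4) g(2) by (simp add: mult.assoc)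
    also have "\<dots> = D X (n - 1) * r g'" unfolding g'(2) yd[symmetric] by (simp add: ring_distribs mult.assoc)
    finally show "\<exists>P e g'. is_epi A e \<and> e \<in> Hom A P W \<and> g' \<in> Hom A P (cobj X (n - 1)) \<and> r g * r e = D X (n - 1) * r g'"
      using e g'(1) by blast
  qed
qed

lemma sub_Neg: "f \<in> Hom C X Y \<Longrightarrow> Neg C f = Neg A f"
proof -
  assume f: "f \<in> Hom C X Y"
  then have "hom_group C (Dom A f) (Cod A f) = hom_group A (Dom A f) (Cod A f)" by (auto simp: hom_group_def sub_Hom Hom_iff)
  then show ?thesis by (simp add: Neg_def)
qed

lemma exact_shift:
  assumes X: "X \<in> Ob"
  shows "A.exact_at (shift C X) n \<longleftrightarrow> A.exact_at X (n + 1)"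
proof -
  have D: "r (cdiff (shift C X) k) = - D X (k + 1)" for k
    using complexD(2)[OF X, of "k + 1"] A.ring_of_neg[of "cdiff X (k + 1)"] sub_Neg[OF complexD(2)[OF X, of "k + 1"]]
    by (simp add: sub_Hom Hom_iff)
  have N: "Neg A g \<in> Hom A P (cobj X n)" "r (Neg A g) = - r g" if "g \<in> Hom A P (cobj X n)" for g P
    using that by (simp_all add: Hom_iff A.ring_arr A.ring_of_neg)
  have sign: "(\<exists>P e g'. is_epi A e \<and> e \<in> Hom A P W \<and> g' \<in> Hom A P (cobj X n) \<and> x * r e = - D X n * r g') \<longleftrightarrow>
    (\<exists>P e g'. is_epi A e \<and> e \<in> Hom A P W \<and> g' \<in> Hom A P (cobj X n) \<and> x * r e = D X n * r g')" (is "?L \<longleftrightarrow> ?R") for W x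
  proof
    assume ?L
    then obtain P e g' where e: "is_epi A e" "e \<in> Hom A P W" "g' \<in> Hom A P (cobj X n)" "x * r e = - D X n * r g'" by blast
    then have "x * r e = D X n * r (Neg A g')" by (simp add: N)
    then show ?R using e N by blast
  next
    assume ?R
    then obtain P e g' where e: "is_epi A e" "e \<in> Hom A P W" "g' \<in> Hom A P (cobj X n)" "x * r e = D X n * r g'" by blast
    then have "x * r e = - D X n * r (Neg A g')" by (simp add: N)
    then show ?L using e N by blast
  qed
  have "cobj (shift C X) n = cobj X (n + 1)" "cobj (shift C X) (n - 1) = cobj X n" "n - 1 + 1 = n" "n + 1 - 1 = n" by simp_all
  then show ?thesis unfolding exact_at_ring[OF s_Ob[OF X]] exact_at_ring[OF X] D by (simp only: sign) simp
qed

end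

section \<open>The subcategories of the homotopy category\<close>

context karoubian_subcategory
begin

lemma K_all_Ob: "K_all A E = Ob"
  by (simp add: K_all_def K_basic)

lemma bounded_filter:
  "left_bounded A X \<longleftrightarrow> (\<forall>\<^sub>F n in at_bot. zero_object A (cobj X n))"
  "right_bounded A X \<longleftrightarrow> (\<forall>\<^sub>F n in at_top. zero_object A (cobj X n))"
  by (simp_all add: left_bounded_def right_bounded_def eventually_at_bot_dense eventually_at_top_dense eventually_principal)

lemma coh_filter:
  assumes "X \<in> Ob"
  shows "coh_left_bounded A X \<longleftrightarrow> (\<forall>\<^sub>F n in at_bot. A.exact_at X n)"
    "coh_right_bounded A X \<longleftrightarrow> (\<forall>\<^sub>F n in at_top. A.exact_at X n)"
    "exact_complex A X \<longleftrightarrow> (\<forall>\<^sub>F n in principal UNIV. A.exact_at X n)"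
  by (simp_all add: coh_left_bounded_def coh_right_bounded_def exact_complex_def eventually_at_bot_dense eventually_at_top_dense eventually_principal
    A.zero_cohomology_iff[OF sub_complex[OF assms]])

text \<open>Left bounded, right bounded and everywhere are the three cases \<open>F = at_bot\<close>, \<open>at_top\<close> and \<open>principal UNIV\<close> of
  \<open>eventually\<close> along a filter on the degrees. Since the cone mixes the degrees \<open>n + 1\<close> and \<open>n\<close>, a class defined in
  this way is triangulated when \<open>F\<close> is invariant under the shift.\<close>

definition shift_invariant :: "int filter \<Rightarrow> bool" where
  "shift_invariant F \<longleftrightarrow> (\<forall>P. (\<forall>\<^sub>F n in F. P (n + 1)) \<longleftrightarrow> (\<forall>\<^sub>F n in F. P n))"

lemma shift_invariant: "shift_invariant at_bot" "shift_invariant at_top" "shift_invariant (principal UNIV)"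
proof -
  have "(\<exists>N. \<forall>n<N. P (n + 1)) \<longleftrightarrow> (\<exists>N. \<forall>n<N. P n)" "(\<exists>N. \<forall>n>N. P (n + 1)) \<longleftrightarrow> (\<exists>N. \<forall>n>N. P n)"
    "(\<forall>n. P (n + 1)) \<longleftrightarrow> (\<forall>n. P n)" for P :: "int \<Rightarrow> bool"
  proof -
    have 1: "P n" if "\<forall>n<N. P (n + 1)" "n < N + 1" for n N using that(1)[rule_format, of "n - 1"] that(2) by simp
    have 2: "P n" if "\<forall>n>N. P (n + 1)" "n > N + 1" for n N using that(1)[rule_format, of "n - 1"] that(2) by simp
    have 3: "P n" if "\<forall>n. P (n + 1)" for n using that[rule_format, of "n - 1"] by simp
    have 4: "P (n + 1)" if "\<forall>n<N. P n" "n < N - 1" for n N using that by simp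
    have 5: "P (n + 1)" if "\<forall>n>N. P n" "n > N" for n N using that by simp
    show "(\<exists>N. \<forall>n<N. P (n + 1)) \<longleftrightarrow> (\<exists>N. \<forall>n<N. P n)" using 1 4 by meson
    show "(\<exists>N. \<forall>n>N. P (n + 1)) \<longleftrightarrow> (\<exists>N. \<forall>n>N. P n)" using 2 5 by meson
    show "(\<forall>n. P (n + 1)) \<longleftrightarrow> (\<forall>n. P n)" using 3 by blast
  qed
  then show "shift_invariant at_bot" "shift_invariant at_top" "shift_invariant (principal UNIV)"
    by (simp_all add: shift_invariant_def eventually_at_bot_dense eventually_at_top_dense eventually_principal)
qed

lemma shift_invariantD: "shift_invariant F \<Longrightarrow> (\<forall>\<^sub>F n in F. P (n + 1)) \<longleftrightarrow> (\<forall>\<^sub>F n in F. P n)"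
  by (simp add: shift_invariant_def)

lemma bounded_triangulated:
  assumes F: "shift_invariant F"
  shows "triangulated_subcat K {X \<in> Ob. \<exists>Y \<in> Ob. (\<forall>\<^sub>F n in F. zero_object A (cobj Y n)) \<and> isomorphic K X Y}"
proof (rule iso_closure_triangulated)
  show "\<forall>\<^sub>F n in F. zero_object A (cobj (Cochain (\<lambda>_. N) (\<lambda>_. Zero C N N)) n)" if "zero_object C N" for N
    using that by (simp add: sub_zero_object)
  show "(\<forall>\<^sub>F n in F. zero_object A (cobj (shift C X) n)) \<longleftrightarrow> (\<forall>\<^sub>F n in F. zero_object A (cobj X n))" for X
    using shift_invariantD[OF F, of "\<lambda>n. zero_object A (cobj X n)"] by simp
next
  fix X Y f Z i j p q assume c: "dg_category.cone Ob G e d X Y f Z i j p q"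
    and X: "\<forall>\<^sub>F n in F. zero_object A (cobj X n)" and Y: "\<forall>\<^sub>F n in F. zero_object A (cobj Y n)"
  have "\<forall>\<^sub>F n in F. zero_object A (cobj X (n + 1))"
    using X shift_invariantD[OF F, of "\<lambda>n. zero_object A (cobj X n)"] by simp
  with Y show "\<forall>\<^sub>F n in F. zero_object A (cobj Z n)"
  proof eventually_elim
    case (elim n)
    then have "zero_object C (cobj Z n)"
      using cone_object_zero[OF c, of n] complexD(1)[OF coneD(2)[OF c]] complexD(1)[OF coneD(3)[OF c]] by (simp add: sub_zero_object)
    then show ?case by (simp add: sub_zero_object)
  qed
qed

lemma exact_iff_isomorphic:
  assumes "isomorphic K X Y"
  shows "A.exact_at X n \<longleftrightarrow> A.exact_at Y n"
proof -
  interpret K: triangulated K by (rule triangulated_K)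
  show ?thesis using exact_of_isomorphic assms K.isomorphic_sym by blast
qed

lemma exact_triangulated:
  assumes F: "shift_invariant F"
  shows "triangulated_subcat K {X \<in> Ob. \<forall>\<^sub>F n in F. A.exact_at X n}"
proof -
  interpret K: triangulated K by (rule triangulated_K)
  have "triangulated_subcat K {X \<in> Ob. \<exists>Y \<in> Ob. (\<forall>\<^sub>F n in F. A.exact_at Y n) \<and> isomorphic K X Y}"
  proof (rule iso_closure_triangulated)
    show "\<forall>\<^sub>F n in F. A.exact_at (Cochain (\<lambda>_. N) (\<lambda>_. Zero C N N)) n" if "zero_object C N" for N
      using that zero_exact[OF zero_complex(1)[OF that]] by (simp add: sub_zero_object)
    show "(\<forall>\<^sub>F n in F. A.exact_at (shift C X) n) \<longleftrightarrow> (\<forall>\<^sub>F n in F. A.exact_at X n)" if "X \<in> Ob" for X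
      using shift_invariantD[OF F, of "A.exact_at X"] by (simp add: exact_shift[OF that])
  next
    fix X Y f Z i j p q assume c: "dg_category.cone Ob G e d X Y f Z i j p q"
      and X: "\<forall>\<^sub>F n in F. A.exact_at X n" and Y: "\<forall>\<^sub>F n in F. A.exact_at Y n"
    have "\<forall>\<^sub>F n in F. A.exact_at X (n + 1)" using X shift_invariantD[OF F, of "A.exact_at X"] by simp
    with Y show "\<forall>\<^sub>F n in F. A.exact_at Z n" by eventually_elim (rule cone_exact_of_exact[OF c])
  qed
  moreover have "{X \<in> Ob. \<exists>Y \<in> Ob. (\<forall>\<^sub>F n in F. A.exact_at Y n) \<and> isomorphic K X Y} = {X \<in> Ob. \<forall>\<^sub>F n in F. A.exact_at X n}"
    using exact_iff_isomorphic K.isomorphic_refl by (auto simp: K_basic)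
  ultimately show ?thesis by simp
qed

lemma heq_closure_eq: "heq_closure A E P = {X \<in> Ob. \<exists>Y \<in> Ob. P Y \<and> isomorphic K X Y}"
  by (simp add: heq_closure_def K_all_Ob)

lemma triangulated_subcats:
  "triangulated_subcat K (K_p A E)" "triangulated_subcat K (K_m A E)" "triangulated_subcat K (K_inf_p A E)"
  "triangulated_subcat K (K_inf_m A E)" "triangulated_subcat K (K_inf_0 A E)" "triangulated_subcat K (K_all A E)"
proof -
  have s: "{X \<in> Ob. coh_left_bounded A X} = {X \<in> Ob. \<forall>\<^sub>F n in at_bot. A.exact_at X n}"
    "{X \<in> Ob. coh_right_bounded A X} = {X \<in> Ob. \<forall>\<^sub>F n in at_top. A.exact_at X n}"
    "{X \<in> Ob. exact_complex A X} = {X \<in> Ob. \<forall>\<^sub>F n in principal UNIV. A.exact_at X n}" by (auto simp: coh_filter)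
  show "triangulated_subcat K (K_inf_p A E)" "triangulated_subcat K (K_inf_m A E)" "triangulated_subcat K (K_inf_0 A E)"
    unfolding K_inf_p_def K_inf_m_def K_inf_0_def K_all_Ob s by (rule exact_triangulated shift_invariant)+
  show "triangulated_subcat K (K_p A E)" "triangulated_subcat K (K_m A E)"
    unfolding K_p_def K_m_def heq_closure_eq bounded_filter by (rule bounded_triangulated shift_invariant)+
  interpret K: triangulated K by (rule triangulated_K)
  show "triangulated_subcat K (K_all A E)"
  proof (rule triangulated_subcatI)
    fix u v w assume T: "(u, v, w) \<in> Tri K"
    have "Dom K u \<in> K_all A E" "Cod K u \<in> K_all A E" "Cod K v \<in> K_all A E"
      using K.tri(1,2)[OF T] K.Dom_Obj K.Cod_Obj unfolding K_all_def by blast+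
    then show "Dom K u \<in> K_all A E" "Cod K u \<in> K_all A E" "Cod K v \<in> K_all A E" by blast+
  qed (auto simp: K_all_Ob K_basic zero_object_def s_Ob)
qed

lemma heq_closure_Int:
  assumes "\<And>X Y. isomorphic K X Y \<Longrightarrow> X \<in> Ob \<Longrightarrow> Y \<in> Ob \<Longrightarrow> Q X \<longleftrightarrow> Q Y"
  shows "heq_closure A E (\<lambda>X. P X \<and> Q X) = heq_closure A E P \<inter> {X \<in> Ob. Q X}"
  unfolding heq_closure_eq using assms by auto

lemma coh_isomorphic:
  assumes "isomorphic K X Y" "X \<in> Ob" "Y \<in> Ob"
  shows "coh_left_bounded A X \<longleftrightarrow> coh_left_bounded A Y" "coh_right_bounded A X \<longleftrightarrow> coh_right_bounded A Y"
    "exact_complex A X \<longleftrightarrow> exact_complex A Y"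
  using exact_iff_isomorphic[OF assms(1)] coh_filter[OF assms(2)] coh_filter[OF assms(3)] by simp_all

text \<open>A complex that is homotopy equivalent to a left bounded one contracts in low degrees. Splitting off this
  part leaves the high degrees as they are, so that a right bound survives.\<close>

lemma K_b_eq: "K_b A E = K_p A E \<inter> K_m A E"
proof
  interpret K: triangulated K by (rule triangulated_K)
  show "K_b A E \<subseteq> K_p A E \<inter> K_m A E" unfolding K_b_def K_p_def K_m_def heq_closure_eq by blast
  show "K_p A E \<inter> K_m A E \<subseteq> K_b A E"
  proof
    fix X assume "X \<in> K_p A E \<inter> K_m A E"
    then obtain Y Y' where Y: "X \<in> Ob" "Y \<in> Ob" "left_bounded A Y" "isomorphic K X Y" "Y' \<in> Ob" "right_bounded A Y'" "isomorphic K X Y'"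
      unfolding K_p_def K_m_def heq_closure_eq by blast
    have "isomorphic K Y' Y" using Y K.isomorphic_sym K.isomorphic_trans by blast
    then obtain h where h: "h \<in> G Y' Y' (-1)" "\<And>n. zero_object C (cobj Y n) \<Longrightarrow> contractible_in Y' h n"
      using contractible_of_isomorphic by metis
    obtain m where m: "\<And>n. n < m \<Longrightarrow> zero_object A (cobj Y n)" using Y(3) by (auto simp: left_bounded_def)
    have cm: "contractible_in Y' h n" if "n < m" for n using h(2) m[OF that] complexD(1)[OF Y(2)] by (simp add: sub_zero_object)
    obtain W where W: "W \<in> Ob" "isomorphic K Y' W" "\<And>n. n < m - 1 \<Longrightarrow> zero_object C (cobj W n)" "\<And>n. n \<ge> m \<Longrightarrow> cobj W n = cobj Y' n"
      by (rule split_low[OF karoubian_sub Y(5) h(1) cm]) blast+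
    obtain N where N: "\<And>n. n > N \<Longrightarrow> zero_object A (cobj Y' n)" using Y(6) by (auto simp: right_bounded_def)
    have "left_bounded A W" using W(3) unfolding left_bounded_def sub_zero_object by blast
    moreover have "right_bounded A W" unfolding right_bounded_def using W(4) N by (intro exI[of _ "max N m"]) auto
    moreover have "isomorphic K X W" using Y(7) W(2) by (rule K.isomorphic_trans)
    ultimately show "X \<in> K_b A E" unfolding K_b_def heq_closure_eq using Y(1) W(1) by blast
  qed
qed

text \<open>Conditions on the cohomology are invariant under homotopy equivalence, so they may be taken out of the closure.\<close>

lemma K_sets:
  "K_inf_b A E = K_inf_p A E \<inter> K_inf_m A E" "K_p_b A E = K_p A E \<inter> K_inf_b A E" "K_m_b A E = K_m A E \<inter> K_inf_b A E"
  "K_p_0 A E = K_p A E \<inter> K_inf_0 A E" "K_m_0 A E = K_m A E \<inter> K_inf_0 A E" "K_b_0 A E = K_b A E \<inter> K_inf_0 A E"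
proof -
  show "K_inf_b A E = K_inf_p A E \<inter> K_inf_m A E" by (auto simp: K_inf_b_def K_inf_p_def K_inf_m_def)
  show "K_p_b A E = K_p A E \<inter> K_inf_b A E" "K_m_b A E = K_m A E \<inter> K_inf_b A E"
    unfolding K_p_b_def K_m_b_def K_p_def K_m_def K_inf_b_def K_all_Ob
    by (rule heq_closure_Int; simp add: coh_isomorphic)+
  show "K_p_0 A E = K_p A E \<inter> K_inf_0 A E" "K_m_0 A E = K_m A E \<inter> K_inf_0 A E"
    unfolding K_p_0_def K_m_0_def K_p_def K_m_def K_inf_0_def K_all_Ob
    by (rule heq_closure_Int; simp add: coh_isomorphic)+
  show "K_b_0 A E = K_b A E \<inter> K_inf_0 A E"
    unfolding K_b_0_def K_b_def K_inf_0_def K_all_Ob conj_assoc[symmetric]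
    by (rule heq_closure_Int; simp add: coh_isomorphic)
qed

lemma K_subset: "K_p A E \<subseteq> K_inf_p A E" "K_m A E \<subseteq> K_inf_m A E" "K_inf_0 A E \<subseteq> K_inf_p A E" "K_inf_0 A E \<subseteq> K_inf_m A E"
  "K_inf_p A E \<subseteq> K_all A E" "K_inf_m A E \<subseteq> K_all A E"
proof -
  have ex: "\<forall>\<^sub>F n in F. A.exact_at X n" if "isomorphic K X Y" "Y \<in> Ob" "\<forall>\<^sub>F n in F. zero_object A (cobj Y n)" for X Y F
    using that(3) by eventually_elim (use exact_of_isomorphic[OF that(1)] zero_exact[OF that(2)] in blast)
  show "K_p A E \<subseteq> K_inf_p A E" "K_m A E \<subseteq> K_inf_m A E"
    unfolding K_p_def K_m_def K_inf_p_def K_inf_m_def K_all_Ob heq_closure_eq using coh_filter bounded_filter ex by auto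
qed (auto simp: K_inf_0_def K_inf_p_def K_inf_m_def coh_left_bounded_def coh_right_bounded_def exact_complex_def)

section \<open>Truncations\<close>

text \<open>A chain map that is the identity in all sufficiently low (high) degrees has a cone that contracts
  there, hence is homotopy equivalent to a left (right) bounded complex.\<close>

lemma identity_contractible:
  assumes c: "cone X Y f Z i j p q" and S: "\<And>k. k \<in> S \<Longrightarrow> cobj X k = cobj Y k \<and> components X Y 0 f k = Ident C (cobj X k)"
  obtains h where "h \<in> G Z Z (-1)" "\<And>n. n \<in> S \<Longrightarrow> n + 1 \<in> S \<Longrightarrow> contractible_in Z h n"
proof -
  note O = coneD(2-4)[OF c]
  obtain fc where fc: "fc \<in> graded_hom C (cobj X) (cobj Y) 0" "f = act C (cobj X) (cobj Y) 0 fc" using coneD(5)[OF c] by (rule GE)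
  have fS: "fc k = Ident A (cobj X k)" if "k \<in> S" for k using S[OF that] by (simp add: fc(2) components_act[OF fc(1)])
  define gc where "gc k = (if k \<in> S then Ident C (cobj Y k) else Zero C (cobj Y k) (cobj X k))" for k
  let ?g = "act C (cobj Y) (cobj X) 0 gc"
  have g: "gc \<in> graded_hom C (cobj Y) (cobj X) 0"
    using S complexD(1)[OF O(1)] complexD(1)[OF O(2)] Ident_Hom zero_Hom by (auto simp: graded_hom_def gc_def)
  have II: "Ident A (cobj X k) \<odot> Ident A (cobj X k) = Ident A (cobj X k)" for k
    using A.Comp_Ident[OF A.Ident_Hom[OF obj_A[OF O(1)]]] .
  have gf: "?g * f = act C (cobj X) (cobj X) 0 (\<lambda>k. gc k \<cdot>\<^bsub>C\<^esub> fc k)" "f * ?g = act C (cobj Y) (cobj Y) 0 (\<lambda>k. fc k \<cdot>\<^bsub>C\<^esub> gc k)"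
    unfolding fc(2) act_mult[OF fc(1) g] act_mult[OF g fc(1)] by simp_all
  have gr: "(\<lambda>k. gc k \<cdot>\<^bsub>C\<^esub> fc k) \<in> graded_hom C (cobj X) (cobj X) 0" "(\<lambda>k. fc k \<cdot>\<^bsub>C\<^esub> gc k) \<in> graded_hom C (cobj Y) (cobj Y) 0"
    using graded_hom_comp[OF fc(1) g] graded_hom_comp[OF g fc(1)] by simp_all
  have "(e X - ?g * f) * pr X k = 0" "(e Y - f * ?g) * pr Y k = 0" if "k \<in> S" for k
    using pr_eq_iff[OF O(1,1) id_graded(1)[OF O(1)] gr(1), of k] pr_eq_iff[OF O(2,2) id_graded(1)[OF O(2)] gr(2), of k]
      fS[OF that] S[OF that] that II[of k]
    by (simp_all add: e_def gf left_diff_distrib gc_def)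
  note inv = this
  have "contractible_in Z (i * (?g * q)) n" if "n \<in> S" "n + 1 \<in> S" for n
    by (rule cone_contractible(2)[OF c GI[OF g]]) (use inv that in auto)
  moreover have "i * (?g * q) \<in> G Z Z (-1)" by (rule G_multI[OF coneD(6)[OF c] G_multI[OF GI[OF g] coneD(9)[OF c] refl]]) simp
  ultimately show ?thesis using that by blast
qed

lemma cone_in_K_p:
  assumes c: "cone X Y f Z i j p q" and S: "\<And>k. k < n \<Longrightarrow> cobj X k = cobj Y k \<and> components X Y 0 f k = Ident C (cobj X k)"
  shows "Z \<in> K_p A E"
proof -
  obtain h where h: "h \<in> G Z Z (-1)" "\<And>k. k \<in> {..<n} \<Longrightarrow> k + 1 \<in> {..<n} \<Longrightarrow> contractible_in Z h k"
    by (rule identity_contractible[OF c, of "{..<n}"]) (use S in auto)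
  obtain W where W: "W \<in> Ob" "isomorphic K Z W" "\<And>k. k < n - 1 - 1 \<Longrightarrow> zero_object C (cobj W k)"
    by (rule split_low[OF karoubian_sub coneD(4)[OF c] h(1), of "n - 1"]) (use h(2) in auto)
  have "left_bounded A W" using W(3) unfolding left_bounded_def sub_zero_object by blast
  then show ?thesis unfolding K_p_def heq_closure_eq using W coneD(4)[OF c] by blast
qed

lemma cone_in_K_m:
  assumes c: "cone X Y f Z i j p q" and S: "\<And>k. k > n \<Longrightarrow> cobj X k = cobj Y k \<and> components X Y 0 f k = Ident C (cobj X k)"
  shows "Z \<in> K_m A E"
proof -
  obtain h where h: "h \<in> G Z Z (-1)" "\<And>k. k \<in> {n<..} \<Longrightarrow> k + 1 \<in> {n<..} \<Longrightarrow> contractible_in Z h k"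
    by (rule identity_contractible[OF c, of "{n<..}"]) (use S in auto)
  obtain W where W: "W \<in> Ob" "isomorphic K Z W" "\<And>k. k > n + 1 \<Longrightarrow> zero_object C (cobj W k)"
    by (rule split_high[OF karoubian_sub coneD(4)[OF c] h(1), of n]) (use h(2) in auto)
  have "right_bounded A W" using W(3) unfolding right_bounded_def sub_zero_object by blast
  then show ?thesis unfolding K_m_def heq_closure_eq using W coneD(4)[OF c] by blast
qed

lemma bounded_in:
  assumes "X \<in> Ob"
  shows "left_bounded A X \<Longrightarrow> X \<in> K_p A E" "right_bounded A X \<Longrightarrow> X \<in> K_m A E"
proof -
  interpret K: triangulated K by (rule triangulated_K)
  show "left_bounded A X \<Longrightarrow> X \<in> K_p A E" "right_bounded A X \<Longrightarrow> X \<in> K_m A E"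
    unfolding K_p_def K_m_def heq_closure_eq using assms K.isomorphic_refl[of X] by (auto simp: K_basic)
qed

lemma chain_map_cone:
  assumes O: "X \<in> Ob" "Y \<in> Ob" and f: "f \<in> chain_maps C X Y"
  obtains x Z i j p q where "cone X Y x Z i j p q" "components X Y 0 x = f" "std_triangle X Y Z x j p \<in> Tri K"
proof -
  let ?x = "act C (cobj X) (cobj Y) 0 f"
  have g: "f \<in> graded_hom C (cobj X) (cobj Y) 0" "chn X Y ?x" using f chain_maps_iff[OF O] by auto
  obtain Z i j p q where c: "cone X Y ?x Z i j p q" by (rule cone_ex[OF g(2)])
  show ?thesis by (rule that[OF c components_act[OF g(1)] std_Tri[OF c]])
qed

text \<open>The inclusion of the brutal truncation \<open>X\<^sup>\<ge>\<^sup>0\<close> as a subcomplex is the identity in degrees \<open>\<ge> 0\<close>, hence its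
  cone is right bounded up to homotopy.\<close>

lemma brutal_truncation:
  assumes X: "X \<in> Ob"
  obtains u v w where "(u, v, w) \<in> Tri K" "Cod K u = X" "Dom K u \<in> K_p A E" "Cod K v \<in> K_m A E"
proof -
  obtain N where N: "zero_object C N" using ex_zero by blast
  have I: "cobj X 0 \<in> Obj C" and D: "cdiff X 0 \<in> Hom C (cobj X 0) (cobj X (0 + 1))"
    using complexD(1)[OF X, of 0] complexD(2)[OF X, of 0] by simp_all
  have dd: "cdiff X (0 + 1) \<cdot>\<^bsub>C\<^esub> cdiff X 0 = Zero C (cobj X 0) (cobj X (0 + 2))" using complexD(3)[OF X, of 0] by simp
  let ?M = "low X 0 N (cobj X 0) (cdiff X 0)" and ?f = "from_low X 0 N (Ident C (cobj X 0))"
  have M: "?M \<in> Ob" by (rule low_complex[OF X N I D dd])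
  have f: "?f \<in> chain_maps C ?M X" by (rule from_low[OF X N I D Ident_Hom[OF I] Comp_Ident[OF D]])
  obtain x Z i j p q where x: "cone ?M X x Z i j p q" "components ?M X 0 x = ?f" "std_triangle ?M X Z x j p \<in> Tri K"
    by (rule chain_map_cone[OF M X f])
  have "Z \<in> K_m A E" by (rule cone_in_K_m[OF x(1), of 0]) (auto simp: x(2) cobj_low from_low_def)
  moreover have "left_bounded A ?M" unfolding left_bounded_def using N by (intro exI[of _ 0]) (auto simp: cobj_low sub_zero_object)
  ultimately show ?thesis
    using that[OF x(3)[unfolded std_triangle_def]] bounded_in(1)[OF M] by (simp add: chn_j[OF x(1)] coneD(1)[OF x(1)])
qed

lemma kernel_mono:
  assumes "is_kernel A f k"
  shows "is_mono A k"
  unfolding is_mono_def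
proof (intro conjI allI ballI impI)
  show k: "k \<in> Arr A" using assms by (simp add: is_kernel_def)
  fix W g h assume g: "g \<in> Hom A W (Dom A k)" "h \<in> Hom A W (Dom A k)" "k \<odot> g = k \<odot> h"
  have kf: "f \<in> Arr A" "Cod A k = Dom A f" "f \<odot> k = Zero A (Dom A k) (Cod A f)" using assms by (auto simp: is_kernel_def)
  have "f \<odot> (k \<odot> g) = (f \<odot> k) \<odot> g" using A.comp_assoc[of g k f] g kf k by (simp add: Hom_iff)
  also have "\<dots> = Zero A W (Cod A f)" unfolding kf(3) by (rule A.zero_comp[OF g(1) A.Cod_Obj[OF kf(1)]])
  finally have "k \<odot> g \<in> Arr A" "Cod A (k \<odot> g) = Dom A f"
    "f \<odot> (k \<odot> g) = Zero A (Dom A (k \<odot> g)) (Cod A f)" "Dom A (k \<odot> g) = W"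
    using g(1) k kf(2) by (simp_all add: Hom_iff)
  then have "\<exists>!u. u \<in> Hom A W (Dom A k) \<and> k \<odot> u = k \<odot> g" using assms unfolding is_kernel_def by metis
  then show "g = h" using g by metis
qed

lemma cokernel_epi:
  assumes "is_cokernel A f c"
  shows "is_epi A c"
  unfolding is_epi_def
proof (intro conjI allI ballI impI)
  show c: "c \<in> Arr A" using assms by (simp add: is_cokernel_def)
  fix W g h assume g: "g \<in> Hom A (Cod A c) W" "h \<in> Hom A (Cod A c) W" "g \<odot> c = h \<odot> c"
  have cf: "f \<in> Arr A" "Dom A c = Cod A f" "c \<odot> f = Zero A (Dom A f) (Cod A c)" using assms by (auto simp: is_cokernel_def)
  have "(g \<odot> c) \<odot> f = g \<odot> (c \<odot> f)" using A.comp_assoc[of f c g] g cf c by (simp add: Hom_iff)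
  also have "\<dots> = Zero A (Dom A f) W" unfolding cf(3) by (rule A.comp_zero[OF g(1) A.Dom_Obj[OF cf(1)]])
  finally have "g \<odot> c \<in> Arr A" "Dom A (g \<odot> c) = Cod A f"
    "(g \<odot> c) \<odot> f = Zero A (Dom A f) (Cod A (g \<odot> c))" "Cod A (g \<odot> c) = W"
    using g(1) c cf(2) by (simp_all add: Hom_iff)
  then have "\<exists>!u. u \<in> Hom A (Cod A c) W \<and> u \<odot> c = g \<odot> c" using assms unfolding is_cokernel_def by metis
  then show "g = h" using g by metis
qed

lemma mono_ident: "X \<in> Obj A \<Longrightarrow> is_mono A (Ident A X)"
  unfolding is_mono_def using A.Ident_Hom[of X] A.Ident_Comp by (auto simp: Hom_iff)

text \<open>The subcomplex \<open>\<tau>\<^sup>\<le>\<^sup>n X\<close> has the kernel of the differential in degree \<open>n\<close>. Its inclusion is the identity below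
  \<open>n\<close> and a monomorphism in degree \<open>n\<close>, which makes the cone exact below \<open>n\<close>; from degree \<open>n\<close> on the
  cone is exact because \<open>X\<close> is and the subcomplex vanishes.\<close>

lemma left_truncation:
  assumes E: "E = Obj A" and X: "X \<in> Ob" and ex: "\<And>k. k \<ge> n \<Longrightarrow> A.exact_at X k"
  obtains u v w where "(u, v, w) \<in> Tri K" "Cod K u = X" "Dom K u \<in> K_m A E" "Cod K v \<in> K_p A E \<inter> K_inf_0 A E"
proof -
  obtain N where N: "zero_object C N" using ex_zero by blast
  have H: "Hom C Y Z = Hom A Y Z" for Y Z unfolding sub_Hom unfolding E using A.Hom_objs by blast
  note D = diff_Hom(1)[OF X, of n] diff_Hom(2)[OF X, of n]
  have dd: "cdiff X n \<odot> cdiff X (n - 1) = Zero A (cobj X (n - 1)) (cobj X (n + 1))"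
    "cdiff X (n - 1) \<odot> cdiff X (n - 2) = Zero A (cobj X (n - 2)) (cobj X n)"
    using complexD(3)[OF X, of "n - 1"] complexD(3)[OF X, of "n - 2"] by (simp_all add: add.commute)
  have D2: "cdiff X (n - 2) \<in> Hom A (cobj X (n - 2)) (cobj X (n - 1))" using diff_Hom(1)[OF X, of "n - 2"] by simp
  obtain k where k: "is_kernel A (cdiff X n) k" using A.ex_kernel[of "cdiff X n"] D(1) by (auto simp: Hom_iff)
  define I where "I = Dom A k"
  have kH: "k \<in> Hom A I (cobj X n)" and dk: "cdiff X n \<odot> k = Zero A I (cobj X (n + 1))"
    using k D by (auto simp: is_kernel_def Hom_iff I_def)
  have IO: "I \<in> Obj C" unfolding sub_simps(1) using A.Hom_objs[OF kH] by (simp add: E)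
  obtain \<delta> where \<delta>: "\<delta> \<in> Hom A (cobj X (n - 1)) I" "k \<odot> \<delta> = cdiff X (n - 1)"
    using A.kernel_factor[OF k, of "cdiff X (n - 1)"] D dd by (auto simp: Hom_iff I_def)
  have "k \<odot> (\<delta> \<odot> cdiff X (n - 2)) = k \<odot> Zero A (cobj X (n - 2)) I"
    using A.Comp_assoc[OF D2 \<delta>(1) kH] A.comp_zero[OF kH obj_A[OF X, of "n - 2"]] dd(2) \<delta>(2) by simp
  then have \<delta>0: "\<delta> \<odot> cdiff X (n - 2) = Zero A (cobj X (n - 2)) I"
    using kernel_mono[OF k] A.Comp_Hom[OF D2 \<delta>(1)] A.zero_Hom[OF obj_A[OF X, of "n - 2"], of I] A.Hom_objs[OF kH]
    unfolding is_mono_def I_def by blast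
  let ?M = "high X n N I \<delta>" and ?f = "from_high X n N k"
  have M: "?M \<in> Ob" by (rule high_complex[OF X N IO]) (use \<delta> \<delta>0 H in auto)
  have f: "?f \<in> chain_maps C ?M X" by (rule from_high[OF X N IO]) (use \<delta> kH dk H in auto)
  obtain x Z i j p q where x: "cone ?M X x Z i j p q" "components ?M X 0 x = ?f" "std_triangle ?M X Z x j p \<in> Tri K"
    by (rule chain_map_cone[OF M X f])
  have "Z \<in> K_p A E" by (rule cone_in_K_p[OF x(1), of n]) (auto simp: x(2) cobj_high from_high_def)
  moreover have "A.exact_at Z m" for m
  proof (cases "m < n")
    case True
    show ?thesis
    proof (rule cone_exact_of_epi_mono[OF x(1)])
      show "is_epi A (components ?M X 0 x m)" using True A.epi_ident[OF obj_A[OF X]] by (simp add: x(2) from_high_def)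
      have "is_mono A (?f (m + 1))"
        using True kernel_mono[OF k] mono_ident[OF obj_A[OF X, of "m + 1"]] by (cases "m + 1 = n") (auto simp: from_high_def)
      then show "is_mono A (components ?M X 0 x (m + 1))" by (simp add: x(2))
    qed
  next
    case False
    have "A.exact_at ?M (m + 1)" by (rule zero_exact[OF M]) (use False N in \<open>simp add: cobj_high sub_zero_object\<close>)
    then show ?thesis by (rule cone_exact_of_exact[OF x(1)]) (use ex False in simp)
  qed
  then have "Z \<in> K_inf_0 A E" unfolding K_inf_0_def K_all_Ob using coneD(4)[OF x(1)] by (simp add: coh_filter)
  moreover have "right_bounded A ?M" unfolding right_bounded_def using N by (intro exI[of _ n]) (auto simp: cobj_high sub_zero_object)
  ultimately show ?thesis
    using that[OF x(3)[unfolded std_triangle_def]] bounded_in(2)[OF M] by (simp add: chn_j[OF x(1)] coneD(1)[OF x(1)])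
qed

text \<open>The quotient \<open>\<tau>\<^sup>\<ge>\<^sup>n X\<close> has the cokernel of the differential in degree \<open>n\<close>. The projection onto it is the identity
  above \<open>n\<close> and an epimorphism in degree \<open>n\<close>. Its fibre, not its cone, is the first term of the
  triangle with middle term \<open>X\<close>.\<close>

lemma right_truncation:
  assumes E: "E = Obj A" and X: "X \<in> Ob" and ex: "\<And>k. k \<le> n \<Longrightarrow> A.exact_at X k"
  obtains u v w where "(u, v, w) \<in> Tri K" "Cod K u = X" "Dom K u \<in> K_m A E \<inter> K_inf_0 A E" "Cod K v \<in> K_p A E"
proof -
  obtain N where N: "zero_object C N" using ex_zero by blast
  have H: "Hom C Y Z = Hom A Y Z" for Y Z unfolding sub_Hom unfolding E using A.Hom_objs by blast
  note D = diff_Hom(1)[OF X, of n] diff_Hom(2)[OF X, of n]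
  have dd: "cdiff X n \<odot> cdiff X (n - 1) = Zero A (cobj X (n - 1)) (cobj X (n + 1))"
    "cdiff X (n + 1) \<odot> cdiff X n = Zero A (cobj X n) (cobj X (n + 2))"
    using complexD(3)[OF X, of "n - 1"] complexD(3)[OF X, of n] by (simp_all add: add.commute)
  have D2: "cdiff X (n + 1) \<in> Hom A (cobj X (n + 1)) (cobj X (n + 2))" using diff_Hom(1)[OF X, of "n + 1"] by (simp add: add.assoc)
  obtain c where c: "is_cokernel A (cdiff X (n - 1)) c" using A.ex_cokernel[of "cdiff X (n - 1)"] D(2) by (auto simp: Hom_iff)
  define I where "I = Cod A c"
  have cH: "c \<in> Hom A (cobj X n) I" and cd: "c \<odot> cdiff X (n - 1) = Zero A (cobj X (n - 1)) I"
    using c D by (auto simp: is_cokernel_def Hom_iff I_def)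
  have IO: "I \<in> Obj C" unfolding sub_simps(1) using A.Hom_objs[OF cH] by (simp add: E)
  have "cdiff X n \<in> Arr A \<and> Dom A (cdiff X n) = Cod A (cdiff X (n - 1)) \<and>
    cdiff X n \<odot> cdiff X (n - 1) = Zero A (Dom A (cdiff X (n - 1))) (Cod A (cdiff X n))" using D dd(1) by (simp add: Hom_iff)
  then have "\<exists>!u. u \<in> Hom A (Cod A c) (Cod A (cdiff X n)) \<and> u \<odot> c = cdiff X n" using c unfolding is_cokernel_def by blast
  then obtain \<delta> where \<delta>: "\<delta> \<in> Hom A I (cobj X (n + 1))" "\<delta> \<odot> c = cdiff X n" using D(1) by (auto simp: Hom_iff I_def)
  have \<delta>0: "cdiff X (n + 1) \<odot> \<delta> = Zero A I (cobj X (n + 2))"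
    by (rule A.epi_cancel_zero[OF cokernel_epi[OF c] cH A.Comp_Hom[OF \<delta>(1) D2]])
      (use A.Comp_assoc[OF cH \<delta>(1) D2] \<delta>(2) dd(2) in simp)
  let ?Q = "low X n N I \<delta>" and ?f = "to_low X n N c"
  have Q: "?Q \<in> Ob" by (rule low_complex[OF X N IO]) (use \<delta> \<delta>0 H in auto)
  have f: "?f \<in> chain_maps C X ?Q" by (rule to_low[OF X N IO]) (use \<delta> \<delta>0 cH cd H in auto)
  obtain x Z i j p q where x: "cone X ?Q x Z i j p q" "components X ?Q 0 x = ?f" "std_triangle X ?Q Z x j p \<in> Tri K"
    by (rule chain_map_cone[OF X Q f])
  have "Z \<in> K_m A E" by (rule cone_in_K_m[OF x(1), of n]) (auto simp: x(2) cobj_low to_low_def)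
  moreover have "A.exact_at Z m" for m
  proof (cases "m \<ge> n")
    case True
    show ?thesis
    proof (rule cone_exact_of_epi_mono[OF x(1)])
      show "is_mono A (components X ?Q 0 x (m + 1))" using True mono_ident[OF obj_A[OF X]] by (simp add: x(2) to_low_def)
      have "is_epi A (?f m)"
        using True cokernel_epi[OF c] A.epi_ident[OF obj_A[OF X, of m]] by (cases "m = n") (auto simp: to_low_def)
      then show "is_epi A (components X ?Q 0 x m)" by (simp add: x(2))
    qed
  next
    case False
    have "A.exact_at ?Q m" by (rule zero_exact[OF Q]) (use False N in \<open>simp add: cobj_low sub_zero_object\<close>)
    then show ?thesis by (rule cone_exact_of_exact[OF x(1), rotated]) (use ex False in simp)
  qed
  then have "Z \<in> K_inf_0 A E" unfolding K_inf_0_def K_all_Ob using coneD(4)[OF x(1)] by (simp add: coh_filter)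
  ultimately have Z: "Z \<in> K_m A E \<inter> K_inf_0 A E" by simp
  interpret L: localization K "K_m A E \<inter> K_inf_0 A E"
    by (intro localization.intro triangulated_K localization_axioms.intro triangulated_subcat_Int triangulated_subcats)
  note cx = coneD(1)[OF x(1)] chn_j[OF x(1)]
  obtain u w where T: "(u, arr X ?Q x, w) \<in> Tri K" using L.extend_second[of "arr X ?Q x"] cx by auto
  note t = L.tri[OF T]
  obtain y where T': "(arr X ?Q x, w, y) \<in> Tri K" using L.rotate[OF T] by blast
  obtain a where a: "a \<in> Hom K (Cod K w) (Cod K (arr ?Q Z j))" "iso_arr K a"
    using L.cone_unique[OF T' x(3)[unfolded std_triangle_def]] by blast
  have "isomorphic K (Cod K w) Z" unfolding isomorphic_def using a cx by auto
  then have "Cod K w \<in> K_m A E \<inter> K_inf_0 A E" using Z L.isomorphic_sym L.U_iso by blast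
  moreover have "Dom K u \<in> Ob" using L.Dom_Obj[OF t(1)] by simp
  ultimately have "Dom K u \<in> K_m A E \<inter> K_inf_0 A E" using t(6) L.U_Sh[of "Dom K u"] by simp
  moreover have "?Q \<in> K_p A E"
    by (rule bounded_in(1)[OF Q]) (use N in \<open>auto simp: left_bounded_def cobj_low sub_zero_object intro!: exI[of _ n]\<close>)
  ultimately show ?thesis using that T t(4) cx by auto
qed

section \<open>The equivalences\<close>

lemma quotient_equivalence:
  assumes "triangulated_subcat K (W A E)" "triangulated_subcat K (V A E)" "triangulated_subcat K (U A E)"
    and "V A E \<subseteq> W A E" "U A E \<subseteq> W A E" "J A E = V A E \<inter> U A E"
    and tri: "(\<forall>X \<in> W A E. \<exists>u v w. (u, v, w) \<in> Tri K \<and> Cod K u = X \<and> Dom K u \<in> V A E \<and> Cod K v \<in> U A E) \<or>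
         (\<forall>X \<in> W A E. \<exists>u v w. (u, v, w) \<in> Tri K \<and> Cod K u = X \<and> Dom K u \<in> U A E \<and> Cod K v \<in> V A E)"
  shows "KQ A E W U \<simeq>\<^sub>\<Delta> KQ A E V J" "KQ A E V J \<simeq>\<^sub>\<Delta> KQ A E W U"
  using triangulated.subquotient_equivalence[OF triangulated_K assms(1-5) tri] unfolding KQ_def assms(6) by auto

text \<open>The pieces of a truncation inherit properties of \<open>X\<close>: if \<open>X\<close> and one outer term of the triangle lie in a
  triangulated subcategory, so does the other outer term.\<close>

lemma brutal_triangle:
  assumes "X \<in> Ob"
  shows "\<exists>u v w. (u, v, w) \<in> Tri K \<and> Cod K u = X \<and> Dom K u \<in> K_p A E \<and> Cod K v \<in> K_m A E \<and>
      (X \<in> K_inf_p A E \<longrightarrow> Cod K v \<in> K_inf_p A E) \<and> (X \<in> K_inf_m A E \<longrightarrow> Dom K u \<in> K_inf_m A E)"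
proof -
  obtain u v w where t: "(u, v, w) \<in> Tri K" "Cod K u = X" "Dom K u \<in> K_p A E" "Cod K v \<in> K_m A E" by (rule brutal_truncation[OF assms])
  have "X \<in> K_inf_p A E \<longrightarrow> Cod K v \<in> K_inf_p A E" "X \<in> K_inf_m A E \<longrightarrow> Dom K u \<in> K_inf_m A E"
    using triangulated_subcatD(4)[OF triangulated_subcats(3) t(1)] triangulated_subcatD(6)[OF triangulated_subcats(4) t(1)] t K_subset by auto
  then show ?thesis using t by blast
qed

lemma left_triangle:
  assumes E: "E = Obj A" and O: "X \<in> Ob" and X: "X \<in> K_inf_m A E"
  shows "\<exists>u v w. (u, v, w) \<in> Tri K \<and> Cod K u = X \<and> Dom K u \<in> K_m A E \<and> Cod K v \<in> K_p A E \<and> Cod K v \<in> K_inf_0 A E \<and>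
      (\<forall>S \<in> {K_inf_p A E, K_p A E, K_inf_0 A E}. X \<in> S \<longrightarrow> Dom K u \<in> S)"
proof -
  obtain n where n: "\<And>k. k \<ge> n \<Longrightarrow> A.exact_at X k"
    using X coh_filter(2)[OF O] unfolding K_inf_m_def eventually_at_top_linorder by blast
  obtain u v w where t: "(u, v, w) \<in> Tri K" "Cod K u = X" "Dom K u \<in> K_m A E" "Cod K v \<in> K_p A E \<inter> K_inf_0 A E"
    by (rule left_truncation[OF E O n])
  have "X \<in> S \<longrightarrow> Dom K u \<in> S" if "S \<in> {K_inf_p A E, K_p A E, K_inf_0 A E}" for S
    using triangulated_subcatD(6)[OF _ t(1), of S] that triangulated_subcats t K_subset by auto
  then show ?thesis using t by blast
qed

lemma right_triangle:
  assumes E: "E = Obj A" and O: "X \<in> Ob" and X: "X \<in> K_inf_p A E"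
  shows "\<exists>u v w. (u, v, w) \<in> Tri K \<and> Cod K u = X \<and> Dom K u \<in> K_m A E \<and> Dom K u \<in> K_inf_0 A E \<and> Cod K v \<in> K_p A E \<and>
      (\<forall>S \<in> {K_inf_m A E, K_m A E, K_inf_0 A E}. X \<in> S \<longrightarrow> Cod K v \<in> S)"
proof -
  obtain n where n: "\<And>k. k \<le> n \<Longrightarrow> A.exact_at X k"
    using X coh_filter(1)[OF O] unfolding K_inf_p_def eventually_at_bot_linorder by blast
  obtain u v w where t: "(u, v, w) \<in> Tri K" "Cod K u = X" "Dom K u \<in> K_m A E \<inter> K_inf_0 A E" "Cod K v \<in> K_p A E"
    by (rule right_truncation[OF E O n])
  have "X \<in> S \<longrightarrow> Cod K v \<in> S" if "S \<in> {K_inf_m A E, K_m A E, K_inf_0 A E}" for S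
    using triangulated_subcatD(4)[OF _ t(1), of S] that triangulated_subcats t K_subset by auto
  then show ?thesis using t by blast
qed

lemmas K_simps = K_sets K_b_eq

lemma triangulated_subcats_Int:
  "triangulated_subcat K (K_inf_b A E)" "triangulated_subcat K (K_p_b A E)" "triangulated_subcat K (K_m_b A E)" "triangulated_subcat K (K_b A E)"
  "triangulated_subcat K (K_p_0 A E)" "triangulated_subcat K (K_m_0 A E)"
  unfolding K_simps by (intro triangulated_subcat_Int triangulated_subcats)+

lemmas tri_all = triangulated_subcats triangulated_subcats_Int

text \<open>In all six cases the triangles are those of the brutal truncation. The sides on which its pieces fall decide
  which of the two forms of \<open>quotient_equivalence\<close> applies.\<close>

lemma equivalences:
  "KQ A E K_inf_p K_p \<simeq>\<^sub>\<Delta> KQ A E K_inf_b K_p_b \<and> KQ A E K_inf_b K_p_b \<simeq>\<^sub>\<Delta> KQ A E K_m_b K_b" (is ?e1)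
  "KQ A E K_inf_m K_m \<simeq>\<^sub>\<Delta> KQ A E K_inf_b K_m_b \<and> KQ A E K_inf_b K_m_b \<simeq>\<^sub>\<Delta> KQ A E K_p_b K_b" (is ?e2)
  "KQ A E K_all K_inf_m \<simeq>\<^sub>\<Delta> KQ A E K_inf_p K_inf_b \<and> KQ A E K_inf_p K_inf_b \<simeq>\<^sub>\<Delta> KQ A E K_p K_p_b" (is ?e3)
  "KQ A E K_all K_inf_p \<simeq>\<^sub>\<Delta> KQ A E K_inf_m K_inf_b \<and> KQ A E K_inf_m K_inf_b \<simeq>\<^sub>\<Delta> KQ A E K_m K_m_b" (is ?e4)
  "KQ A E K_all K_m \<simeq>\<^sub>\<Delta> KQ A E K_inf_p K_m_b \<and> KQ A E K_inf_p K_m_b \<simeq>\<^sub>\<Delta> KQ A E K_p K_b" (is ?e5)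
  "KQ A E K_all K_p \<simeq>\<^sub>\<Delta> KQ A E K_inf_m K_p_b \<and> KQ A E K_inf_m K_p_b \<simeq>\<^sub>\<Delta> KQ A E K_m K_b" (is ?e6)
proof -
  have sub: "K_inf_p A E \<subseteq> Ob" "K_inf_m A E \<subseteq> Ob" using K_subset unfolding K_all_Ob by auto
  have b: "\<exists>u v w. (u, v, w) \<in> Tri K \<and> Cod K u = X \<and> Dom K u \<in> S \<and> Cod K v \<in> S'"
    if "X \<in> Ob" "\<And>M N. M \<in> K_p A E \<Longrightarrow> N \<in> K_m A E \<Longrightarrow> (X \<in> K_inf_p A E \<longrightarrow> N \<in> K_inf_p A E) \<Longrightarrow>
      (X \<in> K_inf_m A E \<longrightarrow> M \<in> K_inf_m A E) \<Longrightarrow> M \<in> S \<and> N \<in> S'" for X S S'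
    using brutal_triangle[OF that(1)] that(2) by blast
  note rules = quotient_equivalence(1)
  show ?e1
    by (intro conjI rules tri_all disjI2 ballI b) (use K_subset sub in \<open>auto simp: K_simps K_all_Ob\<close>)
  show ?e2
    by (intro conjI rules tri_all disjI1 ballI b) (use K_subset sub in \<open>auto simp: K_simps K_all_Ob\<close>)
  show ?e3
    by (intro conjI rules tri_all disjI1 ballI b) (use K_subset sub in \<open>auto simp: K_simps K_all_Ob\<close>)
  show ?e4
    by (intro conjI rules tri_all disjI2 ballI b) (use K_subset sub in \<open>auto simp: K_simps K_all_Ob\<close>)
  show ?e5
    by (intro conjI rules tri_all disjI1 ballI b) (use K_subset sub in \<open>auto simp: K_simps K_all_Ob\<close>)
  show ?e6
    by (intro conjI rules tri_all disjI2 ballI b) (use K_subset sub in \<open>auto simp: K_simps K_all_Ob\<close>)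
qed

text \<open>Here \<open>\<tau>\<^sup>\<le>\<^sup>n\<close> serves for complexes with right bounded cohomology and \<open>\<tau>\<^sup>\<ge>\<^sup>n\<close> for those with left bounded
  cohomology.\<close>

lemma abelian_equivalences:
  assumes E: "E = Obj A"
  shows "KQ A E K_p_b K_p_0 \<simeq>\<^sub>\<Delta> KQ A E K_b K_b_0" (is ?e1) "KQ A E K_b K_b_0 \<simeq>\<^sub>\<Delta> KQ A E K_m_b K_m_0" (is ?e2)
    "KQ A E K_m_b K_m_0 \<simeq>\<^sub>\<Delta> KQ A E K_inf_b K_inf_0" (is ?e3)
    "KQ A E K_inf_b K_p_b \<simeq>\<^sub>\<Delta> KQ A E K_inf_0 K_p_0" (is ?e4) "KQ A E K_inf_0 K_p_0 \<simeq>\<^sub>\<Delta> KQ A E K_m_0 K_b_0" (is ?e5)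
    "KQ A E K_inf_b K_m_b \<simeq>\<^sub>\<Delta> KQ A E K_inf_0 K_m_0" (is ?e6) "KQ A E K_inf_0 K_m_0 \<simeq>\<^sub>\<Delta> KQ A E K_p_0 K_b_0" (is ?e7)
proof -
  have sub: "K_inf_p A E \<subseteq> Ob" "K_inf_m A E \<subseteq> Ob" using K_subset unfolding K_all_Ob by auto
  have l: "\<exists>u v w. (u, v, w) \<in> Tri K \<and> Cod K u = X \<and> Dom K u \<in> S \<and> Cod K v \<in> S'"
    if X: "X \<in> K_inf_m A E" and H: "\<And>M N. M \<in> K_m A E \<Longrightarrow> N \<in> K_p A E \<Longrightarrow> N \<in> K_inf_0 A E \<Longrightarrow> (X \<in> K_inf_p A E \<longrightarrow> M \<in> K_inf_p A E) \<Longrightarrow>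
      (X \<in> K_p A E \<longrightarrow> M \<in> K_p A E) \<Longrightarrow> (X \<in> K_inf_0 A E \<longrightarrow> M \<in> K_inf_0 A E) \<Longrightarrow> M \<in> S \<and> N \<in> S'" for X S S'
  proof -
    obtain u v w where t: "(u, v, w) \<in> Tri K" "Cod K u = X" "Dom K u \<in> K_m A E" "Cod K v \<in> K_p A E" "Cod K v \<in> K_inf_0 A E"
      "\<forall>S \<in> {K_inf_p A E, K_p A E, K_inf_0 A E}. X \<in> S \<longrightarrow> Dom K u \<in> S"
      using left_triangle[OF E _ X] sub(2) X by blast
    have "Dom K u \<in> S \<and> Cod K v \<in> S'" by (rule H[OF t(3-5)]) (use t(6) in simp_all)
    then show ?thesis using t(1,2) by blast
  qed
  have r: "\<exists>u v w. (u, v, w) \<in> Tri K \<and> Cod K u = X \<and> Dom K u \<in> S \<and> Cod K v \<in> S'"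
    if X: "X \<in> K_inf_p A E" and H: "\<And>M N. M \<in> K_m A E \<Longrightarrow> M \<in> K_inf_0 A E \<Longrightarrow> N \<in> K_p A E \<Longrightarrow> (X \<in> K_inf_m A E \<longrightarrow> N \<in> K_inf_m A E) \<Longrightarrow>
      (X \<in> K_m A E \<longrightarrow> N \<in> K_m A E) \<Longrightarrow> (X \<in> K_inf_0 A E \<longrightarrow> N \<in> K_inf_0 A E) \<Longrightarrow> M \<in> S \<and> N \<in> S'" for X S S'
  proof -
    obtain u v w where t: "(u, v, w) \<in> Tri K" "Cod K u = X" "Dom K u \<in> K_m A E" "Dom K u \<in> K_inf_0 A E" "Cod K v \<in> K_p A E"
      "\<forall>S \<in> {K_inf_m A E, K_m A E, K_inf_0 A E}. X \<in> S \<longrightarrow> Cod K v \<in> S"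
      using right_triangle[OF E _ X] sub(1) X by blast
    have "Dom K u \<in> S \<and> Cod K v \<in> S'" by (rule H[OF t(3-5)]) (use t(6) in simp_all)
    then show ?thesis using t(1,2) by blast
  qed
  show ?e1
    by (intro quotient_equivalence(1) tri_all disjI1 ballI l) (use K_subset in \<open>auto simp: K_simps\<close>)
  show ?e2
    by (intro quotient_equivalence(2) tri_all disjI2 ballI r) (use K_subset in \<open>auto simp: K_simps\<close>)
  show ?e3
    by (intro quotient_equivalence(2) tri_all disjI1 ballI l) (use K_subset in \<open>auto simp: K_simps\<close>)
  show ?e4
    by (intro quotient_equivalence(1) tri_all disjI1 ballI r) (use K_subset in \<open>auto simp: K_simps\<close>)
  show ?e5
    by (intro quotient_equivalence(1) tri_all disjI1 ballI l) (use K_subset in \<open>auto simp: K_simps\<close>)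
  show ?e6
    by (intro quotient_equivalence(1) tri_all disjI2 ballI l) (use K_subset in \<open>auto simp: K_simps\<close>)
  show ?e7
    by (intro quotient_equivalence(1) tri_all disjI2 ballI r) (use K_subset in \<open>auto simp: K_simps\<close>)
qed

end

theorem corollary2p3:
  fixes A :: "('o, 'm) acat" and E :: "'o set"
  assumes "abelian_category A"
    and "E \<subseteq> Obj A"
    and "additive_category (full_subcat A E)"
    and "karoubian (full_subcat A E)"
  shows
    "(KQ A E K_inf_p K_p \<simeq>\<^sub>\<Delta> KQ A E K_inf_b K_p_b \<and>
      KQ A E K_inf_b K_p_b \<simeq>\<^sub>\<Delta> KQ A E K_m_b K_b) \<and>
     (KQ A E K_inf_m K_m \<simeq>\<^sub>\<Delta> KQ A E K_inf_b K_m_b \<and>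
      KQ A E K_inf_b K_m_b \<simeq>\<^sub>\<Delta> KQ A E K_p_b K_b) \<and>
     (KQ A E K_all K_inf_m \<simeq>\<^sub>\<Delta> KQ A E K_inf_p K_inf_b \<and>
      KQ A E K_inf_p K_inf_b \<simeq>\<^sub>\<Delta> KQ A E K_p K_p_b) \<and>
     (KQ A E K_all K_inf_p \<simeq>\<^sub>\<Delta> KQ A E K_inf_m K_inf_b \<and>
      KQ A E K_inf_m K_inf_b \<simeq>\<^sub>\<Delta> KQ A E K_m K_m_b) \<and>
     (KQ A E K_all K_m \<simeq>\<^sub>\<Delta> KQ A E K_inf_p K_m_b \<and>
      KQ A E K_inf_p K_m_b \<simeq>\<^sub>\<Delta> KQ A E K_p K_b) \<and>
     (KQ A E K_all K_p \<simeq>\<^sub>\<Delta> KQ A E K_inf_m K_p_b \<and>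
      KQ A E K_inf_m K_p_b \<simeq>\<^sub>\<Delta> KQ A E K_m K_b) \<and>
     (E = Obj A \<longrightarrow>
       (KQ A E K_p_b K_p_0 \<simeq>\<^sub>\<Delta> KQ A E K_b K_b_0 \<and>
        KQ A E K_b K_b_0 \<simeq>\<^sub>\<Delta> KQ A E K_m_b K_m_0 \<and>
        KQ A E K_m_b K_m_0 \<simeq>\<^sub>\<Delta> KQ A E K_inf_b K_inf_0) \<and>
       (KQ A E K_inf_b K_p_b \<simeq>\<^sub>\<Delta> KQ A E K_inf_0 K_p_0 \<and>
        KQ A E K_inf_0 K_p_0 \<simeq>\<^sub>\<Delta> KQ A E K_m_0 K_b_0) \<and>
       (KQ A E K_inf_b K_m_b \<simeq>\<^sub>\<Delta> KQ A E K_inf_0 K_m_0 \<and>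
        KQ A E K_inf_0 K_m_0 \<simeq>\<^sub>\<Delta> KQ A E K_p_0 K_b_0))"
proof -
  interpret karoubian_subcategory A E
    by (intro karoubian_subcategory.intro karoubian_subcategory_axioms.intro abelian_acat.intro assms)
  show ?thesis using equivalences abelian_equivalences by blast
qed

end
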